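(* Let $A\subset\mathbb R^q$ be Borel with $p_A:=\mathbb P(\mathbf Z\in A)>0$ and assume the conditional copula $C(\cdot|A)$ is continuously differentiable on $[0,1]^p$. Let $M\ge 2$. Then the process $$\mathcal C_{n,M,A}(\mathbf u_0,\dots,\mathbf u_M):=\big(\overline{\mathbb C}_n(\mathbf u_0|A),\overline{\mathbb C}^*_{n,1}(\mathbf u_1|A),\dots,\overline{\mathbb C}^*_{n,M}(\mathbf u_M|A)\big)$$ converges weakly in $\ell^\infty([0,1]^{p(M+1)},\mathbb R^{M+1})$ to a process concatenating $M+1$ independent copies of the centered Gaussian process $$\mathbb C_\infty(\mathbf u|A):=\frac{\mathbb B(\mathbf u,A)}{p_A}-\sum_{k=1}^p\frac{\partial_kD(\mathbf u,A)}{p_A^2}\Big(\mathbb B\big((u_k,\mathbf 1_{-k}),A\big)-u_k\mathbb B(\mathbf 1,A)\Big)-\frac{D(\mathbf u,A)}{p_A^2}\mathbb B(\mathbf 1,A),$$ where $\mathbb B(\cdot,A)$ is centered Gaussian with covariance $\mathbb E[\mathbb B(\mathbf u,A)\mathbb B(\mathbf u',A)]=p_AC(\mathbf u\wedge\mathbf u'|A)-p_A^2C(\mathbf u|A)C(\mathbf u'|A)$.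
   Context: Let $(\mathbf X,\mathbf Z)$ be a random vector in $\mathbb R^p\times\mathbb R^q$ with i.i.d. copies $(\mathbf X_i,\mathbf Z_i)_{i\le n}$. Vector inequalities and $\wedge$ are componentwise. Conditional margins $F_k(t|A):=\mathbb P(X_k\le t\mid\mathbf Z\in A)$ are continuous (standing assumption); $C(\cdot|A)$ is the conditional copula of $\mathbf X$ given $\mathbf Z\in A$; $\mathbf U^A:=(F_1(X_1|A),\dots,F_p(X_p|A))$; $D(\mathbf u,A):=\mathbb P(\mathbf U^A\le\mathbf u,\mathbf Z\in A)=p_AC(\mathbf u|A)$, and $\partial_kD$ is its partial derivative in $u_k$. $(u_k,\mathbf 1_{-k})$ has $k$-th coordinate $u_k$ and others $1$. Empirical: $\hat p_A:=n^{-1}\sum_i\mathbf 1(\mathbf Z_i\in A)$, $F_{n,k}(t|A):=\frac1{n\hat p_A}\sum_i\mathbf 1(X_{i,k}\le t,\mathbf Z_i\in A)$, $F^{-1}(u):=\inf\{t:F(t)\ge u\}$, $\overline C_n(\mathbf u|A):=\frac1{n\hat p_A}\sum_i\mathbf 1(X_{i,k}\le F^{-1}_{n,k}(u_k|A)\,\forall k,\mathbf Z_i\in A)$, $\overline{\mathbb C}_n(\mathbf u|A):=\sqrt n(\overline C_n-C)(\mathbf u|A)$. Nonparametric bootstrap: $(\mathbf X^*_i,\mathbf Z^*_i)_{i\le n}$ is drawn with replacement (uniformly, $n$ times) from the original sample; $\hat p^*_A$, $F^*_{n,k}(\cdot|A)$ and $\overline C^*_n(\mathbf u|A):=\frac1{n\hat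 p^*_A}\sum_i\mathbf 1(X^*_{i,k}\le (F^*_{n,k})^{-1}(u_k|A)\,\forall k,\mathbf Z^*_i\in A)$ are the same quantities computed on the bootstrap sample, and $\overline{\mathbb C}^*_n(\mathbf u|A):=\sqrt n(\overline C^*_n-\overline C_n)(\mathbf u|A)$. $\overline{\mathbb C}^*_{n,1},\dots,\overline{\mathbb C}^*_{n,M}$ come from $M$ independent bootstrap resamples. *)

theory Defs
  imports "HOL-Probability.Probability"
begin

definition unit_cube :: "(real^'p) set" where
  "unit_cube = {u. \<forall>k. 0 \<le> u $ k \<and> u $ k \<le> 1}"

definition pA :: "'a measure \<Rightarrow> ('a \<Rightarrow> real^'q) \<Rightarrow> (real^'q) set \<Rightarrow> real" where
  "pA P Z A = measure P {\<omega>\<in>space P. Z \<omega> \<in> A}"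

definition condF :: "'a measure \<Rightarrow> ('a \<Rightarrow> real^'p) \<Rightarrow> ('a \<Rightarrow> real^'q) \<Rightarrow> (real^'q) set
    \<Rightarrow> 'p \<Rightarrow> real \<Rightarrow> real" where
  "condF P X Z A k t = measure P {\<omega>\<in>space P. X \<omega> $ k \<le> t \<and> Z \<omega> \<in> A} / pA P Z A"

definition condD :: "'a measure \<Rightarrow> ('a \<Rightarrow> real^'p) \<Rightarrow> ('a \<Rightarrow> real^'q) \<Rightarrow> (real^'q) set
    \<Rightarrow> real^'p \<Rightarrow> real" where
  "condD P X Z A u =
     measure P {\<omega>\<in>space P. (\<forall>k. condF P X Z A k (X \<omega> $ k) \<le> u $ k) \<and> Z \<omega> \<in> A}"

text \<open>Conditional copula \<open>C(u|A) = D(u,A)/p_A\<close> (continuous conditional margins).\<close>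
definition condC :: "'a measure \<Rightarrow> ('a \<Rightarrow> real^'p) \<Rightarrow> ('a \<Rightarrow> real^'q) \<Rightarrow> (real^'q) set
    \<Rightarrow> real^'p \<Rightarrow> real" where
  "condC P X Z A u = condD P X Z A u / pA P Z A"

text \<open>A sample is a map \<open>s :: nat \<Rightarrow> (real^'p) \<times> (real^'q)\<close>; only \<open>s 0, \<dots>, s (n-1)\<close> are used.\<close>

definition emp_pA :: "nat \<Rightarrow> (nat \<Rightarrow> (real^'p) \<times> (real^'q)) \<Rightarrow> (real^'q) set \<Rightarrow> real" where
  "emp_pA n s A = (\<Sum>i<n. if snd (s i) \<in> A then 1 else 0) / real n"

definition emp_F :: "nat \<Rightarrow> (nat \<Rightarrow> (real^'p) \<times> (real^'q)) \<Rightarrow> (real^'q) set \<Rightarrow> 'p \<Rightarrow> real \<Rightarrow> real" where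
  "emp_F n s A k t =
     (\<Sum>i<n. if fst (s i) $ k \<le> t \<and> snd (s i) \<in> A then 1 else 0) / (real n * emp_pA n s A)"

text \<open>Generalized inverse \<open>F^{-1}(u) = inf {t. F t \<ge> u}\<close>, valued in the extended reals
  (so that it is \<open>-\<infinity>\<close> for \<open>u \<le> 0\<close>, and \<open>+\<infinity>\<close> for the empty set).\<close>
definition ginv :: "(real \<Rightarrow> real) \<Rightarrow> real \<Rightarrow> ereal" where
  "ginv F u = Inf {ereal t | t. F t \<ge> u}"

definition emp_copula :: "nat \<Rightarrow> (nat \<Rightarrow> (real^'p) \<times> (real^'q)) \<Rightarrow> (real^'q) set \<Rightarrow> real^'p \<Rightarrow> real" where
  "emp_copula n s A u =
     (\<Sum>i<n. if (\<forall>k. ereal (fst (s i) $ k) \<le> ginv (emp_F n s A k) (u $ k)) \<and> snd (s i) \<in> A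
             then 1 else 0) / (real n * emp_pA n s A)"

text \<open>Elements of \<open>\<ell>^\<infinity>(T)\<close> with \<open>T \<subseteq> nat \<times> real^'p\<close> are represented by functions
  \<open>nat \<Rightarrow> real^'p \<Rightarrow> real\<close>, bounded on T, with the sup (pseudo)distance over T.\<close>

definition linf :: "(nat \<times> (real^'p)) set \<Rightarrow> (nat \<Rightarrow> real^'p \<Rightarrow> real) set" where
  "linf T = {f. bdd_above ((\<lambda>(m,u). \<bar>f m u\<bar>) ` T)}"

definition sup_dist :: "(nat \<times> (real^'p)) set \<Rightarrow> (nat \<Rightarrow> real^'p \<Rightarrow> real) \<Rightarrow> (nat \<Rightarrow> real^'p \<Rightarrow> real) \<Rightarrow> real" where
  "sup_dist T f g = (SUP x\<in>T. \<bar>f (fst x) (snd x) - g (fst x) (snd x)\<bar>)"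

definition bcont_linf :: "(nat \<times> (real^'p)) set \<Rightarrow> ((nat \<Rightarrow> real^'p \<Rightarrow> real) \<Rightarrow> real) \<Rightarrow> bool" where
  "bcont_linf T h \<longleftrightarrow>
     (\<exists>B. \<forall>f\<in>linf T. \<bar>h f\<bar> \<le> B) \<and>
     (\<forall>f\<in>linf T. \<forall>e>0. \<exists>d>0. \<forall>g\<in>linf T. sup_dist T f g < d \<longrightarrow> \<bar>h f - h g\<bar> < e)"

definition outer_exp :: "'a measure \<Rightarrow> ('a \<Rightarrow> real) \<Rightarrow> real" where
  "outer_exp P f = Inf {integral\<^sup>L P U | U. integrable P U \<and> (\<forall>\<omega>\<in>space P. f \<omega> \<le> U \<omega>)}"

text \<open>\<open>X_n \<leadsto> G\<close> in \<open>\<ell>^\<infinity>(T)\<close>: G is a (Borel) random element on N and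
  \<open>E^* h(X_n) \<rightarrow> E h(G)\<close> for every bounded continuous h.\<close>
definition weak_conv_linf ::
  "(nat \<times> (real^'p)) set \<Rightarrow> 'a measure \<Rightarrow> (nat \<Rightarrow> 'a \<Rightarrow> (nat \<Rightarrow> real^'p \<Rightarrow> real))
     \<Rightarrow> 'b measure \<Rightarrow> ('b \<Rightarrow> (nat \<Rightarrow> real^'p \<Rightarrow> real)) \<Rightarrow> bool" where
  "weak_conv_linf T P Xn N G \<longleftrightarrow>
     (\<forall>h. bcont_linf T h \<longrightarrow>
        (\<lambda>\<omega>. h (G \<omega>)) \<in> borel_measurable N \<and>
        (\<lambda>n. outer_exp P (\<lambda>\<omega>. h (Xn n \<omega>))) \<longlonglongrightarrow> integral\<^sup>L N (\<lambda>\<omega>. h (G \<omega>)))"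

definition gaussian_rv :: "'b measure \<Rightarrow> ('b \<Rightarrow> real) \<Rightarrow> bool" where
  "gaussian_rv N Y \<longleftrightarrow> Y \<in> borel_measurable N \<and>
     ((\<exists>\<mu> \<sigma>. \<sigma> > 0 \<and> distributed N lborel Y (\<lambda>x. ennreal (normal_density \<mu> \<sigma> x)))
      \<or> (\<exists>c. AE \<omega> in N. Y \<omega> = c))"

definition centered_gaussian_process ::
  "'b measure \<Rightarrow> ('b \<Rightarrow> 'i \<Rightarrow> real) \<Rightarrow> 'i set \<Rightarrow> ('i \<Rightarrow> 'i \<Rightarrow> real) \<Rightarrow> bool" where
  "centered_gaussian_process N B S K \<longleftrightarrow>
     (\<forall>F c. finite F \<and> F \<subseteq> S \<longrightarrow> gaussian_rv N (\<lambda>\<omega>. \<Sum>u\<in>F. c u * B \<omega> u)) \<and>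
     (\<forall>u\<in>S. integrable N (\<lambda>\<omega>. B \<omega> u) \<and> integral\<^sup>L N (\<lambda>\<omega>. B \<omega> u) = 0) \<and>
     (\<forall>u\<in>S. \<forall>v\<in>S. integrable N (\<lambda>\<omega>. B \<omega> u * B \<omega> v) \<and>
                    integral\<^sup>L N (\<lambda>\<omega>. B \<omega> u * B \<omega> v) = K u v)"


text \<open>The joint process \<open>(\<overline>\<bbbC>_n(\<cdot>|A), \<overline>\<bbbC>^*_{n,1}(\<cdot>|A), \<dots>, \<overline>\<bbbC>^*_{n,M}(\<cdot>|A))\<close>
  at sample size n, component index m (0 = original sample, m \<ge> 1 = m-th bootstrap resample).
  \<open>J (n,m,i)\<close> is the index of the original observation drawn as i-th bootstrap observation
  in the m-th resample of size n.\<close>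
definition copula_proc ::
  "'a measure \<Rightarrow> (nat \<Rightarrow> 'a \<Rightarrow> real^'p) \<Rightarrow> (nat \<Rightarrow> 'a \<Rightarrow> real^'q) \<Rightarrow> (nat \<times> nat \<times> nat \<Rightarrow> 'a \<Rightarrow> nat)
     \<Rightarrow> (real^'q) set \<Rightarrow> nat \<Rightarrow> 'a \<Rightarrow> nat \<Rightarrow> real^'p \<Rightarrow> real" where
  "copula_proc P X Z J A n \<omega> m u =
     (let s = (\<lambda>i. (X i \<omega>, Z i \<omega>));
          sb = (\<lambda>i. s (J (n, m, i) \<omega>))
      in if m = 0 then sqrt (real n) * (emp_copula n s A u - condC P (X 0) (Z 0) A u)
         else sqrt (real n) * (emp_copula n sb A u - emp_copula n s A u))"

text \<open>\<open>\<bbbC>_\<infinity>(u|A)\<close> built from a path \<open>B = \<bbbB>(\<cdot>,A)\<close>, with \<open>p = p_A\<close>, \<open>D(u,A) = p C(u|A)\<close> and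
  \<open>\<partial>_k D(u,A) = p \<cdot> dC u k\<close>, where \<open>dC u k\<close> is the k-th partial derivative of \<open>C(\<cdot>|A)\<close> at u.\<close>
definition Cinf :: "real \<Rightarrow> (real^'p \<Rightarrow> real) \<Rightarrow> (real^'p \<Rightarrow> 'p \<Rightarrow> real) \<Rightarrow> (real^'p \<Rightarrow> real)
     \<Rightarrow> real^'p \<Rightarrow> real" where
  "Cinf p C dC B u =
     B u / p
     - (\<Sum>k\<in>UNIV. (p * dC u k) / p\<^sup>2 * (B (\<chi> j. if j = k then u $ k else 1) - u $ k * B 1))
     - (p * C u) / p\<^sup>2 * B 1"

end

theory Submission
  imports Defs
begin

text \<open>
  Put \<open>U\<^sub>k = F\<^sub>k(X\<^sub>k|A)\<close> and let \<open>D\<^sub>n\<close>, \<open>D\<^sub>n\<^sup>*\<close> be the empirical measures of the orthants \<open>{U \<le> u, Z \<in> A}\<close> under the sample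
  and a resample. With \<open>G = sqrt n (Q - D)\<close>, \<open>Q \<in> {D\<^sub>n, D\<^sub>n\<^sup>*}\<close>, the copula process \<open>sqrt n (C(Q) - C)\<close> differs from the linear
  functional \<open>Cinf\<close> of \<open>G\<close> by an explicit amount controlled by the supremum and the modulus of continuity of \<open>G\<close>; subtracting the
  two cases, the bootstrap copula process is \<open>Cinf\<close> of \<open>sqrt n (D\<^sub>n\<^sup>* - D\<^sub>n)\<close> up to a negligible error.

  The modulus is controlled by chaining along dyadic grids: the increments of \<open>sqrt n (D\<^sub>n - D)\<close> and, after averaging the conditional
  bound over the data, those of \<open>sqrt n (D\<^sub>n\<^sup>* - D\<^sub>n)\<close> have moment generating function at most \<open>exp (2 \<theta>\<^sup>2 v)\<close> for
  \<open>|\<theta>| \<le> sqrt n / 2\<close>, with \<open>v\<close> the \<open>D\<close>-mass of the increment; below the mesh \<open>1/n\<close> monotonicity takes over. Conditionally on the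
  data the characteristic functions of the resampled sums are \<open>n\<close>-th powers whose limits involve only the empirical
  variances, which gives the asymptotic independence of the components.

  The limit is built on the dyadic points from independent normal variables by a Cholesky factorisation of the covariance and is
  extended continuously by the same chaining bound.
\<close>

section \<open>Dyadic grids and chaining\<close>

text \<open>The sup-norm processes come without measurability, so everything random is reduced to
  finitely many grid increments: off one measurable exceptional set the linearisation is a
  deterministic inequality for a fixed sample, the same for data and resample. For a resample it is
  applied to the process centred at the true \<open>D\<close>, because \<open>C\<close>, unlike the
  empirical copula, is differentiable. The chaining constants are tied together. An edge of mesh
  2^-j carries mass at most 2^-j, so \<theta> = sqrt 2 ^ j keeps the moment generating function
  below exp 2. The restriction on \<theta> then reads 4 * 2^j <= n, and at the last such level L
  monotonicity leaves an error of order sqrt n / 2^L, hence of order 1 / sqrt n. One union bound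
  over edges serves the empirical, the bootstrap and the Gaussian processes. Lipschitz test
  functions are compared with their values on grid restrictions of the paths, so both the
  convergence and the measurability of the limit come from finitely many coordinates.\<close>

definition dyadic_grid :: "nat \<Rightarrow> (real^'p) set" where
  "dyadic_grid j = {u. \<forall>k. \<exists>i::nat. i \<le> 2 ^ j \<and> u $ k = real i / 2 ^ j}"

definition dyadic_floor :: "nat \<Rightarrow> real^'p \<Rightarrow> real^'p" where
  "dyadic_floor j u = (\<chi> k. of_int \<lfloor>2 ^ j * u $ k\<rfloor> / 2 ^ j)"

definition dyadic_ceiling :: "nat \<Rightarrow> real^'p \<Rightarrow> real^'p" where
  "dyadic_ceiling j u = (\<chi> k. of_int \<lceil>2 ^ j * u $ k\<rceil> / 2 ^ j)"

text \<open>The step is not truncated at the boundary of the cube; statements about an edge of the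
  grid therefore carry the hypothesis \<open>bump j k u \<in> unit_cube\<close>.\<close>

definition bump :: "nat \<Rightarrow> 'p \<Rightarrow> real^'p \<Rightarrow> real^'p" where
  "bump j k u = (\<chi> i. if i = k then u $ k + 1 / 2 ^ j else u $ i)"

lemma dyadic_grid_image:
  "(dyadic_grid j :: (real^'p) set) =
     (\<lambda>f. \<chi> k. real (f k) / 2 ^ j) ` (PiE (UNIV::'p set) (\<lambda>_. {..2 ^ j}))"
proof (intro equalityI subsetI)
  fix u :: "real^'p" assume "u \<in> dyadic_grid j"
  then obtain f where f: "\<And>k. f k \<le> (2::nat) ^ j \<and> u $ k = real (f k) / 2 ^ j"
    unfolding dyadic_grid_def by (auto dest!: choice)
  have "u = (\<chi> k. real (f k) / 2 ^ j)"
    using f by (simp add: vec_eq_iff)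
  then show "u \<in> (\<lambda>f. \<chi> k. real (f k) / 2 ^ j) ` (PiE (UNIV::'p set) (\<lambda>_. {..2 ^ j}))"
    using f by (auto intro!: image_eqI[where x=f])
next
  fix u :: "real^'p"
  assume "u \<in> (\<lambda>f. \<chi> k. real (f k) / 2 ^ j) ` (PiE (UNIV::'p set) (\<lambda>_. {..2 ^ j}))"
  then show "u \<in> dyadic_grid j"
    by (auto simp: dyadic_grid_def PiE_def Pi_def)
qed

lemma finite_dyadic_grid: "finite (dyadic_grid j :: (real^'p) set)"
  unfolding dyadic_grid_image by (intro finite_imageI finite_PiE) auto

lemma card_dyadic_grid_le: "card (dyadic_grid j :: (real^'p) set) \<le> (2 ^ j + 1) ^ CARD('p)"
proof -
  have "card (dyadic_grid j :: (real^'p) set) \<le> card (PiE (UNIV::'p set) (\<lambda>_. {..(2::nat) ^ j}))"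
    unfolding dyadic_grid_image by (intro card_image_le finite_PiE) auto
  also have "\<dots> = (2 ^ j + 1) ^ CARD('p)"
    by (subst card_PiE) auto
  finally show ?thesis .
qed

lemma dyadic_grid_subset_unit_cube: "dyadic_grid j \<subseteq> unit_cube"
proof
  fix u :: "real^'p" assume u: "u \<in> dyadic_grid j"
  have "0 \<le> u $ k \<and> u $ k \<le> 1" for k
  proof -
    obtain i where i: "i \<le> 2 ^ j" "u $ k = real i / 2 ^ j" using u by (auto simp: dyadic_grid_def)
    then have "real i \<le> 2 ^ j" by (metis of_nat_le_iff of_nat_numeral of_nat_power)
    then show ?thesis using i by simp
  qed
  then show "u \<in> unit_cube" by (simp add: unit_cube_def)
qed

text \<open>Integrality of \<open>2 ^ j * u $ k\<close> is visibly stable under refinement and under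
  \<open>bump\<close>, which the bounded index in the definition hides.\<close>

lemma dyadic_grid_iff:
  "u \<in> dyadic_grid j \<longleftrightarrow> u \<in> unit_cube \<and> (\<forall>k. 2 ^ j * u $ k \<in> \<int>)"
proof safe
  assume "u \<in> dyadic_grid j"
  then show "u \<in> unit_cube" using dyadic_grid_subset_unit_cube by blast
  fix k show "2 ^ j * u $ k \<in> \<int>"
    using \<open>u \<in> dyadic_grid j\<close> by (auto simp: dyadic_grid_def dest!: spec[of _ k])
next
  assume u: "u \<in> unit_cube" and Z: "\<forall>k. 2 ^ j * u $ k \<in> \<int>"
  show "u \<in> dyadic_grid j"
    unfolding dyadic_grid_def
  proof (intro CollectI allI)
    fix k
    obtain z where z: "2 ^ j * u $ k = of_int z" using Z by (metis Ints_cases)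
    have "0 \<le> z"
      using u z unfolding unit_cube_def
      by (metis (mono_tags, lifting) mem_Collect_eq of_int_0_le_iff zero_le_mult_iff zero_le_numeral zero_le_power)
    moreover have "of_int z \<le> (2 ^ j :: real)"
      using u z[symmetric] unfolding unit_cube_def by (simp add: mult_left_le)
    ultimately have "nat z \<le> 2 ^ j" "real (nat z) = of_int z"
      by (auto simp: nat_le_iff)
    then show "\<exists>i\<le>2 ^ j. u $ k = real i / 2 ^ j"
      using z by (intro exI[of _ "nat z"]) (auto simp: field_simps)
  qed
qed

lemma dyadic_grid_mono: "j \<le> l \<Longrightarrow> dyadic_grid j \<subseteq> dyadic_grid l"
proof
  fix u :: "real^'p" assume jl: "j \<le> l" and "u \<in> dyadic_grid j"
  then have u: "u \<in> unit_cube" "\<And>k. 2 ^ j * u $ k \<in> \<int>" by (auto simp: dyadic_grid_iff)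
  have "2 ^ l * u $ k \<in> \<int>" for k
  proof -
    have "2 ^ l * u $ k = 2 ^ (l - j) * (2 ^ j * u $ k)"
      using jl by (metis le_add_diff_inverse2 mult.assoc power_add)
    also have "\<dots> \<in> \<int>" by (rule Ints_mult[OF _ u(2)[of k]]) auto
    finally show ?thesis .
  qed
  with u show "u \<in> dyadic_grid l" by (simp add: dyadic_grid_iff)
qed

lemma dyadic_floor_in_grid: assumes "u \<in> unit_cube" shows "dyadic_floor j u \<in> dyadic_grid j"
proof -
  have *: "0 \<le> u $ k \<and> u $ k \<le> 1" for k using assms by (auto simp: unit_cube_def)
  have "of_int \<lfloor>2 ^ j * u $ k\<rfloor> \<le> (2 ^ j :: real)" for k
    using * [of k] by (intro order_trans[OF of_int_floor_le]) (simp add: mult_left_le)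
  then show ?thesis
    using * by (auto simp: dyadic_grid_iff dyadic_floor_def unit_cube_def)
qed

lemma dyadic_ceiling_in_grid: assumes "u \<in> unit_cube" shows "dyadic_ceiling j u \<in> dyadic_grid j"
proof -
  have *: "0 \<le> u $ k \<and> u $ k \<le> 1" for k using assms by (auto simp: unit_cube_def)
  have "\<lceil>2 ^ j * u $ k\<rceil> \<le> 2 ^ j" for k
    using * [of k] by (simp add: ceiling_le_iff mult_left_le)
  then have "of_int \<lceil>2 ^ j * u $ k\<rceil> \<le> (2 ^ j :: real)" for k
    by (metis of_int_le_iff of_int_numeral of_int_power)
  moreover have "0 \<le> (of_int \<lceil>2 ^ j * u $ k\<rceil> :: real)" for k
  proof -
    have "0 \<le> 2 ^ j * u $ k" using *[of k] by simp
    then show ?thesis using le_of_int_ceiling order_trans by blast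
  qed
  ultimately show ?thesis
    by (auto simp: dyadic_grid_iff dyadic_ceiling_def unit_cube_def)
qed

lemma dyadic_floor_le: "dyadic_floor j u $ k \<le> u $ k"
  by (simp add: dyadic_floor_def divide_le_eq mult.commute)

lemma dyadic_floor_ge: "u $ k - 1 / 2 ^ j \<le> dyadic_floor j u $ k"
proof -
  have "2 ^ j * u $ k - 1 \<le> of_int \<lfloor>2 ^ j * u $ k\<rfloor>" by linarith
  then have "(2 ^ j * u $ k - 1) / 2 ^ j \<le> of_int \<lfloor>2 ^ j * u $ k\<rfloor> / 2 ^ j"
    by (intro divide_right_mono) auto
  then show ?thesis by (simp add: dyadic_floor_def diff_divide_distrib)
qed

lemma dyadic_ceiling_ge: "u $ k \<le> dyadic_ceiling j u $ k"
  by (simp add: dyadic_ceiling_def le_divide_eq mult.commute)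

lemma dyadic_ceiling_le: "dyadic_ceiling j u $ k \<le> u $ k + 1 / 2 ^ j"
proof -
  have "of_int \<lceil>2 ^ j * u $ k\<rceil> \<le> 2 ^ j * u $ k + 1" by linarith
  then have "of_int \<lceil>2 ^ j * u $ k\<rceil> / 2 ^ j \<le> (2 ^ j * u $ k + 1) / 2 ^ j"
    by (intro divide_right_mono) auto
  then show ?thesis by (simp add: dyadic_ceiling_def add_divide_distrib)
qed

lemma dyadic_ceiling_floor_diff: "dyadic_ceiling j u $ k - dyadic_floor j u $ k \<le> 1 / 2 ^ j"
proof -
  have "\<lceil>2 ^ j * u $ k\<rceil> \<le> \<lfloor>2 ^ j * u $ k\<rfloor> + 1"
    by (simp add: ceiling_le_iff)
  then have "of_int \<lceil>2 ^ j * u $ k\<rceil> \<le> (of_int \<lfloor>2 ^ j * u $ k\<rfloor> + 1 :: real)"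
    by linarith
  then have "(of_int \<lceil>2 ^ j * u $ k\<rceil> - of_int \<lfloor>2 ^ j * u $ k\<rfloor>) / 2 ^ j \<le> (1 / 2 ^ j :: real)"
    by (intro divide_right_mono) auto
  then show ?thesis by (simp add: dyadic_ceiling_def dyadic_floor_def diff_divide_distrib)
qed

lemma dyadic_floor_diff:
  assumes "\<bar>u $ k - v $ k\<bar> \<le> 1 / 2 ^ j"
  shows "\<bar>dyadic_floor j u $ k - dyadic_floor j v $ k\<bar> \<le> 1 / 2 ^ j"
proof -
  have "\<bar>2 ^ j * u $ k - 2 ^ j * v $ k\<bar> \<le> 1"
    using assms unfolding right_diff_distrib[symmetric] abs_mult
    by (simp add: le_divide_eq mult.commute)
  then have "\<bar>\<lfloor>2 ^ j * u $ k\<rfloor> - \<lfloor>2 ^ j * v $ k\<rfloor>\<bar> \<le> 1"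
    by linarith
  then have "\<bar>of_int \<lfloor>2 ^ j * u $ k\<rfloor> - of_int \<lfloor>2 ^ j * v $ k\<rfloor>\<bar> \<le> (1::real)"
    by (metis (no_types) of_int_1_le_iff of_int_abs of_int_diff of_int_le_1_iff)
  then show ?thesis
    by (simp add: dyadic_floor_def diff_divide_distrib[symmetric] divide_le_eq)
qed

text \<open>The floor of 2y is twice the floor of y or one more, so floors at consecutive levels are
  equal or adjacent in every coordinate of the finer grid, as \<open>chain_adjacent\<close>
  requires.\<close>

lemma dyadic_floor_Suc_diff:
  "\<bar>dyadic_floor (Suc j) u $ k - dyadic_floor j u $ k\<bar> \<le> 1 / 2 ^ Suc j"
proof -
  define y where "y = 2 ^ j * u $ k"
  have "\<bar>\<lfloor>2 * y\<rfloor> - 2 * \<lfloor>y\<rfloor>\<bar> \<le> 1" by linarith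
  then have "\<bar>of_int \<lfloor>2 * y\<rfloor> - 2 * of_int \<lfloor>y\<rfloor>\<bar> \<le> (1::real)" by linarith
  then have "\<bar>(of_int \<lfloor>2 * y\<rfloor> - 2 * of_int \<lfloor>y\<rfloor>) / 2 ^ Suc j\<bar> \<le> (1 / 2 ^ Suc j :: real)"
    by (simp add: divide_le_eq)
  moreover have "dyadic_floor (Suc j) u $ k - dyadic_floor j u $ k
      = (of_int \<lfloor>2 * y\<rfloor> - 2 * of_int \<lfloor>y\<rfloor>) / 2 ^ Suc j"
    by (simp add: dyadic_floor_def y_def mult.assoc diff_divide_distrib)
  ultimately show ?thesis by simp
qed

lemma dyadic_floor_id: "u \<in> dyadic_grid j \<Longrightarrow> dyadic_floor j u = u"
  by (auto simp: dyadic_grid_iff dyadic_floor_def vec_eq_iff)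

text \<open>The coordinates of \<open>a\<close> are exchanged for those of \<open>b\<close> one at a
  time. Every intermediate point stays in the grid, and an exchange is either void or a single
  \<open>bump\<close>, taken forwards or backwards.\<close>

lemma chain_adjacent:
  fixes f :: "real^'p \<Rightarrow> real"
  assumes adj: "\<And>u k. u \<in> dyadic_grid j \<Longrightarrow> bump j k u \<in> unit_cube \<Longrightarrow> \<bar>f (bump j k u) - f u\<bar> \<le> x"
    and x: "0 \<le> x"
    and a: "a \<in> dyadic_grid j" and b: "b \<in> dyadic_grid j"
    and ab: "\<And>k. \<bar>a $ k - b $ k\<bar> \<le> 1 / 2 ^ j"
  shows "\<bar>f a - f b\<bar> \<le> real CARD('p) * x"
proof -
  define c where "c F = (\<chi> k. if k \<in> F then b $ k else a $ k)" for F
  have c: "c F \<in> dyadic_grid j" for F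
    using a b by (auto simp: c_def dyadic_grid_def)
  have "\<bar>f a - f (c F)\<bar> \<le> real (card F) * x" for F
  proof (induction F rule: finite_induct[OF finite])
    case 1
    then show ?case by (simp add: c_def)
  next
    case (2 k F)
    have "\<bar>f (c F) - f (c (insert k F))\<bar> \<le> x"
    proof -
      obtain p q where p: "a $ k = real p / 2 ^ j" and q: "b $ k = real q / 2 ^ j"
        using a b by (force simp: dyadic_grid_def)
      have "\<bar>real p - real q\<bar> \<le> 1"
        using ab[of k] unfolding p q by (simp add: diff_divide_distrib[symmetric] divide_le_eq)
      then consider "p = q" | "q = Suc p" | "p = Suc q" by linarith
      then show ?thesis
      proof cases
        case 1
        then have "c (insert k F) = c F" using p q by (auto simp: c_def vec_eq_iff)
        then show ?thesis using x by simp
      next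
        case 2
        then have "c (insert k F) = bump j k (c F)"
          using p q \<open>k \<notin> F\<close> by (auto simp: c_def bump_def vec_eq_iff field_simps)
        then show ?thesis using adj[OF c[of F], of k] c[of "insert k F"] dyadic_grid_subset_unit_cube
          by (auto simp: abs_minus_commute)
      next
        case 3
        then have "c F = bump j k (c (insert k F))"
          using p q \<open>k \<notin> F\<close> by (auto simp: c_def bump_def vec_eq_iff field_simps)
        then show ?thesis using adj[OF c[of "insert k F"], of k] c[of F] dyadic_grid_subset_unit_cube
          by auto
      qed
    qed
    then show ?case using 2 by (simp add: algebra_simps)
  qed
  from this[of UNIV] show ?thesis by (simp add: c_def)
qed

text \<open>Telescoping over levels: the floors at levels j and j+1 both lie in the finer grid and
  are adjacent there. The summand of level \<open>l\<close> itself is slack.\<close>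

lemma chain_levels:
  fixes f :: "real^'p \<Rightarrow> real"
  assumes adj: "\<And>j u k. l \<le> j \<Longrightarrow> j \<le> L \<Longrightarrow> u \<in> dyadic_grid j \<Longrightarrow> bump j k u \<in> unit_cube
      \<Longrightarrow> \<bar>f (bump j k u) - f u\<bar> \<le> x j"
    and x: "\<And>j. 0 \<le> x j" and "l \<le> L" and u: "u \<in> unit_cube"
  shows "\<bar>f (dyadic_floor L u) - f (dyadic_floor l u)\<bar> \<le> real CARD('p) * (\<Sum>j=l..L. x j)"
  using \<open>l \<le> L\<close> adj
proof (induction L rule: dec_induct)
  case base
  then show ?case using x by simp
next
  case (step L)
  have "\<bar>f (dyadic_floor (Suc L) u) - f (dyadic_floor L u)\<bar> \<le> real CARD('p) * x (Suc L)"
  proof (rule chain_adjacent[where j = "Suc L"])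
    show "dyadic_floor (Suc L) u \<in> dyadic_grid (Suc L)" using u by (rule dyadic_floor_in_grid)
    show "dyadic_floor L u \<in> dyadic_grid (Suc L)"
      using dyadic_floor_in_grid[OF u] dyadic_grid_mono[of L "Suc L"] by auto
    show "\<bar>dyadic_floor (Suc L) u $ k - dyadic_floor L u $ k\<bar> \<le> 1 / 2 ^ Suc L" for k
      by (rule dyadic_floor_Suc_diff)
  qed (use step x in auto)
  moreover have "\<bar>f (dyadic_floor L u) - f (dyadic_floor l u)\<bar> \<le> real CARD('p) * (\<Sum>j=l..L. x j)"
    using step by auto
  ultimately show ?case using step by (simp add: algebra_simps)
qed

text \<open>The detour u, floor of u, floor of v, v costs two approximation errors and one pair of
  equal or adjacent grid points.\<close>

lemma modulus_from_floor:
  fixes f :: "real^'p \<Rightarrow> real"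
  assumes adj: "\<And>u k. u \<in> dyadic_grid l \<Longrightarrow> bump l k u \<in> unit_cube \<Longrightarrow> \<bar>f (bump l k u) - f u\<bar> \<le> x"
    and x: "0 \<le> x"
    and fl: "\<And>w. w \<in> {u, v} \<Longrightarrow> \<bar>f w - f (dyadic_floor l w)\<bar> \<le> \<tau>"
    and uv: "u \<in> unit_cube" "v \<in> unit_cube" "\<And>k. \<bar>u $ k - v $ k\<bar> \<le> 1 / 2 ^ l"
  shows "\<bar>f u - f v\<bar> \<le> 2 * \<tau> + real CARD('p) * x"
proof -
  have "\<bar>f (dyadic_floor l u) - f (dyadic_floor l v)\<bar> \<le> real CARD('p) * x"
    by (rule chain_adjacent[OF adj x]) (use uv in \<open>auto intro!: dyadic_floor_in_grid dyadic_floor_diff\<close>)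
  then show ?thesis using fl[of u] fl[of v] by simp
qed

text \<open>Inside a cell of the last level no probabilistic bound is used: \<open>Q\<close> is
  sandwiched between its values at the floor and the ceiling, which are adjacent grid points, and
  the drift of \<open>D\<close> over a cell is at most d / 2^L before scaling by
  \<open>r\<close>.\<close>

lemma monotone_fill:
  fixes Q D :: "real^'p \<Rightarrow> real"
  assumes mono: "\<And>u v. (\<And>k. u $ k \<le> v $ k) \<Longrightarrow> Q u \<le> Q v"
    and lip: "\<And>u v. u \<in> unit_cube \<Longrightarrow> v \<in> unit_cube \<Longrightarrow> (\<And>k. u $ k \<le> v $ k)
        \<Longrightarrow> D u \<le> D v \<and> D v - D u \<le> (\<Sum>k\<in>UNIV. v $ k - u $ k)"
    and r: "0 \<le> r"
    and f: "\<And>u. f u = r * (Q u - D u)"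
    and adj: "\<And>u k. u \<in> dyadic_grid L \<Longrightarrow> bump L k u \<in> unit_cube \<Longrightarrow> \<bar>f (bump L k u) - f u\<bar> \<le> x"
    and x: "0 \<le> x" and u: "u \<in> unit_cube"
  shows "\<bar>f u - f (dyadic_floor L u)\<bar> \<le> real CARD('p) * x + r * (real CARD('p) / 2 ^ L)"
proof -
  let ?lo = "dyadic_floor L u" and ?hi = "dyadic_ceiling L u"
  note lo = dyadic_floor_in_grid[OF u, of L] and hi = dyadic_ceiling_in_grid[OF u, of L]
  have loc: "?lo \<in> unit_cube" "?hi \<in> unit_cube" using lo hi dyadic_grid_subset_unit_cube by blast+
  have "(\<Sum>k\<in>UNIV. u $ k - ?lo $ k) \<le> (\<Sum>k\<in>(UNIV::'p set). 1 / 2 ^ L)"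
    using dyadic_floor_ge[of u] by (intro sum_mono) (simp add: algebra_simps)
  then have Dlo: "D u - D ?lo \<le> real CARD('p) / 2 ^ L"
    using lip[OF loc(1) u] dyadic_floor_le[of L u] by auto
  have "(\<Sum>k\<in>UNIV. ?hi $ k - u $ k) \<le> (\<Sum>k\<in>(UNIV::'p set). 1 / 2 ^ L)"
    using dyadic_ceiling_le[of L u] by (intro sum_mono) (simp add: algebra_simps)
  then have Dhi: "D ?hi - D u \<le> real CARD('p) / 2 ^ L"
    using lip[OF u loc(2)] dyadic_ceiling_ge[of u _ L] by auto
  have hl: "\<bar>f ?hi - f ?lo\<bar> \<le> real CARD('p) * x"
  proof (rule chain_adjacent[OF adj x hi lo])
    fix k show "\<bar>?hi $ k - ?lo $ k\<bar> \<le> 1 / 2 ^ L"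
      using dyadic_ceiling_floor_diff[of L u k] dyadic_floor_le[of L u k] dyadic_ceiling_ge[of u k L] by auto
  qed
  have "r * (Q u - D u) \<le> r * (Q ?hi - D ?hi + real CARD('p) / 2 ^ L)"
    using mono[of u ?hi] dyadic_ceiling_ge[of u _ L] Dhi r by (intro mult_left_mono) auto
  then have 1: "f u \<le> f ?hi + r * (real CARD('p) / 2 ^ L)"
    unfolding f by (simp add: algebra_simps)
  have "r * (Q ?lo - D ?lo - real CARD('p) / 2 ^ L) \<le> r * (Q u - D u)"
    using mono[of ?lo u] dyadic_floor_le[of L u] Dlo r by (intro mult_left_mono) auto
  then have 2: "f ?lo - r * (real CARD('p) / 2 ^ L) \<le> f u"
    unfolding f by (simp add: algebra_simps)
  show ?thesis using 1 2 hl x by auto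
qed

text \<open>The factor sqrt(1/2)^j is the order of the standard deviation of an increment over mesh
  2^-j. The factor (d+1)(j+1) makes \<open>sqrt 2 ^ j * chain_step d j\<close> equal to (d+1)(j+1),
  so that a Chernoff bound at sqrt 2 ^ j outweighs the number of edges of the grid, while the steps
  remain summable.\<close>

definition chain_step :: "nat \<Rightarrow> nat \<Rightarrow> real" where
  "chain_step d j = (real d + 1) * (real (Suc j) * sqrt (1/2) ^ j)"

definition chain_tail :: "nat \<Rightarrow> nat \<Rightarrow> real" where
  "chain_tail d l = (\<Sum>j. chain_step d (j + l))"

lemma chain_step_nonneg: "0 \<le> chain_step d j"
  by (simp add: chain_step_def)

lemma summable_chain_step: "summable (chain_step d)"
proof -
  have "norm (sqrt (1/2)) < 1" by (simp add: real_sqrt_divide)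
  from geometric_deriv_sums[OF this] show ?thesis
    unfolding chain_step_def by (intro summable_mult) (auto simp: sums_iff)
qed

lemma chain_tail_tendsto: "chain_tail d \<longlonglongrightarrow> 0"
  unfolding chain_tail_def using suminf_exist_split2[OF summable_chain_step] .

lemma sum_chain_step_le_tail: "l \<le> L \<Longrightarrow> (\<Sum>j=l..L. chain_step d j) \<le> chain_tail d l"
proof -
  assume l: "l \<le> L"
  have "(\<Sum>j=l..L. chain_step d j) = (\<Sum>j<Suc (L - l). chain_step d (j + l))"
    using l by (intro sum.reindex_bij_witness[of _ "\<lambda>j. j + l" "\<lambda>j. j - l"]) auto
  also have "\<dots> \<le> chain_tail d l"
    unfolding chain_tail_def
    by (intro sum_le_suminf) (use summable_chain_step chain_step_nonneg in \<open>auto simp: summable_iff_shift\<close>)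
  finally show ?thesis .
qed

lemma chain_step_le_tail: "l \<le> j \<Longrightarrow> chain_step d j \<le> chain_tail d l"
proof -
  assume l: "l \<le> j"
  have "chain_step d j \<le> (\<Sum>j=l..j. chain_step d j)"
    using l chain_step_nonneg by (intro member_le_sum) auto
  also have "\<dots> \<le> chain_tail d l" using l by (rule sum_chain_step_le_tail)
  finally show ?thesis .
qed

text \<open>The factor 2 in \<open>adj\<close> is there because the process of a resample is a sum
  of two chained processes. Each endpoint costs 2 tails for the cell at level \<open>L\<close> and 2
  for the levels between; two endpoints and the 2 tails of the pair of floors make 10.\<close>

lemma empirical_modulus:
  fixes Q D :: "real^'p \<Rightarrow> real"
  assumes mono: "\<And>u v. (\<And>k. u $ k \<le> v $ k) \<Longrightarrow> Q u \<le> Q v"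
    and lip: "\<And>u v. u \<in> unit_cube \<Longrightarrow> v \<in> unit_cube \<Longrightarrow> (\<And>k. u $ k \<le> v $ k)
        \<Longrightarrow> D u \<le> D v \<and> D v - D u \<le> (\<Sum>k\<in>UNIV. v $ k - u $ k)"
    and r: "0 \<le> r"
    and f: "\<And>u. f u = r * (Q u - D u)"
    and adj: "\<And>j u k. l \<le> j \<Longrightarrow> j \<le> L \<Longrightarrow> u \<in> dyadic_grid j \<Longrightarrow> bump j k u \<in> unit_cube
        \<Longrightarrow> \<bar>f (bump j k u) - f u\<bar> \<le> 2 * chain_step CARD('p) j"
    and l: "l \<le> L"
    and uv: "u \<in> unit_cube" "v \<in> unit_cube" "\<And>k. \<bar>u $ k - v $ k\<bar> \<le> 1 / 2 ^ l"
  shows "\<bar>f u - f v\<bar> \<le> real CARD('p) * (10 * chain_tail CARD('p) l + 2 * r / 2 ^ L)"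
proof -
  let ?d = "CARD('p)"
  have t: "chain_step ?d L \<le> chain_tail ?d l" "chain_step ?d l \<le> chain_tail ?d l"
    using l by (auto intro: chain_step_le_tail)
  have fl: "\<bar>f w - f (dyadic_floor l w)\<bar> \<le> real ?d * (4 * chain_tail ?d l + r / 2 ^ L)"
    if w: "w \<in> unit_cube" for w
  proof -
    have "\<bar>f w - f (dyadic_floor L w)\<bar> \<le> real ?d * (2 * chain_step ?d L) + r * (real ?d / 2 ^ L)"
      by (rule monotone_fill[OF mono lip r f adj]) (use l w chain_step_nonneg in auto)
    moreover have "\<bar>f (dyadic_floor L w) - f (dyadic_floor l w)\<bar> \<le> real ?d * (\<Sum>j=l..L. 2 * chain_step ?d j)"
      by (rule chain_levels[OF adj]) (use l w chain_step_nonneg in auto)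
    moreover have "real ?d * (\<Sum>j=l..L. 2 * chain_step ?d j) \<le> real ?d * (2 * chain_tail ?d l)"
      using sum_chain_step_le_tail[OF l, of ?d] by (simp add: sum_distrib_left[symmetric])
    moreover have "real ?d * (2 * chain_step ?d L) \<le> real ?d * (2 * chain_tail ?d l)"
      using t by simp
    ultimately have "\<bar>f w - f (dyadic_floor l w)\<bar>
        \<le> real ?d * (2 * chain_tail ?d l) + real ?d * (2 * chain_tail ?d l) + r * (real ?d / 2 ^ L)"
      by linarith
    then show ?thesis by (simp add: algebra_simps)
  qed
  have "\<bar>f u - f v\<bar> \<le> 2 * (real ?d * (4 * chain_tail ?d l + r / 2 ^ L)) + real ?d * (2 * chain_step ?d l)"
    by (rule modulus_from_floor[OF adj _ _ uv]) (use l chain_step_nonneg fl uv in auto)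
  also have "\<dots> \<le> 2 * (real ?d * (4 * chain_tail ?d l + r / 2 ^ L)) + real ?d * (2 * chain_tail ?d l)"
    using t by simp
  finally show ?thesis by (simp add: algebra_simps)
qed

section \<open>Convergence of finite-dimensional distributions\<close>

text \<open>These functions form an algebra, since frequencies add under multiplication, and their
  expectations are finite combinations of values of characteristic functions.\<close>

inductive trig_poly :: "nat \<Rightarrow> ((nat \<Rightarrow> real) \<Rightarrow> complex) \<Rightarrow> bool" for J where
  mono: "trig_poly J (\<lambda>x. c * cis (\<Sum>j<J. t j * x j))"
| add: "trig_poly J f \<Longrightarrow> trig_poly J g \<Longrightarrow> trig_poly J (\<lambda>x. f x + g x)"

lemma trig_poly_mult:
  assumes "trig_poly J f" "trig_poly J g"
  shows "trig_poly J (\<lambda>x. f x * g x)"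
  using assms(1)
proof induction
  case (mono c t)
  show ?case using assms(2)
  proof induction
    case (mono c' t')
    have "(\<lambda>x. c * cis (\<Sum>j<J. t j * x j) * (c' * cis (\<Sum>j<J. t' j * x j)))
        = (\<lambda>x. (c * c') * cis (\<Sum>j<J. (t j + t' j) * x j))"
      by (auto simp: fun_eq_iff cis_mult[symmetric] sum.distrib distrib_right)
    then show ?case using trig_poly.mono[of J "c * c'" "\<lambda>j. t j + t' j"] by simp
  next
    case (add f g)
    then show ?case by (simp add: distrib_left trig_poly.add)
  qed
next
  case (add f g)
  then show ?case by (simp add: distrib_right trig_poly.add)
qed

lemma trig_poly_const: "trig_poly J (\<lambda>x. c)"
  using trig_poly.mono[of J c "\<lambda>_. 0"] by simp

text \<open>The sine is (cis y - cis (-y)) / 2i; \<open>t s\<close> is the frequency vector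
  supported at \<open>i\<close> with value s / M. These functions supply the separation of points in
  Stone--Weierstrass.\<close>

lemma trig_poly_sin:
  assumes "i < J"
  shows "trig_poly J (\<lambda>x. complex_of_real (M * sin (x i / M)))"
proof -
  define t where "t s = (\<lambda>j. if j = i then s / M else (0::real))" for s
  have t: "(\<Sum>j<J. t s j * x j) = s * x i / M" for s x
    using assms by (simp add: t_def if_distrib[of "\<lambda>a. a * _"] cong: if_cong)
  have eq: "(\<lambda>x. complex_of_real (M * sin (x i / M)))
     = (\<lambda>x. (of_real M / (2 * \<i>)) * cis (\<Sum>j<J. t 1 j * x j) + (- of_real M / (2 * \<i>)) * cis (\<Sum>j<J. t (-1) j * x j))"
    unfolding t by (auto simp: fun_eq_iff complex_eq_iff)
  show ?thesis unfolding eq by (rule trig_poly.add[OF trig_poly.mono trig_poly.mono])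
qed

lemma (in prob_space) trig_poly_integrable:
  assumes "trig_poly J g" and "\<And>j. (\<lambda>\<omega>. Y \<omega> j) \<in> borel_measurable M"
  shows "integrable M (\<lambda>\<omega>. g (Y \<omega>))"
  using assms(1)
proof induction
  case (mono c t)
  have "(\<lambda>\<omega>. cis (\<Sum>j<J. t j * Y \<omega> j)) \<in> borel_measurable M"
    unfolding cis_conv_exp using assms(2) by measurable
  then show ?case
    by (intro integrable_mult_right integrable_const_bound[of _ 1]) auto
qed auto

lemma trig_poly_tendsto:
  fixes Y :: "nat \<Rightarrow> 'a \<Rightarrow> nat \<Rightarrow> real"
  assumes "trig_poly J g" and P: "prob_space P" and N: "prob_space N"
    and Ym: "\<And>n j. (\<lambda>\<omega>. Y n \<omega> j) \<in> borel_measurable P"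
    and Vm: "\<And>j. (\<lambda>\<omega>. V \<omega> j) \<in> borel_measurable N"
    and cf: "\<And>t. (\<lambda>n. \<integral>\<omega>. cis (\<Sum>j<J. t j * Y n \<omega> j) \<partial>P) \<longlonglongrightarrow> (\<integral>\<omega>. cis (\<Sum>j<J. t j * V \<omega> j) \<partial>N)"
  shows "(\<lambda>n. \<integral>\<omega>. g (Y n \<omega>) \<partial>P) \<longlonglongrightarrow> (\<integral>\<omega>. g (V \<omega>) \<partial>N)"
  using assms(1)
proof induction
  case (mono c t)
  then show ?case using tendsto_mult[OF tendsto_const cf] by simp
next
  case (add f g)
  interpret P: prob_space P by fact
  interpret N: prob_space N by fact
  have "integrable P (\<lambda>\<omega>. h (Y n \<omega>))" "integrable N (\<lambda>\<omega>. h (V \<omega>))" if "h \<in> {f, g}" for h n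
    using that add P.trig_poly_integrable[where Y = "Y n", OF _ Ym] N.trig_poly_integrable[where Y = V, OF _ Vm]
    by auto
  then show ?case
    using tendsto_add[OF add.IH] by simp
qed

lemma lipschitz_coords_continuous:
  fixes f :: "(nat \<Rightarrow> real) \<Rightarrow> real"
  assumes "\<And>x y. \<bar>f x - f y\<bar> \<le> L * (\<Sum>j<J. \<bar>x j - y j\<bar>)"
  shows "continuous_on UNIV f"
proof -
  have "(f \<longlongrightarrow> f x) (at x)" for x
  proof -
    have c: "((\<lambda>y. y j) \<longlongrightarrow> x j) (at x)" for j :: nat
      using continuous_on_product_coordinates[of j] by (auto simp: continuous_on_def)
    have "((\<lambda>y. L * (\<Sum>j<J. \<bar>y j - x j\<bar>)) \<longlongrightarrow> L * (\<Sum>j<J. \<bar>x j - x j\<bar>)) (at x)"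
      by (intro tendsto_intros c)
    then have "((\<lambda>y. L * (\<Sum>j<J. \<bar>y j - x j\<bar>)) \<longlongrightarrow> 0) (at x)" by simp
    then have "((\<lambda>y. f y - f x) \<longlongrightarrow> 0) (at x)"
      by (rule Lim_null_comparison[rotated]) (use assms in auto)
    then show ?thesis by (simp add: LIM_zero_iff)
  qed
  then show ?thesis by (simp add: continuous_on_def)
qed

lemma borel_measurable_continuous_coords:
  fixes f :: "(nat \<Rightarrow> real) \<Rightarrow> real"
  assumes "continuous_on UNIV f" and "\<And>j. (\<lambda>\<omega>. Y \<omega> j) \<in> borel_measurable M"
  shows "(\<lambda>\<omega>. f (Y \<omega>)) \<in> borel_measurable M"
proof -
  have "Y \<in> borel_measurable M"
    using assms(2) by (rule measurable_coordinatewise_then_product)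
  then show ?thesis
    using borel_measurable_continuous_onI[OF assms(1)] by (rule measurable_compose)
qed

text \<open>Vectors of J entries live in the infinite product \<open>nat \<Rightarrow> real\<close>;
  freezing the remaining coordinates at 0 restores compactness.\<close>

lemma compact_finite_box:
  "compact {x :: nat \<Rightarrow> real. \<forall>j. x j \<in> (if j < J then {-M..M} else {0})}" (is "compact ?S")
proof -
  have "?S = PiE UNIV (\<lambda>j. if j < J then {-M..M} else {0})" by (auto simp: PiE_def Pi_def)
  moreover have "compactin (product_topology (\<lambda>_. euclidean) UNIV)
     (PiE (UNIV::nat set) (\<lambda>j. if j < J then {-M..M} else {0::real}))"
    unfolding compactin_PiE by auto
  ultimately show ?thesis by (simp add: euclidean_product_topology)
qed

text \<open>The remainder is kept quadratic, although a cubic one holds, because second moments are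
  the ones that are controlled uniformly in n.\<close>

lemma sin_scaled_bound: "M > 0 \<Longrightarrow> \<bar>M * sin (x / M) - x\<bar> \<le> x\<^sup>2 / M" for x M :: real
proof -
  assume M: "M > 0"
  have "\<bar>sin y - y\<bar> \<le> y\<^sup>2 / 2" for y :: real
    using Maclaurin_sin_bound[of y 2] by (simp add: numeral_2_eq_2 sin_coeff_def power2_eq_square)
  from this[of "x / M"] have "M * \<bar>sin (x / M) - x / M\<bar> \<le> M * ((x / M)\<^sup>2 / 2)"
    using M by (intro mult_left_mono) auto
  also have "\<dots> = x\<^sup>2 / (2 * M)" using M by (simp add: power2_eq_square field_simps)
  also have "\<dots> \<le> x\<^sup>2 / M" using M by (intro divide_left_mono) auto
  also have "M * \<bar>sin (x / M) - x / M\<bar> = \<bar>M * sin (x / M) - x\<bar>"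
  proof -
    have "\<bar>M * sin (x / M) - x\<bar> = \<bar>M * (sin (x / M) - x / M)\<bar>" using M by (simp add: right_diff_distrib)
    then show ?thesis using M by (simp add: abs_mult)
  qed
  finally show ?thesis .
qed

text \<open>The zeros from index \<open>J\<close> on put the image into the compact box of
  \<open>compact_finite_box\<close>.\<close>

definition sin_coords :: "nat \<Rightarrow> real \<Rightarrow> (nat \<Rightarrow> real) \<Rightarrow> nat \<Rightarrow> real" where
  "sin_coords J M x = (\<lambda>j. if j < J then M * sin (x j / M) else 0)"

lemma measurable_sin_coords:
  assumes "\<And>j. (\<lambda>\<omega>. U \<omega> j) \<in> borel_measurable Q"
  shows "(\<lambda>\<omega>. sin_coords J M (U \<omega>) j) \<in> borel_measurable Q"
  unfolding sin_coords_def using assms by (cases "j < J") auto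

lemma (in prob_space) integrable_lipschitz_coords:
  fixes f :: "(nat \<Rightarrow> real) \<Rightarrow> real"
  assumes lip: "\<And>x y. \<bar>f x - f y\<bar> \<le> L * (\<Sum>j<J. \<bar>x j - y j\<bar>)"
    and bnd: "\<And>x. \<bar>f x\<bar> \<le> b"
    and Um: "\<And>j. (\<lambda>\<omega>. U \<omega> j) \<in> borel_measurable M"
  shows "integrable M (\<lambda>\<omega>. f (U \<omega>))"
proof (rule integrable_const_bound[of _ b])
  show "(\<lambda>\<omega>. f (U \<omega>)) \<in> borel_measurable M"
    by (rule borel_measurable_continuous_coords[OF lipschitz_coords_continuous[OF lip] Um])
qed (simp add: bnd)

lemma (in prob_space) sin_coords_mean_error:
  fixes f :: "(nat \<Rightarrow> real) \<Rightarrow> real"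
  assumes lip: "\<And>x y. \<bar>f x - f y\<bar> \<le> L * (\<Sum>j<J. \<bar>x j - y j\<bar>)" and L: "0 \<le> L"
    and bnd: "\<And>x. \<bar>f x\<bar> \<le> b"
    and Um: "\<And>j. (\<lambda>\<omega>. U \<omega> j) \<in> borel_measurable M" and R: "R > 0"
    and U2: "\<And>j. j < J \<Longrightarrow> integrable M (\<lambda>\<omega>. (U \<omega> j)\<^sup>2) \<and> (\<integral>\<omega>. (U \<omega> j)\<^sup>2 \<partial>M) \<le> c"
  shows "\<bar>(\<integral>\<omega>. f (sin_coords J R (U \<omega>)) \<partial>M) - (\<integral>\<omega>. f (U \<omega>) \<partial>M)\<bar> \<le> L * (real J * c) / R"
proof -
  have pt: "\<bar>f (sin_coords J R x) - f x\<bar> \<le> L * (\<Sum>j<J. (x j)\<^sup>2 / R)" for x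
  proof -
    have "\<bar>f (sin_coords J R x) - f x\<bar> \<le> L * (\<Sum>j<J. \<bar>sin_coords J R x j - x j\<bar>)" by (rule lip)
    also have "\<dots> \<le> L * (\<Sum>j<J. (x j)\<^sup>2 / R)"
      using sin_scaled_bound[OF R] L by (intro mult_left_mono sum_mono) (auto simp: sin_coords_def)
    finally show ?thesis .
  qed
  have i1: "integrable M (\<lambda>\<omega>. f (sin_coords J R (U \<omega>)))"
    by (rule integrable_lipschitz_coords[OF lip bnd]) (rule measurable_sin_coords[OF Um])
  have i2: "integrable M (\<lambda>\<omega>. f (U \<omega>))"
    by (rule integrable_lipschitz_coords[OF lip bnd Um])
  have "\<bar>(\<integral>\<omega>. f (sin_coords J R (U \<omega>)) \<partial>M) - (\<integral>\<omega>. f (U \<omega>) \<partial>M)\<bar>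
      = \<bar>\<integral>\<omega>. f (sin_coords J R (U \<omega>)) - f (U \<omega>) \<partial>M\<bar>"
    using i1 i2 by simp
  also have "\<dots> \<le> (\<integral>\<omega>. \<bar>f (sin_coords J R (U \<omega>)) - f (U \<omega>)\<bar> \<partial>M)"
    by (rule integral_abs_bound)
  also have "\<dots> \<le> (\<integral>\<omega>. L * (\<Sum>j<J. (U \<omega> j)\<^sup>2 / R) \<partial>M)"
    using U2 by (intro integral_mono pt integrable_abs Bochner_Integration.integrable_diff i1 i2
        integrable_mult_right Bochner_Integration.integrable_sum integrable_divide) auto
  also have "\<dots> = L * (\<Sum>j<J. (\<integral>\<omega>. (U \<omega> j)\<^sup>2 \<partial>M) / R)"
    using U2 by (subst integral_mult_right_zero, subst Bochner_Integration.integral_sum) auto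
  also have "\<dots> \<le> L * (\<Sum>j<J. c / R)"
    using L R U2 by (intro mult_left_mono sum_mono divide_right_mono) auto
  finally show ?thesis by simp
qed

lemma (in prob_space) mean_uniform_error:
  assumes i: "integrable M f" "integrable M g" and e: "\<And>\<omega>. \<bar>f \<omega> - g \<omega>\<bar> \<le> (e::real)"
  shows "\<bar>(\<integral>\<omega>. f \<omega> \<partial>M) - (\<integral>\<omega>. g \<omega> \<partial>M)\<bar> \<le> e"
proof -
  have "\<bar>(\<integral>\<omega>. f \<omega> \<partial>M) - (\<integral>\<omega>. g \<omega> \<partial>M)\<bar> = \<bar>\<integral>\<omega>. f \<omega> - g \<omega> \<partial>M\<bar>"
    using i by simp
  also have "\<dots> \<le> (\<integral>\<omega>. \<bar>f \<omega> - g \<omega>\<bar> \<partial>M)" by (rule integral_abs_bound)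
  also have "\<dots> \<le> (\<integral>\<omega>. e \<partial>M)" using i e by (intro integral_mono) auto
  finally show ?thesis by (simp add: prob_space)
qed

text \<open>Composing \<open>f\<close> with \<open>x \<mapsto> R sin (x / R)\<close> costs only \<open>O(1/R)\<close> in mean and confines the argument to a
  compact box, where Stone--Weierstrass turns \<open>f\<close> into a trigonometric polynomial.\<close>
lemma cramer_wold_lipschitz:
  fixes Y :: "nat \<Rightarrow> 'a \<Rightarrow> nat \<Rightarrow> real" and V :: "'b \<Rightarrow> nat \<Rightarrow> real" and f :: "(nat \<Rightarrow> real) \<Rightarrow> real"
  assumes P: "prob_space P" and N: "prob_space N"
    and Ym: "\<And>n j. (\<lambda>\<omega>. Y n \<omega> j) \<in> borel_measurable P"
    and Vm: "\<And>j. (\<lambda>\<omega>. V \<omega> j) \<in> borel_measurable N"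
    and cf: "\<And>t. (\<lambda>n. \<integral>\<omega>. cis (\<Sum>j<J. t j * Y n \<omega> j) \<partial>P) \<longlonglongrightarrow> (\<integral>\<omega>. cis (\<Sum>j<J. t j * V \<omega> j) \<partial>N)"
    and Y2: "\<And>n j. j < J \<Longrightarrow> integrable P (\<lambda>\<omega>. (Y n \<omega> j)\<^sup>2) \<and> (\<integral>\<omega>. (Y n \<omega> j)\<^sup>2 \<partial>P) \<le> c"
    and V2: "\<And>j. j < J \<Longrightarrow> integrable N (\<lambda>\<omega>. (V \<omega> j)\<^sup>2) \<and> (\<integral>\<omega>. (V \<omega> j)\<^sup>2 \<partial>N) \<le> c"
    and lip: "\<And>x y. \<bar>f x - f y\<bar> \<le> L * (\<Sum>j<J. \<bar>x j - y j\<bar>)" and L: "0 \<le> L"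
    and bnd: "\<And>x. \<bar>f x\<bar> \<le> b"
  shows "(\<lambda>n. \<integral>\<omega>. f (Y n \<omega>) \<partial>P) \<longlonglongrightarrow> (\<integral>\<omega>. f (V \<omega>) \<partial>N)"
proof (rule LIMSEQ_I)
  interpret P: prob_space P by fact
  interpret N: prob_space N by fact
  fix e :: real assume e: "0 < e"
  \<comment> \<open>Five errors of at most e/5 are spent: sine truncation and polynomial
    approximation, each for \<open>Y n\<close> and for \<open>V\<close>, and convergence for the
    polynomial. \<open>R\<close> makes the truncation small; the maximum with 1 keeps it
    positive.\<close>
  define R where "R = max 1 (L * (real J * c) * 5 / e)"
  have R: "R > 0" by (simp add: R_def)
  have "L * (real J * c) * 5 / e \<le> R" by (simp add: R_def)
  then have Re: "L * (real J * c) / R \<le> e / 5"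
    using R e by (simp add: field_simps)
  define S where "S = {x :: nat \<Rightarrow> real. \<forall>j. x j \<in> (if j < J then {-R..R} else {0})}"
  \<comment> \<open>A coordinate is not a trigonometric polynomial, but its composite with
    \<open>sin_coords\<close> is one. The class is therefore described through composites, and the
    coordinates belong to it and separate points of \<open>S\<close>.\<close>
  let ?R = "\<lambda>g :: (nat \<Rightarrow> real) \<Rightarrow> real. continuous_on S g \<and> trig_poly J (\<lambda>x. complex_of_real (g (sin_coords J R x)))"
  have "\<exists>g. ?R g \<and> (\<forall>x\<in>S. \<bar>f x - g x\<bar> < e / 5)"
  proof (rule Stone_Weierstrass_HOL[of S ?R f])
    show "compact S" unfolding S_def by (rule compact_finite_box)
    show "continuous_on S f"
      using lipschitz_coords_continuous[OF lip] continuous_on_subset by blast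
    show "?R (\<lambda>x. c)" for c by (simp add: trig_poly_const)
    show "?R (\<lambda>x. f x + g x)" if "?R f \<and> ?R g" for f g
      using that by (simp add: continuous_on_add trig_poly.add)
    show "?R (\<lambda>x. f x * g x)" if "?R f \<and> ?R g" for f g
      using that by (simp add: continuous_on_mult trig_poly_mult)
    show "\<exists>g. ?R g \<and> g x \<noteq> g y" if xy: "x \<in> S \<and> y \<in> S \<and> x \<noteq> y" for x y
    proof -
      obtain j where j: "x j \<noteq> y j" using xy by auto
      have "j < J"
      proof (rule ccontr)
        assume "\<not> j < J"
        moreover have "x j \<in> (if j < J then {-R..R} else {0})" "y j \<in> (if j < J then {-R..R} else {0})"
          using xy unfolding S_def by blast+
        ultimately show False using j by simp
      qed
      then have "?R (\<lambda>x. x j)"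
        using trig_poly_sin[of j J R] continuous_on_subset[OF continuous_on_product_coordinates[of j], of S]
        by (simp add: sin_coords_def)
      then show ?thesis using j by blast
    qed
  qed (use e in auto)
  then obtain g where g: "?R g" "\<And>x. x \<in> S \<Longrightarrow> \<bar>f x - g x\<bar> < e / 5" by blast
  have "sin_coords J R x \<in> S" for x
  proof -
    have "\<bar>R * sin y\<bar> \<le> R" for y using R by (simp add: abs_mult mult_left_le)
    then have "- R \<le> R * sin y \<and> R * sin y \<le> R" for y by (metis abs_le_iff minus_le_iff)
    then show ?thesis by (auto simp: S_def sin_coords_def)
  qed
  then have fg: "\<bar>f (sin_coords J R x) - g (sin_coords J R x)\<bar> \<le> e / 5" for x
    using g(2) less_imp_le by blast
  have "(\<lambda>n. \<integral>\<omega>. complex_of_real (g (sin_coords J R (Y n \<omega>))) \<partial>P)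
      \<longlonglongrightarrow> (\<integral>\<omega>. complex_of_real (g (sin_coords J R (V \<omega>))) \<partial>N)"
    by (rule trig_poly_tendsto[where g = "\<lambda>x. complex_of_real (g (sin_coords J R x))", OF _ P N Ym Vm cf])
      (use g in auto)
  then have "(\<lambda>n. (\<integral>\<omega>. g (sin_coords J R (Y n \<omega>)) \<partial>P)) \<longlonglongrightarrow> (\<integral>\<omega>. g (sin_coords J R (V \<omega>)) \<partial>N)"
    unfolding integral_complex_of_real by (rule tendsto_of_real_iff[THEN iffD1])
  then obtain n0 where n0: "\<And>n. n \<ge> n0 \<Longrightarrow>
      \<bar>(\<integral>\<omega>. g (sin_coords J R (Y n \<omega>)) \<partial>P) - (\<integral>\<omega>. g (sin_coords J R (V \<omega>)) \<partial>N)\<bar> < e / 5"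
    using LIMSEQ_D[where r = "e / 5"] e by (metis half_gt_zero_iff real_norm_def zero_less_divide_iff zero_less_numeral)
  have gP: "integrable P (\<lambda>\<omega>. g (sin_coords J R (Y n \<omega>)))" for n
    using P.trig_poly_integrable[where Y = "Y n" and g = "\<lambda>x. complex_of_real (g (sin_coords J R x))", OF g(1)[THEN conjunct2] Ym]
    by (simp add: complex_of_real_integrable_eq)
  have gN: "integrable N (\<lambda>\<omega>. g (sin_coords J R (V \<omega>)))"
    using N.trig_poly_integrable[where Y = V and g = "\<lambda>x. complex_of_real (g (sin_coords J R x))", OF g(1)[THEN conjunct2] Vm]
    by (simp add: complex_of_real_integrable_eq)
  have 1: "\<bar>(\<integral>\<omega>. f (sin_coords J R (Y n \<omega>)) \<partial>P) - (\<integral>\<omega>. g (sin_coords J R (Y n \<omega>)) \<partial>P)\<bar> \<le> e / 5" for n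
    by (rule P.mean_uniform_error[OF _ gP fg])
      (rule P.integrable_lipschitz_coords[OF lip bnd], rule measurable_sin_coords, rule Ym)
  have 2: "\<bar>(\<integral>\<omega>. f (sin_coords J R (V \<omega>)) \<partial>N) - (\<integral>\<omega>. g (sin_coords J R (V \<omega>)) \<partial>N)\<bar> \<le> e / 5"
    by (rule N.mean_uniform_error[OF _ gN fg])
      (rule N.integrable_lipschitz_coords[OF lip bnd], rule measurable_sin_coords, rule Vm)
  have 3: "\<bar>(\<integral>\<omega>. f (sin_coords J R (Y n \<omega>)) \<partial>P) - (\<integral>\<omega>. f (Y n \<omega>) \<partial>P)\<bar> \<le> L * (real J * c) / R" for n
    by (rule P.sin_coords_mean_error[OF lip L bnd Ym R Y2])
  have 4: "\<bar>(\<integral>\<omega>. f (sin_coords J R (V \<omega>)) \<partial>N) - (\<integral>\<omega>. f (V \<omega>) \<partial>N)\<bar> \<le> L * (real J * c) / R"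
    by (rule N.sin_coords_mean_error[OF lip L bnd Vm R V2])
  have "\<bar>(\<integral>\<omega>. f (Y n \<omega>) \<partial>P) - (\<integral>\<omega>. f (V \<omega>) \<partial>N)\<bar> < e" if "n \<ge> n0" for n
    using n0[OF that] 1[of n] 2 3[of n] 4 Re by linarith
  then show "\<exists>no. \<forall>n\<ge>no. norm ((\<integral>\<omega>. f (Y n \<omega>) \<partial>P) - (\<integral>\<omega>. f (V \<omega>) \<partial>N)) < e"
    by auto
qed

section \<open>Elementary bounds on the exponential function\<close>

lemma exp_minus_le_quadratic: "0 \<le> y \<Longrightarrow> exp (- y) \<le> 1 - y + y\<^sup>2" for y :: real
proof -
  assume y: "0 \<le> y"
  have "exp (- y) \<le> 1 / (1 + y)"
    using exp_ge_add_one_self[of y] y by (simp add: exp_minus field_simps)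
  also have "\<dots> \<le> 1 - y + y\<^sup>2"
  proof -
    have "(1 - y + y\<^sup>2) * (1 + y) = 1 + y ^ 3" by (simp add: algebra_simps power2_eq_square power3_eq_cube)
    then have "1 \<le> (1 - y + y\<^sup>2) * (1 + y)" using y by simp
    then show ?thesis using y by (simp add: divide_le_eq)
  qed
  finally show ?thesis .
qed

lemma exp_le_quadratic: "\<bar>x\<bar> \<le> 1 \<Longrightarrow> exp x \<le> 1 + x + x\<^sup>2" for x :: real
  using exp_bound[of x] exp_minus_le_quadratic[of "- x"] by (cases "0 \<le> x") auto

lemma exp_minus_lipschitz: "0 \<le> a \<Longrightarrow> 0 \<le> b \<Longrightarrow> \<bar>exp (- a) - exp (- b)\<bar> \<le> \<bar>a - b\<bar>" for a b :: real
proof (induction a b rule: linorder_wlog)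
  case (le a b)
  have "1 - exp (- (b - a)) \<le> b - a"
    using exp_ge_add_one_self[of "- (b - a)"] by linarith
  then have "exp (- a) * (1 - exp (- (b - a))) \<le> 1 * (b - a)"
    using le by (intro mult_mono) auto
  then show ?case using le by (simp add: right_diff_distrib exp_add[symmetric])
qed (simp add: abs_minus_commute)

text \<open>Turns exponential moments at 1 and -1 into second moments. For y <= 2 the Taylor
  polynomial 2 + y^2/2 suffices, beyond that exp y is the square of exp (y/2) >= y.\<close>

lemma square_le_exp_sum: "x\<^sup>2 \<le> exp x + exp (- x)" for x :: real
proof -
  have *: "y\<^sup>2 \<le> exp y + exp (- y)" if "0 \<le> y" for y :: real
  proof -
    have "1 + y + y\<^sup>2 / 2 \<le> exp y" using exp_lower_Taylor_quadratic[OF that] .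
    moreover have "1 - y \<le> exp (- y)" using exp_ge_add_one_self[of "- y"] by simp
    ultimately have a: "2 + y\<^sup>2 / 2 \<le> exp y + exp (- y)" by simp
    show ?thesis
    proof (cases "y \<le> 2")
      case True
      then have "y\<^sup>2 \<le> 2\<^sup>2" using that by (intro power_mono) auto
      then show ?thesis using a by simp
    next
      case False
      have "1 + y / 2 + (y / 2)\<^sup>2 / 2 \<le> exp (y / 2)" using that by (intro exp_lower_Taylor_quadratic) simp
      moreover have "y \<le> 1 + y / 2 + (y / 2)\<^sup>2 / 2"
      proof -
        have "0 \<le> (y / 2 - 1)\<^sup>2" by simp
        then show ?thesis by (simp add: power2_eq_square algebra_simps)
      qed
      ultimately have "y\<^sup>2 \<le> (exp (y / 2))\<^sup>2" using that by (intro power_mono) auto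
      also have "\<dots> = exp y" by (simp add: power2_eq_square exp_add[symmetric])
      finally show ?thesis using exp_ge_zero[of "- y"] by linarith
    qed
  qed
  show ?thesis using *[of x] *[of "- x"] by (cases "0 \<le> x") auto
qed

section \<open>Moment generating and characteristic functions of bounded variables\<close>

context prob_space
begin

text \<open>With |t| <= 1/2 and |Y - E Y| <= 2 the exponent stays in [-1, 1], where exp x <= 1 + x +
  x^2; the linear term integrates to 0. Being stated in any probability space, the bound applies to
  the data and, given the data, to the uniform law on the sample.\<close>

lemma mgf_centered_le:
  assumes Ym [measurable]: "Y \<in> borel_measurable M" and Y1: "\<And>x. \<bar>Y x\<bar> \<le> (1::real)" and t: "\<bar>t\<bar> \<le> 1 / 2"
  shows "expectation (\<lambda>x. exp (t * (Y x - expectation Y))) \<le> exp (t\<^sup>2 * expectation (\<lambda>x. (Y x)\<^sup>2))"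
proof -
  let ?\<mu> = "expectation Y"
  have iY: "integrable M Y" by (rule integrable_const_bound[of _ 1]) (use Y1 in auto)
  have iY2: "integrable M (\<lambda>x. (Y x)\<^sup>2)"
    by (rule integrable_const_bound[of _ 1]) (use Y1 in \<open>auto simp: abs_square_le_1\<close>)
  have \<mu>: "\<bar>?\<mu>\<bar> \<le> 1"
  proof -
    have "\<bar>?\<mu>\<bar> \<le> expectation (\<lambda>x. \<bar>Y x\<bar>)" by (rule integral_abs_bound)
    also have "\<dots> \<le> expectation (\<lambda>x. 1)" using iY Y1 by (intro integral_mono) auto
    finally show ?thesis by (simp add: prob_space)
  qed
  have small: "\<bar>t * (Y x - ?\<mu>)\<bar> \<le> 1" for x
  proof -
    have "\<bar>t\<bar> * \<bar>Y x - ?\<mu>\<bar> \<le> 1 / 2 * 2" using Y1[of x] \<mu> t by (intro mult_mono) auto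
    then show ?thesis by (simp add: abs_mult)
  qed
  have "expectation (\<lambda>x. exp (t * (Y x - ?\<mu>))) \<le> expectation (\<lambda>x. 1 + t * (Y x - ?\<mu>) + (t * (Y x - ?\<mu>))\<^sup>2)"
  proof (rule integral_mono)
    show "integrable M (\<lambda>x. exp (t * (Y x - ?\<mu>)))"
      by (rule integrable_const_bound[of _ "exp 1"]) (use small in \<open>auto simp: abs_le_iff\<close>)
    show "integrable M (\<lambda>x. 1 + t * (Y x - ?\<mu>) + (t * (Y x - ?\<mu>))\<^sup>2)"
      using iY iY2 by (simp add: power_mult_distrib power2_diff)
  qed (rule exp_le_quadratic[OF small])
  also have "\<dots> = 1 + t\<^sup>2 * (expectation (\<lambda>x. (Y x)\<^sup>2) - ?\<mu>\<^sup>2)"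
    using iY iY2 by (simp add: power_mult_distrib power2_diff prob_space) (simp add: power2_eq_square algebra_simps)
  also have "\<dots> \<le> 1 + t\<^sup>2 * expectation (\<lambda>x. (Y x)\<^sup>2)" by (simp add: mult_left_mono)
  also have "\<dots> \<le> exp (t\<^sup>2 * expectation (\<lambda>x. (Y x)\<^sup>2))" by (rule exp_ge_add_one_self)
  finally show ?thesis .
qed

text \<open>An explicit rate depending only on the bound \<open>c\<close> replaces the central limit
  theorem, because for the bootstrap it must hold uniformly over the laws produced by the data. A
  third-order expansion with t = 1 / sqrt n gives an error of order t^3 in each factor.\<close>

lemma cf_power_approx:
  assumes Ym [measurable]: "Y \<in> borel_measurable M" and Yc: "\<And>x. \<bar>Y x\<bar> \<le> (c::real)"
    and mean: "expectation Y = 0" and n: "0 < n"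
  shows "cmod (expectation (\<lambda>x. cis (Y x / sqrt (real n))) ^ n - exp (- expectation (\<lambda>x. (Y x)\<^sup>2) / 2))
    \<le> (c ^ 3 + c ^ 4) / sqrt (real n)"
proof -
  define t where "t = 1 / sqrt (real n)"
  have t: "0 < t" "t \<le> 1" "t\<^sup>2 = 1 / real n" using n by (auto simp: t_def power_divide)
  define \<sigma> where "\<sigma> = expectation (\<lambda>x. (Y x)\<^sup>2)"
  have c: "0 \<le> c" using Yc[of undefined] by linarith
  have iY: "integrable M Y" by (rule integrable_const_bound[of _ c]) (use Yc in auto)
  have sq: "(Y x)\<^sup>2 \<le> c\<^sup>2" for x using Yc[of x] c by (simp add: abs_le_square_iff[symmetric])
  have iY2: "integrable M (\<lambda>x. (Y x)\<^sup>2)"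
    by (rule integrable_const_bound[of _ "c\<^sup>2"]) (use sq in auto)
  have \<sigma>: "0 \<le> \<sigma>" "\<sigma> \<le> c\<^sup>2"
  proof -
    show "0 \<le> \<sigma>" unfolding \<sigma>_def by (intro integral_nonneg_AE) simp
    have "\<sigma> \<le> expectation (\<lambda>x. c\<^sup>2)" unfolding \<sigma>_def using iY2 sq by (intro integral_mono) auto
    then show "\<sigma> \<le> c\<^sup>2" by (simp add: prob_space)
  qed
  have icis: "integrable M (\<lambda>x. cis (t * Y x))"
    unfolding cis_conv_exp by (rule integrable_const_bound[of _ 1]) auto
  define q where "q x = 1 + \<i> * of_real (t * Y x) - of_real ((t * Y x)\<^sup>2 / 2)" for x
  have pt: "cmod (cis (t * Y x) - q x) \<le> t ^ 3 * c ^ 3" for x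
  proof -
    have "cmod (iexp (t * Y x) - (\<Sum>k\<le>2. (\<i> * of_real (t * Y x)) ^ k / fact k)) \<le> \<bar>t * Y x\<bar> ^ Suc 2 / fact (Suc 2)"
      by (rule iexp_approx1)
    also have "(\<Sum>k\<le>2. (\<i> * of_real (t * Y x)) ^ k / fact k) = q x"
      by (simp add: q_def numeral_2_eq_2 power_mult_distrib)
    also have "\<bar>t * Y x\<bar> ^ Suc 2 / fact (Suc 2) \<le> (t * c) ^ 3"
    proof -
      have "\<bar>t * Y x\<bar> ^ 3 \<le> (t * c) ^ 3" using Yc[of x] t by (intro power_mono) (auto simp: abs_mult)
      moreover have "\<bar>t * Y x\<bar> ^ 3 / fact 3 \<le> \<bar>t * Y x\<bar> ^ 3"
        by (simp add: divide_le_eq fact_numeral mult_left_le)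
      ultimately show ?thesis by (simp add: eval_nat_numeral(3)[symmetric])
    qed
    finally show ?thesis by (simp add: cis_conv_exp power_mult_distrib)
  qed
  have iq: "integrable M q" unfolding q_def
    by (intro Bochner_Integration.integrable_diff Bochner_Integration.integrable_add integrable_mult_right)
      (use iY iY2 in \<open>auto simp: power_mult_distrib complex_of_real_integrable_eq simp del: of_real_mult of_real_power of_real_divide\<close>)
  have Eq: "(\<integral>x. q x \<partial>M) = of_real (1 - t\<^sup>2 * \<sigma> / 2)"
  proof -
    have "(\<integral>x. q x \<partial>M) = 1 + \<i> * of_real (\<integral>x. t * Y x \<partial>M) - of_real (\<integral>x. (t * Y x)\<^sup>2 / 2 \<partial>M)"
      unfolding q_def
      by (subst Bochner_Integration.integral_diff Bochner_Integration.integral_add | subst integral_mult_right_zero | subst integral_complex_of_real)+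
        (use iY iY2 in \<open>auto simp: prob_space power_mult_distrib complex_of_real_integrable_eq simp del: of_real_mult of_real_power of_real_divide\<close>)
    then show ?thesis by (simp add: mean power_mult_distrib \<sigma>_def)
  qed
  define \<phi> where "\<phi> = (\<integral>x. cis (t * Y x) \<partial>M)"
  have 1: "cmod (\<phi> - of_real (1 - t\<^sup>2 * \<sigma> / 2)) \<le> t ^ 3 * c ^ 3"
  proof -
    have "\<phi> - of_real (1 - t\<^sup>2 * \<sigma> / 2) = (\<integral>x. cis (t * Y x) - q x \<partial>M)"
      unfolding \<phi>_def using icis iq Eq by simp
    also have "cmod \<dots> \<le> (\<integral>x. cmod (cis (t * Y x) - q x) \<partial>M)" by (rule integral_norm_bound)
    also have "\<dots> \<le> (\<integral>x. t ^ 3 * c ^ 3 \<partial>M)" using icis iq pt by (intro integral_mono) auto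
    finally show ?thesis by (simp add: prob_space)
  qed
  define y where "y = t\<^sup>2 * \<sigma> / 2"
  have y: "0 \<le> y" using \<sigma> by (simp add: y_def)
  have 2: "\<bar>exp (- y) - (1 - y)\<bar> \<le> t ^ 3 * c ^ 4"
  proof -
    have "\<bar>exp (- y) - (1 - y)\<bar> \<le> y\<^sup>2"
      using exp_minus_le_quadratic[OF y] exp_minus_ge[of y] by simp
    also have "\<dots> \<le> (t\<^sup>2 * c\<^sup>2)\<^sup>2"
    proof (rule power_mono[OF _ y])
      have "t\<^sup>2 * \<sigma> \<le> t\<^sup>2 * c\<^sup>2" "0 \<le> t\<^sup>2 * \<sigma>" using \<sigma> by (auto intro: mult_left_mono)
      then show "y \<le> t\<^sup>2 * c\<^sup>2" unfolding y_def by linarith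
    qed
    \<comment> \<open>The natural order is t^4; one power is given up, using t <= 1, to match the
      third-order error of the expansion.\<close>
    also have "\<dots> = t * (t ^ 3 * c ^ 4)" by (simp add: eval_nat_numeral algebra_simps)
    also have "\<dots> \<le> 1 * (t ^ 3 * c ^ 4)" using t c by (intro mult_right_mono) auto
    finally show ?thesis by simp
  qed
  have 3: "cmod (\<phi> - of_real (exp (- y))) \<le> t ^ 3 * (c ^ 3 + c ^ 4)"
  proof -
    have "\<phi> - of_real (exp (- y)) = (\<phi> - of_real (1 - y)) - of_real (exp (- y) - (1 - y))" by simp
    also have "cmod \<dots> \<le> cmod (\<phi> - of_real (1 - y)) + cmod (of_real (exp (- y) - (1 - y)))"
      by (rule norm_triangle_ineq4)
    also have "\<dots> \<le> t ^ 3 * c ^ 3 + t ^ 3 * c ^ 4"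
      using 1 2 unfolding norm_of_real y_def[symmetric] by (rule add_mono)
    finally show ?thesis by (simp add: algebra_simps)
  qed
  have \<phi>1: "cmod \<phi> \<le> 1"
  proof -
    have "cmod \<phi> \<le> (\<integral>x. cmod (cis (t * Y x)) \<partial>M)" unfolding \<phi>_def by (rule integral_norm_bound)
    then show ?thesis by (simp add: prob_space)
  qed
  \<comment> \<open>Both bases lie in the closed unit disc, so the n-th powers differ by at most n
    times the bases, and n t^3 = t.\<close>
  have "cmod (\<phi> ^ n - of_real (exp (- y)) ^ n) \<le> real n * cmod (\<phi> - of_real (exp (- y)))"
    using y by (intro norm_power_diff \<phi>1) simp
  also have "\<dots> \<le> real n * (t ^ 3 * (c ^ 3 + c ^ 4))" using 3 by (intro mult_left_mono) auto
  also have "\<dots> = (c ^ 3 + c ^ 4) / sqrt (real n)"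
  proof -
    have "real n * t ^ 3 = (real n * t\<^sup>2) * t" by (simp add: eval_nat_numeral)
    also have "\<dots> = t" using n t(3) by simp
    finally show ?thesis by (simp add: t_def mult.assoc[symmetric])
  qed
  also have "of_real (exp (- y)) ^ n = of_real (exp (- \<sigma> / 2))"
  proof -
    have "exp (- y) ^ n = exp (real n * (- y))" by (rule exp_of_nat_mult[symmetric])
    also have "real n * (- y) = - \<sigma> / 2" using n t(3) by (simp add: y_def)
    finally show ?thesis by (metis of_real_power)
  qed
  finally show ?thesis by (simp add: \<phi>_def \<sigma>_def t_def)
qed

end

section \<open>Linearisation of the empirical copula\<close>

definition emp_D :: "('p \<Rightarrow> real \<Rightarrow> real) \<Rightarrow> nat \<Rightarrow> (nat \<Rightarrow> (real^'p) \<times> (real^'q)) \<Rightarrow> (real^'q) set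
    \<Rightarrow> real^'p \<Rightarrow> real" where
  "emp_D F n s A u =
     (\<Sum>i<n. if (\<forall>k. F k (fst (s i) $ k) \<le> u $ k) \<and> snd (s i) \<in> A then 1 else 0) / real n"

text \<open>This is (t, 1_{-k}): as the functions \<open>F j\<close> are at most 1, its orthant
  restricts only the k-th margin.\<close>

definition edge :: "'p \<Rightarrow> real \<Rightarrow> real^'p" where
  "edge k t = (\<chi> j. if j = k then t else 1)"

lemma emp_D_mono: "(\<And>k. u $ k \<le> v $ k) \<Longrightarrow> emp_D F n s A u \<le> emp_D F n s A v"
  unfolding emp_D_def by (intro divide_right_mono sum_mono) (auto intro: order_trans)

lemma emp_D_one:
  assumes "\<And>k t. F k t \<le> 1" shows "emp_D F n s A 1 = emp_pA n s A"
  using assms by (simp add: emp_D_def emp_pA_def)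

lemma emp_D_edge:
  assumes "\<And>k t. F k t \<le> 1"
  shows "emp_D F n s A (edge k t) =
    (\<Sum>i<n. if F k (fst (s i) $ k) \<le> t \<and> snd (s i) \<in> A then 1 else 0) / real n"
proof -
  have "(\<forall>j. F j (fst (s i) $ j) \<le> edge k t $ j) \<longleftrightarrow> F k (fst (s i) $ k) \<le> t" for i
    using assms by (auto simp: edge_def)
  then show ?thesis by (simp add: emp_D_def)
qed

text \<open>The infimum is attained because the empirical margin jumps only at observations: any
  \<open>t\<close> with value at least \<open>u\<close> > 0 can be lowered to the largest
  observation below it (\<open>below\<close>), which leaves finitely many candidates.
  \<open>u\<close> <= 1 makes the largest observation one of them.\<close>

lemma ginv_emp_F:
  assumes ex: "\<exists>i<n. snd (s i) \<in> A" and u: "0 < u" "u \<le> 1"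
  obtains x where "ginv (emp_F n s A k) u = ereal x" "u \<le> emp_F n s A k x"
    "\<And>t. t < x \<Longrightarrow> emp_F n s A k t < u"
proof -
  let ?F = "emp_F n s A k"
  define I where "I = {i. i < n \<and> snd (s i) \<in> A}"
  have I: "finite I" "I \<noteq> {}" using ex by (auto simp: I_def)
  have F: "?F t = real (card {i \<in> I. fst (s i) $ k \<le> t}) / real (card I)" for t
  proof -
    have "(\<Sum>i<n. if fst (s i) $ k \<le> t \<and> snd (s i) \<in> A then 1 else 0::real)
        = real (card {i \<in> I. fst (s i) $ k \<le> t})"
      by (auto simp: sum.If_cases I_def intro!: arg_cong[where f=card])
    moreover have "(\<Sum>i<n. if snd (s i) \<in> A then 1 else 0::real) = real (card I)"
      by (auto simp: sum.If_cases I_def intro!: arg_cong[where f=card])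
    moreover have "n > 0" using ex by auto
    ultimately show ?thesis by (simp add: emp_F_def emp_pA_def)
  qed
  have cI: "real (card I) > 0" using I by (simp add: card_gt_0_iff)
  have Fmono: "?F a \<le> ?F b" if "a \<le> b" for a b
    unfolding F using that I(1) by (intro divide_right_mono of_nat_mono card_mono) auto
  define V where "V = (\<lambda>i. fst (s i) $ k) ` I"
  have V: "finite V" "V \<noteq> {}" using I by (auto simp: V_def)
  define S where "S = {t \<in> V. u \<le> ?F t}"
  have below: "\<exists>y\<in>S. y \<le> t" if "u \<le> ?F t" for t
  proof -
    have "{i \<in> I. fst (s i) $ k \<le> t} \<noteq> {}"
    proof
      assume "{i \<in> I. fst (s i) $ k \<le> t} = {}"
      then have "?F t = 0" unfolding F by (simp only: card.empty)
      then show False using that u by simp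
    qed
    then have ne: "{y \<in> V. y \<le> t} \<noteq> {}" by (auto simp: V_def)
    define y where "y = Max {y \<in> V. y \<le> t}"
    have y: "y \<in> V" "y \<le> t" "\<And>z. z \<in> V \<Longrightarrow> z \<le> t \<Longrightarrow> z \<le> y"
      using Max_in[OF _ ne] V(1) by (auto simp: y_def)
    have "{i \<in> I. fst (s i) $ k \<le> t} = {i \<in> I. fst (s i) $ k \<le> y}"
      using y by (auto simp: V_def)
    then have "?F y = ?F t" by (simp add: F)
    then show ?thesis using y that by (auto simp: S_def)
  qed
  have "?F (Max V) = 1"
  proof -
    have "{i \<in> I. fst (s i) $ k \<le> Max V} = I" using V by (auto simp: V_def)
    then show ?thesis using cI by (simp add: F)
  qed
  then have S: "finite S" "S \<noteq> {}" using V u by (auto simp: S_def intro!: Max_in)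
  define x where "x = Min S"
  have x: "x \<in> S" "\<And>y. y \<in> S \<Longrightarrow> x \<le> y" using S by (auto simp: x_def)
  have le: "x \<le> t" if "u \<le> ?F t" for t
    using below[OF that] x(2) by force
  show thesis
  proof
    show "u \<le> ?F x" using x by (simp add: S_def)
    show "ginv ?F u = ereal x"
      unfolding ginv_def
    proof (rule Inf_eqI)
      show "ereal x \<le> i" if "i \<in> {ereal t |t. u \<le> ?F t}" for i
        using that le by auto
      show "y \<le> ereal x" if "\<And>i. i \<in> {ereal t |t. u \<le> ?F t} \<Longrightarrow> y \<le> i" for y
        using that[of "ereal x"] \<open>u \<le> ?F x\<close> by auto
    qed
    show "?F t < u" if "t < x" for t using le[of t] that by force
  qed
qed

lemma ginv_nonpos:
  assumes F: "\<And>t. 0 \<le> F t" and "u \<le> 0"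
  shows "ginv F u = -\<infinity>"
proof -
  have "{ereal t | t. F t \<ge> u} = range ereal"
    using order_trans[OF assms(2) F] by blast
  moreover have "Inf (range ereal) = -\<infinity>"
  proof (rule ereal_bot)
    fix B show "Inf (range ereal) \<le> ereal B" by (intro Inf_lower) auto
  qed
  ultimately show ?thesis by (simp add: ginv_def)
qed

lemma emp_F_nonneg: "0 \<le> emp_F n s A k t"
  unfolding emp_F_def emp_pA_def by (intro divide_nonneg_nonneg sum_nonneg mult_nonneg_nonneg) auto

text \<open>The empirical copula at \<open>u\<close> is squeezed between the values of the (normalised) empirical distribution of
  the \<open>F\<^sub>k(X\<^sub>k)\<close> at the random point \<open>v\<^sub>k = F\<^sub>k(F\<^sub>n\<^sub>,\<^sub>k\<^sup>-\<^sup>1(u\<^sub>k))\<close> and just below it; ties of \<open>F\<^sub>k(X\<^sub>k)\<close> are harmless.\<close>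
lemma emp_copula_squeeze:
  fixes F :: "'p::finite \<Rightarrow> real \<Rightarrow> real" and s :: "nat \<Rightarrow> (real^'p) \<times> (real^'q)"
  assumes F01: "\<And>k t. 0 \<le> F k t \<and> F k t \<le> 1" and Fmono: "\<And>k. mono (F k)"
    and ex: "\<exists>i<n. snd (s i) \<in> A"
    and nz: "\<And>i k. i < n \<Longrightarrow> snd (s i) \<in> A \<Longrightarrow> 0 < F k (fst (s i) $ k)"
    and u: "u \<in> unit_cube"
  obtains v where "v \<in> unit_cube"
    "\<And>k. u $ k * emp_pA n s A \<le> emp_D F n s A (edge k (v $ k))"
    "\<And>k a. 0 \<le> a \<Longrightarrow> a < v $ k \<or> a = 0 \<Longrightarrow> emp_D F n s A (edge k a) \<le> u $ k * emp_pA n s A"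
    "\<And>a. (\<And>k. a $ k < v $ k \<or> a $ k = 0) \<Longrightarrow> emp_D F n s A a \<le> emp_copula n s A u * emp_pA n s A"
    "emp_copula n s A u * emp_pA n s A \<le> emp_D F n s A v"
proof -
  let ?q = "emp_pA n s A"
  have n: "n > 0" using ex by auto
  have q: "?q > 0"
  proof -
    obtain i where i: "i < n" "snd (s i) \<in> A" using ex by blast
    have "(1::real) = (if snd (s i) \<in> A then 1 else 0)" using i by simp
    also have "\<dots> \<le> (\<Sum>i<n. if snd (s i) \<in> A then 1 else 0)"
      using i by (intro member_le_sum) auto
    finally show ?thesis using n by (simp add: emp_pA_def)
  qed
  have u01: "0 \<le> u $ k" "u $ k \<le> 1" for k using u by (auto simp: unit_cube_def)
  have "\<exists>x. u $ k > 0 \<longrightarrow> ginv (emp_F n s A k) (u $ k) = ereal x \<and> u $ k \<le> emp_F n s A k x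
      \<and> (\<forall>t<x. emp_F n s A k t < u $ k)" for k
  proof (cases "u $ k > 0")
    case True
    from ginv_emp_F[OF ex True u01(2), of k] show ?thesis by metis
  qed simp
  then obtain x where x: "\<And>k. u $ k > 0 \<Longrightarrow> ginv (emp_F n s A k) (u $ k) = ereal (x k) \<and> u $ k \<le> emp_F n s A k (x k)
      \<and> (\<forall>t<x k. emp_F n s A k t < u $ k)" by metis
  \<comment> \<open>At \<open>u $ k\<close> = 0 the generalised inverse is minus infinity, so no
    observation counts; the value 0 matches this, because \<open>nz\<close> leaves no observation
    with F = 0.\<close>
  define v where "v = (\<chi> k. if u $ k > 0 then F k (x k) else 0)"
  have cop: "emp_copula n s A u * ?q = (\<Sum>i<n. if (\<forall>k. ereal (fst (s i) $ k) \<le> ginv (emp_F n s A k) (u $ k)) \<and> snd (s i) \<in> A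
             then 1 else 0) / real n"
    using q by (simp add: emp_copula_def)
  have cntF: "emp_F n s A k t * ?q = (\<Sum>i<n. if fst (s i) $ k \<le> t \<and> snd (s i) \<in> A then 1 else 0) / real n" for k t
    using q by (simp add: emp_F_def)
  have edge: "emp_D F n s A (edge k t) =
    (\<Sum>i<n. if F k (fst (s i) $ k) \<le> t \<and> snd (s i) \<in> A then 1 else 0) / real n" for k t
    using F01 by (intro emp_D_edge) auto
  show thesis
  proof
    show "v \<in> unit_cube" using F01 by (auto simp: v_def unit_cube_def)
    show "u $ k * ?q \<le> emp_D F n s A (edge k (v $ k))" for k
    proof (cases "u $ k > 0")
      case True
      have "u $ k * ?q \<le> emp_F n s A k (x k) * ?q" using x[OF True] q by (intro mult_right_mono) auto
      also have "\<dots> \<le> emp_D F n s A (edge k (v $ k))"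
        unfolding cntF edge using True monoD[OF Fmono[of k]]
        by (intro divide_right_mono sum_mono) (auto simp: v_def)
      finally show ?thesis .
    next
      case False
      then have "u $ k = 0" using u01[of k] by simp
      then show ?thesis unfolding edge by (auto intro!: divide_nonneg_nonneg sum_nonneg)
    qed
    show "emp_D F n s A (edge k a) \<le> u $ k * ?q" if a: "0 \<le> a" "a < v $ k \<or> a = 0" for k a
    proof (cases "a = 0")
      case True
      have "emp_D F n s A (edge k a) = 0"
        unfolding edge True using nz by (auto intro!: sum.neutral simp: not_le)
      then show ?thesis using u01 q by simp
    next
      case False
      then have av: "a < v $ k" using a by simp
      then have uk: "u $ k > 0" using a by (auto simp: v_def split: if_splits)
      define I where "I = {i. i < n \<and> snd (s i) \<in> A \<and> F k (fst (s i) $ k) \<le> a}"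
      show ?thesis
      proof (cases "I = {}")
        case True
        have "emp_D F n s A (edge k a) = 0" unfolding edge using True
          by (auto intro!: sum.neutral simp: I_def)
        then show ?thesis using u01 q by simp
      next
        case False
        \<comment> \<open>The largest observation with F at most \<open>a\<close>. Comparing values
          of F, not arguments, places it strictly below the quantile \<open>x k\<close>, even when F
          has flat stretches.\<close>
        define t where "t = Max ((\<lambda>i. fst (s i) $ k) ` I)"
        have fin: "finite I" by (simp add: I_def)
        have "t \<in> (\<lambda>i. fst (s i) $ k) ` I" unfolding t_def using fin False by (intro Max_in) auto
        then have "F k t \<le> a" by (auto simp: I_def)
        then have "F k t < F k (x k)" using av uk by (simp add: v_def)
        then have "t < x k" using monoD[OF Fmono[of k], of "x k" t] by force
        then have "emp_F n s A k t * ?q \<le> u $ k * ?q" using x[OF uk] q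
          by (intro mult_right_mono) (auto intro: less_imp_le)
        moreover have "emp_D F n s A (edge k a) \<le> emp_F n s A k t * ?q"
          unfolding cntF edge
        proof (intro divide_right_mono sum_mono)
          fix i assume "i \<in> {..<n}"
          moreover have "fst (s i) $ k \<le> t" if "i \<in> I" for i
            unfolding t_def using that fin by (intro Max_ge) auto
          ultimately show "(if F k (fst (s i) $ k) \<le> a \<and> snd (s i) \<in> A then 1 else 0::real)
            \<le> (if fst (s i) $ k \<le> t \<and> snd (s i) \<in> A then 1 else 0)"
            by (auto simp: I_def)
        qed simp
        ultimately show ?thesis by simp
      qed
    qed
    show "emp_D F n s A a \<le> emp_copula n s A u * ?q" if a: "\<And>k. a $ k < v $ k \<or> a $ k = 0" for a
      unfolding cop emp_D_def
    proof (intro divide_right_mono sum_mono)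
      fix i assume i: "i \<in> {..<n}"
      have "ereal (fst (s i) $ k) \<le> ginv (emp_F n s A k) (u $ k)"
        if Fi: "\<forall>k. F k (fst (s i) $ k) \<le> a $ k" and A: "snd (s i) \<in> A" for k
      proof -
        have pos: "0 < F k (fst (s i) $ k)" using nz i A by auto
        then have "a $ k \<noteq> 0" using Fi by (metis not_le)
        then have av: "a $ k < v $ k" using a[of k] by simp
        then have uk: "u $ k > 0"
          using pos Fi by (auto simp: v_def split: if_splits) (metis not_le order_trans less_imp_le)
        have "F k (fst (s i) $ k) < F k (x k)" using Fi av uk by (auto simp: v_def intro: le_less_trans)
        then have "fst (s i) $ k < x k" using monoD[OF Fmono[of k], of "x k" "fst (s i) $ k"] by force
        then show ?thesis using x[OF uk] by simp
      qed
      then show "(if (\<forall>k. F k (fst (s i) $ k) \<le> a $ k) \<and> snd (s i) \<in> A then 1 else 0::real)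
         \<le> (if (\<forall>k. ereal (fst (s i) $ k) \<le> ginv (emp_F n s A k) (u $ k)) \<and> snd (s i) \<in> A then 1 else 0)"
        by auto
    qed simp
    show "emp_copula n s A u * ?q \<le> emp_D F n s A v"
      unfolding cop emp_D_def
    proof (intro divide_right_mono sum_mono)
      fix i assume i: "i \<in> {..<n}"
      have "F k (fst (s i) $ k) \<le> v $ k" if g: "\<forall>k. ereal (fst (s i) $ k) \<le> ginv (emp_F n s A k) (u $ k)" for k
      proof (cases "u $ k > 0")
        case True
        then have "fst (s i) $ k \<le> x k" using g x[OF True] by (metis ereal_less_eq(3))
        then show ?thesis using True monoD[OF Fmono[of k]] by (simp add: v_def)
      next
        case False
        then have "ginv (emp_F n s A k) (u $ k) = -\<infinity>"
          by (intro ginv_nonpos emp_F_nonneg) simp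
        then show ?thesis using g[rule_format, of k] by simp
      qed
      then show "(if (\<forall>k. ereal (fst (s i) $ k) \<le> ginv (emp_F n s A k) (u $ k)) \<and> snd (s i) \<in> A then 1 else 0::real)
         \<le> (if (\<forall>k. F k (fst (s i) $ k) \<le> v $ k) \<and> snd (s i) \<in> A then 1 else 0)"
        by auto
    qed simp
  qed
qed

section \<open>The delta method for one fixed sample\<close>

lemma convex_unit_cube: "convex unit_cube"
  unfolding convex_def unit_cube_def
  by (auto intro!: add_nonneg_nonneg mult_nonneg_nonneg convex_bound_le)

text \<open>The mean value inequality along the segment from \<open>u\<close> to \<open>v\<close>,
  which stays in the cube and within \<delta> of \<open>u\<close> in every coordinate. Derivatives
  within the cube cover its boundary.\<close>

lemma linearization_remainder:
  fixes C :: "real^'p \<Rightarrow> real" and C' :: "real^'p \<Rightarrow> (real^'p) \<Rightarrow>\<^sub>L real"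
  assumes Cder: "\<And>u. u \<in> unit_cube \<Longrightarrow> (C has_derivative blinfun_apply (C' u)) (at u within unit_cube)"
    and \<rho>: "\<And>w. w \<in> unit_cube \<Longrightarrow> (\<And>k. \<bar>w $ k - u $ k\<bar> \<le> \<delta>) \<Longrightarrow> norm (C' w - C' u) \<le> \<rho>"
    and u: "u \<in> unit_cube" and v: "v \<in> unit_cube" and uv: "\<And>k. \<bar>v $ k - u $ k\<bar> \<le> \<delta>"
  shows "\<bar>C v - C u - (\<Sum>k\<in>UNIV. (v $ k - u $ k) * C' u (axis k 1))\<bar> \<le> (\<Sum>k\<in>UNIV. \<bar>v $ k - u $ k\<bar>) * \<rho>"
proof -
  let ?S = "unit_cube \<inter> {w. \<forall>k. \<bar>w $ k - u $ k\<bar> \<le> \<delta>}"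
  have \<delta>: "0 \<le> \<delta>" using uv[of undefined] by simp
  have uS: "u \<in> ?S" using u \<delta> by simp
  have \<rho>0: "0 \<le> \<rho>" using \<rho>[OF u] \<delta> by simp
  have "norm (C v - C u - blinfun_apply (C' u) (v - u)) \<le> norm (v - u) * \<rho>"
  proof (rule differentiable_bound_linearization[where S = ?S and f' = "\<lambda>x. blinfun_apply (C' x)"])
    fix t :: real assume t: "t \<in> {0..1}"
    have "u + t *\<^sub>R (v - u) = (1 - t) *\<^sub>R u + t *\<^sub>R v" by (simp add: algebra_simps)
    also have "\<dots> \<in> unit_cube" using convex_unit_cube u v t unfolding convex_def by auto
    finally have "u + t *\<^sub>R (v - u) \<in> unit_cube" .
    moreover have "\<bar>t * (v $ k - u $ k)\<bar> \<le> \<delta>" for k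
    proof -
      have "\<bar>t * (v $ k - u $ k)\<bar> \<le> 1 * \<delta>"
        unfolding abs_mult using t uv[of k] by (intro mult_mono) auto
      then show ?thesis by simp
    qed
    ultimately show "u + t *\<^sub>R (v - u) \<in> ?S" by simp
  next
    fix x assume x: "x \<in> ?S"
    show "(C has_derivative blinfun_apply (C' x)) (at x within ?S)"
      using has_derivative_subset[OF Cder] x by blast
    have "norm (C' x - C' u) \<le> \<rho>" using \<rho> x by blast
    then show "onorm (blinfun_apply (C' x) - blinfun_apply (C' u)) \<le> \<rho>"
      by (simp add: norm_blinfun.rep_eq minus_blinfun.rep_eq fun_diff_def)
  qed (rule uS)
  also have "norm (v - u) * \<rho> \<le> (\<Sum>k\<in>UNIV. \<bar>v $ k - u $ k\<bar>) * \<rho>"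
    using norm_le_l1_cart[of "v - u"] \<rho>0 by (intro mult_right_mono) auto
  also have "blinfun_apply (C' u) (v - u) = (\<Sum>k\<in>UNIV. (v $ k - u $ k) * C' u (axis k 1))"
  proof -
    have "v - u = (\<Sum>k\<in>UNIV. (v $ k - u $ k) *\<^sub>R axis k 1)"
      using basis_expansion[of "v - u"] by (simp add: scalar_mult_eq_scaleR)
    then have "blinfun_apply (C' u) (v - u) = blinfun_apply (C' u) (\<Sum>k\<in>UNIV. (v $ k - u $ k) *\<^sub>R axis k 1)"
      by simp
    then show ?thesis by (simp add: blinfun.sum_right blinfun.scaleR_right)
  qed
  finally show ?thesis by simp
qed

text \<open>Purely deterministic: \<kappa> bounds \<open>G\<close>, \<eta> bounds its oscillation at
  scale \<delta>, and \<rho> that of \<open>C'\<close>. The first condition in \<open>large\<close>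
  forces \<open>emp_pA\<close> to be at least p/2, the second keeps the random point
  \<open>v\<close> of the squeeze within \<delta> of \<open>u\<close>. The reason for the form of
  \<open>Cinf\<close> is that sqrt n * p * (v_k - u_k) equals u_k G(1) - G(u_k, 1_{-k}) up to
  multiples of \<eta>.\<close>

lemma delta_method_bound:
  fixes F :: "'p::finite \<Rightarrow> real \<Rightarrow> real" and s :: "nat \<Rightarrow> (real^'p) \<times> (real^'q)"
    and C :: "real^'p \<Rightarrow> real" and C' :: "real^'p \<Rightarrow> (real^'p) \<Rightarrow>\<^sub>L real"
  defines "d \<equiv> real CARD('p)"
  assumes F01: "\<And>k t. 0 \<le> F k t \<and> F k t \<le> 1" and Fmono: "\<And>k. mono (F k)"
    and nz: "\<And>i k. i < n \<Longrightarrow> snd (s i) \<in> A \<Longrightarrow> 0 < F k (fst (s i) $ k)"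
    and p: "0 < p" "p \<le> 1"
    and C01: "\<And>u. u \<in> unit_cube \<Longrightarrow> 0 \<le> C u \<and> C u \<le> 1"
    and Dlip: "\<And>u v. u \<in> unit_cube \<Longrightarrow> v \<in> unit_cube \<Longrightarrow> (\<And>k. u $ k \<le> v $ k)
        \<Longrightarrow> p * C v - p * C u \<le> (\<Sum>k\<in>UNIV. v $ k - u $ k)"
    and Cedge: "\<And>k t. 0 \<le> t \<Longrightarrow> t \<le> 1 \<Longrightarrow> C (edge k t) = t"
    and Cder: "\<And>u. u \<in> unit_cube \<Longrightarrow> (C has_derivative blinfun_apply (C' u)) (at u within unit_cube)"
    and c1: "\<And>u. u \<in> unit_cube \<Longrightarrow> norm (C' u) \<le> c1"
    and \<rho>: "\<And>u w. u \<in> unit_cube \<Longrightarrow> w \<in> unit_cube \<Longrightarrow> (\<And>k. \<bar>w $ k - u $ k\<bar> \<le> \<delta>) \<Longrightarrow> norm (C' w - C' u) \<le> \<rho>"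
    and G: "\<And>u. G u = sqrt (real n) * (emp_D F n s A u - p * C u)"
    and \<kappa>: "\<And>u. u \<in> unit_cube \<Longrightarrow> \<bar>G u\<bar> \<le> \<kappa>"
    and \<eta>: "\<And>u w. u \<in> unit_cube \<Longrightarrow> w \<in> unit_cube \<Longrightarrow> (\<And>k. \<bar>w $ k - u $ k\<bar> \<le> \<delta>) \<Longrightarrow> \<bar>G w - G u\<bar> \<le> \<eta>"
    and pos: "0 < \<eta>" "0 < \<delta>" "0 < n"
    and large: "2 * \<kappa> \<le> sqrt (real n) * p" "2 * \<kappa> + 2 * \<eta> \<le> \<delta> * (sqrt (real n) * p)"
    and u: "u \<in> unit_cube"
  shows "\<bar>sqrt (real n) * (emp_copula n s A u - C u) - Cinf p C (\<lambda>v k. blinfun_apply (C' v) (axis k 1)) G u\<bar>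
    \<le> 2 / p * ((d + 2 + 3 * d * c1) * \<eta> + d * (2 * \<kappa> + 2 * \<eta>) * \<rho>)
      + 2 * \<kappa> / (sqrt (real n) * p) * (\<kappa> * (2 + 2 * d * c1) / p)"
proof -
  define r where "r = sqrt (real n)"
  have r: "r > 0" using pos by (simp add: r_def)
  define Q where "Q = emp_D F n s A"
  define q where "q = emp_pA n s A"
  have edge_cube: "edge k t \<in> unit_cube" if "0 \<le> t" "t \<le> 1" for k t
    using that by (auto simp: edge_def unit_cube_def)
  have one_cube: "(1::real^'p) \<in> unit_cube" by (simp add: unit_cube_def)
  have edge1: "edge k 1 = (1::real^'p)" for k by (simp add: edge_def vec_eq_iff)
  have C1: "C 1 = 1" using Cedge[of 1] by (simp add: edge1)
  have Q1: "Q 1 = q" using F01 by (simp add: Q_def q_def emp_D_one)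
  have QG: "Q w = p * C w + G w / r" for w
    using r by (simp add: G Q_def r_def)
  have \<kappa>0: "0 \<le> \<kappa>" using \<kappa>[OF one_cube] by simp
  have qG: "q = p + G 1 / r" using QG[of 1] by (simp add: C1 Q1)
  have "\<bar>G 1 / r\<bar> \<le> p / 2"
  proof -
    have "\<bar>G 1\<bar> \<le> r * p / 2" using \<kappa>[OF one_cube] large by (simp add: r_def)
    then show ?thesis using r by (simp add: field_simps)
  qed
  then have qp: "p / 2 \<le> q" unfolding qG by linarith
  then have q: "0 < q" using p by simp
  have ex: "\<exists>i<n. snd (s i) \<in> A"
  proof (rule ccontr)
    assume "\<not> ?thesis"
    then have "q = 0" by (simp add: q_def emp_pA_def)
    then show False using q by simp
  qed
  obtain v where v: "v \<in> unit_cube"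
    and v1: "\<And>k. u $ k * q \<le> Q (edge k (v $ k))"
    and v2: "\<And>k a. 0 \<le> a \<Longrightarrow> a < v $ k \<or> a = 0 \<Longrightarrow> Q (edge k a) \<le> u $ k * q"
    and v3: "\<And>a. (\<And>k. a $ k < v $ k \<or> a $ k = 0) \<Longrightarrow> Q a \<le> emp_copula n s A u * q"
    and v4: "emp_copula n s A u * q \<le> Q v"
    using emp_copula_squeeze[OF F01 Fmono ex nz u] unfolding Q_def q_def by blast
  have u01: "0 \<le> u $ k" "u $ k \<le> 1" for k using u by (auto simp: unit_cube_def)
  have v01: "0 \<le> v $ k" "v $ k \<le> 1" for k using v by (auto simp: unit_cube_def)
  \<comment> \<open>How far to step below \<open>v\<close>: at most \<delta>, so that the modulus of
    \<open>G\<close> applies, and at most \<eta> / r, so that the drift of \<open>D\<close>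
    multiplied by sqrt n is of order \<eta>.\<close>
  define \<tau> where "\<tau> = min \<delta> (\<eta> / r)"
  have \<tau>: "0 < \<tau>" "\<tau> \<le> \<delta>" "r * \<tau> \<le> \<eta>"
    using pos r by (auto simp: \<tau>_def min_def field_simps)
  define a where "a = (\<chi> k. max 0 (v $ k - \<tau>))"
  have a01: "0 \<le> a $ k" "a $ k \<le> 1" "a $ k \<le> v $ k" "v $ k - a $ k \<le> \<tau>" "a $ k < v $ k \<or> a $ k = 0" for k
    using v01[of k] \<tau> by (auto simp: a_def max_def)
  have a: "a \<in> unit_cube" using a01 by (simp add: unit_cube_def)
  \<comment> \<open>This is sqrt n times the overshoot Q(v_k, 1_{-k}) - q u_k of the k-th empirical
    quantile. It is nonnegative by \<open>v1\<close>, and at most 2 \<eta> by \<open>v2\<close> at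
    the point \<open>a\<close> just below \<open>v\<close>.\<close>
  define e where "e k = r * p * (v $ k - u $ k) - (u $ k * G 1 - G (edge k (v $ k)))" for k
  have e0: "0 \<le> e k" for k
  proof -
    have "u $ k * (p + G 1 / r) \<le> p * v $ k + G (edge k (v $ k)) / r"
      using v1[of k] QG[of "edge k (v $ k)"] Cedge[of "v $ k" k] v01[of k] qG by simp
    then have "r * (u $ k * (p + G 1 / r)) \<le> r * (p * v $ k + G (edge k (v $ k)) / r)"
      using r by (intro mult_left_mono) auto
    then show ?thesis using r by (simp add: e_def algebra_simps)
  qed
  have e2: "e k \<le> 2 * \<eta>" for k
  proof -
    have "p * a $ k + G (edge k (a $ k)) / r \<le> u $ k * (p + G 1 / r)"
      using v2[of "a $ k" k] QG[of "edge k (a $ k)"] Cedge[of "a $ k" k] a01[of k] qG by simp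
    then have "r * (p * a $ k + G (edge k (a $ k)) / r) \<le> r * (u $ k * (p + G 1 / r))"
      using r by (intro mult_left_mono) auto
    then have 1: "r * p * a $ k + G (edge k (a $ k)) \<le> r * p * u $ k + u $ k * G 1"
      using r by (simp add: algebra_simps)
    have "p * (r * (v $ k - a $ k)) \<le> 1 * (r * \<tau>)"
      using p r a01[of k] \<tau> by (intro mult_mono) auto
    then have 2: "r * p * v $ k - r * p * a $ k \<le> \<eta>" using \<tau> by (simp add: algebra_simps)
    have "\<bar>G (edge k (v $ k)) - G (edge k (a $ k))\<bar> \<le> \<eta>"
      using a01[of k] v01[of k] \<tau> by (intro \<eta> edge_cube) (auto simp: edge_def)
    then show ?thesis using 1 2 by (simp add: e_def algebra_simps)
  qed
  have vu: "\<bar>r * p * (v $ k - u $ k)\<bar> \<le> 2 * \<kappa> + 2 * \<eta>" for k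
  proof -
    have "\<bar>u $ k * G 1\<bar> \<le> 1 * \<kappa>"
      unfolding abs_mult using u01[of k] \<kappa>[OF one_cube] by (intro mult_mono) auto
    moreover have "\<bar>G (edge k (v $ k))\<bar> \<le> \<kappa>" using v01[of k] by (intro \<kappa> edge_cube) auto
    ultimately show ?thesis using e0[of k] e2[of k] by (simp add: e_def)
  qed
  have rp: "0 < r * p" using r p by simp
  have vud: "\<bar>v $ k - u $ k\<bar> \<le> \<delta>" for k
  proof -
    have "r * p * \<bar>v $ k - u $ k\<bar> = \<bar>r * p * (v $ k - u $ k)\<bar>" using r p by (simp add: abs_mult)
    also have "\<dots> \<le> r * p * \<delta>"
      using vu[of k] large(2) by (simp only: r_def[symmetric] mult.commute[of \<delta>] order_trans)
    finally have "r * p * \<bar>v $ k - u $ k\<bar> \<le> r * p * \<delta>" .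
    then show ?thesis using mult_le_cancel_left_pos[OF rp] by blast
  qed
  \<comment> \<open>Moves the argument of \<open>G\<close> from the random v_k to u_k, at the price
    of one more \<eta>.\<close>
  define e' where "e' k = r * p * (v $ k - u $ k) - (u $ k * G 1 - G (edge k (u $ k)))" for k
  have e': "\<bar>e' k\<bar> \<le> 3 * \<eta>" for k
  proof -
    have "\<bar>G (edge k (v $ k)) - G (edge k (u $ k))\<bar> \<le> \<eta>"
      using u01[of k] v01[of k] vud[of k] pos by (intro \<eta> edge_cube) (auto simp: edge_def)
    then show ?thesis using e0[of k] e2[of k] by (simp add: e_def e'_def)
  qed
  have Gvu: "\<bar>G v - G u\<bar> \<le> \<eta>" using u v vud by (intro \<eta>)
  have joint: "\<bar>r * (emp_copula n s A u * q) - r * Q v\<bar> \<le> (d + 1) * \<eta>"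
  proof -
    have "Q a \<le> emp_copula n s A u * q" using v3 a01 by blast
    then have "\<bar>emp_copula n s A u * q - Q v\<bar> \<le> Q v - Q a" using v4 by simp
    also have "\<dots> = (p * C v - p * C a) + (G v - G a) / r" unfolding QG by (simp add: diff_divide_distrib)
    also have "\<dots> \<le> d * \<tau> + \<eta> / r"
    proof (intro add_mono divide_right_mono)
      have "p * C v - p * C a \<le> (\<Sum>k\<in>UNIV. v $ k - a $ k)" using a v a01 by (intro Dlip)
      also have "\<dots> \<le> (\<Sum>k\<in>(UNIV::'p set). \<tau>)" using a01 by (intro sum_mono)
      finally show "p * C v - p * C a \<le> d * \<tau>" by (simp add: d_def)
      have "\<bar>v $ k - a $ k\<bar> \<le> \<delta>" for k using a01[of k] \<tau> by auto
      then show "G v - G a \<le> \<eta>" using \<eta>[OF a v] by fastforce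
    qed (use r in auto)
    finally have "r * \<bar>emp_copula n s A u * q - Q v\<bar> \<le> r * (d * \<tau> + \<eta> / r)"
      using r by (intro mult_left_mono) auto
    also have "\<dots> = d * (r * \<tau>) + \<eta>" using r by (simp add: algebra_simps)
    also have "\<dots> \<le> d * \<eta> + \<eta>" using \<tau> by (intro add_mono mult_left_mono) (auto simp: d_def)
    finally have "\<bar>r * (emp_copula n s A u * q - Q v)\<bar> \<le> (d + 1) * \<eta>"
      using r by (simp add: abs_mult distrib_right)
    then show ?thesis by (simp only: right_diff_distrib)
  qed
  define dC where "dC k = blinfun_apply (C' u) (axis k 1)" for k
  have dC: "\<bar>dC k\<bar> \<le> c1" for k
    using norm_blinfun[of "C' u" "axis k 1"] c1[OF u] by (simp add: dC_def norm_axis_1)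
  have c10: "0 \<le> c1" using dC[of undefined] by simp
  have rho0: "0 \<le> \<rho>" using \<rho>[OF u u] pos by simp
  define e2 where "e2 = C v - C u - (\<Sum>k\<in>UNIV. (v $ k - u $ k) * dC k)"
  have e2b: "\<bar>r * p * e2\<bar> \<le> d * (2 * \<kappa> + 2 * \<eta>) * \<rho>"
  proof -
    have "\<bar>e2\<bar> \<le> (\<Sum>k\<in>UNIV. \<bar>v $ k - u $ k\<bar>) * \<rho>"
      unfolding e2_def dC_def using linearization_remainder[OF Cder \<rho>[OF u] u v vud] by blast
    then have "r * p * \<bar>e2\<bar> \<le> r * p * ((\<Sum>k\<in>UNIV. \<bar>v $ k - u $ k\<bar>) * \<rho>)"
      using rp by (intro mult_left_mono) auto
    also have "\<dots> = (\<Sum>k\<in>UNIV. \<bar>r * p * (v $ k - u $ k)\<bar>) * \<rho>"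
      using r p by (simp add: sum_distrib_left abs_mult mult.assoc)
    also have "\<dots> \<le> (\<Sum>k\<in>(UNIV::'p set). 2 * \<kappa> + 2 * \<eta>) * \<rho>"
      using rho0 by (intro mult_right_mono sum_mono vu) auto
    finally show ?thesis using r p by (simp add: abs_mult d_def)
  qed
  define L where "L = Cinf p C (\<lambda>v k. blinfun_apply (C' v) (axis k 1)) G u"
  have pL: "p * L = G u - (\<Sum>k\<in>UNIV. dC k * (G (edge k (u $ k)) - u $ k * G 1)) - C u * G 1"
    unfolding L_def Cinf_def dC_def edge_def[symmetric] using p
    by (simp add: power2_eq_square right_diff_distrib sum_distrib_left)
  define err where "err = r * (emp_copula n s A u - C u) * q - p * L"
  \<comment> \<open>The four terms are the gap between the copula and \<open>Q\<close> at
    \<open>v\<close>, the oscillation of \<open>G\<close> between \<open>u\<close> and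
    \<open>v\<close>, the marginal quantile errors weighted by the partial derivatives, and the
    Taylor remainder of \<open>C\<close>. The first three give the coefficient d + 2 + 3 d c1 of
    \<eta>.\<close>
  have err_eq: "err = (r * (emp_copula n s A u * q) - r * Q v) + (G v - G u)
      + (\<Sum>k\<in>UNIV. e' k * dC k) + r * p * e2"
  proof -
    have "(\<Sum>k\<in>UNIV. e' k * dC k) = r * p * (\<Sum>k\<in>UNIV. (v $ k - u $ k) * dC k)
        + (\<Sum>k\<in>UNIV. dC k * (G (edge k (u $ k)) - u $ k * G 1))"
      unfolding e'_def by (simp add: sum_distrib_left sum.distrib[symmetric] algebra_simps)
    moreover have "r * Q v = r * p * C v + G v" unfolding QG using r by (simp add: algebra_simps)
    moreover have "r * (emp_copula n s A u - C u) * q = r * (emp_copula n s A u * q) - C u * (r * p) - C u * G 1"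
      unfolding qG using r by (simp add: algebra_simps)
    ultimately show ?thesis unfolding err_def pL e2_def by (simp add: algebra_simps)
  qed
  have se: "\<bar>\<Sum>k\<in>UNIV. e' k * dC k\<bar> \<le> 3 * d * c1 * \<eta>"
  proof -
    have "\<bar>\<Sum>k\<in>UNIV. e' k * dC k\<bar> \<le> (\<Sum>k\<in>(UNIV::'p set). (3 * \<eta>) * c1)"
      using e' dC pos by (intro order_trans[OF sum_abs] sum_mono) (auto simp: abs_mult intro!: mult_mono)
    then show ?thesis by (simp add: d_def algebra_simps)
  qed
  have err: "\<bar>err\<bar> \<le> (d + 2 + 3 * d * c1) * \<eta> + d * (2 * \<kappa> + 2 * \<eta>) * \<rho>"
  proof -
    have "\<bar>err\<bar> \<le> (d + 1) * \<eta> + \<eta> + 3 * d * c1 * \<eta> + d * (2 * \<kappa> + 2 * \<eta>) * \<rho>"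
      unfolding err_eq using joint Gvu se e2b by linarith
    then show ?thesis by (simp add: algebra_simps)
  qed
  have Lb: "\<bar>L\<bar> \<le> \<kappa> * (2 + 2 * d * c1) / p"
  proof -
    have "\<bar>dC k * (G (edge k (u $ k)) - u $ k * G 1)\<bar> \<le> c1 * (2 * \<kappa>)" for k
    proof -
      have "\<bar>u $ k * G 1\<bar> \<le> 1 * \<kappa>"
        unfolding abs_mult using u01[of k] \<kappa>[OF one_cube] by (intro mult_mono) auto
      moreover have "\<bar>G (edge k (u $ k))\<bar> \<le> \<kappa>" using u01[of k] by (intro \<kappa> edge_cube) auto
      ultimately have "\<bar>G (edge k (u $ k)) - u $ k * G 1\<bar> \<le> 2 * \<kappa>" by simp
      then show ?thesis unfolding abs_mult using dC c10 by (intro mult_mono) auto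
    qed
    then have "\<bar>\<Sum>k\<in>UNIV. dC k * (G (edge k (u $ k)) - u $ k * G 1)\<bar> \<le> (\<Sum>k\<in>(UNIV::'p set). c1 * (2 * \<kappa>))"
      by (intro order_trans[OF sum_abs] sum_mono)
    moreover have "\<bar>C u * G 1\<bar> \<le> 1 * \<kappa>"
      unfolding abs_mult using C01[OF u] \<kappa>[OF one_cube] by (intro mult_mono) auto
    ultimately have "\<bar>p * L\<bar> \<le> \<kappa> + d * (c1 * (2 * \<kappa>)) + \<kappa>"
      unfolding pL using \<kappa>[OF u] by (simp add: d_def)
    then show ?thesis using p by (simp add: abs_mult field_simps)
  qed
  \<comment> \<open>\<open>err\<close> carries the random factor q in place of p. Dividing it out
    leaves a term in p - q, which is of order 1 / sqrt n, and q >= p/2 bounds the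
    denominators.\<close>
  have "r * (emp_copula n s A u - C u) - L = err / q + L * (p - q) / q"
    unfolding err_def using q by (simp add: field_simps)
  also have "\<bar>\<dots>\<bar> \<le> \<bar>err\<bar> / q + \<bar>L\<bar> * \<bar>p - q\<bar> / q"
    using q by (intro order_trans[OF abs_triangle_ineq]) (simp add: abs_mult)
  also have "\<dots> \<le> \<bar>err\<bar> / (p / 2) + \<bar>L\<bar> * (\<kappa> / r) / (p / 2)"
  proof (intro add_mono frac_le mult_left_mono mult_nonneg_nonneg)
    show "\<bar>p - q\<bar> \<le> \<kappa> / r" unfolding qG using r \<kappa>[OF one_cube] by (simp add: divide_right_mono)
  qed (use p qp r \<kappa>0 in auto)
  also have "\<dots> = 2 / p * \<bar>err\<bar> + 2 * \<kappa> / (r * p) * \<bar>L\<bar>" by (simp add: field_simps)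
  also have "\<dots> \<le> 2 / p * ((d + 2 + 3 * d * c1) * \<eta> + d * (2 * \<kappa> + 2 * \<eta>) * \<rho>)
      + 2 * \<kappa> / (r * p) * (\<kappa> * (2 + 2 * d * c1) / p)"
    using err Lb p r \<kappa>0 by (intro add_mono mult_left_mono) auto
  finally show ?thesis unfolding L_def r_def .
qed

section \<open>Bootstrap samples\<close>

locale bootstrap_sample = prob_space P for P :: "'a measure" +
  fixes X :: "nat \<Rightarrow> 'a \<Rightarrow> real^'p"
    and Z :: "nat \<Rightarrow> 'a \<Rightarrow> real^'q"
    and J :: "nat \<times> nat \<times> nat \<Rightarrow> 'a \<Rightarrow> nat"
  assumes X_meas [measurable]: "\<And>i. X i \<in> borel_measurable P"
    and Z_meas [measurable]: "\<And>i. Z i \<in> borel_measurable P"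
    and iid_indep: "indep_vars (\<lambda>_. borel) (\<lambda>i \<omega>. (X i \<omega>, Z i \<omega>)) UNIV"
    and iid_dist: "\<And>i. distr P borel (\<lambda>\<omega>. (X i \<omega>, Z i \<omega>)) = distr P borel (\<lambda>\<omega>. (X 0 \<omega>, Z 0 \<omega>))"
    and boot_indep: "indep_vars (\<lambda>_. count_space UNIV) J UNIV"
    and boot_unif: "\<And>n m i. i < n \<Longrightarrow>
          distr P (count_space UNIV) (J (n, m, i)) = measure_pmf (pmf_of_set {..<n})"
    and boot_data_indep: "\<And>S T. S \<in> sets (Pi\<^sub>M UNIV (\<lambda>_. borel)) \<Longrightarrow>
          T \<in> sets (Pi\<^sub>M UNIV (\<lambda>_. count_space UNIV)) \<Longrightarrow>
          prob {\<omega>\<in>space P. (\<lambda>i. (X i \<omega>, Z i \<omega>)) \<in> S \<and> (\<lambda>k. J k \<omega>) \<in> T}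
          = prob {\<omega>\<in>space P. (\<lambda>i. (X i \<omega>, Z i \<omega>)) \<in> S}
            * prob {\<omega>\<in>space P. (\<lambda>k. J k \<omega>) \<in> T}"
begin

definition obs :: "'a \<Rightarrow> nat \<Rightarrow> (real^'p) \<times> (real^'q)" where
  "obs \<omega> i = (X i \<omega>, Z i \<omega>)"

lemma obs_meas [measurable]: "(\<lambda>\<omega>. obs \<omega> i) \<in> borel_measurable P"
  unfolding obs_def by measurable

lemma obs_path_meas [measurable]: "obs \<in> measurable P (Pi\<^sub>M UNIV (\<lambda>_. borel))"
proof -
  have "(\<lambda>\<omega> i. obs \<omega> i) \<in> measurable P (Pi\<^sub>M UNIV (\<lambda>_. borel))"
    by (rule measurable_PiM_single') (auto simp: obs_meas)
  then show ?thesis by simp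
qed

lemma J_meas [measurable]: "J x \<in> measurable P (count_space UNIV)"
  using boot_indep unfolding indep_vars_def by blast

lemma J_path_meas: "(\<lambda>\<omega> k. J k \<omega>) \<in> measurable P (Pi\<^sub>M UNIV (\<lambda>_. count_space UNIV))"
  by (rule measurable_PiM_single') (auto simp: J_meas)

text \<open>Product probabilities are assumed for measurable sets of whole paths; preimages form an
  intersection-stable generator, so they extend to independence of any two functionals of data and
  draws.\<close>

lemma indep_obs_J:
  assumes f: "f \<in> measurable (Pi\<^sub>M UNIV (\<lambda>_. borel)) N" and k: "k \<in> measurable (Pi\<^sub>M UNIV (\<lambda>_. count_space UNIV)) N"
  shows "indep_var N (\<lambda>\<omega>. f (obs \<omega>)) N (\<lambda>\<omega>. k (\<lambda>x. J x \<omega>))"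
  unfolding indep_var_eq
proof (intro conjI indep_set_sigma_sets indep_setI)
  let ?A = "{(\<lambda>\<omega>. f (obs \<omega>)) -` A \<inter> space P |A. A \<in> sets N}"
  let ?B = "{(\<lambda>\<omega>. k (\<lambda>x. J x \<omega>)) -` A \<inter> space P |A. A \<in> sets N}"
  show fm: "(\<lambda>\<omega>. f (obs \<omega>)) \<in> measurable P N" by (rule measurable_compose[OF obs_path_meas f])
  show km: "(\<lambda>\<omega>. k (\<lambda>x. J x \<omega>)) \<in> measurable P N" by (rule measurable_compose[OF J_path_meas k])
  show "?A \<subseteq> events" "?B \<subseteq> events"
    using measurable_sets[OF fm] measurable_sets[OF km] by blast+
  have stable: "Int_stable {h -` A \<inter> space P |A. A \<in> sets N}" for h :: "'a \<Rightarrow> _"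
  proof (rule Int_stableI)
    fix a b assume "a \<in> {h -` A \<inter> space P |A. A \<in> sets N}" "b \<in> {h -` A \<inter> space P |A. A \<in> sets N}"
    then obtain A B where "a = h -` A \<inter> space P" "b = h -` B \<inter> space P" "A \<in> sets N" "B \<in> sets N" by blast
    then have "a \<inter> b = h -` (A \<inter> B) \<inter> space P" "A \<inter> B \<in> sets N" by auto
    then show "a \<inter> b \<in> {h -` A \<inter> space P |A. A \<in> sets N}" by blast
  qed
  show "Int_stable ?A" "Int_stable ?B" by (rule stable)+
  show "prob (a \<inter> b) = prob a * prob b" if ab: "a \<in> ?A" "b \<in> ?B" for a b
  proof -
    obtain A B where A: "A \<in> sets N" "a = (\<lambda>\<omega>. f (obs \<omega>)) -` A \<inter> space P"
      and B: "B \<in> sets N" "b = (\<lambda>\<omega>. k (\<lambda>x. J x \<omega>)) -` B \<inter> space P"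
      using ab by blast
    define S where "S = f -` A \<inter> space (Pi\<^sub>M UNIV (\<lambda>_. borel))"
    define T where "T = k -` B \<inter> space (Pi\<^sub>M UNIV (\<lambda>_. count_space UNIV))"
    have S: "S \<in> sets (Pi\<^sub>M UNIV (\<lambda>_. borel))" unfolding S_def by (rule measurable_sets[OF f A(1)])
    have T: "T \<in> sets (Pi\<^sub>M UNIV (\<lambda>_. count_space UNIV))" unfolding T_def by (rule measurable_sets[OF k B(1)])
    have o: "obs \<omega> = (\<lambda>i. (X i \<omega>, Z i \<omega>))" for \<omega> by (simp add: obs_def fun_eq_iff)
    have "a = {\<omega>\<in>space P. (\<lambda>i. (X i \<omega>, Z i \<omega>)) \<in> S}" "b = {\<omega>\<in>space P. (\<lambda>k. J k \<omega>) \<in> T}"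
      "a \<inter> b = {\<omega>\<in>space P. (\<lambda>i. (X i \<omega>, Z i \<omega>)) \<in> S \<and> (\<lambda>k. J k \<omega>) \<in> T}"
      using A B by (auto simp: o S_def T_def space_PiM)
    then show ?thesis using boot_data_indep[OF S T] by simp
  qed
qed

lemma prob_J_eq:
  assumes "l < n" "i < n"
  shows "prob (J (n, m, i) -` {l} \<inter> space P) = 1 / real n"
proof -
  have "prob (J (n, m, i) -` {l} \<inter> space P) = measure (distr P (count_space UNIV) (J (n, m, i))) {l}"
    by (simp add: measure_distr)
  also have "\<dots> = 1 / real n"
    unfolding boot_unif[OF assms(2)] using assms by (simp add: measure_pmf_single pmf_of_set lessThan_empty_iff)
  finally show ?thesis .
qed

lemma AE_J_less:
  assumes "i < n" shows "AE \<omega> in P. J (n, m, i) \<omega> < n"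
proof -
  have "AE x in distr P (count_space UNIV) (J (n, m, i)). x < n"
    unfolding boot_unif[OF assms] using assms by (auto simp: AE_measure_pmf_iff lessThan_empty_iff)
  then show ?thesis by (subst (asm) AE_distr_iff) auto
qed

text \<open>Conditioning on the data is carried out by hand: sum over all tables \<open>j\<close> of
  drawn indices, each of probability n^(-card I) and independent of the data. The sum over tables of
  products is a product of sums, which turns each resample into the n-th power of an average over
  the data.\<close>

lemma boot_expectation:
  fixes b :: "(nat \<Rightarrow> (real^'p) \<times> (real^'q)) \<Rightarrow> 'c::{real_normed_field,banach,second_countable_topology}"
    and a :: "nat \<Rightarrow> nat \<Rightarrow> (nat \<Rightarrow> (real^'p) \<times> (real^'q)) \<Rightarrow> 'c"
  assumes n: "0 < n" and S: "finite S"
    and bm [measurable]: "b \<in> borel_measurable (Pi\<^sub>M UNIV (\<lambda>_. borel))"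
    and am [measurable]: "\<And>m l. a m l \<in> borel_measurable (Pi\<^sub>M UNIV (\<lambda>_. borel))"
    and bb: "\<And>x. norm (b x) \<le> cb" and ab: "\<And>m l x. norm (a m l x) \<le> ca"
  shows "expectation (\<lambda>\<omega>. b (obs \<omega>) * (\<Prod>m\<in>S. \<Prod>i<n. a m (J (n, m, i) \<omega>) (obs \<omega>)))
       = expectation (\<lambda>\<omega>. b (obs \<omega>) * (\<Prod>m\<in>S. ((\<Sum>l<n. a m l (obs \<omega>)) / of_nat n) ^ n))"
proof -
  define I where "I = S \<times> {..<n}"
  have I: "finite I" using S by (simp add: I_def)
  define JJ where "JJ = PiE I (\<lambda>_. {..<n})"
  have JJ: "finite JJ" using I unfolding JJ_def by (intro finite_PiE) auto
  define E where "E j = {\<omega> \<in> space P. \<forall>x\<in>I. J (n, fst x, snd x) \<omega> = j x}" for j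
  define f where "f j x = b x * (\<Prod>y\<in>I. a (fst y) (j y) x)" for j :: "nat \<times> nat \<Rightarrow> nat" and x
  have fm [measurable]: "f j \<in> borel_measurable (Pi\<^sub>M UNIV (\<lambda>_. borel))" for j
    unfolding f_def by measurable
  have fb: "norm (f j x) \<le> cb * ca ^ card I" for j x
  proof -
    have cb0: "0 \<le> cb" using bb order_trans[OF norm_ge_zero] by blast
    have "norm (f j x) \<le> cb * (\<Prod>y\<in>I. ca)"
      unfolding f_def norm_mult prod_norm[symmetric]
      by (intro mult_mono bb prod_mono conjI ab norm_ge_zero cb0 prod_nonneg)
    then show ?thesis by simp
  qed
  have fint: "integrable P (\<lambda>\<omega>. f j (obs \<omega>))" for j
    by (intro integrable_const_bound[of _ "cb * ca ^ card I"]) (auto simp: fb)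
  have Em [measurable]: "E j \<in> events" for j
    unfolding E_def using I by measurable
  have Eprob: "prob (E j) = (1 / real n) ^ card I" if "j \<in> JJ" for j
  proof (cases "I = {}")
    case True
    then show ?thesis by (simp add: E_def prob_space)
  next
    case False
    define h where "h x = (n, fst x, snd x)" for x :: "nat \<times> nat"
    have inj: "inj_on h I" by (auto simp: h_def inj_on_def prod_eq_iff)
    have "E j = (\<Inter>y\<in>h ` I. J y -` {j (snd y)} \<inter> space P)"
      using False by (auto simp: E_def h_def)
    also have "prob \<dots> = (\<Prod>y\<in>h ` I. prob (J y -` {j (snd y)} \<inter> space P))"
      using False I by (intro indep_varsD[OF boot_indep]) auto
    also have "\<dots> = (\<Prod>x\<in>I. prob (J (h x) -` {j x} \<inter> space P))"
      by (subst prod.reindex[OF inj]) (simp add: h_def)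
    also have "\<dots> = (\<Prod>x\<in>I. 1 / real n)"
      using that by (intro prod.cong refl) (auto simp: h_def I_def JJ_def PiE_def Pi_def intro!: prob_J_eq)
    finally show ?thesis by simp
  qed
  \<comment> \<open>For a fixed table \<open>j\<close> the first factor depends on the data only and
    the indicator on the draws only.\<close>
  have Eind: "expectation (\<lambda>\<omega>. f j (obs \<omega>) * indicator (E j) \<omega>) = expectation (\<lambda>\<omega>. f j (obs \<omega>)) * of_real ((1 / real n) ^ card I)"
    if "j \<in> JJ" for j
  proof -
    define k :: "(nat \<times> nat \<times> nat \<Rightarrow> nat) \<Rightarrow> 'c" where "k y = indicator {y. \<forall>x\<in>I. y (n, fst x, snd x) = j x} y" for y
    have km: "k \<in> borel_measurable (Pi\<^sub>M UNIV (\<lambda>_. count_space UNIV))"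
    proof -
      have "{y \<in> space (Pi\<^sub>M UNIV (\<lambda>_. count_space UNIV)). \<forall>x\<in>I. y (n, fst x, snd x) = j x} \<in> sets (Pi\<^sub>M UNIV (\<lambda>_. count_space UNIV))"
        using I by measurable
      then show ?thesis unfolding k_def by (intro borel_measurable_indicator) (simp add: space_PiM)
    qed
    have kE: "k (\<lambda>x. J x \<omega>) = indicator (E j) \<omega>" if "\<omega> \<in> space P" for \<omega>
      using that by (simp add: k_def E_def indicator_def)
    have "indep_var borel (\<lambda>\<omega>. f j (obs \<omega>)) borel (\<lambda>\<omega>. k (\<lambda>x. J x \<omega>))"
      by (rule indep_obs_J[OF fm km])
    moreover have ki: "integrable P (\<lambda>\<omega>. k (\<lambda>x. J x \<omega>))"
      by (rule integrable_const_bound[of _ 1])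
        (use measurable_compose[OF J_path_meas km] in \<open>auto simp: k_def indicator_def\<close>)
    ultimately have "expectation (\<lambda>\<omega>. f j (obs \<omega>) * k (\<lambda>x. J x \<omega>)) = expectation (\<lambda>\<omega>. f j (obs \<omega>)) * expectation (\<lambda>\<omega>. k (\<lambda>x. J x \<omega>))"
      using fint by (intro indep_var_lebesgue_integral)
    moreover have "expectation (\<lambda>\<omega>. f j (obs \<omega>) * k (\<lambda>x. J x \<omega>)) = expectation (\<lambda>\<omega>. f j (obs \<omega>) * indicator (E j) \<omega>)"
      by (intro Bochner_Integration.integral_cong refl) (simp add: kE)
    moreover have "expectation (\<lambda>\<omega>. k (\<lambda>x. J x \<omega>)) = expectation (\<lambda>\<omega>. indicator (E j) \<omega> *\<^sub>R 1)"
      by (intro Bochner_Integration.integral_cong refl) (simp add: kE indicator_def)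
    moreover have "expectation (\<lambda>\<omega>. indicator (E j) \<omega> *\<^sub>R (1::'c)) = of_real (prob (E j))"
      using Em[of j] by (subst integral_scaleR_left) (auto simp: of_real_def sets.Int_space_eq2 emeasure_eq_measure)
    ultimately show ?thesis using Eprob[OF that] by simp
  qed
  \<comment> \<open>The draws are below n only almost surely; on this event exactly one table
    \<open>j0\<close> occurs.\<close>
  have "AE \<omega> in P. \<forall>x\<in>I. J (n, fst x, snd x) \<omega> < n"
    using I by (intro AE_finite_allI) (auto simp: I_def intro!: AE_J_less)
  then have "AE \<omega> in P. b (obs \<omega>) * (\<Prod>m\<in>S. \<Prod>i<n. a m (J (n, m, i) \<omega>) (obs \<omega>))
      = (\<Sum>j\<in>JJ. f j (obs \<omega>) * indicator (E j) \<omega>)"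
    using AE_space
  proof eventually_elim
    case (elim \<omega>)
    define j0 where "j0 = restrict (\<lambda>x. J (n, fst x, snd x) \<omega>) I"
    have j0: "j0 \<in> JJ" using elim by (auto simp: j0_def JJ_def)
    have "\<omega> \<in> E j \<longleftrightarrow> j = j0" if "j \<in> JJ" for j
    proof
      assume "\<omega> \<in> E j"
      then show "j = j0" using that j0
        by (intro PiE_ext[of j I "\<lambda>_. {..<n}" j0]) (auto simp: JJ_def E_def j0_def)
    qed (use elim in \<open>auto simp: E_def j0_def\<close>)
    then have "(\<Sum>j\<in>JJ. f j (obs \<omega>) * indicator (E j) \<omega>) = (\<Sum>j\<in>JJ. if j = j0 then f j0 (obs \<omega>) else 0)"
      by (intro sum.cong refl) (auto simp: indicator_def)
    also have "\<dots> = f j0 (obs \<omega>)" using JJ j0 by simp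
    also have "\<dots> = b (obs \<omega>) * (\<Prod>x\<in>I. a (fst x) (J (n, fst x, snd x) \<omega>) (obs \<omega>))"
      unfolding f_def by (simp add: j0_def)
    also have "(\<Prod>x\<in>I. a (fst x) (J (n, fst x, snd x) \<omega>) (obs \<omega>)) = (\<Prod>m\<in>S. \<Prod>i<n. a m (J (n, m, i) \<omega>) (obs \<omega>))"
      unfolding I_def by (subst prod.cartesian_product) (simp add: case_prod_beta)
    finally show ?case by simp
  qed
  then have "expectation (\<lambda>\<omega>. b (obs \<omega>) * (\<Prod>m\<in>S. \<Prod>i<n. a m (J (n, m, i) \<omega>) (obs \<omega>)))
      = expectation (\<lambda>\<omega>. \<Sum>j\<in>JJ. f j (obs \<omega>) * indicator (E j) \<omega>)"
    by (rule integral_cong_AE[rotated 2]) measurable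
  also have "\<dots> = (\<Sum>j\<in>JJ. expectation (\<lambda>\<omega>. f j (obs \<omega>) * indicator (E j) \<omega>))"
    by (rule Bochner_Integration.integral_sum)
      (auto intro!: integrable_const_bound[of _ "cb * ca ^ card I"] AE_I2 simp: indicator_def fb order_trans[OF norm_ge_zero fb])
  also have "\<dots> = (\<Sum>j\<in>JJ. expectation (\<lambda>\<omega>. f j (obs \<omega>)) * of_real ((1 / real n) ^ card I))"
    by (intro sum.cong refl Eind)
  also have "\<dots> = expectation (\<lambda>\<omega>. (\<Sum>j\<in>JJ. f j (obs \<omega>)) * of_real ((1 / real n) ^ card I))"
    by (simp add: Bochner_Integration.integral_sum fint sum_distrib_right)
  also have "\<dots> = expectation (\<lambda>\<omega>. b (obs \<omega>) * (\<Prod>m\<in>S. ((\<Sum>l<n. a m l (obs \<omega>)) / of_nat n) ^ n))"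
  proof (intro Bochner_Integration.integral_cong refl)
    fix \<omega>
    have "(\<Sum>j\<in>JJ. f j (obs \<omega>)) = b (obs \<omega>) * (\<Prod>x\<in>I. \<Sum>l<n. a (fst x) l (obs \<omega>))"
      unfolding f_def JJ_def sum_distrib_left[symmetric] using I by (subst prod_sum_PiE) auto
    moreover have "(of_real ((1 / real n) ^ card I) :: 'c) = (\<Prod>x\<in>I. 1 / of_nat n)"
      by simp
    ultimately have "(\<Sum>j\<in>JJ. f j (obs \<omega>)) * of_real ((1 / real n) ^ card I)
        = b (obs \<omega>) * (\<Prod>x\<in>I. (\<Sum>l<n. a (fst x) l (obs \<omega>)) / of_nat n)"
      by (simp only: prod.distrib[symmetric] mult.assoc) simp
    also have "(\<Prod>x\<in>I. (\<Sum>l<n. a (fst x) l (obs \<omega>)) / of_nat n) = (\<Prod>m\<in>S. ((\<Sum>l<n. a m l (obs \<omega>)) / of_nat n) ^ n)"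
      unfolding I_def by (simp add: prod.cartesian_product' split_beta)
    finally show "(\<Sum>j\<in>JJ. f j (obs \<omega>)) * of_real ((1 / real n) ^ card I)
        = b (obs \<omega>) * (\<Prod>m\<in>S. ((\<Sum>l<n. a m l (obs \<omega>)) / of_nat n) ^ n)" .
  qed
  finally show ?thesis .
qed

lemma integral_obs_eq:
  fixes f :: "(real^'p) \<times> (real^'q) \<Rightarrow> 'c::{banach,second_countable_topology}"
  assumes [measurable]: "f \<in> borel_measurable borel"
  shows "expectation (\<lambda>\<omega>. f (obs \<omega> i)) = expectation (\<lambda>\<omega>. f (obs \<omega> 0))"
proof -
  have "expectation (\<lambda>\<omega>. f (obs \<omega> i)) = (\<integral>x. f x \<partial>distr P borel (\<lambda>\<omega>. obs \<omega> i))"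
    by (simp add: integral_distr)
  also have "distr P borel (\<lambda>\<omega>. obs \<omega> i) = distr P borel (\<lambda>\<omega>. obs \<omega> 0)"
    using iid_dist[of i] by (simp add: obs_def)
  also have "(\<integral>x. f x \<partial>distr P borel (\<lambda>\<omega>. obs \<omega> 0)) = expectation (\<lambda>\<omega>. f (obs \<omega> 0))"
    by (simp add: integral_distr)
  finally show ?thesis .
qed

lemma iid_prod_expectation:
  fixes f :: "(real^'p) \<times> (real^'q) \<Rightarrow> 'c::{real_normed_field,banach,second_countable_topology}"
  assumes [measurable]: "f \<in> borel_measurable borel" and b: "\<And>x. norm (f x) \<le> c"
  shows "expectation (\<lambda>\<omega>. \<Prod>i<n. f (obs \<omega> i)) = expectation (\<lambda>\<omega>. f (obs \<omega> 0)) ^ n"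
proof -
  have "indep_vars (\<lambda>_. borel) (\<lambda>i \<omega>. f (obs \<omega> i)) {..<n}"
    using indep_vars_compose2[OF iid_indep, of "\<lambda>_. f" "\<lambda>_. borel"]
    by (auto simp: obs_def intro: indep_vars_subset)
  moreover have "integrable P (\<lambda>\<omega>. f (obs \<omega> i))" for i
    by (rule integrable_const_bound[of _ c]) (auto simp: b)
  ultimately have "expectation (\<lambda>\<omega>. \<Prod>i<n. f (obs \<omega> i)) = (\<Prod>i<n. expectation (\<lambda>\<omega>. f (obs \<omega> i)))"
    by (intro indep_vars_lebesgue_integral) auto
  also have "\<dots> = (\<Prod>i<n. expectation (\<lambda>\<omega>. f (obs \<omega> 0)))"
    by (intro prod.cong refl integral_obs_eq) measurable
  also have "\<dots> = expectation (\<lambda>\<omega>. f (obs \<omega> 0)) ^ n" by simp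
  finally show ?thesis .
qed

end

section \<open>Sample averages as expectations under the uniform law on the sample\<close>

definition avg :: "nat \<Rightarrow> ('s \<Rightarrow> real) \<Rightarrow> (nat \<Rightarrow> 's) \<Rightarrow> real" where
  "avg n y x = (\<Sum>l<n. y (x l)) / real n"

lemma abs_avg_le:
  assumes "\<And>s. \<bar>y s\<bar> \<le> c" "0 < n" shows "\<bar>avg n y x\<bar> \<le> c"
proof -
  have "\<bar>\<Sum>l<n. y (x l)\<bar> \<le> (\<Sum>l<n. c)" by (intro order_trans[OF sum_abs] sum_mono assms)
  then show ?thesis using assms(2) by (simp add: avg_def abs_divide divide_le_eq mult.commute)
qed

text \<open>Lets the moment and characteristic function bounds be used conditionally on the data,
  with the drawn index as random variable.\<close>

lemma integral_uniform:
  fixes f :: "nat \<Rightarrow> 'b::{banach, second_countable_topology, real_normed_field}"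
  assumes "0 < n"
  shows "measure_pmf.expectation (pmf_of_set {..<n}) f = (\<Sum>l<n. f l) / of_nat n"
proof -
  have "measure_pmf.expectation (pmf_of_set {..<n}) f = (\<Sum>l<n. pmf (pmf_of_set {..<n}) l *\<^sub>R f l)"
    by (rule integral_measure_pmf) (use assms in \<open>auto simp: lessThan_empty_iff\<close>)
  also have "\<dots> = (\<Sum>l<n. f l / of_nat n)"
    using assms by (intro sum.cong refl) (auto simp: pmf_of_set lessThan_empty_iff scaleR_conv_of_real)
  finally show ?thesis by (simp add: sum_divide_distrib)
qed

lemma cis_sum: "cis (\<Sum>i\<in>I. f i) = (\<Prod>i\<in>I. cis (f i))"
  by (induction I rule: infinite_finite_induct) (auto simp: cis_mult[symmetric])

lemma borel_measurable_cis:
  "f \<in> borel_measurable N \<Longrightarrow> (\<lambda>x. cis (f x)) \<in> borel_measurable N"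
  unfolding cis_conv_exp by measurable

context bootstrap_sample
begin

lemma measurable_coord:
  assumes "y \<in> borel_measurable borel"
  shows "(\<lambda>x. y (x l)) \<in> borel_measurable (Pi\<^sub>M (UNIV :: nat set) (\<lambda>_. borel))"
  by (rule measurable_compose[OF _ assms]) measurable

lemma measurable_avg [measurable]:
  assumes [measurable]: "y \<in> borel_measurable borel"
  shows "avg n y \<in> borel_measurable (Pi\<^sub>M (UNIV :: nat set) (\<lambda>_. borel))"
  unfolding avg_def by (intro borel_measurable_divide borel_measurable_sum measurable_coord) auto

definition emean :: "((real^'p) \<times> (real^'q) \<Rightarrow> real) \<Rightarrow> real" where
  "emean y = expectation (\<lambda>\<omega>. y (obs \<omega> 0))"

text \<open>Indexed by functions rather than by points of the cube, so that grid increments and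
  linear combinations of orthants are again instances.\<close>

definition proc :: "nat \<Rightarrow> nat \<Rightarrow> ((real^'p) \<times> (real^'q) \<Rightarrow> real) \<Rightarrow> 'a \<Rightarrow> real" where
  "proc n m y \<omega> = (\<Sum>i<n. if m = 0 then y (obs \<omega> i) - emean y
      else y (obs \<omega> (J (n, m, i) \<omega>)) - avg n y (obs \<omega>)) / sqrt (real n)"

lemma measurable_obs_J [measurable]:
  assumes [measurable]: "y \<in> borel_measurable borel"
  shows "(\<lambda>\<omega>. y (obs \<omega> (J x \<omega>))) \<in> borel_measurable P"
  by (rule measurable_compose_countable[where g = "J x"]) measurable

lemma measurable_proc [measurable]:
  assumes [measurable]: "y \<in> borel_measurable borel"
  shows "proc n m y \<in> borel_measurable P"
  unfolding proc_def by (cases "m = 0") (auto intro!: borel_measurable_divide borel_measurable_sum borel_measurable_diff)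

lemma abs_emean_le:
  assumes [measurable]: "y \<in> borel_measurable borel" and b: "\<And>s. \<bar>y s\<bar> \<le> c"
  shows "\<bar>emean y\<bar> \<le> c"
proof -
  have i: "integrable P (\<lambda>\<omega>. y (obs \<omega> 0))" by (rule integrable_const_bound[of _ c]) (auto simp: b)
  have "\<bar>emean y\<bar> \<le> expectation (\<lambda>\<omega>. \<bar>y (obs \<omega> 0)\<bar>)" unfolding emean_def by (rule integral_abs_bound)
  also have "\<dots> \<le> expectation (\<lambda>\<omega>. c)" using i by (intro integral_mono) (auto simp: b)
  finally show ?thesis by (simp add: prob_space)
qed

lemma proc_diff:
  assumes [measurable]: "y \<in> borel_measurable borel" "z \<in> borel_measurable borel"
    and y: "\<And>s. \<bar>y s\<bar> \<le> c" and z: "\<And>s. \<bar>z s\<bar> \<le> c"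
  shows "proc n m (\<lambda>s. y s - z s) \<omega> = proc n m y \<omega> - proc n m z \<omega>"
proof -
  have "integrable P (\<lambda>\<omega>. y (obs \<omega> 0))" "integrable P (\<lambda>\<omega>. z (obs \<omega> 0))"
    by (auto intro!: integrable_const_bound[of _ c] simp: y z)
  then have "emean (\<lambda>s. y s - z s) = emean y - emean z" by (simp add: emean_def)
  moreover have "avg n (\<lambda>s. y s - z s) x = avg n y x - avg n z x" for x :: "nat \<Rightarrow> (real^'p) \<times> (real^'q)"
    by (simp add: avg_def sum_subtractf diff_divide_distrib)
  ultimately show ?thesis
    unfolding proc_def diff_divide_distrib[symmetric] sum_subtractf[symmetric]
    by (intro arg_cong2[where f = "(/)"] sum.cong refl) auto
qed

lemma abs_proc_le:
  assumes [measurable]: "y \<in> borel_measurable borel" and y: "\<And>s. \<bar>y s\<bar> \<le> 1"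
  shows "\<bar>proc n m y \<omega>\<bar> \<le> 2 * sqrt (real n)"
proof (cases "n = 0")
  case False
  have "\<bar>\<Sum>i<n. if m = 0 then y (obs \<omega> i) - emean y
      else y (obs \<omega> (J (n, m, i) \<omega>)) - avg n y (obs \<omega>)\<bar> \<le> (\<Sum>i<n. 2)"
  proof (intro order_trans[OF sum_abs] sum_mono)
    have *: "\<bar>a - b\<bar> \<le> 2" if "\<bar>a\<bar> \<le> 1" "\<bar>b\<bar> \<le> 1" for a b :: real using that by linarith
    fix i
    show "\<bar>if m = 0 then y (obs \<omega> i) - emean y else y (obs \<omega> (J (n, m, i) \<omega>)) - avg n y (obs \<omega>)\<bar> \<le> 2"
      using abs_emean_le[where y = y, OF _ y] abs_avg_le[where y = y and x = "obs \<omega>", OF y, of n] False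
      by (auto intro!: * y)
  qed
  then have "\<bar>proc n m y \<omega>\<bar> \<le> real n * 2 / sqrt (real n)"
    unfolding proc_def abs_divide by (intro frac_le) (use False in auto)
  also have "\<dots> = 2 * sqrt (real n)" using False by (simp add: field_simps)
  finally show ?thesis .
qed (simp add: proc_def)

text \<open>For a resample, the conditional bound is exp (\<theta>^2 times the empirical second
  moment), a product over the observations; averaging it over the data uses exp z <= 1 + 2z on
  [0, 1]. This is the origin of the factor 2, which the original sample could do without.\<close>

lemma proc_mgf:
  assumes ym [measurable]: "y \<in> borel_measurable borel" and y: "\<And>s. \<bar>y s\<bar> \<le> 1"
    and n: "0 < n" and \<theta>: "\<bar>\<theta>\<bar> \<le> sqrt (real n) / 2"
  shows "expectation (\<lambda>\<omega>. exp (\<theta> * proc n m y \<omega>)) \<le> exp (2 * \<theta>\<^sup>2 * emean (\<lambda>s. (y s)\<^sup>2))"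
proof -
  define t where "t = \<theta> / sqrt (real n)"
  have t: "\<bar>t\<bar> \<le> 1 / 2" using \<theta> n by (simp add: t_def abs_divide divide_le_eq)
  have nt: "real n * t\<^sup>2 = \<theta>\<^sup>2" using n by (simp add: t_def power_divide)
  have \<theta>2: "0 \<le> \<theta>\<^sup>2 * emean (\<lambda>s. (y s)\<^sup>2)"
    unfolding emean_def by (intro mult_nonneg_nonneg integral_nonneg_AE) auto
  have bnd: "exp (t * (a - b)) \<le> exp 1" if "\<bar>a\<bar> \<le> 1" "\<bar>b\<bar> \<le> 1" for a b
  proof -
    have "\<bar>t\<bar> * \<bar>a - b\<bar> \<le> 1 / 2 * 2" using that t by (intro mult_mono) auto
    then show ?thesis by (simp add: abs_mult[symmetric])
  qed
  show ?thesis
  proof (cases "m = 0")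
    case True
    have "exp (\<theta> * proc n m y \<omega>) = (\<Prod>i<n. exp (t * (y (obs \<omega> i) - emean y)))" for \<omega>
      using True by (simp add: proc_def t_def exp_sum[symmetric] sum_distrib_left)
        (simp add: sum_divide_distrib)
    then have "expectation (\<lambda>\<omega>. exp (\<theta> * proc n m y \<omega>)) = expectation (\<lambda>\<omega>. exp (t * (y (obs \<omega> 0) - emean y))) ^ n"
      using iid_prod_expectation[of "\<lambda>s. exp (t * (y s - emean y))" "exp 1" n] abs_emean_le[OF ym y] bnd[OF y]
      by simp
    also have "\<dots> \<le> exp (t\<^sup>2 * emean (\<lambda>s. (y s)\<^sup>2)) ^ n"
      using mgf_centered_le[of "\<lambda>\<omega>. y (obs \<omega> 0)" t] y t
      by (intro power_mono) (auto simp: emean_def intro!: integral_nonneg_AE)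
    also have "\<dots> = exp (\<theta>\<^sup>2 * emean (\<lambda>s. (y s)\<^sup>2))"
      unfolding exp_of_nat_mult[symmetric] nt[symmetric] by (simp add: mult.assoc)
    also have "\<dots> \<le> exp (2 * \<theta>\<^sup>2 * emean (\<lambda>s. (y s)\<^sup>2))" using \<theta>2 by simp
    finally show ?thesis .
  next
    case False
    define a :: "nat \<Rightarrow> nat \<Rightarrow> (nat \<Rightarrow> (real^'p) \<times> (real^'q)) \<Rightarrow> real"
      where "a m' l x = exp (t * (y (x l) - avg n y x))" for m' l x
    have am [measurable]: "a m' l \<in> borel_measurable (Pi\<^sub>M UNIV (\<lambda>_. borel))" for m' l
      unfolding a_def
      by (intro measurable_compose[OF _ borel_measurable_exp] borel_measurable_times borel_measurable_diff
          measurable_coord measurable_avg) auto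
    have ab: "norm (a m' l x) \<le> exp 1" for m' l x
      using bnd[OF y abs_avg_le[OF y n]] by (simp add: a_def)
    have "exp (\<theta> * proc n m y \<omega>) = 1 * (\<Prod>m'\<in>{m}. \<Prod>i<n. a m' (J (n, m', i) \<omega>) (obs \<omega>))" for \<omega>
      using False by (simp add: proc_def t_def a_def exp_sum[symmetric] sum_distrib_left)
        (simp add: sum_divide_distrib)
    then have "expectation (\<lambda>\<omega>. exp (\<theta> * proc n m y \<omega>))
        = expectation (\<lambda>\<omega>. 1 * (\<Prod>m'\<in>{m}. ((\<Sum>l<n. a m' l (obs \<omega>)) / of_nat n) ^ n))"
      by (simp only:) (rule boot_expectation[OF n _ _ am _ ab, of _ "\<lambda>_. 1" 1], auto)
    also have "\<dots> \<le> expectation (\<lambda>\<omega>. \<Prod>l<n. exp (t\<^sup>2 * (y (obs \<omega> l))\<^sup>2))"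
    proof (rule integral_mono)
      have b1: "0 \<le> (\<Sum>l<n. a m l x) / real n \<and> (\<Sum>l<n. a m l x) / real n \<le> exp 1" for x
      proof -
        have "(\<Sum>l<n. a m l x) \<le> (\<Sum>l<n. exp 1)" using ab by (intro sum_mono) (simp add: a_def)
        then show ?thesis using n by (auto simp: a_def divide_le_eq mult.commute intro!: divide_nonneg_nonneg sum_nonneg)
      qed
      have [measurable]: "(\<lambda>\<omega>. a m' l (obs \<omega>)) \<in> borel_measurable P" for m' l
        by (rule measurable_compose[OF obs_path_meas am])
      show "integrable P (\<lambda>\<omega>. 1 * (\<Prod>m'\<in>{m}. ((\<Sum>l<n. a m' l (obs \<omega>)) / of_nat n) ^ n))"
        using b1 by (intro integrable_const_bound[of _ "exp 1 ^ n"]) (auto intro!: power_mono simp del: exp_of_nat_mult)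
      have b2: "exp (t\<^sup>2 * (y s)\<^sup>2) \<le> exp 1" for s
      proof -
        have "t\<^sup>2 \<le> 1" "(y s)\<^sup>2 \<le> 1" using t y[of s] by (auto simp: abs_square_le_1)
        then have "t\<^sup>2 * (y s)\<^sup>2 \<le> 1 * 1" by (intro mult_mono) auto
        then show ?thesis by simp
      qed
      have "(\<Prod>l<n. exp (t\<^sup>2 * (y (x l))\<^sup>2)) \<le> (\<Prod>l<n. exp 1)" for x :: "nat \<Rightarrow> (real^'p) \<times> (real^'q)"
        by (intro prod_mono) (auto simp: b2[simplified])
      then show "integrable P (\<lambda>\<omega>. \<Prod>l<n. exp (t\<^sup>2 * (y (obs \<omega> l))\<^sup>2))"
        by (intro integrable_const_bound[of _ "\<Prod>l<n. exp 1"]) (auto simp: abs_prod)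
      fix \<omega>
      \<comment> \<open>Given the data, one resampled summand is uniform on the sample, and
        \<open>avg n y\<close> is its mean.\<close>
      have "(\<Sum>l<n. a m l (obs \<omega>)) / real n \<le> exp (t\<^sup>2 * avg n (\<lambda>s. (y s)\<^sup>2) (obs \<omega>))"
        using measure_pmf.mgf_centered_le[of "\<lambda>l. y (obs \<omega> l)" "pmf_of_set {..<n}" t] y t n
        by (simp add: integral_uniform a_def avg_def)
      then have "((\<Sum>l<n. a m l (obs \<omega>)) / real n) ^ n \<le> exp (t\<^sup>2 * avg n (\<lambda>s. (y s)\<^sup>2) (obs \<omega>)) ^ n"
        using b1 by (intro power_mono) auto
      also have "\<dots> = (\<Prod>l<n. exp (t\<^sup>2 * (y (obs \<omega> l))\<^sup>2))"
        using n unfolding exp_of_nat_mult[symmetric] exp_sum[OF finite_lessThan, symmetric]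
        by (simp add: avg_def sum_distrib_left[symmetric])
      finally show "1 * (\<Prod>m'\<in>{m}. ((\<Sum>l<n. a m' l (obs \<omega>)) / of_nat n) ^ n) \<le> (\<Prod>l<n. exp (t\<^sup>2 * (y (obs \<omega> l))\<^sup>2))"
        by simp
    qed
    also have "\<dots> = expectation (\<lambda>\<omega>. exp (t\<^sup>2 * (y (obs \<omega> 0))\<^sup>2)) ^ n"
    proof (rule iid_prod_expectation[of "\<lambda>s. exp (t\<^sup>2 * (y s)\<^sup>2)" "exp 1"])
      fix s
      have "t\<^sup>2 \<le> 1" "(y s)\<^sup>2 \<le> 1" using t y[of s] by (auto simp: abs_square_le_1)
      then have "t\<^sup>2 * (y s)\<^sup>2 \<le> 1 * 1" by (intro mult_mono) auto
      then show "norm (exp (t\<^sup>2 * (y s)\<^sup>2)) \<le> exp 1" by simp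
    qed measurable
    also have "\<dots> \<le> (1 + 2 * t\<^sup>2 * emean (\<lambda>s. (y s)\<^sup>2)) ^ n"
    proof (rule power_mono)
      have i: "integrable P (\<lambda>\<omega>. (y (obs \<omega> 0))\<^sup>2)"
        by (rule integrable_const_bound[of _ 1]) (use y in \<open>auto simp: abs_square_le_1\<close>)
      have pt: "0 \<le> t\<^sup>2 * (y s)\<^sup>2 \<and> t\<^sup>2 * (y s)\<^sup>2 \<le> 1" for s
      proof -
        have "t\<^sup>2 \<le> 1" "(y s)\<^sup>2 \<le> 1" using t y[of s] by (auto simp: abs_square_le_1)
        then have "t\<^sup>2 * (y s)\<^sup>2 \<le> 1 * 1" by (intro mult_mono) auto
        then show ?thesis by simp
      qed
      have "expectation (\<lambda>\<omega>. exp (t\<^sup>2 * (y (obs \<omega> 0))\<^sup>2)) \<le> expectation (\<lambda>\<omega>. 1 + 2 * (t\<^sup>2 * (y (obs \<omega> 0))\<^sup>2))"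
      proof (rule integral_mono)
        show "integrable P (\<lambda>\<omega>. exp (t\<^sup>2 * (y (obs \<omega> 0))\<^sup>2))"
          by (rule integrable_const_bound[of _ "exp 1"]) (use pt in auto)
        show "integrable P (\<lambda>\<omega>. 1 + 2 * (t\<^sup>2 * (y (obs \<omega> 0))\<^sup>2))" using i by simp
        fix \<omega>
        let ?z = "t\<^sup>2 * (y (obs \<omega> 0))\<^sup>2"
        have "?z\<^sup>2 \<le> ?z" using pt[of "obs \<omega> 0"] by (simp only: power2_eq_square[of ?z] mult_left_le)
        then show "exp ?z \<le> 1 + 2 * ?z" using exp_bound[of ?z] pt[of "obs \<omega> 0"] by linarith
      qed
      also have "\<dots> = 1 + 2 * t\<^sup>2 * emean (\<lambda>s. (y s)\<^sup>2)" using i by (simp add: emean_def prob_space)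
      finally show "expectation (\<lambda>\<omega>. exp (t\<^sup>2 * (y (obs \<omega> 0))\<^sup>2)) \<le> 1 + 2 * t\<^sup>2 * emean (\<lambda>s. (y s)\<^sup>2)" .
    qed (auto intro!: integral_nonneg_AE)
    also have "\<dots> \<le> exp (2 * t\<^sup>2 * emean (\<lambda>s. (y s)\<^sup>2)) ^ n"
      by (intro power_mono exp_ge_add_one_self add_nonneg_nonneg mult_nonneg_nonneg) (auto simp: emean_def intro!: integral_nonneg_AE)
    also have "\<dots> = exp (2 * \<theta>\<^sup>2 * emean (\<lambda>s. (y s)\<^sup>2))"
      unfolding exp_of_nat_mult[symmetric] nt[symmetric] by (simp add: mult_ac)
    finally show ?thesis .
  qed
qed

text \<open>For n >= 4 the value 1 is admissible for \<theta>, and the exponential moments at 1 and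
  -1 give 2 exp 2; the smaller n fall under the crude bound 4 n.\<close>

definition moment_bound :: real where "moment_bound = 2 * exp 2 + 16"

lemma proc_second_moment:
  assumes ym [measurable]: "y \<in> borel_measurable borel" and y: "\<And>s. \<bar>y s\<bar> \<le> 1"
  shows "integrable P (\<lambda>\<omega>. (proc n m y \<omega>)\<^sup>2)" "expectation (\<lambda>\<omega>. (proc n m y \<omega>)\<^sup>2) \<le> moment_bound"
proof -
  have sq: "(proc n m y \<omega>)\<^sup>2 \<le> 4 * real n" for \<omega>
  proof -
    have "\<bar>proc n m y \<omega>\<bar> ^ 2 \<le> (2 * sqrt (real n)) ^ 2" by (intro power_mono abs_proc_le[OF ym y]) auto
    then show ?thesis by (simp add: power_mult_distrib)
  qed
  show i: "integrable P (\<lambda>\<omega>. (proc n m y \<omega>)\<^sup>2)"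
    by (rule integrable_const_bound[of _ "4 * real n"]) (auto simp: sq)
  show "expectation (\<lambda>\<omega>. (proc n m y \<omega>)\<^sup>2) \<le> moment_bound"
  proof (cases "n < 4")
    case True
    have "expectation (\<lambda>\<omega>. (proc n m y \<omega>)\<^sup>2) \<le> expectation (\<lambda>\<omega>. 4 * real n)"
      by (intro integral_mono i sq) auto
    also have "\<dots> \<le> 16" using True by (simp add: prob_space)
    also have "\<dots> \<le> moment_bound" by (simp add: moment_bound_def)
    finally show ?thesis .
  next
    case False
    then have n: "0 < n" "1 \<le> sqrt (real n) / 2"
      by (auto simp: real_le_rsqrt)
    have ei: "integrable P (\<lambda>\<omega>. exp (\<theta> * proc n m y \<omega>))" if "\<bar>\<theta>\<bar> = 1" for \<theta>
    proof (rule integrable_const_bound[of _ "exp (2 * sqrt (real n))"])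
      have "\<theta> * proc n m y \<omega> \<le> 2 * sqrt (real n)" for \<omega>
        using abs_proc_le[OF ym y, of n m \<omega>] that abs_mult[of \<theta> "proc n m y \<omega>"] by simp
      then show "AE \<omega> in P. norm (exp (\<theta> * proc n m y \<omega>)) \<le> exp (2 * sqrt (real n))" by simp
    qed measurable
    have e1: "emean (\<lambda>s. (y s)\<^sup>2) \<le> 1"
      using abs_emean_le[of "\<lambda>s. (y s)\<^sup>2" 1] y by (auto simp: abs_square_le_1 abs_le_iff)
    have mg: "expectation (\<lambda>\<omega>. exp (\<theta> * proc n m y \<omega>)) \<le> exp 2" if "\<bar>\<theta>\<bar> = 1" for \<theta>
    proof -
      have "\<theta>\<^sup>2 = 1" using that by (metis power2_abs one_power2)
      then have "expectation (\<lambda>\<omega>. exp (\<theta> * proc n m y \<omega>)) \<le> exp (2 * 1 * emean (\<lambda>s. (y s)\<^sup>2))"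
        using proc_mgf[OF ym y n(1), of \<theta> m] n(2) that by simp
      also have "\<dots> \<le> exp 2" using e1 by simp
      finally show ?thesis .
    qed
    have "expectation (\<lambda>\<omega>. (proc n m y \<omega>)\<^sup>2) \<le> expectation (\<lambda>\<omega>. exp (1 * proc n m y \<omega>) + exp (-1 * proc n m y \<omega>))"
      by (intro integral_mono i Bochner_Integration.integrable_add ei) (use square_le_exp_sum in auto)
    also have "\<dots> = expectation (\<lambda>\<omega>. exp (1 * proc n m y \<omega>)) + expectation (\<lambda>\<omega>. exp (-1 * proc n m y \<omega>))"
      by (intro Bochner_Integration.integral_add ei) auto
    also have "\<dots> \<le> exp 2 + exp 2" by (intro add_mono mg) auto
    finally show ?thesis by (simp add: moment_bound_def)
  qed
qed

text \<open>The weak law in mean with a rate: the error is |\<open>proc n 0\<close>| / sqrt n after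
  rescaling to sup norm 1, and |x| <= 1 + x^2 reduces it to second moments.\<close>

lemma lln_mean:
  assumes ym [measurable]: "y \<in> borel_measurable borel" and y: "\<And>s. \<bar>y s\<bar> \<le> c" and c: "0 < c" and n: "0 < n"
  shows "expectation (\<lambda>\<omega>. \<bar>avg n y (obs \<omega>) - emean y\<bar>) \<le> c * (1 + moment_bound) / sqrt (real n)"
proof -
  define z where "z s = y s / c" for s
  have z [measurable]: "z \<in> borel_measurable borel" unfolding z_def by measurable
  have z1: "\<bar>z s\<bar> \<le> 1" for s using y[of s] c by (simp add: z_def)
  have eq: "\<bar>avg n y (obs \<omega>) - emean y\<bar> = c * \<bar>proc n 0 z \<omega>\<bar> / sqrt (real n)" for \<omega>
  proof -
    have "emean z = emean y / c" by (simp add: emean_def z_def)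
    then have "proc n 0 z \<omega> = ((\<Sum>i<n. y (obs \<omega> i)) / c - real n * (emean y / c)) / sqrt (real n)"
      by (simp add: proc_def z_def sum_subtractf sum_divide_distrib)
    also have "(\<Sum>i<n. y (obs \<omega> i)) = real n * avg n y (obs \<omega>)"
      using n by (simp add: avg_def)
    also have "(real n * avg n y (obs \<omega>) / c - real n * (emean y / c)) / sqrt (real n)
        = (real n / sqrt (real n)) * (avg n y (obs \<omega>) - emean y) / c"
      by (simp add: right_diff_distrib diff_divide_distrib mult_ac)
    also have "real n / sqrt (real n) = sqrt (real n)" by (rule real_div_sqrt) simp
    finally have "proc n 0 z \<omega> = (avg n y (obs \<omega>) - emean y) * sqrt (real n) / c"
      by (simp add: mult.commute)
    then show ?thesis using n c by (simp add: abs_mult)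
  qed
  have i: "integrable P (\<lambda>\<omega>. \<bar>proc n 0 z \<omega>\<bar>)"
    by (rule integrable_const_bound[of _ "2 * sqrt (real n)"]) (auto simp: abs_proc_le[OF z z1])
  have "expectation (\<lambda>\<omega>. \<bar>proc n 0 z \<omega>\<bar>) \<le> expectation (\<lambda>\<omega>. 1 + (proc n 0 z \<omega>)\<^sup>2)"
  proof (intro integral_mono i Bochner_Integration.integrable_add proc_second_moment[OF z z1])
    fix \<omega>
    have "0 \<le> (\<bar>proc n 0 z \<omega>\<bar> - 1 / 2)\<^sup>2" by simp
    then show "\<bar>proc n 0 z \<omega>\<bar> \<le> 1 + (proc n 0 z \<omega>)\<^sup>2" by (simp add: power2_diff power_divide)
  qed simp
  also have "\<dots> \<le> 1 + moment_bound"
    using proc_second_moment[OF z z1, of n 0] by (simp add: prob_space)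
  finally show ?thesis
    unfolding eq using n c by (simp add: divide_right_mono mult_left_mono)
qed

definition evar :: "((real^'p) \<times> (real^'q) \<Rightarrow> real) \<Rightarrow> real" where
  "evar y = emean (\<lambda>s. (y s)\<^sup>2) - (emean y)\<^sup>2"

lemma evar_nonneg:
  assumes [measurable]: "y \<in> borel_measurable borel" and y: "\<And>s. \<bar>y s\<bar> \<le> c"
  shows "evar y = expectation (\<lambda>\<omega>. (y (obs \<omega> 0) - emean y)\<^sup>2)" "0 \<le> evar y"
proof -
  have i: "integrable P (\<lambda>\<omega>. y (obs \<omega> 0))" by (rule integrable_const_bound[of _ c]) (auto simp: y)
  have i2: "integrable P (\<lambda>\<omega>. (y (obs \<omega> 0))\<^sup>2)"
    by (rule integrable_const_bound[of _ "c\<^sup>2"]) (auto intro!: AE_I2 simp: y abs_le_square_iff[symmetric] intro: order_trans[OF y abs_ge_self])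
  show eq: "evar y = expectation (\<lambda>\<omega>. (y (obs \<omega> 0) - emean y)\<^sup>2)"
    using i i2 by (simp add: evar_def power2_diff prob_space emean_def[symmetric])
      (simp add: emean_def power2_eq_square)
  show "0 \<le> evar y" unfolding eq by (intro integral_nonneg_AE) simp
qed

text \<open>The conditional variance, given the data \<open>x\<close>, of one resampled value of
  \<open>y\<close>.\<close>

definition avar :: "nat \<Rightarrow> ((real^'p) \<times> (real^'q) \<Rightarrow> real) \<Rightarrow> (nat \<Rightarrow> (real^'p) \<times> (real^'q)) \<Rightarrow> real" where
  "avar n y x = avg n (\<lambda>s. (y s)\<^sup>2) x - (avg n y x)\<^sup>2"

text \<open>\<open>cf_power_approx\<close> for the uniform law on the sample; centring by the sample
  average doubles the bound \<open>c\<close>. The estimate holds for every data path, so only the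
  variance remains random.\<close>

lemma resample_cf_power_approx:
  assumes y: "\<And>s. \<bar>y s\<bar> \<le> c" and n: "0 < n"
  shows "cmod (((\<Sum>l<n. cis ((y (x l) - avg n y x) / sqrt (real n))) / of_nat n) ^ n - exp (- avar n y x / 2))
      \<le> ((2 * c) ^ 3 + (2 * c) ^ 4) / sqrt (real n)" and "0 \<le> avar n y x"
proof -
  let ?U = "pmf_of_set {..<n}"
  define Y where "Y l = y (x l) - avg n y x" for l
  have Yc: "\<bar>Y l\<bar> \<le> 2 * c" for l
    using y[of "x l"] abs_avg_le[of y c n x, OF y n] by (simp add: Y_def)
  have m0: "measure_pmf.expectation ?U Y = 0"
    using n by (simp add: integral_uniform Y_def sum_subtractf avg_def)
  have v: "measure_pmf.expectation ?U (\<lambda>l. (Y l)\<^sup>2) = avar n y x"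
  proof -
    have "(\<Sum>l<n. (Y l)\<^sup>2) = (\<Sum>l<n. (y (x l))\<^sup>2) - 2 * avg n y x * (\<Sum>l<n. y (x l)) + real n * (avg n y x)\<^sup>2"
      by (simp add: Y_def power2_diff sum.distrib sum_subtractf sum_distrib_left mult_ac)
    also have "(\<Sum>l<n. y (x l)) = real n * avg n y x" using n by (simp add: avg_def)
    finally have "(\<Sum>l<n. (Y l)\<^sup>2) = (\<Sum>l<n. (y (x l))\<^sup>2) - real n * (avg n y x)\<^sup>2"
      by (simp add: power2_eq_square)
    then show ?thesis using n by (simp add: integral_uniform avar_def diff_divide_distrib) (simp add: avg_def)
  qed
  have "cmod (measure_pmf.expectation ?U (\<lambda>l. cis (Y l / sqrt (real n))) ^ n - exp (- measure_pmf.expectation ?U (\<lambda>l. (Y l)\<^sup>2) / 2))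
      \<le> ((2 * c) ^ 3 + (2 * c) ^ 4) / sqrt (real n)"
    using measure_pmf.cf_power_approx[of Y ?U "2 * c" n, OF _ Yc m0 n] by simp
  then show "cmod (((\<Sum>l<n. cis ((y (x l) - avg n y x) / sqrt (real n))) / of_nat n) ^ n - exp (- avar n y x / 2))
      \<le> ((2 * c) ^ 3 + (2 * c) ^ 4) / sqrt (real n)"
    using n unfolding v by (simp add: integral_uniform Y_def)
  show "0 \<le> avar n y x" unfolding v[symmetric] by (intro integral_nonneg_AE) simp
qed

text \<open>The average of y^2 contributes c^2, and the difference of squared averages, factored as
  sum times difference, contributes 2 c times c.\<close>

lemma avar_mean_error:
  assumes ym [measurable]: "y \<in> borel_measurable borel" and y: "\<And>s. \<bar>y s\<bar> \<le> c" and c: "0 < c" and n: "0 < n"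
  shows "integrable P (\<lambda>\<omega>. \<bar>avar n y (obs \<omega>) - evar y\<bar>)"
    "expectation (\<lambda>\<omega>. \<bar>avar n y (obs \<omega>) - evar y\<bar>) \<le> 3 * c\<^sup>2 * (1 + moment_bound) / sqrt (real n)"
proof -
  define y2 where "y2 s = (y s)\<^sup>2" for s
  have y2m [measurable]: "y2 \<in> borel_measurable borel" unfolding y2_def by measurable
  have y2: "\<bar>y2 s\<bar> \<le> c\<^sup>2" for s
    using y[of s] c by (simp add: y2_def abs_le_square_iff[symmetric])
  have am [measurable]: "(\<lambda>\<omega>. avg n z (obs \<omega>)) \<in> borel_measurable P" if "z \<in> borel_measurable borel" for z
    by (rule measurable_compose[OF obs_path_meas measurable_avg[OF that]])
  have ai: "integrable P (\<lambda>\<omega>. \<bar>avg n z (obs \<omega>) - emean z\<bar>)"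
    if zm: "z \<in> borel_measurable borel" and z: "\<And>s. \<bar>z s\<bar> \<le> b" for z b
  proof (rule integrable_const_bound[of _ "2 * b"])
    have "\<bar>avg n z (obs \<omega>) - emean z\<bar> \<le> 2 * b" for \<omega>
      using abs_avg_le[where y = z and x = "obs \<omega>", OF z n] abs_emean_le[where y = z, OF zm z] by linarith
    then show "AE \<omega> in P. norm \<bar>avg n z (obs \<omega>) - emean z\<bar> \<le> 2 * b" by simp
  qed (use zm in measurable)
  have pt: "\<bar>avar n y x - evar y\<bar> \<le> \<bar>avg n y2 x - emean y2\<bar> + 2 * c * \<bar>avg n y x - emean y\<bar>" for x
  proof -
    have "avar n y x - evar y = (avg n y2 x - emean y2) - (avg n y x + emean y) * (avg n y x - emean y)"
      unfolding avar_def evar_def y2_def by (simp add: power2_eq_square algebra_simps)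
    also have "\<bar>\<dots>\<bar> \<le> \<bar>avg n y2 x - emean y2\<bar> + \<bar>avg n y x + emean y\<bar> * \<bar>avg n y x - emean y\<bar>"
      unfolding abs_mult[symmetric] by (rule abs_triangle_ineq4)
    also have "\<bar>avg n y x + emean y\<bar> \<le> 2 * c"
      using abs_avg_le[where y = y and x = x, OF y n] abs_emean_le[where y = y, OF ym y] by linarith
    finally show ?thesis by (simp add: mult_right_mono)
  qed
  have i: "integrable P (\<lambda>\<omega>. \<bar>avg n y2 (obs \<omega>) - emean y2\<bar> + 2 * c * \<bar>avg n y (obs \<omega>) - emean y\<bar>)"
    by (intro Bochner_Integration.integrable_add integrable_mult_right ai[OF y2m y2] ai[OF ym y])
  show i': "integrable P (\<lambda>\<omega>. \<bar>avar n y (obs \<omega>) - evar y\<bar>)"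
    by (rule Bochner_Integration.integrable_bound[OF i])
      (use am[OF ym] am[OF y2m] pt in \<open>auto simp: avar_def y2_def[symmetric, abs_def] intro!: AE_I2 order_trans[OF _ abs_ge_self]\<close>)
  have "expectation (\<lambda>\<omega>. \<bar>avar n y (obs \<omega>) - evar y\<bar>)
      \<le> expectation (\<lambda>\<omega>. \<bar>avg n y2 (obs \<omega>) - emean y2\<bar> + 2 * c * \<bar>avg n y (obs \<omega>) - emean y\<bar>)"
    by (intro integral_mono i i' pt)
  also have "\<dots> = expectation (\<lambda>\<omega>. \<bar>avg n y2 (obs \<omega>) - emean y2\<bar>) + 2 * c * expectation (\<lambda>\<omega>. \<bar>avg n y (obs \<omega>) - emean y\<bar>)"
    using ai[OF y2m y2] ai[OF ym y] by simp
  also have "\<dots> \<le> c\<^sup>2 * (1 + moment_bound) / sqrt (real n) + 2 * c * (c * (1 + moment_bound) / sqrt (real n))"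
    using c by (intro add_mono mult_left_mono lln_mean[OF y2m y2 _ n] lln_mean[OF ym y c n]) auto
  also have "\<dots> = 3 * c\<^sup>2 * (1 + moment_bound) / sqrt (real n)"
    by (simp add: power2_eq_square add_divide_distrib[symmetric] algebra_simps)
  finally show "expectation (\<lambda>\<omega>. \<bar>avar n y (obs \<omega>) - evar y\<bar>) \<le> 3 * c\<^sup>2 * (1 + moment_bound) / sqrt (real n)" .
qed

text \<open>Asymptotic independence: given the data, the components m >= 1 factor into functions
  \<phi> m that are close in mean to constants \<open>e m\<close>. Once these constants are
  substituted, only the characteristic function of the data itself is left.\<close>

lemma proc_cf_error:
  assumes ym [measurable]: "\<And>m. y m \<in> borel_measurable borel" and y: "\<And>m s. \<bar>y m s\<bar> \<le> c" and c: "0 < c" and n: "0 < n"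
  defines "K \<equiv> (2 * c) ^ 3 + (2 * c) ^ 4"
  shows "cmod (expectation (\<lambda>\<omega>. cis (\<Sum>m\<le>M. proc n m (y m) \<omega>)) - exp (- (\<Sum>m\<le>M. evar (y m)) / 2))
      \<le> (real M * (K + 3 * c\<^sup>2 * (1 + moment_bound)) + K) / sqrt (real n)"
proof -
  define r where "r = sqrt (real n)"
  have r: "r > 0" using n by (simp add: r_def)
  define b where "b x = (\<Prod>i<n. cis ((y 0 (x i) - emean (y 0)) / r))" for x
  define a where "a m l x = cis ((y m (x l) - avg n (y m) x) / r)" for m l x
  have am: "a m l \<in> borel_measurable (Pi\<^sub>M UNIV (\<lambda>_. borel))" for m l
    unfolding a_def
    by (intro borel_measurable_cis borel_measurable_divide borel_measurable_diff measurable_coord measurable_avg ym) auto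
  have bm: "b \<in> borel_measurable (Pi\<^sub>M UNIV (\<lambda>_. borel))"
    unfolding b_def
    by (intro borel_measurable_prod borel_measurable_cis borel_measurable_divide borel_measurable_diff measurable_coord ym) auto
  have b1: "cmod (b x) \<le> 1" for x by (simp add: b_def prod_norm[symmetric])
  have a1: "cmod (a m l x) \<le> 1" for m l x by (simp add: a_def)
  have M: "{..M} = insert 0 {1..M}" by auto
  have split: "cis (\<Sum>m\<le>M. proc n m (y m) \<omega>) = b (obs \<omega>) * (\<Prod>m\<in>{1..M}. \<Prod>i<n. a m (J (n, m, i) \<omega>) (obs \<omega>))" for \<omega>
  proof -
    have "cis (proc n 0 (y 0) \<omega>) = b (obs \<omega>)"
      by (simp add: proc_def b_def cis_sum[symmetric] sum_divide_distrib r_def)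
    moreover have "cis (proc n m (y m) \<omega>) = (\<Prod>i<n. a m (J (n, m, i) \<omega>) (obs \<omega>))" if "m \<in> {1..M}" for m
      using that by (simp add: proc_def a_def cis_sum[symmetric] sum_divide_distrib r_def)
    ultimately show ?thesis unfolding M by (subst cis_sum) simp
  qed
  define \<phi> where "\<phi> m x = ((\<Sum>l<n. a m l x) / of_nat n) ^ n" for m x
  define e where "e m = complex_of_real (exp (- evar (y m) / 2))" for m
  have "expectation (\<lambda>\<omega>. cis (\<Sum>m\<le>M. proc n m (y m) \<omega>)) = expectation (\<lambda>\<omega>. b (obs \<omega>) * (\<Prod>m\<in>{1..M}. \<phi> m (obs \<omega>)))"
    unfolding split \<phi>_def by (rule boot_expectation[OF n _ bm am b1 a1]) simp
  moreover have "exp (- (\<Sum>m\<le>M. evar (y m)) / 2) = e 0 * (\<Prod>m\<in>{1..M}. e m)"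
  proof -
    have "exp (- (\<Sum>m\<le>M. evar (y m)) / 2) = (\<Prod>m\<le>M. exp (- evar (y m) / 2))"
      by (subst exp_sum[symmetric]) (auto simp: sum_negf sum_divide_distrib)
    then have "complex_of_real (exp (- (\<Sum>m\<le>M. evar (y m)) / 2)) = (\<Prod>m\<le>M. e m)" by (simp add: e_def)
    also have "\<dots> = e 0 * (\<Prod>m\<in>{1..M}. e m)" by (subst M) simp
    finally show ?thesis .
  qed
  moreover have "cmod (expectation (\<lambda>\<omega>. b (obs \<omega>) * (\<Prod>m\<in>{1..M}. \<phi> m (obs \<omega>))) - e 0 * (\<Prod>m\<in>{1..M}. e m))
      \<le> real M * ((K + 3 * c\<^sup>2 * (1 + moment_bound)) / r) + K / r"
  proof -
    have \<phi>m [measurable]: "(\<lambda>\<omega>. \<phi> m (obs \<omega>)) \<in> borel_measurable P" for m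
      unfolding \<phi>_def using measurable_compose[OF obs_path_meas am]
      by (intro borel_measurable_power borel_measurable_divide borel_measurable_sum) auto
    have bm' [measurable]: "(\<lambda>\<omega>. b (obs \<omega>)) \<in> borel_measurable P"
      by (rule measurable_compose[OF obs_path_meas bm])
    have \<phi>1: "cmod (\<phi> m x) \<le> 1" for m x
    proof -
      have "cmod (\<Sum>l<n. a m l x) \<le> (\<Sum>l<n. 1)" by (intro sum_norm_le a1)
      then have "cmod ((\<Sum>l<n. a m l x) / of_nat n) \<le> 1" using n by (simp add: norm_divide)
      then show ?thesis unfolding \<phi>_def norm_power by (intro power_le_one) auto
    qed
    have e1: "cmod (e m) \<le> 1" for m using evar_nonneg(2)[of "y m" c, OF ym y] by (simp add: e_def)
    have pe1: "cmod (\<Prod>m\<in>{1..M}. e m) \<le> 1" unfolding prod_norm[symmetric] by (intro prod_le_1) (auto simp: e1)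
    have p\<phi>1: "cmod (\<Prod>m\<in>{1..M}. \<phi> m x) \<le> 1" for x unfolding prod_norm[symmetric] by (intro prod_le_1) (auto simp: \<phi>1)
    have ib: "integrable P (\<lambda>\<omega>. b (obs \<omega>))" by (rule integrable_const_bound[of _ 1]) (auto simp: b1)
    have ib\<phi>: "integrable P (\<lambda>\<omega>. b (obs \<omega>) * (\<Prod>m\<in>{1..M}. \<phi> m (obs \<omega>)))"
      by (rule integrable_const_bound[of _ 1]) (auto simp: norm_mult simp del: One_nat_def intro!: AE_I2 mult_le_one b1 p\<phi>1)
    have i\<phi>: "integrable P (\<lambda>\<omega>. cmod (\<phi> m (obs \<omega>) - e m))" for m
    proof (rule integrable_const_bound[of _ 2])
      have "cmod (\<phi> m (obs \<omega>) - e m) \<le> 2" for \<omega>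
        using norm_triangle_ineq4[of "\<phi> m (obs \<omega>)" "e m"] \<phi>1[of m "obs \<omega>"] e1[of m] by linarith
      then show "AE \<omega> in P. norm (cmod (\<phi> m (obs \<omega>) - e m)) \<le> 2" by simp
    qed measurable
    have E\<phi>: "expectation (\<lambda>\<omega>. cmod (\<phi> m (obs \<omega>) - e m)) \<le> (K + 3 * c\<^sup>2 * (1 + moment_bound)) / r" for m
    proof -
      have "cmod (\<phi> m x - e m) \<le> K / r + \<bar>avar n (y m) x - evar (y m)\<bar>" for x
      proof -
        have "cmod (\<phi> m x - exp (- avar n (y m) x / 2)) \<le> K / r"
          using resample_cf_power_approx(1)[of "y m" c n x, OF y n] by (simp add: \<phi>_def a_def r_def K_def)
        moreover have "\<bar>exp (- (avar n (y m) x / 2)) - exp (- (evar (y m) / 2))\<bar> \<le> \<bar>avar n (y m) x / 2 - evar (y m) / 2\<bar>"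
          using resample_cf_power_approx(2)[of "y m" c n x, OF y n] evar_nonneg(2)[of "y m" c, OF ym y]
          by (intro exp_minus_lipschitz) auto
        then have "cmod (exp (- avar n (y m) x / 2) - e m) \<le> \<bar>avar n (y m) x - evar (y m)\<bar>"
          unfolding e_def of_real_exp[symmetric] of_real_diff[symmetric] norm_of_real by simp
        ultimately show ?thesis
          using norm_triangle_ineq[of "\<phi> m x - exp (- avar n (y m) x / 2)" "exp (- avar n (y m) x / 2) - e m"] by simp
      qed
      then have "expectation (\<lambda>\<omega>. cmod (\<phi> m (obs \<omega>) - e m)) \<le> expectation (\<lambda>\<omega>. K / r + \<bar>avar n (y m) (obs \<omega>) - evar (y m)\<bar>)"
        using avar_mean_error(1)[OF ym y c n] by (intro integral_mono i\<phi> Bochner_Integration.integrable_add) auto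
      also have "\<dots> \<le> K / r + 3 * c\<^sup>2 * (1 + moment_bound) / r"
        using avar_mean_error[OF ym y c n, of m] by (simp add: prob_space r_def)
      finally show ?thesis by (simp add: add_divide_distrib)
    qed
    have E0: "cmod (expectation (\<lambda>\<omega>. b (obs \<omega>)) - e 0) \<le> K / r"
    proof -
      have "expectation (\<lambda>\<omega>. b (obs \<omega>)) = expectation (\<lambda>\<omega>. cis ((y 0 (obs \<omega> 0) - emean (y 0)) / r)) ^ n"
        unfolding b_def by (rule iid_prod_expectation[of "\<lambda>s. cis ((y 0 s - emean (y 0)) / r)" 1])
          (auto intro!: borel_measurable_cis borel_measurable_divide borel_measurable_diff ym)
      moreover have "\<bar>y 0 s - emean (y 0)\<bar> \<le> 2 * c" for s
        using y[of 0 s] abs_emean_le[of "y 0" c, OF ym y] by linarith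
      moreover have "expectation (\<lambda>\<omega>. y 0 (obs \<omega> 0) - emean (y 0)) = 0"
      proof -
        have "integrable P (\<lambda>\<omega>. y 0 (obs \<omega> 0))" by (rule integrable_const_bound[of _ c]) (auto simp: y)
        then show ?thesis by (simp add: emean_def prob_space)
      qed
      ultimately show ?thesis
        using cf_power_approx[of "\<lambda>\<omega>. y 0 (obs \<omega> 0) - emean (y 0)" "2 * c" n] n evar_nonneg(1)[of "y 0" c, OF ym y]
        by (simp add: e_def r_def K_def)
    qed
    \<comment> \<open>Replace the conditional factors first, while the data factor is still inside
      the expectation and has modulus at most 1, and then the data factor alone.\<close>
    have eq: "expectation (\<lambda>\<omega>. b (obs \<omega>) * (\<Prod>m\<in>{1..M}. \<phi> m (obs \<omega>))) - e 0 * (\<Prod>m\<in>{1..M}. e m)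
        = expectation (\<lambda>\<omega>. b (obs \<omega>) * ((\<Prod>m\<in>{1..M}. \<phi> m (obs \<omega>)) - (\<Prod>m\<in>{1..M}. e m)))
          + (expectation (\<lambda>\<omega>. b (obs \<omega>)) - e 0) * (\<Prod>m\<in>{1..M}. e m)"
      unfolding right_diff_distrib Bochner_Integration.integral_diff[OF ib\<phi> integrable_mult_left[OF ib]]
      by (simp add: left_diff_distrib)
    have "cmod (expectation (\<lambda>\<omega>. b (obs \<omega>) * (\<Prod>m\<in>{1..M}. \<phi> m (obs \<omega>))) - e 0 * (\<Prod>m\<in>{1..M}. e m))
        \<le> cmod (expectation (\<lambda>\<omega>. b (obs \<omega>) * ((\<Prod>m\<in>{1..M}. \<phi> m (obs \<omega>)) - (\<Prod>m\<in>{1..M}. e m))))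
        + cmod ((expectation (\<lambda>\<omega>. b (obs \<omega>)) - e 0) * (\<Prod>m\<in>{1..M}. e m))"
      unfolding eq by (rule norm_triangle_ineq)
    also have "\<dots> \<le> real M * ((K + 3 * c\<^sup>2 * (1 + moment_bound)) / r) + K / r"
    proof (rule add_mono)
      have "cmod (expectation (\<lambda>\<omega>. b (obs \<omega>) * ((\<Prod>m\<in>{1..M}. \<phi> m (obs \<omega>)) - (\<Prod>m\<in>{1..M}. e m))))
          \<le> expectation (\<lambda>\<omega>. cmod (b (obs \<omega>) * ((\<Prod>m\<in>{1..M}. \<phi> m (obs \<omega>)) - (\<Prod>m\<in>{1..M}. e m))))"
        by (rule integral_norm_bound)
      also have "\<dots> \<le> expectation (\<lambda>\<omega>. \<Sum>m\<in>{1..M}. cmod (\<phi> m (obs \<omega>) - e m))"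
      proof (rule integral_mono)
        show "integrable P (\<lambda>\<omega>. cmod (b (obs \<omega>) * ((\<Prod>m\<in>{1..M}. \<phi> m (obs \<omega>)) - (\<Prod>m\<in>{1..M}. e m))))"
          unfolding right_diff_distrib
          by (rule integrable_norm[OF Bochner_Integration.integrable_diff[OF ib\<phi> integrable_mult_left[OF ib]]])
        fix \<omega>
        have "cmod (b (obs \<omega>) * ((\<Prod>m\<in>{1..M}. \<phi> m (obs \<omega>)) - (\<Prod>m\<in>{1..M}. e m)))
            \<le> 1 * cmod ((\<Prod>m\<in>{1..M}. \<phi> m (obs \<omega>)) - (\<Prod>m\<in>{1..M}. e m))"
          unfolding norm_mult by (intro mult_right_mono b1) auto
        also have "\<dots> \<le> (\<Sum>m\<in>{1..M}. cmod (\<phi> m (obs \<omega>) - e m))"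
          unfolding mult_1_left by (rule norm_prod_diff[OF \<phi>1 e1])
        finally show "cmod (b (obs \<omega>) * ((\<Prod>m\<in>{1..M}. \<phi> m (obs \<omega>)) - (\<Prod>m\<in>{1..M}. e m)))
            \<le> (\<Sum>m\<in>{1..M}. cmod (\<phi> m (obs \<omega>) - e m))" .
      qed (rule Bochner_Integration.integrable_sum[OF i\<phi>])
      also have "\<dots> = (\<Sum>m\<in>{1..M}. expectation (\<lambda>\<omega>. cmod (\<phi> m (obs \<omega>) - e m)))"
        using i\<phi> by (rule Bochner_Integration.integral_sum)
      also have "\<dots> \<le> (\<Sum>m\<in>{1..M}. (K + 3 * c\<^sup>2 * (1 + moment_bound)) / r)" by (intro sum_mono E\<phi>)
      finally show "cmod (expectation (\<lambda>\<omega>. b (obs \<omega>) * ((\<Prod>m\<in>{1..M}. \<phi> m (obs \<omega>)) - (\<Prod>m\<in>{1..M}. e m))))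
          \<le> real M * ((K + 3 * c\<^sup>2 * (1 + moment_bound)) / r)" by simp
      show "cmod ((expectation (\<lambda>\<omega>. b (obs \<omega>)) - e 0) * (\<Prod>m\<in>{1..M}. e m)) \<le> K / r"
        unfolding norm_mult using mult_mono[OF E0 pe1 order_trans[OF norm_ge_zero E0] norm_ge_zero] by linarith
    qed
    finally show ?thesis .
  qed
  ultimately show ?thesis
    unfolding r_def times_divide_eq_right add_divide_distrib[symmetric] by (simp only:)
qed

lemma proc_cf_limit:
  assumes ym: "\<And>m. y m \<in> borel_measurable borel" and y: "\<And>m s. \<bar>y m s\<bar> \<le> c" and c: "0 < c"
  shows "(\<lambda>n. expectation (\<lambda>\<omega>. cis (\<Sum>m\<le>M. proc n m (y m) \<omega>))) \<longlonglongrightarrow> exp (- (\<Sum>m\<le>M. evar (y m)) / 2)"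
proof -
  define K where "K = (2 * c) ^ 3 + (2 * c) ^ 4"
  define K' where "K' = real M * (K + 3 * c\<^sup>2 * (1 + moment_bound)) + K"
  have "eventually (\<lambda>n. norm (expectation (\<lambda>\<omega>. cis (\<Sum>m\<le>M. proc n m (y m) \<omega>)) - exp (- (\<Sum>m\<le>M. evar (y m)) / 2))
      \<le> K' / sqrt (real n)) sequentially"
    using eventually_gt_at_top[of 0]
    by eventually_elim (use proc_cf_error[OF ym y c] in \<open>simp add: K'_def K_def\<close>)
  moreover have "(\<lambda>n. K' / sqrt (real n)) \<longlonglongrightarrow> 0"
    by (intro tendsto_divide_0[OF tendsto_const] filterlim_at_top_imp_at_infinity
        filterlim_compose[OF sqrt_at_top filterlim_real_sequentially])
  ultimately have "(\<lambda>n. expectation (\<lambda>\<omega>. cis (\<Sum>m\<le>M. proc n m (y m) \<omega>)) - exp (- (\<Sum>m\<le>M. evar (y m)) / 2)) \<longlonglongrightarrow> 0"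
    by (rule Lim_null_comparison)
  then show ?thesis by (simp add: LIM_zero_iff)
qed

end

section \<open>Empirical and bootstrap processes of the copula scale\<close>

lemma borel_measurable_vec_component [measurable (raw)]:
  fixes f :: "'a \<Rightarrow> real^'n"
  assumes "f \<in> borel_measurable M" shows "(\<lambda>x. f x $ k) \<in> borel_measurable M"
  by (rule measurable_compose[OF assms]) (intro borel_measurable_continuous_onI continuous_intros)

locale copula_sample = bootstrap_sample P X Z J
  for P :: "'a measure" and X :: "nat \<Rightarrow> 'a \<Rightarrow> real^'p" and Z :: "nat \<Rightarrow> 'a \<Rightarrow> real^'q"
    and J :: "nat \<times> nat \<times> nat \<Rightarrow> 'a \<Rightarrow> nat" +
  fixes A :: "(real^'q) set" and C' :: "real^'p \<Rightarrow> ((real^'p) \<Rightarrow>\<^sub>L real)"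
  assumes A_borel [measurable]: "A \<in> sets borel"
    and pA_pos: "pA P (Z 0) A > 0"
    and margins_cont: "\<And>k. continuous_on UNIV (condF P (X 0) (Z 0) A k)"
    and C_deriv: "\<And>u. u \<in> unit_cube \<Longrightarrow>
          (condC P (X 0) (Z 0) A has_derivative blinfun_apply (C' u)) (at u within unit_cube)"
    and C'_cont: "continuous_on unit_cube C'"
begin

section \<open>Margins, orthants and the conditional copula\<close>

abbreviation p where "p \<equiv> pA P (Z 0) A"
abbreviation F where "F \<equiv> condF P (X 0) (Z 0) A"
abbreviation D where "D \<equiv> condD P (X 0) (Z 0) A"
abbreviation C where "C \<equiv> condC P (X 0) (Z 0) A"

definition orthant :: "real^'p \<Rightarrow> (real^'p) \<times> (real^'q) \<Rightarrow> real" where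
  "orthant u s = (if (\<forall>k. F k (fst s $ k) \<le> u $ k) \<and> snd s \<in> A then 1 else 0)"

lemma F_mono: "mono (F k)"
proof (rule monoI)
  fix a b :: real assume "a \<le> b"
  then show "F k a \<le> F k b"
    unfolding condF_def using pA_pos by (intro divide_right_mono finite_measure_mono) auto
qed

lemma F_01: "0 \<le> F k t \<and> F k t \<le> 1"
proof -
  have "prob {\<omega> \<in> space P. X 0 \<omega> $ k \<le> t \<and> Z 0 \<omega> \<in> A} \<le> p"
    unfolding pA_def by (intro finite_measure_mono) auto
  then show ?thesis using pA_pos by (simp add: condF_def divide_le_eq)
qed

lemma F_meas: "F k \<in> borel_measurable borel"
  by (rule borel_measurable_continuous_onI[OF margins_cont])

lemma F_X_meas [measurable]: "(\<lambda>\<omega>. F k (X i \<omega> $ k)) \<in> borel_measurable P"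
  by (rule measurable_compose[OF _ F_meas]) measurable

lemma p_le_1: "p \<le> 1" by (simp add: pA_def)

lemma orthant_meas [measurable]: "orthant u \<in> borel_measurable borel"
proof -
  have f: "(\<lambda>s :: (real^'p) \<times> (real^'q). fst s) \<in> borel_measurable borel"
    and sn: "(\<lambda>s :: (real^'p) \<times> (real^'q). snd s) \<in> borel_measurable borel"
    by (intro borel_measurable_continuous_onI continuous_intros)+
  have Fk: "(\<lambda>s :: (real^'p) \<times> (real^'q). F k (fst s $ k)) \<in> borel_measurable borel" for k
    by (rule measurable_compose[OF borel_measurable_vec_component[OF f] F_meas])
  have "{s \<in> space borel. F k (fst s $ k) \<le> u $ k} \<in> sets (borel :: ((real^'p) \<times> (real^'q)) measure)" for k
    by (rule borel_measurable_le[OF Fk borel_measurable_const])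
  then have "(\<Inter>k. {s \<in> space borel. F k (fst s $ k) \<le> u $ k}) \<in> sets (borel :: ((real^'p) \<times> (real^'q)) measure)"
    by (rule sets.finite_INT[OF finite UNIV_not_empty])
  from sets.Int[OF this measurable_sets[OF sn A_borel]]
  have S: "(\<Inter>k. {s \<in> space borel. F k (fst s $ k) \<le> u $ k}) \<inter> (snd -` A \<inter> space borel)
      \<in> sets (borel :: ((real^'p) \<times> (real^'q)) measure)" .
  have "orthant u = indicator ((\<Inter>k. {s \<in> space borel. F k (fst s $ k) \<le> u $ k}) \<inter> (snd -` A \<inter> space borel))"
    by (auto simp: fun_eq_iff orthant_def indicator_def)
  then show ?thesis using borel_measurable_indicator[OF S] by (simp only:)
qed

lemma orthant_01: "orthant u s = 0 \<or> orthant u s = 1"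
  by (simp add: orthant_def)

lemma abs_orthant_le: "\<bar>orthant u s\<bar> \<le> 1"
  by (simp add: orthant_def)

lemma orthant_integrable: "integrable P (\<lambda>\<omega>. orthant u (obs \<omega> i))"
  by (rule integrable_const_bound[of _ 1]) (auto simp: abs_orthant_le)

lemma emean_orthant: "emean (orthant u) = D u"
proof -
  have "emean (orthant u) = expectation (indicator {\<omega>\<in>space P. (\<forall>k. F k (X 0 \<omega> $ k) \<le> u $ k) \<and> Z 0 \<omega> \<in> A})"
    unfolding emean_def by (intro Bochner_Integration.integral_cong) (auto simp: orthant_def obs_def indicator_def)
  also have "\<dots> = D u" by (simp add: condD_def Int_absorb1)
  finally show ?thesis .
qed

lemma D_eq: "D u = p * C u" using pA_pos by (simp add: condC_def)

lemma orthant_mult: "orthant u s * orthant v s = orthant (\<chi> k. min (u $ k) (v $ k)) s"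
  by (auto simp: orthant_def)

lemma orthant_mono: "(\<And>k. u $ k \<le> v $ k) \<Longrightarrow> orthant u s \<le> orthant v s"
  by (auto simp: orthant_def intro: order_trans)

lemma orthant_edge: "orthant (edge k a) s = (if F k (fst s $ k) \<le> a \<and> snd s \<in> A then 1 else 0)"
proof -
  have "(\<forall>j. F j (fst s $ j) \<le> edge k a $ j) \<longleftrightarrow> F k (fst s $ k) \<le> a"
    using F_01 by (auto simp: edge_def)
  then show ?thesis by (simp add: orthant_def)
qed

text \<open>\<open>F k\<close> is, up to the factor p, the distribution function of the finite
  measure \<mu>: the law of X_k on the event Z in A, of total mass p.\<close>

lemma F_limits: "((\<lambda>t. F k t) \<longlongrightarrow> 1) at_top" "((\<lambda>t. F k t) \<longlongrightarrow> 0) at_bot"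
proof -
  let ?E = "{\<omega>\<in>space P. Z 0 \<omega> \<in> A}"
  define \<mu> where "\<mu> = distr (restrict_space P ?E) borel (\<lambda>\<omega>. X 0 \<omega> $ k)"
  have E [measurable]: "?E \<in> events" by measurable
  have mX: "(\<lambda>\<omega>. X 0 \<omega> $ k) \<in> borel_measurable (restrict_space P ?E)"
    by (intro measurable_restrict_space1) measurable
  interpret R: finite_measure "restrict_space P ?E"
    by (rule finite_measure_restrict_space) (use E in auto)
  interpret \<mu>: finite_borel_measure \<mu>
    unfolding \<mu>_def finite_borel_measure_def finite_borel_measure_axioms_def
    using R.finite_measure_distr[OF mX] by simp
  have meas: "measure \<mu> B = prob {\<omega>\<in>space P. X 0 \<omega> $ k \<in> B \<and> Z 0 \<omega> \<in> A}" if "B \<in> sets borel" for B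
  proof -
    have "measure \<mu> B = measure (restrict_space P ?E) ((\<lambda>\<omega>. X 0 \<omega> $ k) -` B \<inter> space (restrict_space P ?E))"
      unfolding \<mu>_def by (rule measure_distr[OF mX that])
    also have "\<dots> = prob ((\<lambda>\<omega>. X 0 \<omega> $ k) -` B \<inter> space (restrict_space P ?E))"
      using E by (intro measure_restrict_space) (auto simp: space_restrict_space)
    also have "(\<lambda>\<omega>. X 0 \<omega> $ k) -` B \<inter> space (restrict_space P ?E) = {\<omega>\<in>space P. X 0 \<omega> $ k \<in> B \<and> Z 0 \<omega> \<in> A}"
      by (auto simp: space_restrict_space)
    finally show ?thesis .
  qed
  have cdf: "F k t = cdf \<mu> t / p" for t
    by (simp add: condF_def cdf_def meas)
  have tot: "measure \<mu> (space \<mu>) = p"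
    using meas[of UNIV] by (simp add: \<mu>_def pA_def)
  show "((\<lambda>t. F k t) \<longlongrightarrow> 1) at_top"
    unfolding cdf using tendsto_divide[OF \<mu>.cdf_lim_at_top tendsto_const, of p] pA_pos by (simp add: tot)
  show "((\<lambda>t. F k t) \<longlongrightarrow> 0) at_bot"
    unfolding cdf using tendsto_divide[OF \<mu>.cdf_lim_at_bot tendsto_const, of p] pA_pos by simp
qed

text \<open>The probability integral transform for a margin that may have flat stretches: {F <= a}
  is a closed half-line ending at its supremum \<open>s\<close>, and the intermediate value theorem
  forces F s = a. It is unbounded only at a = 1 and can be empty only at a = 0, by the limit at
  minus infinity.\<close>

lemma uniform_margin:
  assumes a: "0 \<le> a" "a \<le> 1"
  shows "prob {\<omega>\<in>space P. F k (X 0 \<omega> $ k) \<le> a \<and> Z 0 \<omega> \<in> A} = a * p"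
proof (cases "a = 1")
  case True
  then show ?thesis using F_01 by (simp add: pA_def)
next
  case False
  then have a1: "a < 1" using a by simp
  let ?S = "{t. F k t \<le> a}"
  show ?thesis
  proof (cases "?S = {}")
    case True
    have "a = 0"
    proof (rule ccontr)
      assume "a \<noteq> 0"
      then have "0 < a" using a by simp
      then have "eventually (\<lambda>t. F k t < a) at_bot" using F_limits(2) by (rule order_tendstoD(2)[rotated])
      then obtain t where "F k t < a" using eventually_happens by (metis trivial_limit_at_bot_linorder)
      then show False using True by (auto intro: less_imp_le)
    qed
    moreover have "{\<omega>\<in>space P. F k (X 0 \<omega> $ k) \<le> a \<and> Z 0 \<omega> \<in> A} = {}" using True by auto
    ultimately show ?thesis by (simp only: measure_empty mult_zero_left)
  next
    case ne: False
    have "eventually (\<lambda>t. a < F k t) at_top" using F_limits(1) a1 by (rule order_tendstoD)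
    then obtain T where T: "a < F k T" using eventually_happens by (metis trivial_limit_at_top_linorder)
    have bdd: "bdd_above ?S"
    proof (rule bdd_aboveI[of _ T])
      fix t assume "t \<in> ?S"
      then show "t \<le> T" using T monoD[OF F_mono[of k], of T t] by force
    qed
    have cl: "closed ?S" using margins_cont[of k] by (intro closed_Collect_le) auto
    define s where "s = Sup ?S"
    have sS: "F k s \<le> a" using closed_contains_Sup[OF ne bdd cl] by (simp add: s_def)
    have iff: "F k t \<le> a \<longleftrightarrow> t \<le> s" for t
    proof
      show "t \<le> s" if "F k t \<le> a" unfolding s_def using that bdd by (intro cSup_upper) auto
      show "F k t \<le> a" if "t \<le> s" using monoD[OF F_mono that, of k] sS by simp
    qed
    have "s \<le> T" using T iff[of T] by simp
    obtain x where x: "s \<le> x" "x \<le> T" "F k x = a"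
      using IVT'[of "F k" s a T] sS T \<open>s \<le> T\<close> continuous_on_subset[OF margins_cont[of k]] by (metis less_imp_le subset_UNIV)
    then have "F k s = a" using iff[of x] by (metis order_antisym order_refl)
    then have "prob {\<omega>\<in>space P. X 0 \<omega> $ k \<le> s \<and> Z 0 \<omega> \<in> A} = a * p"
      using pA_pos by (simp add: condF_def field_simps)
    then show ?thesis by (simp add: iff)
  qed
qed

lemma D_edge: "0 \<le> a \<Longrightarrow> a \<le> 1 \<Longrightarrow> D (edge k a) = a * p"
proof -
  assume a: "0 \<le> a" "a \<le> 1"
  have "(\<forall>j. F j (x $ j) \<le> edge k a $ j) \<longleftrightarrow> F k (x $ k) \<le> a" for x :: "real^'p"
    using F_01 by (auto simp: edge_def)
  then show ?thesis using uniform_margin[OF a] by (simp add: condD_def)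
qed

lemma C_edge: "0 \<le> a \<Longrightarrow> a \<le> 1 \<Longrightarrow> C (edge k a) = a"
  using D_edge[of a k] pA_pos by (simp add: condC_def)

lemma C_01: "0 \<le> C u \<and> C u \<le> 1"
proof -
  have "D u \<le> p" unfolding condD_def pA_def by (intro finite_measure_mono) auto
  then show ?thesis using pA_pos by (simp add: condC_def condD_def divide_le_eq)
qed

text \<open>The difference of two nested orthants is covered by the strips of the single
  coordinates, whose masses are (v_k - u_k) p by uniformity of the margins.\<close>

lemma D_lip:
  assumes u: "u \<in> unit_cube" and v: "v \<in> unit_cube" and uv: "\<And>k. u $ k \<le> v $ k"
  shows "D u \<le> D v \<and> D v - D u \<le> (\<Sum>k\<in>UNIV. v $ k - u $ k)"
proof
  show "D u \<le> D v"
    unfolding condD_def using uv by (intro finite_measure_mono) (auto intro: order_trans)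
  have pt: "orthant v s - orthant u s \<le> (\<Sum>k\<in>UNIV. orthant (edge k (v $ k)) s - orthant (edge k (u $ k)) s)" for s
  proof -
    have nn: "0 \<le> orthant (edge k (v $ k)) s - orthant (edge k (u $ k)) s" for k
      using orthant_mono[of "edge k (u $ k)" "edge k (v $ k)" s] uv[of k] by (simp add: edge_def)
    show ?thesis
    proof (cases "orthant v s = 1 \<and> orthant u s = 0")
      case True
      then have "\<forall>k. F k (fst s $ k) \<le> v $ k" "snd s \<in> A" by (auto simp: orthant_def split: if_splits)
      moreover obtain k where k: "\<not> F k (fst s $ k) \<le> u $ k"
        using True \<open>snd s \<in> A\<close> by (auto simp: orthant_def split: if_splits)
      ultimately have "1 = orthant (edge k (v $ k)) s - orthant (edge k (u $ k)) s" by (simp add: orthant_edge)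
      also have "\<dots> \<le> (\<Sum>k\<in>UNIV. orthant (edge k (v $ k)) s - orthant (edge k (u $ k)) s)"
        using nn by (intro member_le_sum) auto
      finally show ?thesis using True by simp
    next
      case False
      then have "orthant v s - orthant u s \<le> 0"
        using orthant_01[of v s] orthant_01[of u s] by auto
      also have "0 \<le> (\<Sum>k\<in>UNIV. orthant (edge k (v $ k)) s - orthant (edge k (u $ k)) s)"
        using nn by (intro sum_nonneg)
      finally show ?thesis .
    qed
  qed
  have "D v - D u = expectation (\<lambda>\<omega>. orthant v (obs \<omega> 0) - orthant u (obs \<omega> 0))"
    using orthant_integrable by (simp add: emean_orthant[symmetric] emean_def)
  also have "\<dots> \<le> expectation (\<lambda>\<omega>. \<Sum>k\<in>UNIV. orthant (edge k (v $ k)) (obs \<omega> 0) - orthant (edge k (u $ k)) (obs \<omega> 0))"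
    using orthant_integrable pt by (intro integral_mono Bochner_Integration.integrable_sum Bochner_Integration.integrable_diff) auto
  also have "\<dots> = (\<Sum>k\<in>UNIV. D (edge k (v $ k)) - D (edge k (u $ k)))"
    using orthant_integrable by (simp add: Bochner_Integration.integral_sum emean_orthant[symmetric] emean_def)
  also have "\<dots> = (\<Sum>k\<in>UNIV. (v $ k - u $ k) * p)"
    using u v by (intro sum.cong refl) (simp add: D_edge unit_cube_def left_diff_distrib)
  also have "\<dots> \<le> (\<Sum>k\<in>UNIV. v $ k - u $ k)"
    using uv p_le_1 pA_pos by (intro sum_mono) (simp add: mult_left_le)
  finally show "D v - D u \<le> (\<Sum>k\<in>UNIV. v $ k - u $ k)" .
qed

text \<open>The face with k-th coordinate 0 has mass 0. This provides the positivity demanded by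
  \<open>emp_copula_squeeze\<close>, for the data and hence for every resample.\<close>

lemma AE_F_pos: "AE \<omega> in P. \<forall>i k. Z i \<omega> \<in> A \<longrightarrow> 0 < F k (X i \<omega> $ k)"
proof -
  have "AE \<omega> in P. Z i \<omega> \<in> A \<longrightarrow> 0 < F k (X i \<omega> $ k)" for i k
  proof -
    have "expectation (\<lambda>\<omega>. orthant (edge k 0) (obs \<omega> i)) = 0"
      using integral_obs_eq[of "orthant (edge k 0)" i] emean_orthant[of "edge k 0"] D_edge[of 0 k]
      by (simp add: emean_def)
    moreover have "AE \<omega> in P. 0 \<le> orthant (edge k 0) (obs \<omega> i)" by (simp add: orthant_def)
    ultimately have "AE \<omega> in P. orthant (edge k 0) (obs \<omega> i) = 0"
      using integral_nonneg_eq_0_iff_AE[OF orthant_integrable] by blast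
    then show ?thesis
    proof eventually_elim
      case (elim \<omega>)
      then show ?case using F_01[of k "X i \<omega> $ k"] by (auto simp: orthant_edge obs_def split: if_splits)
    qed
  qed
  then have "AE \<omega> in P. \<forall>k\<in>UNIV. Z i \<omega> \<in> A \<longrightarrow> 0 < F k (X i \<omega> $ k)" for i
    by (subst AE_finite_all) auto
  then show ?thesis by (simp add: AE_all_countable)
qed

definition cov :: "real^'p \<Rightarrow> real^'p \<Rightarrow> real" where
  "cov u v = p * C (\<chi> k. min (u $ k) (v $ k)) - p\<^sup>2 * C u * C v"

text \<open>The product of two orthants is the orthant of the componentwise minimum, which is how u
  \<and> v enters the covariance.\<close>

lemma evar_orthant_sum:
  assumes "finite S"
  shows "evar (\<lambda>s. \<Sum>i\<in>S. c i * orthant (x i) s) = (\<Sum>i\<in>S. \<Sum>j\<in>S. c i * c j * cov (x i) (x j))"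
proof -
  have m: "emean (\<lambda>s. \<Sum>i\<in>S. c i * orthant (x i) s) = (\<Sum>i\<in>S. c i * (p * C (x i)))"
    using orthant_integrable unfolding emean_def
    by (simp add: Bochner_Integration.integral_sum emean_orthant[unfolded emean_def] D_eq)
  have "emean (\<lambda>s. (\<Sum>i\<in>S. c i * orthant (x i) s)\<^sup>2)
      = emean (\<lambda>s. \<Sum>i\<in>S. \<Sum>j\<in>S. c i * c j * orthant (\<chi> k. min (x i $ k) (x j $ k)) s)"
    unfolding power2_eq_square sum_product orthant_mult[symmetric] by (simp add: mult_ac)
  also have "\<dots> = (\<Sum>i\<in>S. \<Sum>j\<in>S. c i * c j * (p * C (\<chi> k. min (x i $ k) (x j $ k))))"
    using orthant_integrable unfolding emean_def
    by (simp add: Bochner_Integration.integral_sum emean_orthant[unfolded emean_def] D_eq)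
  finally have m2: "emean (\<lambda>s. (\<Sum>i\<in>S. c i * orthant (x i) s)\<^sup>2) = \<dots>" .
  show ?thesis
    unfolding evar_def m2 unfolding m power2_eq_square sum_product sum_subtractf[symmetric] cov_def
    by (intro sum.cong refl) (simp add: algebra_simps)
qed

end

section \<open>A union bound over the edges of a dyadic grid\<close>

definition chain_prob :: "nat \<Rightarrow> nat \<Rightarrow> real" where
  "chain_prob d j = real d * exp 2 * (1/2) ^ j"

definition level_bad :: "'b measure \<Rightarrow> ('b \<Rightarrow> real^'p \<Rightarrow> real) \<Rightarrow> nat \<Rightarrow> 'b set" where
  "level_bad N f j = {\<omega>\<in>space N. \<exists>u\<in>dyadic_grid j. \<exists>k. bump j k u \<in> unit_cube
      \<and> chain_step CARD('p) j < \<bar>f \<omega> (bump j k u) - f \<omega> u\<bar>}"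

text \<open>At most 2^((j+1)d) d edges face the Chernoff factor exp (-(d+1)(j+1)), which is at most
  2^(-(d+1)(j+1)); the surplus 2^(-(j+1)) absorbs the 2 of the two-sided bound.\<close>

lemma level_count_bound:
  "real ((2 ^ j + 1) ^ d * d) * (2 * exp 2 * exp (- (sqrt 2 ^ j * chain_step d j))) \<le> chain_prob d j"
proof -
  have "sqrt 2 ^ j * sqrt (1/2) ^ j = 1"
    unfolding power_mult_distrib[symmetric] real_sqrt_mult[symmetric] by simp
  then have "sqrt 2 ^ j * chain_step d j = (real d + 1) * real (Suc j)"
    by (simp add: chain_step_def mult.left_commute)
  then have "exp (- (sqrt 2 ^ j * chain_step d j)) = exp (- 1) ^ ((d + 1) * Suc j)"
    by (simp only: exp_of_nat_mult[symmetric]) (simp add: algebra_simps)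
  also have "\<dots> \<le> (1 / 2) ^ ((d + 1) * Suc j)"
  proof (rule power_mono)
    have "2 \<le> exp (1::real)" using exp_ge_add_one_self[of 1] by simp
    then show "exp (- 1) \<le> (1 / 2 :: real)" by (simp add: exp_minus field_simps)
  qed simp
  finally have e: "exp (- (sqrt 2 ^ j * chain_step d j)) \<le> (1 / 2) ^ ((d + 1) * Suc j)" .
  have "(2 ^ j + 1 :: nat) \<le> 2 ^ Suc j" by simp
  then have "(2 ^ j + 1 :: nat) ^ d \<le> (2 ^ Suc j) ^ d" by (rule power_mono) simp
  then have "real ((2 ^ j + 1) ^ d) \<le> real ((2 ^ Suc j) ^ d)" by (rule of_nat_mono)
  also have "\<dots> = 2 ^ (Suc j * d)" unfolding power_mult by simp
  finally have c: "real ((2 ^ j + 1) ^ d) \<le> 2 ^ (Suc j * d)" .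
  have "real ((2 ^ j + 1) ^ d * d) * (2 * exp 2 * exp (- (sqrt 2 ^ j * chain_step d j)))
      \<le> (2 ^ (Suc j * d) * real d) * (2 * exp 2 * (1 / 2) ^ ((d + 1) * Suc j))"
    unfolding of_nat_mult using c e by (intro mult_mono) auto
  also have "\<dots> = real d * exp 2 * (2 * (2 ^ (Suc j * d) * (1 / 2) ^ (Suc j * d) * (1 / 2) ^ Suc j))"
    by (simp add: power_add[symmetric] algebra_simps)
  also have "(2::real) ^ (Suc j * d) * (1 / 2) ^ (Suc j * d) = 1"
    unfolding power_mult_distrib[symmetric] by simp
  finally show ?thesis by (simp add: chain_prob_def)
qed

lemma (in prob_space) two_sided_chernoff:
  assumes [measurable]: "Y \<in> borel_measurable M" and \<theta>: "0 < \<theta>"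
    and i: "integrable M (\<lambda>\<omega>. exp (\<theta> * Y \<omega>))" "integrable M (\<lambda>\<omega>. exp (- \<theta> * Y \<omega>))"
    and b: "expectation (\<lambda>\<omega>. exp (\<theta> * Y \<omega>)) \<le> c" "expectation (\<lambda>\<omega>. exp (- \<theta> * Y \<omega>)) \<le> c"
  shows "prob {\<omega>\<in>space M. x < \<bar>Y \<omega>\<bar>} \<le> 2 * c * exp (- (\<theta> * x))"
proof -
  let ?f = "\<lambda>\<omega>. exp (\<theta> * Y \<omega>) + exp (- \<theta> * Y \<omega>)"
  have "prob {\<omega>\<in>space M. x < \<bar>Y \<omega>\<bar>} \<le> prob {\<omega>\<in>space M. exp (\<theta> * x) \<le> ?f \<omega>}"
  proof (rule finite_measure_mono)
    show "{\<omega>\<in>space M. x < \<bar>Y \<omega>\<bar>} \<subseteq> {\<omega>\<in>space M. exp (\<theta> * x) \<le> ?f \<omega>}"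
    proof safe
      fix \<omega> assume "x < \<bar>Y \<omega>\<bar>"
      then have "x \<le> Y \<omega> \<or> x \<le> - Y \<omega>" by auto
      then have "\<theta> * x \<le> \<theta> * Y \<omega> \<or> \<theta> * x \<le> \<theta> * (- Y \<omega>)" using \<theta> mult_left_mono[of x "Y \<omega>" \<theta>] mult_left_mono[of x "- Y \<omega>" \<theta>] by linarith
      then have "exp (\<theta> * x) \<le> exp (\<theta> * Y \<omega>) \<or> exp (\<theta> * x) \<le> exp (- \<theta> * Y \<omega>)" by simp
      then show "exp (\<theta> * x) \<le> ?f \<omega>" using exp_ge_zero[of "\<theta> * Y \<omega>"] exp_ge_zero[of "- \<theta> * Y \<omega>"] by linarith
    qed
  qed measurable
  also have "\<dots> \<le> expectation ?f / exp (\<theta> * x)"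
    by (rule integral_Markov_inequality_measure[of _ _ "{}"]) (use i in auto)
  also have "expectation ?f \<le> 2 * c" using i b by simp
  finally show ?thesis by (simp add: exp_minus field_simps divide_right_mono)
qed

lemma (in prob_space) level_bad_prob:
  fixes f :: "'a \<Rightarrow> real^'p \<Rightarrow> real"
  assumes [measurable]: "\<And>u. u \<in> dyadic_grid j \<Longrightarrow> (\<lambda>\<omega>. f \<omega> u) \<in> borel_measurable M"
    and mgf: "\<And>u k \<theta>. u \<in> dyadic_grid j \<Longrightarrow> bump j k u \<in> unit_cube \<Longrightarrow> \<bar>\<theta>\<bar> = sqrt 2 ^ j \<Longrightarrow>
        integrable M (\<lambda>\<omega>. exp (\<theta> * (f \<omega> (bump j k u) - f \<omega> u)))
        \<and> expectation (\<lambda>\<omega>. exp (\<theta> * (f \<omega> (bump j k u) - f \<omega> u))) \<le> exp 2"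
  shows "level_bad M f j \<in> events" "prob (level_bad M f j) \<le> chain_prob CARD('p) j"
proof -
  let ?d = "CARD('p)"
  let ?I = "{x \<in> dyadic_grid j \<times> (UNIV :: 'p set). bump j (snd x) (fst x) \<in> unit_cube}"
  let ?B = "\<lambda>x. {\<omega>\<in>space M. chain_step ?d j < \<bar>f \<omega> (bump j (snd x) (fst x)) - f \<omega> (fst x)\<bar>}"
  have fin: "finite ?I"
    by (rule finite_subset[of _ "dyadic_grid j \<times> UNIV"]) (auto simp: finite_dyadic_grid)
  have bump_grid: "bump j k u \<in> dyadic_grid j" if "u \<in> dyadic_grid j" "bump j k u \<in> unit_cube" for u k
    unfolding dyadic_grid_iff
  proof (intro conjI allI that(2))
    fix i show "2 ^ j * bump j k u $ i \<in> \<int>"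
      using that(1) by (auto simp: dyadic_grid_iff bump_def distrib_left)
  qed
  have eq: "level_bad M f j = (\<Union>x\<in>?I. ?B x)" by (auto simp: level_bad_def) blast
  have Bm: "?B x \<in> events" if "x \<in> ?I" for x
  proof -
    have "(\<lambda>\<omega>. f \<omega> (fst x)) \<in> borel_measurable M" "(\<lambda>\<omega>. f \<omega> (bump j (snd x) (fst x))) \<in> borel_measurable M"
      using that bump_grid by (auto intro!: assms(1))
    then show ?thesis by measurable
  qed
  show "level_bad M f j \<in> events" unfolding eq using fin Bm by (intro sets.finite_UN)
  have "prob (level_bad M f j) \<le> (\<Sum>x\<in>?I. prob (?B x))"
    unfolding eq using fin Bm by (intro finite_measure_subadditive_finite) auto
  also have "\<dots> \<le> (\<Sum>x\<in>?I. 2 * exp 2 * exp (- (sqrt 2 ^ j * chain_step ?d j)))"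
  proof (rule sum_mono)
    fix x assume x: "x \<in> ?I"
    have "(\<lambda>\<omega>. f \<omega> (fst x)) \<in> borel_measurable M" "(\<lambda>\<omega>. f \<omega> (bump j (snd x) (fst x))) \<in> borel_measurable M"
      using x bump_grid by (auto intro!: assms(1))
    then have "(\<lambda>\<omega>. f \<omega> (bump j (snd x) (fst x)) - f \<omega> (fst x)) \<in> borel_measurable M" by measurable
    then show "prob (?B x) \<le> 2 * exp 2 * exp (- (sqrt 2 ^ j * chain_step ?d j))"
      using mgf[of "fst x" "snd x" "sqrt 2 ^ j"] mgf[of "fst x" "snd x" "- (sqrt 2 ^ j)"] x
      by (intro two_sided_chernoff) auto
  qed
  also have "\<dots> = real (card ?I) * (2 * exp 2 * exp (- (sqrt 2 ^ j * chain_step ?d j)))" by simp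
  also have "\<dots> \<le> real ((2 ^ j + 1) ^ ?d * ?d) * (2 * exp 2 * exp (- (sqrt 2 ^ j * chain_step ?d j)))"
  proof (intro mult_right_mono of_nat_mono)
    have "card ?I \<le> card ((dyadic_grid j :: (real^'p) set) \<times> (UNIV :: 'p set))"
      by (intro card_mono finite_cartesian_product finite_dyadic_grid) auto
    also have "\<dots> \<le> (2 ^ j + 1) ^ ?d * ?d"
      unfolding card_cartesian_product by (intro mult_right_mono card_dyadic_grid_le) simp
    finally show "card ?I \<le> (2 ^ j + 1) ^ ?d * ?d" .
  qed simp
  also have "\<dots> \<le> chain_prob ?d j" by (rule level_count_bound)
  finally show "prob (level_bad M f j) \<le> chain_prob ?d j" .
qed

lemma summable_chain_prob: "summable (chain_prob d)"
  unfolding chain_prob_def by (intro summable_mult summable_geometric) simp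

lemma chain_prob_nonneg: "0 \<le> chain_prob d j" by (simp add: chain_prob_def)

lemma sum_chain_prob_le: "(\<Sum>j=l..L. chain_prob d j) \<le> 2 * chain_prob d l"
proof (cases "l \<le> L")
  case True
  have "(\<Sum>j=l..L. chain_prob d j) = chain_prob d l * (\<Sum>j=0..L-l. (1/2) ^ j)"
    using True by (subst sum.atLeastAtMost_shift_0) (auto simp: chain_prob_def sum_distrib_left power_add mult_ac)
  also have "\<dots> \<le> chain_prob d l * 2"
    by (intro mult_left_mono chain_prob_nonneg) (simp add: sum_gp0 atLeast0AtMost)
  finally show ?thesis by simp
qed (simp add: chain_prob_nonneg)

lemma ev_const_over_sqrt: "0 < e \<Longrightarrow> eventually (\<lambda>n. c / sqrt (real n) < (e::real)) sequentially"
proof -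
  assume e: "0 < e"
  have "(\<lambda>n. c / sqrt (real n)) \<longlonglongrightarrow> 0"
    by (intro tendsto_divide_0[OF tendsto_const] filterlim_at_top_imp_at_infinity
        filterlim_compose[OF sqrt_at_top filterlim_real_sequentially])
  then show ?thesis using e by (rule order_tendstoD)
qed

text \<open>Linearity in the path: it passes from two linearisations at \<open>C\<close> to one for
  the difference of the processes.\<close>

lemma Cinf_diff: "Cinf p' c dc f u - Cinf p' c dc g u = Cinf p' c dc (\<lambda>v. f v - g v) u"
  unfolding Cinf_def
  by (simp add: diff_divide_distrib right_diff_distrib left_diff_distrib sum_subtractf sum.distrib algebra_simps)

lemma unit_cube_cbox: "unit_cube = cbox 0 (1 :: real^'n)"
  by (auto simp: unit_cube_def mem_box_cart)

section \<open>Oscillation, size and linearisation of the sampled processes\<close>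

context copula_sample
begin

abbreviation W :: "nat \<Rightarrow> nat \<Rightarrow> 'a \<Rightarrow> real^'p \<Rightarrow> real" where
  "W n m \<omega> u \<equiv> proc n m (orthant u) \<omega>"

text \<open>For m >= 1 this recentres the bootstrap process at the true \<open>D\<close>: the sum is
  sqrt n (D_n^* - D), the process to which \<open>delta_method_bound\<close> applies.\<close>

definition G :: "nat \<Rightarrow> nat \<Rightarrow> 'a \<Rightarrow> real^'p \<Rightarrow> real" where
  "G n m \<omega> u = (if m = 0 then W n 0 \<omega> u else W n 0 \<omega> u + W n m \<omega> u)"

definition resample :: "nat \<Rightarrow> nat \<Rightarrow> 'a \<Rightarrow> nat \<Rightarrow> (real^'p) \<times> (real^'q)" where
  "resample n m \<omega> i = (if m = 0 then obs \<omega> i else obs \<omega> (J (n, m, i) \<omega>))"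

lemma emp_D_avg: "emp_D F n s A u = avg n (orthant u) s"
  by (simp add: emp_D_def avg_def orthant_def)

lemma G_eq: "G n m \<omega> u = sqrt (real n) * (emp_D F n (resample n m \<omega>) A u - p * C u)"
proof (cases "n = 0")
  case False
  have s: "a / sqrt (real n) = sqrt (real n) * (a / real n)" for a
  proof -
    have "sqrt (real n) * (a / real n) = a * (sqrt (real n) / real n)" by simp
    also have "sqrt (real n) / real n = inverse (sqrt (real n))" by (rule sqrt_divide_self_eq) simp
    finally show ?thesis by (simp only: divide_inverse)
  qed
  have 0: "W n 0 \<omega> u = sqrt (real n) * (avg n (orthant u) (obs \<omega>) - p * C u)"
    using False by (simp add: proc_def s emean_orthant D_eq sum_subtractf diff_divide_distrib avg_def)
  show ?thesis
  proof (cases "m = 0")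
    case True
    have "resample n 0 \<omega> = obs \<omega>" by (simp add: resample_def fun_eq_iff)
    then show ?thesis using True by (simp add: G_def 0 emp_D_avg)
  next
    case m: False
    have "W n m \<omega> u = sqrt (real n) * (avg n (orthant u) (resample n m \<omega>) - avg n (orthant u) (obs \<omega>))"
      using False m by (simp add: proc_def s sum_subtractf diff_divide_distrib resample_def) (simp add: avg_def resample_def)
    then show ?thesis using m by (simp add: G_def 0 emp_D_avg right_diff_distrib)
  qed
qed (simp add: G_def proc_def)

text \<open>An edge increment is the process at the indicator of a strip of mass at most 2^-j, so
  \<theta>^2 = 2^j makes the exponent at most 2, and 4 * 2^j <= n is the restriction on \<theta> in
  \<open>proc_mgf\<close>.\<close>

lemma W_level_prob:
  assumes n: "4 * 2 ^ j \<le> n"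
  shows "level_bad P (W n m) j \<in> events" "prob (level_bad P (W n m) j) \<le> chain_prob CARD('p) j"
proof -
  have n0: "0 < n" using n by (metis gr0I le_zero_eq mult_is_0 power_not_zero zero_neq_numeral)
  have mg: "integrable P (\<lambda>\<omega>. exp (\<theta> * (W n m \<omega> (bump j k u) - W n m \<omega> u)))
        \<and> expectation (\<lambda>\<omega>. exp (\<theta> * (W n m \<omega> (bump j k u) - W n m \<omega> u))) \<le> exp 2"
    if u: "u \<in> dyadic_grid j" and b: "bump j k u \<in> unit_cube" and \<theta>: "\<bar>\<theta>\<bar> = sqrt 2 ^ j" for u k \<theta>
  proof -
    define y where "y s = orthant (bump j k u) s - orthant u s" for s
    have ym: "y \<in> borel_measurable borel" unfolding y_def by (intro borel_measurable_diff orthant_meas)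
    have le: "u $ i \<le> bump j k u $ i" for i by (simp add: bump_def)
    have y01: "y s = 0 \<or> y s = 1" for s
      using orthant_01[of u s] orthant_01[of "bump j k u" s] orthant_mono[OF le, of s] by (auto simp: y_def)
    then have y1: "\<bar>y s\<bar> \<le> 1" for s by (metis abs_0 abs_1 order_refl zero_le_one)
    have eq: "W n m \<omega> (bump j k u) - W n m \<omega> u = proc n m y \<omega>" for \<omega>
      unfolding y_def by (rule proc_diff[OF orthant_meas orthant_meas abs_orthant_le abs_orthant_le, symmetric])
    have uc: "u \<in> unit_cube" using u dyadic_grid_subset_unit_cube by blast
    have "emean (\<lambda>s. (y s)\<^sup>2) = emean y"
    proof -
      have "(\<lambda>s. (y s)\<^sup>2) = y" using y01 by (auto simp: fun_eq_iff) (metis one_power2 zero_power2)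
      then show ?thesis by simp
    qed
    also have "\<dots> = D (bump j k u) - D u"
      using orthant_integrable by (simp add: emean_orthant[symmetric] emean_def y_def)
    also have "\<dots> \<le> (\<Sum>i\<in>UNIV. bump j k u $ i - u $ i)" using D_lip[OF uc b le] by blast
    also have "\<dots> = (\<Sum>i\<in>UNIV. if i = k then 1 / 2 ^ j else 0)" by (intro sum.cong refl) (simp add: bump_def)
    also have "\<dots> = 1 / 2 ^ j" by simp
    finally have v: "emean (\<lambda>s. (y s)\<^sup>2) \<le> 1 / 2 ^ j" .
    have \<theta>2: "\<theta>\<^sup>2 = 2 ^ j"
    proof -
      have "\<theta>\<^sup>2 = (sqrt 2 ^ j)\<^sup>2" using \<theta> by (metis power2_abs)
      also have "\<dots> = 2 ^ j" by (simp add: power_mult[symmetric] mult.commute[of j] power_mult)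
      finally show ?thesis .
    qed
    have \<theta>n: "\<bar>\<theta>\<bar> \<le> sqrt (real n) / 2"
    proof -
      have "real (4 * 2 ^ j) \<le> real n" using n by (rule of_nat_mono)
      then have "(2 * \<bar>\<theta>\<bar>)\<^sup>2 \<le> real n" using \<theta>2 by (simp add: power_mult_distrib)
      then show ?thesis using real_le_rsqrt by fastforce
    qed
    have "expectation (\<lambda>\<omega>. exp (\<theta> * proc n m y \<omega>)) \<le> exp (2 * \<theta>\<^sup>2 * emean (\<lambda>s. (y s)\<^sup>2))"
      by (rule proc_mgf[OF ym y1 n0 \<theta>n])
    also have "\<dots> \<le> exp 2"
    proof -
      have "2 ^ j * emean (\<lambda>s. (y s)\<^sup>2) \<le> 2 ^ j * (1 / 2 ^ j)" using v by (intro mult_left_mono) auto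
      then show ?thesis by (simp add: \<theta>2)
    qed
    finally have "expectation (\<lambda>\<omega>. exp (\<theta> * proc n m y \<omega>)) \<le> exp 2" .
    moreover have "integrable P (\<lambda>\<omega>. exp (\<theta> * proc n m y \<omega>))"
    proof (rule integrable_const_bound[of _ "exp (\<bar>\<theta>\<bar> * (2 * sqrt (real n)))"])
      have "\<theta> * proc n m y \<omega> \<le> \<bar>\<theta>\<bar> * (2 * sqrt (real n))" for \<omega>
      proof -
        have "\<theta> * proc n m y \<omega> \<le> \<bar>\<theta>\<bar> * \<bar>proc n m y \<omega>\<bar>" by (simp add: abs_mult[symmetric])
        also have "\<dots> \<le> \<bar>\<theta>\<bar> * (2 * sqrt (real n))" by (intro mult_left_mono abs_proc_le[OF ym y1]) auto
        finally show ?thesis .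
      qed
      then show "AE \<omega> in P. norm (exp (\<theta> * proc n m y \<omega>)) \<le> exp (\<bar>\<theta>\<bar> * (2 * sqrt (real n)))" by simp
      show "(\<lambda>\<omega>. exp (\<theta> * proc n m y \<omega>)) \<in> borel_measurable P"
        using measurable_proc[OF ym] by measurable
    qed
    ultimately show ?thesis unfolding eq by simp
  qed
  show "level_bad P (W n m) j \<in> events" "prob (level_bad P (W n m) j) \<le> chain_prob CARD('p) j"
    using level_bad_prob[of j "W n m", OF measurable_proc[OF orthant_meas] mg] by auto
qed

lemma G_modulus:
  assumes good: "\<And>m j. m \<in> {0, m0} \<Longrightarrow> j \<in> {l..L} \<Longrightarrow> \<omega> \<notin> level_bad P (W n m) j" and \<omega>: "\<omega> \<in> space P" and l: "l \<le> L"
    and uv: "u \<in> unit_cube" "v \<in> unit_cube" "\<And>k. \<bar>u $ k - v $ k\<bar> \<le> 1 / 2 ^ l"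
  shows "\<bar>G n m0 \<omega> u - G n m0 \<omega> v\<bar> \<le> real CARD('p) * (10 * chain_tail CARD('p) l + 2 * sqrt (real n) / 2 ^ L)"
proof (rule empirical_modulus[OF _ _ _ _ _ l uv, where f = "G n m0 \<omega>" and Q = "emp_D F n (resample n m0 \<omega>) A" and D = D])
  show "emp_D F n (resample n m0 \<omega>) A u \<le> emp_D F n (resample n m0 \<omega>) A v" if "\<And>k. u $ k \<le> v $ k" for u v
    using that by (rule emp_D_mono)
  show "D u \<le> D v \<and> D v - D u \<le> (\<Sum>k\<in>UNIV. v $ k - u $ k)"
    if "u \<in> unit_cube" "v \<in> unit_cube" "\<And>k. u $ k \<le> v $ k" for u v
    using that by (rule D_lip)
  show "0 \<le> sqrt (real n)" by simp
  show "G n m0 \<omega> u = sqrt (real n) * (emp_D F n (resample n m0 \<omega>) A u - D u)" for u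
    by (simp add: G_eq D_eq)
  fix j k and u :: "real^'p"
  assume j: "l \<le> j" "j \<le> L" and u: "u \<in> dyadic_grid j" "bump j k u \<in> unit_cube"
  have "\<bar>W n m \<omega> (bump j k u) - W n m \<omega> u\<bar> \<le> chain_step CARD('p) j" if "m \<in> {0, m0}" for m
  proof (rule ccontr)
    assume "\<not> ?thesis"
    then have "\<omega> \<in> level_bad P (W n m) j" using u \<omega> unfolding level_bad_def by (auto simp: not_le)
    then show False using good[OF that, of j] j by simp
  qed
  from this[of 0, OF insertI1] this[of m0, OF insertI2[OF singletonI]] show "\<bar>G n m0 \<omega> (bump j k u) - G n m0 \<omega> u\<bar> \<le> 2 * chain_step CARD('p) j"
    using chain_step_nonneg[of "CARD('p)" j] by (auto simp: G_def abs_le_iff)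
qed

text \<open>The mesh is fixed before n tends to infinity. The bad levels above \<open>l\<close> have
  small total probability by the geometric decay of \<open>chain_prob\<close>, and the chained
  increments are bounded by the tail of a convergent series.\<close>

lemma asymptotic_equicontinuity:
  assumes \<epsilon>: "0 < \<epsilon>"
  shows "\<exists>l0. \<forall>l\<ge>l0. eventually (\<lambda>n. \<exists>E\<in>events. prob E \<le> \<epsilon> \<and>
     (\<forall>\<omega>\<in>space P - E. \<forall>m\<le>M. \<forall>u\<in>unit_cube. \<forall>v\<in>unit_cube. (\<forall>k. \<bar>u $ k - v $ k\<bar> \<le> 1 / 2 ^ l)
        \<longrightarrow> \<bar>G n m \<omega> u - G n m \<omega> v\<bar> \<le> \<epsilon>)) sequentially"
proof -
  let ?d = "CARD('p)"
  have "(\<lambda>l. real ?d * (10 * chain_tail ?d l)) \<longlonglongrightarrow> real ?d * (10 * 0)"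
    by (intro tendsto_intros chain_tail_tendsto)
  from order_tendstoD(2)[OF this, of "\<epsilon> / 2"]
  have "eventually (\<lambda>l. real ?d * (10 * chain_tail ?d l) < \<epsilon> / 2) sequentially" using \<epsilon> by simp
  moreover have "(\<lambda>l. real (Suc M) * (2 * chain_prob ?d l)) \<longlonglongrightarrow> real (Suc M) * (2 * 0)"
    by (intro tendsto_intros summable_LIMSEQ_zero[OF summable_chain_prob])
  from order_tendstoD(2)[OF this, of \<epsilon>]
  have "eventually (\<lambda>l. real (Suc M) * (2 * chain_prob ?d l) < \<epsilon>) sequentially" using \<epsilon> by simp
  ultimately have "eventually (\<lambda>l. real ?d * (10 * chain_tail ?d l) < \<epsilon> / 2 \<and> real (Suc M) * (2 * chain_prob ?d l) < \<epsilon>) sequentially"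
    by (rule eventually_conj)
  then obtain l0 where l0: "\<And>l. l \<ge> l0 \<Longrightarrow> real ?d * (10 * chain_tail ?d l) < \<epsilon> / 2 \<and> real (Suc M) * (2 * chain_prob ?d l) < \<epsilon>"
    unfolding eventually_sequentially by blast
  show ?thesis
  proof (intro exI[of _ l0] allI impI)
    fix l assume l: "l0 \<le> l"
    have "eventually (\<lambda>n. 8 * 2 ^ l \<le> n) sequentially" by (rule eventually_ge_at_top)
    moreover have "eventually (\<lambda>n. 16 * real ?d / sqrt (real n) < \<epsilon> / 2) sequentially"
      using \<epsilon> by (intro ev_const_over_sqrt) simp
    ultimately show "eventually (\<lambda>n. \<exists>E\<in>events. prob E \<le> \<epsilon> \<and>
     (\<forall>\<omega>\<in>space P - E. \<forall>m\<le>M. \<forall>u\<in>unit_cube. \<forall>v\<in>unit_cube. (\<forall>k. \<bar>u $ k - v $ k\<bar> \<le> 1 / 2 ^ l)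
        \<longrightarrow> \<bar>G n m \<omega> u - G n m \<omega> v\<bar> \<le> \<epsilon>)) sequentially"
    proof eventually_elim
      case (elim n)
      have n1: "1 \<le> n div 4"
      proof -
        have "4 * 1 \<le> 8 * (2::nat) ^ l" by simp
        then have "4 * 1 \<le> n" using elim(1) by linarith
        then show ?thesis by linarith
      qed
      \<comment> \<open>The finest level at which the moment bound is available: 4 * 2^L <= n < 8 *
        2^L. The upper inequality turns the residual sqrt n / 2^L into at most 8 / sqrt n.\<close>
      obtain L where L: "2 ^ L \<le> n div 4" "n div 4 < 2 ^ (L + 1)"
        using ex_power_ivl1[of 2 "n div 4"] n1 by auto
      have L1: "4 * 2 ^ L \<le> n" "n < 8 * 2 ^ L" using L by auto
      have lL: "l \<le> L"
      proof -
        have "(2::nat) ^ l < 2 ^ L" using elim(1) L1 by linarith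
        then show ?thesis by simp
      qed
      have lev: "4 * 2 ^ j \<le> n" if "j \<le> L" for j
      proof -
        have "(2::nat) ^ j \<le> 2 ^ L" using that by (intro power_increasing) auto
        then show ?thesis using L1 by linarith
      qed
      define E where "E = (\<Union>m\<le>M. \<Union>j\<in>{l..L}. level_bad P (W n m) j)"
      have Em: "E \<in> events" unfolding E_def using W_level_prob(1)[OF lev] by (intro sets.finite_UN) auto
      have "prob E \<le> (\<Sum>m\<le>M. prob (\<Union>j\<in>{l..L}. level_bad P (W n m) j))"
        unfolding E_def using W_level_prob(1)[OF lev]
        by (intro finite_measure_subadditive_finite) auto
      also have "\<dots> \<le> (\<Sum>m\<le>M. \<Sum>j=l..L. prob (level_bad P (W n m) j))"
        using W_level_prob(1)[OF lev] by (intro sum_mono finite_measure_subadditive_finite) auto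
      also have "\<dots> \<le> (\<Sum>m\<le>M. \<Sum>j=l..L. chain_prob ?d j)"
        using W_level_prob(2)[OF lev] by (intro sum_mono) auto
      also have "\<dots> \<le> (\<Sum>m\<le>M. 2 * chain_prob ?d l)" by (intro sum_mono sum_chain_prob_le)
      also have "\<dots> = real (Suc M) * (2 * chain_prob ?d l)" by simp
      finally have PE: "prob E \<le> \<epsilon>" using l0[OF l] by linarith
      have small: "real ?d * (10 * chain_tail ?d l + 2 * sqrt (real n) / 2 ^ L) \<le> \<epsilon>"
      proof -
        have n0: "0 < sqrt (real n)" using n1 by (simp add: real_sqrt_gt_zero)
        have "real n < 8 * 2 ^ L" using L1(2) by (metis of_nat_less_iff of_nat_mult of_nat_numeral of_nat_power)
        then have "sqrt (real n) * sqrt (real n) \<le> 8 * 2 ^ L" by simp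
        then have "sqrt (real n) / 2 ^ L \<le> 8 / sqrt (real n)"
          using n0 by (simp add: field_simps)
        then have "real ?d * (2 * (sqrt (real n) / 2 ^ L)) \<le> real ?d * (2 * (8 / sqrt (real n)))"
          by (intro mult_left_mono) auto
        then have "real ?d * (2 * sqrt (real n) / 2 ^ L) \<le> 16 * real ?d / sqrt (real n)" by (simp add: mult.commute)
        then show ?thesis using elim(2) l0[OF l] by (simp add: distrib_left)
      qed
      show ?case
      proof (intro bexI[OF _ Em] conjI PE ballI allI impI)
        fix \<omega> m and u v :: "real^'p"
        assume \<omega>: "\<omega> \<in> space P - E" and m: "m \<le> M" and uv: "u \<in> unit_cube" "v \<in> unit_cube" "\<forall>k. \<bar>u $ k - v $ k\<bar> \<le> 1 / 2 ^ l"
        have "\<bar>G n m \<omega> u - G n m \<omega> v\<bar> \<le> real ?d * (10 * chain_tail ?d l + 2 * sqrt (real n) / 2 ^ L)"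
        proof (rule G_modulus[OF _ _ lL uv(1,2)])
          show "\<omega> \<notin> level_bad P (W n m') j" if "m' \<in> {0, m}" "j \<in> {l..L}" for m' j
            using \<omega> that m unfolding E_def by auto
        qed (use \<omega> uv in auto)
        then show "\<bar>G n m \<omega> u - G n m \<omega> v\<bar> \<le> \<epsilon>" using small by linarith
      qed
    qed
  qed
qed

lemma W_chebyshev:
  assumes "0 < \<kappa>" shows "prob {\<omega>\<in>space P. \<kappa> < \<bar>W n m \<omega> u\<bar>} \<le> moment_bound / \<kappa>\<^sup>2"
proof -
  have [measurable]: "(\<lambda>\<omega>. W n m \<omega> u) \<in> borel_measurable P" by (rule measurable_proc[OF orthant_meas])
  have "prob {\<omega>\<in>space P. \<kappa> < \<bar>W n m \<omega> u\<bar>} \<le> prob {\<omega>\<in>space P. \<kappa>\<^sup>2 \<le> (W n m \<omega> u)\<^sup>2}"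
    using assms by (intro finite_measure_mono) (auto simp: abs_le_square_iff[symmetric])
  also have "\<dots> \<le> expectation (\<lambda>\<omega>. (W n m \<omega> u)\<^sup>2) / \<kappa>\<^sup>2"
    using proc_second_moment(1)[OF orthant_meas abs_orthant_le] assms
    by (intro integral_Markov_inequality_measure[of _ _ "{}"]) auto
  also have "\<dots> \<le> moment_bound / \<kappa>\<^sup>2"
    using proc_second_moment(2)[OF orthant_meas abs_orthant_le] by (intro divide_right_mono) auto
  finally show ?thesis .
qed

text \<open>Chebyshev at the finitely many points of one grid, combined with the oscillation bound
  around them.\<close>

lemma asymptotic_boundedness:
  assumes \<epsilon>: "0 < \<epsilon>"
  shows "\<exists>\<kappa>>0. eventually (\<lambda>n. \<exists>E\<in>events. prob E \<le> \<epsilon> \<and>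
     (\<forall>\<omega>\<in>space P - E. \<forall>m\<le>M. \<forall>u\<in>unit_cube. \<bar>G n m \<omega> u\<bar> \<le> \<kappa>)) sequentially"
proof -
  obtain l where l: "eventually (\<lambda>n. \<exists>E\<in>events. prob E \<le> \<epsilon> / 2 \<and>
     (\<forall>\<omega>\<in>space P - E. \<forall>m\<le>M. \<forall>u\<in>unit_cube. \<forall>v\<in>unit_cube. (\<forall>k. \<bar>u $ k - v $ k\<bar> \<le> 1 / 2 ^ l)
        \<longrightarrow> \<bar>G n m \<omega> u - G n m \<omega> v\<bar> \<le> \<epsilon> / 2)) sequentially"
    using asymptotic_equicontinuity[of "\<epsilon> / 2" M] \<epsilon> by (metis half_gt_zero order_refl)
  let ?g = "dyadic_grid l :: (real^'p) set"
  define N where "N = real (Suc M) * real (card ?g) * moment_bound"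
  have mb: "0 < moment_bound" unfolding moment_bound_def using exp_gt_zero[of "2::real"] by linarith
  have N0: "0 \<le> N" using mb by (simp add: N_def)
  \<comment> \<open>Chosen so that the Chebyshev bounds, summed over grid points and components,
    amount to at most \<epsilon>/2. The final bound contains 2 \<kappa> because \<open>G\<close> is
    a sum of up to two processes \<open>W\<close>.\<close>
  define \<kappa> where "\<kappa> = sqrt (2 * (N + 1) / \<epsilon>)"
  have \<kappa>: "0 < \<kappa>" "N / \<kappa>\<^sup>2 \<le> \<epsilon> / 2"
  proof -
    show "0 < \<kappa>" using N0 \<epsilon> by (simp add: \<kappa>_def)
    have "\<kappa>\<^sup>2 = 2 * (N + 1) / \<epsilon>" using N0 \<epsilon> by (simp add: \<kappa>_def)
    then have "N \<le> \<epsilon> / 2 * \<kappa>\<^sup>2" using N0 \<epsilon> by (simp add: field_simps)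
    moreover have "0 < \<kappa>\<^sup>2" using \<open>0 < \<kappa>\<close> by simp
    ultimately show "N / \<kappa>\<^sup>2 \<le> \<epsilon> / 2" by (simp add: pos_divide_le_eq)
  qed
  show ?thesis
  proof (intro exI[of _ "2 * \<kappa> + \<epsilon> / 2"] conjI)
    show "0 < 2 * \<kappa> + \<epsilon> / 2" using \<kappa> \<epsilon> by simp
    show "eventually (\<lambda>n. \<exists>E\<in>events. prob E \<le> \<epsilon> \<and>
     (\<forall>\<omega>\<in>space P - E. \<forall>m\<le>M. \<forall>u\<in>unit_cube. \<bar>G n m \<omega> u\<bar> \<le> 2 * \<kappa> + \<epsilon> / 2)) sequentially"
      using l
    proof eventually_elim
      case (elim n)
      then obtain E where E: "E \<in> events" "prob E \<le> \<epsilon> / 2"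
        and mod: "\<And>\<omega> m u v. \<omega> \<in> space P - E \<Longrightarrow> m \<le> M \<Longrightarrow> u \<in> unit_cube \<Longrightarrow> v \<in> unit_cube
          \<Longrightarrow> (\<And>k. \<bar>u $ k - v $ k\<bar> \<le> 1 / 2 ^ l) \<Longrightarrow> \<bar>G n m \<omega> u - G n m \<omega> v\<bar> \<le> \<epsilon> / 2" by blast
      let ?B = "\<lambda>m u. {\<omega>\<in>space P. \<kappa> < \<bar>W n m \<omega> u\<bar>}"
      define E' where "E' = (\<Union>m\<le>M. \<Union>u\<in>?g. ?B m u)"
      have Bm: "?B m u \<in> events" for m u
        using measurable_proc[OF orthant_meas, of n m u] by measurable
      have E'm: "E' \<in> events" unfolding E'_def using Bm finite_dyadic_grid by (intro sets.finite_UN) auto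
      have "prob E' \<le> (\<Sum>m\<le>M. prob (\<Union>u\<in>?g. ?B m u))"
        unfolding E'_def using Bm finite_dyadic_grid
        by (intro finite_measure_subadditive_finite) (auto intro!: sets.finite_UN)
      also have "\<dots> \<le> (\<Sum>m\<le>M. \<Sum>u\<in>?g. prob (?B m u))"
        using Bm finite_dyadic_grid by (intro sum_mono finite_measure_subadditive_finite) auto
      also have "\<dots> \<le> (\<Sum>m\<le>M. \<Sum>u\<in>?g. moment_bound / \<kappa>\<^sup>2)"
        by (intro sum_mono W_chebyshev \<kappa>)
      also have "\<dots> = N / \<kappa>\<^sup>2" by (simp add: N_def)
      finally have PE': "prob E' \<le> \<epsilon> / 2" using \<kappa> by linarith
      show ?case
      proof (intro bexI[of _ "E \<union> E'"] conjI ballI allI impI)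
        have "prob (E \<union> E') \<le> prob E + prob E'" using E E'm by (intro measure_Un_le)
        then show "prob (E \<union> E') \<le> \<epsilon>" using PE' E by linarith
        show "E \<union> E' \<in> events" using E E'm by auto
        fix \<omega> m and u :: "real^'p" assume \<omega>: "\<omega> \<in> space P - (E \<union> E')" and m: "m \<le> M" and u: "u \<in> unit_cube"
        let ?v = "dyadic_floor l u"
        have v: "?v \<in> ?g" using u by (rule dyadic_floor_in_grid)
        have "\<bar>G n m \<omega> u - G n m \<omega> ?v\<bar> \<le> \<epsilon> / 2"
        proof (rule mod)
          show "?v \<in> unit_cube" using v dyadic_grid_subset_unit_cube by blast
          show "\<bar>u $ k - ?v $ k\<bar> \<le> 1 / 2 ^ l" for k
            using dyadic_floor_le[of l u k] dyadic_floor_ge[of u k l] by linarith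
        qed (use \<omega> m u in auto)
        moreover have "\<bar>W n m' \<omega> ?v\<bar> \<le> \<kappa>" if "m' \<le> M" for m'
          using \<omega> v that unfolding E'_def by (auto simp: not_less)
        from this[of 0] this[OF m] have "\<bar>G n m \<omega> ?v\<bar> \<le> 2 * \<kappa>" using \<kappa> by (auto simp: G_def abs_le_iff)
        ultimately show "\<bar>G n m \<omega> u\<bar> \<le> 2 * \<kappa> + \<epsilon> / 2" by linarith
      qed
    qed
  qed
qed

text \<open>The bootstrap process as a difference of two processes that are both centred at the true
  copula.\<close>

lemma copula_proc_eq:
  "copula_proc P X Z J A n \<omega> m u =
     sqrt (real n) * (emp_copula n (resample n m \<omega>) A u - C u)
     - (if m = 0 then 0 else sqrt (real n) * (emp_copula n (resample n 0 \<omega>) A u - C u))"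
proof -
  have "resample n 0 \<omega> = (\<lambda>i. (X i \<omega>, Z i \<omega>))" by (simp add: resample_def obs_def fun_eq_iff)
  moreover have "m \<noteq> 0 \<Longrightarrow> resample n m \<omega> = (\<lambda>i. (X (J (n, m, i) \<omega>) \<omega>, Z (J (n, m, i) \<omega>) \<omega>))"
    by (simp add: resample_def obs_def fun_eq_iff)
  ultimately show ?thesis by (auto simp: copula_proc_def Let_def right_diff_distrib)
qed

abbreviation dC where "dC \<equiv> (\<lambda>v k. blinfun_apply (C' v) (axis k 1))"

lemma C'_bounded: obtains c1 where "0 \<le> c1" "\<And>u. u \<in> unit_cube \<Longrightarrow> norm (C' u) \<le> c1"
proof -
  have "compact (C' ` unit_cube)"
    using C'_cont unfolding unit_cube_cbox by (intro compact_continuous_image) auto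
  then have "bounded (C' ` unit_cube)" by (rule compact_imp_bounded)
  then obtain c1 where "\<And>u. u \<in> unit_cube \<Longrightarrow> norm (C' u) \<le> c1" by (auto simp: bounded_iff)
  then show thesis using that[of "max 0 c1"] by force
qed

lemma C'_modulus:
  assumes "0 < \<rho>"
  obtains l0 where "\<And>l u w. l \<ge> l0 \<Longrightarrow> u \<in> unit_cube \<Longrightarrow> w \<in> unit_cube \<Longrightarrow> (\<And>k. \<bar>w $ k - u $ k\<bar> \<le> 1 / 2 ^ l)
    \<Longrightarrow> norm (C' w - C' u) \<le> \<rho>"
proof -
  have "uniformly_continuous_on unit_cube C'"
    using C'_cont unfolding unit_cube_cbox by (intro compact_uniformly_continuous) auto
  then obtain \<delta> where \<delta>: "0 < \<delta>" "\<And>u w. u \<in> unit_cube \<Longrightarrow> w \<in> unit_cube \<Longrightarrow> dist w u < \<delta> \<Longrightarrow> dist (C' w) (C' u) < \<rho>"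
    unfolding uniformly_continuous_on_def using assms by metis
  have "(\<lambda>l. real CARD('p) * (1 / 2) ^ l) \<longlonglongrightarrow> real CARD('p) * 0"
    by (intro tendsto_intros LIMSEQ_power_zero) simp
  from order_tendstoD(2)[OF this, of \<delta>] \<delta> obtain l0 where l0: "\<And>l. l \<ge> l0 \<Longrightarrow> real CARD('p) * (1 / 2) ^ l < \<delta>"
    by (auto simp: eventually_sequentially)
  show thesis
  proof (rule that[of l0])
    fix l and u w :: "real^'p" assume l: "l0 \<le> l" and u: "u \<in> unit_cube" "w \<in> unit_cube" and uw: "\<And>k. \<bar>w $ k - u $ k\<bar> \<le> 1 / 2 ^ l"
    have "dist w u \<le> (\<Sum>k\<in>UNIV. \<bar>w $ k - u $ k\<bar>)"
      using norm_le_l1_cart[of "w - u"] by (simp add: dist_norm)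
    also have "\<dots> \<le> (\<Sum>k\<in>(UNIV::'p set). 1 / 2 ^ l)" by (intro sum_mono uw)
    also have "\<dots> < \<delta>" using l0[OF l] by (simp add: power_divide)
    finally have "dist (C' w) (C' u) < \<rho>" using \<delta> u by blast
    then show "norm (C' w - C' u) \<le> \<rho>" by (simp add: dist_norm)
  qed
qed

text \<open>The constants are chosen in the order \<kappa>, then \<eta> and \<rho>, then the scale
  \<delta>, and n last: \<rho> has to be small compared with \<kappa>, and \<delta> depends on both
  moduli. Each linearisation may cost \<epsilon>/2, since a bootstrap component uses two of
  them.\<close>

lemma copula_proc_linearization:
  assumes \<epsilon>: "0 < \<epsilon>"
  shows "eventually (\<lambda>n. \<exists>E\<in>events. prob E \<le> \<epsilon> \<and>
     (\<forall>\<omega>\<in>space P - E. \<forall>m\<le>M. \<forall>u\<in>unit_cube. \<bar>copula_proc P X Z J A n \<omega> m u - Cinf p C dC (W n m \<omega>) u\<bar> \<le> \<epsilon>)) sequentially"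
proof -
  let ?d = "real CARD('p)"
  obtain c1 where c1: "0 \<le> c1" "\<And>u. u \<in> unit_cube \<Longrightarrow> norm (C' u) \<le> c1" using C'_bounded by blast
  obtain \<kappa> where \<kappa>: "0 < \<kappa>" and bdd: "eventually (\<lambda>n. \<exists>E\<in>events. prob E \<le> \<epsilon> / 2 \<and>
     (\<forall>\<omega>\<in>space P - E. \<forall>m\<le>M. \<forall>u\<in>unit_cube. \<bar>G n m \<omega> u\<bar> \<le> \<kappa>)) sequentially"
    using asymptotic_boundedness[of "\<epsilon> / 2" M] \<epsilon> by auto
  \<comment> \<open>\<open>a1\<close> and \<open>a2\<close> majorise the coefficients of \<eta> and
    \<rho> in \<open>delta_method_bound\<close>; with \<eta> <= 1 the second no longer involves
    \<eta>. Together with the term \<open>a3\<close> / sqrt n this makes three errors of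
    \<epsilon>/8.\<close>
  define a1 where "a1 = 2 / p * (?d + 2 + 3 * ?d * c1)"
  define a2 where "a2 = 2 / p * (?d * (2 * \<kappa> + 2))"
  have a: "0 < a1" "0 < a2"
  proof -
    have "0 \<le> 3 * ?d * c1" using c1(1) by simp
    then have "0 < ?d + 2 + 3 * ?d * c1" by linarith
    then show "0 < a1" using pA_pos by (simp add: a1_def)
    show "0 < a2" using pA_pos \<kappa> by (simp add: a2_def add_pos_pos)
  qed
  define \<eta> where "\<eta> = min (min 1 (\<epsilon> / 2)) (\<epsilon> / 8 / a1)"
  have \<eta>: "0 < \<eta>" "\<eta> \<le> 1" "\<eta> \<le> \<epsilon> / 2" "a1 * \<eta> \<le> \<epsilon> / 8"
  proof -
    show "0 < \<eta>" "\<eta> \<le> 1" "\<eta> \<le> \<epsilon> / 2" using \<epsilon> a by (auto simp: \<eta>_def)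
    have "\<eta> \<le> \<epsilon> / 8 / a1" by (simp add: \<eta>_def)
    then show "a1 * \<eta> \<le> \<epsilon> / 8" using a(1) by (simp add: le_divide_eq mult.commute)
  qed
  define \<rho> where "\<rho> = \<epsilon> / 8 / a2"
  have \<rho>: "0 < \<rho>" "a2 * \<rho> = \<epsilon> / 8" using \<epsilon> a by (auto simp: \<rho>_def)
  obtain l1 where l1: "\<And>l u w. l \<ge> l1 \<Longrightarrow> u \<in> unit_cube \<Longrightarrow> w \<in> unit_cube \<Longrightarrow> (\<And>k. \<bar>w $ k - u $ k\<bar> \<le> 1 / 2 ^ l)
    \<Longrightarrow> norm (C' w - C' u) \<le> \<rho>" using C'_modulus[OF \<rho>(1)] by blast
  obtain l0 where l0: "\<forall>l\<ge>l0. eventually (\<lambda>n. \<exists>E\<in>events. prob E \<le> \<eta> \<and>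
     (\<forall>\<omega>\<in>space P - E. \<forall>m\<le>M. \<forall>u\<in>unit_cube. \<forall>v\<in>unit_cube. (\<forall>k. \<bar>u $ k - v $ k\<bar> \<le> 1 / 2 ^ l)
        \<longrightarrow> \<bar>G n m \<omega> u - G n m \<omega> v\<bar> \<le> \<eta>)) sequentially"
    using asymptotic_equicontinuity[OF \<eta>(1), of M] by blast
  define l where "l = max l0 l1"
  define \<delta> where "\<delta> = 1 / (2::real) ^ l"
  have \<delta>: "0 < \<delta>" by (simp add: \<delta>_def)
  have osc: "eventually (\<lambda>n. \<exists>E\<in>events. prob E \<le> \<eta> \<and>
     (\<forall>\<omega>\<in>space P - E. \<forall>m\<le>M. \<forall>u\<in>unit_cube. \<forall>v\<in>unit_cube. (\<forall>k. \<bar>u $ k - v $ k\<bar> \<le> \<delta>)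
        \<longrightarrow> \<bar>G n m \<omega> u - G n m \<omega> v\<bar> \<le> \<eta>)) sequentially"
    using l0 unfolding \<delta>_def l_def by (meson max.cobounded1)
  have mod: "norm (C' w - C' u) \<le> \<rho>" if "u \<in> unit_cube" "w \<in> unit_cube" "\<And>k. \<bar>w $ k - u $ k\<bar> \<le> \<delta>" for u w
    using l1[of l u w] that unfolding \<delta>_def l_def by auto
  \<comment> \<open>The exceptional set is enclosed in a measurable null set, so that it can join
    the events \<open>E1\<close> and \<open>E2\<close>.\<close>
  obtain N where N: "N \<in> null_sets P" "{\<omega>\<in>space P. \<not> (\<forall>i k. Z i \<omega> \<in> A \<longrightarrow> 0 < F k (X i \<omega> $ k))} \<subseteq> N"
    using AE_F_pos by (auto elim!: AE_E simp: null_sets_def emeasure_eq_measure)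
  define a3 where "a3 = 2 * \<kappa> / p * (\<kappa> * (2 + 2 * ?d * c1) / p)"
  have "eventually (\<lambda>n. a3 / sqrt (real n) < \<epsilon> / 8) sequentially" using \<epsilon> by (intro ev_const_over_sqrt) simp
  moreover have "eventually (\<lambda>n. (2 * \<kappa> / p) / sqrt (real n) < 1) sequentially" by (intro ev_const_over_sqrt) simp
  moreover have "eventually (\<lambda>n. ((2 * \<kappa> + 2 * \<eta>) / p) / sqrt (real n) < \<delta>) sequentially" using \<delta> by (intro ev_const_over_sqrt)
  moreover have "eventually (\<lambda>n. 0 < n) sequentially" by (rule eventually_gt_at_top)
  ultimately show ?thesis using bdd osc
  proof eventually_elim
    case (elim n)
    have r: "0 < sqrt (real n)" using elim(4) by simp
    have large: "2 * \<kappa> \<le> sqrt (real n) * p" "2 * \<kappa> + 2 * \<eta> \<le> \<delta> * (sqrt (real n) * p)"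
      using elim(2,3) r pA_pos by (simp_all add: field_simps)
    obtain E1 where E1: "E1 \<in> events" "prob E1 \<le> \<epsilon> / 2"
      and b: "\<And>\<omega> m u. \<omega> \<in> space P - E1 \<Longrightarrow> m \<le> M \<Longrightarrow> u \<in> unit_cube \<Longrightarrow> \<bar>G n m \<omega> u\<bar> \<le> \<kappa>"
      using elim(5) by blast
    obtain E2 where E2: "E2 \<in> events" "prob E2 \<le> \<eta>"
      and o: "\<And>\<omega> m u v. \<omega> \<in> space P - E2 \<Longrightarrow> m \<le> M \<Longrightarrow> u \<in> unit_cube \<Longrightarrow> v \<in> unit_cube
        \<Longrightarrow> (\<And>k. \<bar>v $ k - u $ k\<bar> \<le> \<delta>) \<Longrightarrow> \<bar>G n m \<omega> v - G n m \<omega> u\<bar> \<le> \<eta>"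
      using elim(6) by blast
    have lin: "\<bar>sqrt (real n) * (emp_copula n (resample n m \<omega>) A u - C u) - Cinf p C dC (G n m \<omega>) u\<bar> \<le> \<epsilon> / 2"
      if \<omega>: "\<omega> \<in> space P - (E1 \<union> E2 \<union> N)" and m: "m \<le> M" and u: "u \<in> unit_cube" for \<omega> m u
    proof -
      have "\<bar>sqrt (real n) * (emp_copula n (resample n m \<omega>) A u - C u) - Cinf p C dC (G n m \<omega>) u\<bar>
        \<le> 2 / p * ((?d + 2 + 3 * ?d * c1) * \<eta> + ?d * (2 * \<kappa> + 2 * \<eta>) * \<rho>)
          + 2 * \<kappa> / (sqrt (real n) * p) * (\<kappa> * (2 + 2 * ?d * c1) / p)"
      proof (rule delta_method_bound[where F = F and \<delta> = \<delta>])
        show "0 < F k (fst (resample n m \<omega> i) $ k)" if "snd (resample n m \<omega> i) \<in> A" for i k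
        proof -
          have "\<forall>i k. Z i \<omega> \<in> A \<longrightarrow> 0 < F k (X i \<omega> $ k)" using N(2) \<omega> by blast
          then show ?thesis using that by (auto simp: resample_def obs_def split: if_splits)
        qed
        show "p * C v - p * C u \<le> (\<Sum>k\<in>UNIV. v $ k - u $ k)"
          if "u \<in> unit_cube" "v \<in> unit_cube" "\<And>k. u $ k \<le> v $ k" for u v
          using D_lip[OF that] by (simp add: D_eq)
        show "\<bar>G n m \<omega> u\<bar> \<le> \<kappa>" if "u \<in> unit_cube" for u using b[OF _ m that] \<omega> by blast
        show "\<bar>G n m \<omega> w - G n m \<omega> u\<bar> \<le> \<eta>" if "u \<in> unit_cube" "w \<in> unit_cube" "\<And>k. \<bar>w $ k - u $ k\<bar> \<le> \<delta>" for u w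
          using o[OF _ m that] \<omega> by blast
        show "G n m \<omega> u = sqrt (real n) * (emp_D F n (resample n m \<omega>) A u - p * C u)" for u by (rule G_eq)
        show "0 \<le> F k t \<and> F k t \<le> 1" for k t by (rule F_01)
        show "mono (F k)" for k by (rule F_mono)
        show "C (edge k t) = t" if "0 \<le> t" "t \<le> 1" for k t using that by (rule C_edge)
        show "0 \<le> C u \<and> C u \<le> 1" for u by (rule C_01)
      qed (rule pA_pos p_le_1 C_deriv c1 mod \<eta> \<delta> elim(4) large u | assumption)+
      also have "2 / p * ((?d + 2 + 3 * ?d * c1) * \<eta> + ?d * (2 * \<kappa> + 2 * \<eta>) * \<rho>) \<le> a1 * \<eta> + a2 * \<rho>"
      proof -
        have "2 / p * (?d * (2 * \<kappa> + 2 * \<eta>) * \<rho>) \<le> 2 / p * (?d * (2 * \<kappa> + 2) * \<rho>)"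
          using pA_pos \<eta> \<rho> by (intro mult_left_mono mult_right_mono) auto
        moreover have "2 / p * (?d * (2 * \<kappa> + 2) * \<rho>) = a2 * \<rho>" "2 / p * ((?d + 2 + 3 * ?d * c1) * \<eta>) = a1 * \<eta>"
          by (simp_all only: a1_def a2_def mult.assoc)
        ultimately show ?thesis unfolding distrib_left[of "2 / p" "(?d + 2 + 3 * ?d * c1) * \<eta>"] by linarith
      qed
      also have "2 * \<kappa> / (sqrt (real n) * p) * (\<kappa> * (2 + 2 * ?d * c1) / p) = a3 / sqrt (real n)"
        by (simp add: a3_def)
      finally show ?thesis using \<eta>(4) \<rho>(2) elim(1) by linarith
    qed
    show ?case
    proof (intro bexI[of _ "E1 \<union> E2 \<union> N"] conjI ballI allI impI)
      show "E1 \<union> E2 \<union> N \<in> events" using E1 E2 N by auto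
      have "prob (E1 \<union> E2 \<union> N) \<le> prob (E1 \<union> E2) + prob N" using E1 E2 N by (intro measure_Un_le) auto
      moreover have "prob (E1 \<union> E2) \<le> prob E1 + prob E2" using E1 E2 by (intro measure_Un_le)
      moreover have "prob N = 0" using N by (simp add: null_sets_def measure_def)
      ultimately show "prob (E1 \<union> E2 \<union> N) \<le> \<epsilon>" using E1 E2 \<eta>(3) by linarith
      fix \<omega> m and u :: "real^'p" assume \<omega>: "\<omega> \<in> space P - (E1 \<union> E2 \<union> N)" and m: "m \<le> M" and u: "u \<in> unit_cube"
      show "\<bar>copula_proc P X Z J A n \<omega> m u - Cinf p C dC (W n m \<omega>) u\<bar> \<le> \<epsilon>"
      proof (cases "m = 0")
        case True
        moreover have "G n 0 \<omega> = W n 0 \<omega>" by (simp add: G_def fun_eq_iff)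
        ultimately show ?thesis using lin[OF \<omega> m u] \<epsilon> by (simp add: copula_proc_eq)
      next
        case False
        have "Cinf p C dC (W n m \<omega>) u = Cinf p C dC (G n m \<omega>) u - Cinf p C dC (G n 0 \<omega>) u"
          unfolding Cinf_diff using False by (simp add: G_def)
        then show ?thesis using lin[OF \<omega> m u] lin[OF \<omega> le0 u] False
          unfolding copula_proc_eq by (simp only: if_False)
      qed
    qed
  qed
qed

end

section \<open>Gaussian processes with continuous paths\<close>

definition psd_kernel :: "(nat \<Rightarrow> nat \<Rightarrow> real) \<Rightarrow> bool" where
  "psd_kernel K \<longleftrightarrow> (\<forall>i j. K i j = K j i) \<and>
     (\<forall>n c. 0 \<le> (\<Sum>i<n. \<Sum>j<n. c i * c j * K i j))"

text \<open>If the pivot vanishes, so does its row (positive semidefiniteness), and division by zero yields \<open>0\<close>: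
  the step is then the identity.\<close>
fun schur_step :: "(nat \<Rightarrow> nat \<Rightarrow> real) \<Rightarrow> nat \<Rightarrow> nat \<Rightarrow> nat \<Rightarrow> real" where
  "schur_step K 0 = K"
| "schur_step K (Suc l) = (\<lambda>i j. schur_step K l i j - schur_step K l i l * schur_step K l j l / schur_step K l l l)"

lemma psd_kernel_finite:
  assumes "psd_kernel K" "finite S"
  shows "0 \<le> (\<Sum>i\<in>S. \<Sum>j\<in>S. c i * c j * K i j)"
proof -
  obtain n where n: "S \<subseteq> {..<n}" using finite_nat_iff_bounded assms(2) by blast
  define c' where "c' i = (if i \<in> S then c i else 0)" for i
  have "(\<Sum>i\<in>S. \<Sum>j\<in>S. c i * c j * K i j) = (\<Sum>i\<in>S. \<Sum>j\<in>S. c' i * c' j * K i j)"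
    by (simp add: c'_def)
  also have "\<dots> = (\<Sum>i\<in>S. \<Sum>j<n. c' i * c' j * K i j)"
    by (intro sum.cong refl sum.mono_neutral_left) (use n in \<open>auto simp: c'_def\<close>)
  also have "\<dots> = (\<Sum>i<n. \<Sum>j<n. c' i * c' j * K i j)"
    by (intro sum.mono_neutral_left) (use n in \<open>auto simp: c'_def\<close>)
  also have "0 \<le> \<dots>" using assms(1) by (simp add: psd_kernel_def)
  finally show ?thesis .
qed

lemma psd_kernel_diag: "psd_kernel K \<Longrightarrow> 0 \<le> K i i"
  using psd_kernel_finite[of K "{i}" "\<lambda>_. 1"] by simp

text \<open>With K l l = 0 the quadratic form at e_i + t e_l is affine in t and nonnegative for all
  t, so its slope vanishes.\<close>

lemma psd_kernel_zero_row:
  assumes "psd_kernel K" "K l l = 0" shows "K i l = 0"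
proof (cases "i = l")
  case False
  have sym: "K l i = K i l" using assms(1) by (simp add: psd_kernel_def)
  have q: "0 \<le> K i i + 2 * t * K i l" for t
  proof -
    have "0 \<le> (\<Sum>a\<in>{i,l}. \<Sum>b\<in>{i,l}. (if a = i then 1 else t) * (if b = i then 1 else t) * K a b)"
      using assms(1) by (rule psd_kernel_finite) auto
    then show ?thesis using False assms(2) sym by (simp add: algebra_simps)
  qed
  show ?thesis
  proof (rule ccontr)
    assume "K i l \<noteq> 0"
    \<comment> \<open>At this t the form takes the value -1.\<close>
    then show False using q[of "- (K i i + 1) / (2 * K i l)"] by (simp add: field_simps)
  qed
qed (use assms in simp)

text \<open>Completing the square: the form of the Schur complement at c is the form of the kernel
  before elimination at c - (b / pivot) e_l, with b the pairing of c with column l.\<close>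

lemma psd_schur_step: "psd_kernel K \<Longrightarrow> psd_kernel (schur_step K l)"
proof (induction l)
  case (Suc l)
  let ?A = "schur_step K l"
  have A: "psd_kernel ?A" using Suc by simp
  have sym: "?A i j = ?A j i" for i j using A unfolding psd_kernel_def by blast
  show ?case
    unfolding psd_kernel_def
  proof (intro conjI allI)
    show "schur_step K (Suc l) i j = schur_step K (Suc l) j i" for i j
      using sym[of i j] by simp
    fix n c
    show "0 \<le> (\<Sum>i<n. \<Sum>j<n. c i * c j * schur_step K (Suc l) i j)"
    proof (cases "?A l l = 0")
      case True
      then show ?thesis using A by (simp add: psd_kernel_def)
    next
      case False
      \<comment> \<open>The sums are extended to include the pivot index \<open>l\<close>, which may
        lie beyond \<open>n\<close>.\<close>
      define m where "m = max n (Suc l)"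
      define c' where "c' i = (if i < n then c i else 0)" for i
      define b where "b = (\<Sum>i<n. c i * ?A i l)"
      define t where "t i = (if i = l then b / ?A l l else 0)" for i
      have nm: "{..<n} \<subseteq> {..<m}" and l: "l < m" by (auto simp: m_def)
      have ext: "(\<Sum>i<n. c i * f i) = (\<Sum>i<m. c' i * f i)" for f
        using nm by (intro sum.mono_neutral_cong_left) (auto simp: c'_def)
      have tsum: "(\<Sum>i<m. t i * f i) = b / ?A l l * f l" for f
        using l by (simp add: t_def if_distrib[of "\<lambda>a. a * _"] cong: if_cong)
      have "0 \<le> (\<Sum>i<m. \<Sum>j<m. (c' i - t i) * (c' j - t j) * ?A i j)"
        using A by (simp add: psd_kernel_def)
      also have "\<dots> = (\<Sum>i<m. (c' i - t i) * (\<Sum>j<m. (c' j - t j) * ?A i j))"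
        by (simp add: sum_distrib_left mult.assoc)
      also have "\<dots> = (\<Sum>i<m. (c' i - t i) * ((\<Sum>j<n. c j * ?A i j) - b / ?A l l * ?A i l))"
        by (simp add: left_diff_distrib sum_subtractf tsum ext)
      also have "\<dots> = (\<Sum>i<n. c i * ((\<Sum>j<n. c j * ?A i j) - b / ?A l l * ?A i l))
          - b / ?A l l * ((\<Sum>j<n. c j * ?A l j) - b / ?A l l * ?A l l)"
        by (simp only: left_diff_distrib[of "c' _"] sum_subtractf tsum ext)
      also have "(\<Sum>j<n. c j * ?A l j) = b" unfolding b_def by (simp add: sym[of l])
      also have "(\<Sum>i<n. c i * ((\<Sum>j<n. c j * ?A i j) - b / ?A l l * ?A i l)) - b / ?A l l * (b - b / ?A l l * ?A l l)
         = (\<Sum>i<n. c i * (\<Sum>j<n. c j * ?A i j)) - b / ?A l l * (\<Sum>i<n. c i * ?A i l)"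
        using False by (simp add: right_diff_distrib sum_subtractf sum_distrib_left mult_ac)
      also have "\<dots> = (\<Sum>i<n. \<Sum>j<n. c i * c j * ?A i j) - b * b / ?A l l"
        by (simp add: b_def[symmetric] sum_distrib_left mult.assoc)
      also have "b * b / ?A l l = (\<Sum>i<n. \<Sum>j<n. c i * c j * (?A i l * ?A j l / ?A l l))"
        unfolding b_def sum_product sum_divide_distrib by (simp add: mult_ac)
      finally show ?thesis
        by (simp add: right_diff_distrib sum_subtractf)
    qed
  qed
qed simp

text \<open>A row disappears when its own pivot is processed, by subtraction or, for a zero pivot,
  because it was already zero; later steps keep it zero.\<close>

lemma schur_step_eliminated:
  assumes "psd_kernel K" shows "i < l \<Longrightarrow> schur_step K l i j = 0"
proof (induction l arbitrary: j)
  case (Suc l)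
  have A: "psd_kernel (schur_step K l)" using assms by (rule psd_schur_step)
  have sym: "schur_step K l a b = schur_step K l b a" for a b
    using A unfolding psd_kernel_def by blast
  show ?case
  proof (cases "i = l")
    case True
    show ?thesis
    proof (cases "schur_step K l l l = 0")
      case True
      then show ?thesis using psd_kernel_zero_row[OF A True, of j] \<open>i = l\<close> sym[of l j] by simp
    qed (use True sym[of l j] in simp)
  next
    case False
    then show ?thesis using Suc by simp
  qed
qed simp

text \<open>The columns of \<open>L\<close> are the rank-one terms peeled off by the elimination,
  and after n steps the remainder vanishes on indices below n. Hence a single \<open>L\<close> works
  for every n.\<close>

lemma psd_kernel_cholesky:
  assumes K: "psd_kernel K"
  obtains L :: "nat \<Rightarrow> nat \<Rightarrow> real"
  where "\<And>i j n. i < n \<Longrightarrow> j < n \<Longrightarrow> K i j = (\<Sum>l<n. L i l * L j l)"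
proof -
  let ?S = "schur_step K"
  define L where "L i l = ?S l i l / sqrt (?S l l l)" for i l
  have LL: "L i l * L j l = ?S l i l * ?S l j l / ?S l l l" for i j l
    using psd_kernel_diag[OF psd_schur_step[OF K, of l], of l] by (simp add: L_def)
  have "K i j = (\<Sum>l<n. L i l * L j l) + ?S n i j" for i j n
    by (induction n) (simp_all add: LL)
  then have "K i j = (\<Sum>l<n. L i l * L j l)" if "i < n" "j < n" for i j n
    using schur_step_eliminated[OF K that(1), of j] by (metis add.right_neutral)
  then show thesis using that by blast
qed

section \<open>Independent standard normal coordinates\<close>

lemma indep_vars_PiM_coords:
  assumes "\<And>i. prob_space (M i)"
  shows "prob_space.indep_vars (Pi\<^sub>M UNIV M) M (\<lambda>i x. x i) UNIV"
proof -
  interpret product_prob_space M UNIV by (rule product_prob_spaceI) (rule assms)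
  have "distr (Pi\<^sub>M UNIV M) (Pi\<^sub>M UNIV M) (\<lambda>x. \<lambda>i\<in>UNIV. x i) = Pi\<^sub>M UNIV M"
    by (simp only: restrict_UNIV distr_id)
  also have "\<dots> = Pi\<^sub>M UNIV (\<lambda>i. distr (Pi\<^sub>M UNIV M) (M i) (\<lambda>x. x i))"
    by (simp add: PiM_component)
  finally show ?thesis by (subst P.indep_vars_iff_distr_eq_PiM') auto
qed

abbreviation std_gauss :: "real measure" where "std_gauss \<equiv> density lborel (\<lambda>x. ennreal (std_normal_density x))"

definition gauss_seq :: "(nat \<Rightarrow> real) measure" where "gauss_seq = Pi\<^sub>M UNIV (\<lambda>_. std_gauss)"

lemma prob_space_std_gauss: "prob_space std_gauss"
  by (rule prob_space_normal_density) simp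

lemma prob_space_gauss_seq: "prob_space gauss_seq"
  unfolding gauss_seq_def by (rule prob_space_PiM) (rule prob_space_std_gauss)

lemma space_gauss_seq [simp]: "space gauss_seq = UNIV"
  by (simp add: gauss_seq_def space_PiM)

lemma gauss_coord_meas [measurable]: "(\<lambda>\<zeta>. \<zeta> l) \<in> borel_measurable gauss_seq"
proof -
  have "(\<lambda>\<zeta>. \<zeta> l) \<in> measurable gauss_seq std_gauss" unfolding gauss_seq_def by measurable
  then show ?thesis by (simp cong: measurable_cong_sets)
qed

lemma std_gauss_cf: "(\<integral>x. cis (t * x) \<partial>std_gauss) = exp (- t\<^sup>2 / 2)"
proof -
  have "char std_gauss t = complex_of_real (exp (- t\<^sup>2 / 2))"
    using char_std_normal_distribution by (simp add: fun_eq_iff)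
  then show ?thesis by (simp add: char_def cis_conv_exp)
qed

lemma std_gauss_mgf: "integrable std_gauss (\<lambda>x. exp (t * x))" "(\<integral>x. exp (t * x) \<partial>std_gauss) = exp (t\<^sup>2 / 2)"
proof -
  have eq: "std_normal_density x * exp (t * x) = exp (t\<^sup>2 / 2) * normal_density t 1 x" for x
    unfolding std_normal_density_def normal_density_def by (simp add: exp_add[symmetric] power2_eq_square field_simps)
  have "integrable lborel (\<lambda>x. std_normal_density x *\<^sub>R exp (t * x))"
    by (simp add: eq integrable_normal_density)
  then show "integrable std_gauss (\<lambda>x. exp (t * x))"
    by (subst integrable_density) auto
  have "(\<integral>x. exp (t * x) \<partial>std_gauss) = (\<integral>x. std_normal_density x *\<^sub>R exp (t * x) \<partial>lborel)"
    by (subst integral_density) auto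
  also have "\<dots> = exp (t\<^sup>2 / 2)" by (simp add: eq)
  finally show "(\<integral>x. exp (t * x) \<partial>std_gauss) = exp (t\<^sup>2 / 2)" .
qed

lemma gauss_seq_indep: "prob_space.indep_vars gauss_seq (\<lambda>_. borel) (\<lambda>l \<zeta>. \<zeta> l) UNIV"
proof -
  interpret prob_space gauss_seq by (rule prob_space_gauss_seq)
  have "indep_vars (\<lambda>_. std_gauss) (\<lambda>l \<zeta>. \<zeta> l) UNIV"
    using indep_vars_PiM_coords[of "\<lambda>_::nat. std_gauss"] prob_space_std_gauss by (simp add: gauss_seq_def)
  from indep_vars_compose2[OF this, of "\<lambda>_ x. x" "\<lambda>_. borel"] show ?thesis by simp
qed

lemma gauss_seq_component: "distr gauss_seq std_gauss (\<lambda>\<zeta>. \<zeta> l) = std_gauss"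
proof -
  interpret product_prob_space "\<lambda>_::nat. std_gauss" UNIV by (rule product_prob_spaceI) (rule prob_space_std_gauss)
  show ?thesis unfolding gauss_seq_def using PiM_component[of l] by simp
qed

lemma gauss_seq_prod:
  fixes f :: "real \<Rightarrow> real \<Rightarrow> 'c::{real_normed_field,banach,second_countable_topology}"
  assumes [measurable]: "\<And>t. f t \<in> borel_measurable borel" and i: "\<And>t. integrable std_gauss (f t)"
  shows "integrable gauss_seq (\<lambda>\<zeta>. \<Prod>l<n. f (b l) (\<zeta> l))"
    "(\<integral>\<zeta>. (\<Prod>l<n. f (b l) (\<zeta> l)) \<partial>gauss_seq) = (\<Prod>l<n. \<integral>x. f (b l) x \<partial>std_gauss)"
proof -
  interpret prob_space gauss_seq by (rule prob_space_gauss_seq)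
  have ind: "indep_vars (\<lambda>_. borel) (\<lambda>l \<zeta>. f (b l) (\<zeta> l)) {..<n}"
    using indep_vars_compose2[OF gauss_seq_indep, of "\<lambda>l. f (b l)" "\<lambda>_. borel"] by (auto intro: indep_vars_subset)
  have m: "(\<lambda>\<zeta>. \<zeta> l) \<in> measurable gauss_seq std_gauss" for l
    unfolding gauss_seq_def by measurable
  have int: "integrable gauss_seq (\<lambda>\<zeta>. f t (\<zeta> l))" for t l
    using i[of t] integrable_distr_eq[OF m, of "f t" l] by (simp add: gauss_seq_component)
  have eq: "(\<integral>\<zeta>. f t (\<zeta> l) \<partial>gauss_seq) = (\<integral>x. f t x \<partial>std_gauss)" for t l
    using integral_distr[OF m, of "f t" l] by (simp add: gauss_seq_component)
  show "integrable gauss_seq (\<lambda>\<zeta>. \<Prod>l<n. f (b l) (\<zeta> l))"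
    by (rule indep_vars_integrable[OF _ ind]) (auto intro: int)
  show "(\<integral>\<zeta>. (\<Prod>l<n. f (b l) (\<zeta> l)) \<partial>gauss_seq) = (\<Prod>l<n. \<integral>x. f (b l) x \<partial>std_gauss)"
    using indep_vars_lebesgue_integral[OF _ ind int] by (simp add: eq)
qed

lemma gauss_seq_cf: "(\<integral>\<zeta>. cis (\<Sum>l<n. b l * \<zeta> l) \<partial>gauss_seq) = exp (- (\<Sum>l<n. (b l)\<^sup>2) / 2)"
proof -
  interpret S: prob_space std_gauss by (rule prob_space_std_gauss)
  have m: "(\<lambda>x. cis (t * x)) \<in> borel_measurable borel" for t by (rule borel_measurable_cis) measurable
  have "(\<integral>\<zeta>. cis (\<Sum>l<n. b l * \<zeta> l) \<partial>gauss_seq) = (\<Prod>l<n. \<integral>x. cis (b l * x) \<partial>std_gauss)"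
    unfolding cis_sum by (rule gauss_seq_prod(2)[of "\<lambda>t x. cis (t * x)", OF m]) (rule S.integrable_const_bound[of _ 1], auto simp: m)
  also have "\<dots> = complex_of_real (\<Prod>l<n. exp (- (b l)\<^sup>2 / 2))" by (simp add: std_gauss_cf)
  also have "(\<Prod>l<n. exp (- (b l)\<^sup>2 / 2)) = exp (- (\<Sum>l<n. (b l)\<^sup>2) / 2)"
    by (subst exp_sum[symmetric]) (auto simp: sum_negf sum_divide_distrib)
  finally show ?thesis .
qed

lemma gauss_seq_mgf:
  "integrable gauss_seq (\<lambda>\<zeta>. exp (\<Sum>l<n. b l * \<zeta> l))"
  "(\<integral>\<zeta>. exp (\<Sum>l<n. b l * \<zeta> l) \<partial>gauss_seq) = exp ((\<Sum>l<n. (b l)\<^sup>2) / 2)"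
proof -
  have e: "exp (\<Sum>l<n. b l * \<zeta> l) = (\<Prod>l<n. exp (b l * \<zeta> l))" for \<zeta> by (rule exp_sum) simp
  show "integrable gauss_seq (\<lambda>\<zeta>. exp (\<Sum>l<n. b l * \<zeta> l))"
    unfolding e by (rule gauss_seq_prod(1)[of "\<lambda>t x. exp (t * x)"]) (auto intro: std_gauss_mgf)
  have "(\<integral>\<zeta>. exp (\<Sum>l<n. b l * \<zeta> l) \<partial>gauss_seq) = (\<Prod>l<n. \<integral>x. exp (b l * x) \<partial>std_gauss)"
    unfolding e by (rule gauss_seq_prod(2)[of "\<lambda>t x. exp (t * x)"]) (auto intro: std_gauss_mgf)
  also have "\<dots> = exp ((\<Sum>l<n. (b l)\<^sup>2) / 2)" by (simp add: std_gauss_mgf exp_sum[symmetric] sum_divide_distrib)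
  finally show "(\<integral>\<zeta>. exp (\<Sum>l<n. b l * \<zeta> l) \<partial>gauss_seq) = exp ((\<Sum>l<n. (b l)\<^sup>2) / 2)" .
qed

text \<open>The covariance enters through characteristic functions, which identify all
  finite-dimensional laws, and through exponential moments of increments, which feed the
  chaining.\<close>

lemma gaussian_sequence_exists:
  assumes K: "psd_kernel K"
  obtains Y :: "nat \<Rightarrow> (nat \<Rightarrow> real) \<Rightarrow> real"
  where "\<And>i. Y i \<in> borel_measurable gauss_seq"
    "\<And>S (c::'i \<Rightarrow> real) x. finite S \<Longrightarrow> (\<integral>\<zeta>. cis (\<Sum>i\<in>S. c i * Y (x i) \<zeta>) \<partial>gauss_seq)
        = exp (- (\<Sum>i\<in>S. \<Sum>j\<in>S. c i * c j * K (x i) (x j)) / 2)"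
    "\<And>i j \<theta>. integrable gauss_seq (\<lambda>\<zeta>. exp (\<theta> * (Y i \<zeta> - Y j \<zeta>)))"
    "\<And>i j \<theta>. (\<integral>\<zeta>. exp (\<theta> * (Y i \<zeta> - Y j \<zeta>)) \<partial>gauss_seq) = exp (\<theta>\<^sup>2 * (K i i - 2 * K i j + K j j) / 2)"
proof -
  obtain L where L: "\<And>i j n. i < n \<Longrightarrow> j < n \<Longrightarrow> K i j = (\<Sum>l<n. L i l * L j l)"
    using psd_kernel_cholesky[OF K] by blast
  \<comment> \<open>\<open>L\<close> is lower triangular: the expansions of K i i with l and with l
    + 1 terms differ by the square of L i l. Hence each Y i is a finite sum.\<close>
  have Lz: "L i l = 0" if "i < l" for i l
  proof -
    have "K i i = (\<Sum>l<l. L i l * L i l)" "K i i = (\<Sum>l<Suc l. L i l * L i l)"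
      using that by (intro L; simp)+
    then show ?thesis by simp
  qed
  define Y where "Y i \<zeta> = (\<Sum>l<Suc i. L i l * \<zeta> l)" for i and \<zeta> :: "nat \<Rightarrow> real"
  have Yn: "Y i \<zeta> = (\<Sum>l<n. L i l * \<zeta> l)" if "i < n" for i n \<zeta>
    unfolding Y_def using that by (intro sum.mono_neutral_left) (auto intro: Lz)
  have comb: "(\<Sum>i\<in>S. c i * Y (x i) \<zeta>) = (\<Sum>l<n. (\<Sum>i\<in>S. c i * L (x i) l) * \<zeta> l)"
    if "\<And>i. i \<in> S \<Longrightarrow> x i < n" for S and c :: "'i \<Rightarrow> real" and x n \<zeta>
  proof -
    have "(\<Sum>i\<in>S. c i * Y (x i) \<zeta>) = (\<Sum>i\<in>S. \<Sum>l<n. c i * (L (x i) l * \<zeta> l))"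
      using that by (intro sum.cong refl) (simp add: Yn[OF that] sum_distrib_left)
    also have "\<dots> = (\<Sum>l<n. \<Sum>i\<in>S. c i * (L (x i) l * \<zeta> l))" by (rule sum.swap)
    finally show ?thesis by (simp add: sum_distrib_right mult.assoc)
  qed
  have var: "(\<Sum>l<n. (\<Sum>i\<in>S. c i * L (x i) l)\<^sup>2) = (\<Sum>i\<in>S. \<Sum>j\<in>S. c i * c j * K (x i) (x j))"
    if "\<And>i. i \<in> S \<Longrightarrow> x i < n" for S and c :: "'i \<Rightarrow> real" and x n
  proof -
    have "(\<Sum>l<n. (\<Sum>i\<in>S. c i * L (x i) l)\<^sup>2) = (\<Sum>l<n. \<Sum>i\<in>S. \<Sum>j\<in>S. c i * c j * (L (x i) l * L (x j) l))"
      by (simp add: power2_eq_square sum_product mult_ac)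
    also have "\<dots> = (\<Sum>i\<in>S. \<Sum>j\<in>S. \<Sum>l<n. c i * c j * (L (x i) l * L (x j) l))"
      by (subst sum.swap) (intro sum.cong refl sum.swap)
    also have "\<dots> = (\<Sum>i\<in>S. \<Sum>j\<in>S. c i * c j * K (x i) (x j))"
      using that by (intro sum.cong refl) (simp add: L[OF that that] sum_distrib_left)
    finally show ?thesis .
  qed
  show thesis
  proof
    show "Y i \<in> borel_measurable gauss_seq" for i unfolding Y_def by measurable
    fix S :: "'i set" and c :: "'i \<Rightarrow> real" and x :: "'i \<Rightarrow> nat"
    assume S: "finite S"
    then obtain n where n: "x ` S \<subseteq> {..<n}" using finite_nat_iff_bounded[of "x ` S"] by auto
    then have xn: "x i < n" if "i \<in> S" for i using that by auto
    show "(\<integral>\<zeta>. cis (\<Sum>i\<in>S. c i * Y (x i) \<zeta>) \<partial>gauss_seq) = exp (- (\<Sum>i\<in>S. \<Sum>j\<in>S. c i * c j * K (x i) (x j)) / 2)"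
      by (simp only: comb[where S = S and x = x and n = n and c = c, OF xn]
          var[where S = S and x = x and n = n and c = c, OF xn, symmetric] gauss_seq_cf)
  next
    fix i j \<theta>
    define n where "n = Suc (max i j)"
    have ij: "i < n" "j < n" by (auto simp: n_def)
    have e: "\<theta> * (Y i \<zeta> - Y j \<zeta>) = (\<Sum>l<n. \<theta> * (L i l - L j l) * \<zeta> l)" for \<zeta>
      unfolding Yn[OF ij(1)] Yn[OF ij(2)] by (simp add: sum_subtractf[symmetric] sum_distrib_left algebra_simps)
    have v: "(\<Sum>l<n. (\<theta> * (L i l - L j l))\<^sup>2) = \<theta>\<^sup>2 * (K i i - 2 * K i j + K j j)"
      unfolding L[OF ij(1) ij(1)] L[OF ij] L[OF ij(2) ij(2)]
      by (simp add: sum_distrib_left sum_subtractf[symmetric] sum.distrib[symmetric] power2_eq_square algebra_simps)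
    show "integrable gauss_seq (\<lambda>\<zeta>. exp (\<theta> * (Y i \<zeta> - Y j \<zeta>)))"
      unfolding e by (rule gauss_seq_mgf)
    show "(\<integral>\<zeta>. exp (\<theta> * (Y i \<zeta> - Y j \<zeta>)) \<partial>gauss_seq) = exp (\<theta>\<^sup>2 * (K i i - 2 * K i j + K j j) / 2)"
      unfolding e gauss_seq_mgf v ..
  qed
qed

section \<open>Continuous extension from the dyadic points\<close>

definition cube_dyadics :: "(real^'p) set" where "cube_dyadics = (\<Union>j. dyadic_grid j)"

lemma countable_dyadics: "countable cube_dyadics"
  unfolding cube_dyadics_def by (intro countable_UN countableI_type countable_finite finite_dyadic_grid)

lemma dyadic_floor_dyadics: "u \<in> unit_cube \<Longrightarrow> dyadic_floor l u \<in> cube_dyadics"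
  unfolding cube_dyadics_def using dyadic_floor_in_grid by blast

lemma dyadic_floor_tendsto: "(\<lambda>l. dyadic_floor l u) \<longlonglongrightarrow> u"
proof (rule vec_tendstoI)
  fix k
  have "(\<lambda>l. u $ k - (1 / 2) ^ l) \<longlonglongrightarrow> u $ k - 0"
    by (intro tendsto_intros LIMSEQ_power_zero) simp
  then have low: "(\<lambda>l. u $ k - (1 / 2) ^ l) \<longlonglongrightarrow> u $ k" by simp
  show "(\<lambda>l. dyadic_floor l u $ k) \<longlonglongrightarrow> u $ k"
  proof (rule tendsto_sandwich[OF _ _ low tendsto_const])
    show "eventually (\<lambda>l. u $ k - (1 / 2) ^ l \<le> dyadic_floor l u $ k) sequentially"
      by (intro always_eventually allI) (simp only: power_one_over dyadic_floor_ge)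
    show "eventually (\<lambda>l. dyadic_floor l u $ k \<le> u $ k) sequentially"
      by (intro always_eventually allI dyadic_floor_le)
  qed
qed

lemma unit_cube_subset_closure_dyadics: "unit_cube \<subseteq> closure (cube_dyadics :: (real^'p) set)"
proof
  fix u :: "real^'p" assume "u \<in> unit_cube"
  then show "u \<in> closure cube_dyadics"
    unfolding closure_sequential
    by (intro exI[of _ "\<lambda>l. dyadic_floor l u"]) (auto intro: dyadic_floor_dyadics dyadic_floor_tendsto)
qed

text \<open>A dyadic point equals its floor at every sufficiently fine level, so chaining reaches it
  exactly and leaves no residual as it does for empirical processes. Bounds from some level
  \<open>l0\<close> on suffice, as Borel--Cantelli delivers them.\<close>

lemma uniformly_continuous_on_dyadics:
  fixes f :: "real^'p \<Rightarrow> real"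
  assumes adj: "\<And>j u k. l0 \<le> j \<Longrightarrow> u \<in> dyadic_grid j \<Longrightarrow> bump j k u \<in> unit_cube
        \<Longrightarrow> \<bar>f (bump j k u) - f u\<bar> \<le> chain_step CARD('p) j"
  shows "uniformly_continuous_on cube_dyadics f"
  unfolding uniformly_continuous_on_def
proof (intro allI impI)
  let ?d = "CARD('p)"
  fix e :: real assume e: "0 < e"
  have "(\<lambda>l. 3 * (real ?d * chain_tail ?d l)) \<longlonglongrightarrow> 3 * (real ?d * 0)"
    by (intro tendsto_intros chain_tail_tendsto)
  from order_tendstoD(2)[OF this, of e] e obtain l1 where l1: "\<And>l. l \<ge> l1 \<Longrightarrow> 3 * (real ?d * chain_tail ?d l) < e"
    by (auto simp: eventually_sequentially)
  define l where "l = max l0 l1"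
  show "\<exists>d>0. \<forall>x\<in>cube_dyadics. \<forall>x'\<in>cube_dyadics. dist x' x < d \<longrightarrow> dist (f x') (f x) < e"
  proof (intro exI[of _ "1 / 2 ^ l"] conjI ballI impI)
    fix u v :: "real^'p" assume u: "u \<in> cube_dyadics" and v: "v \<in> cube_dyadics" and uv: "dist v u < 1 / 2 ^ l"
    obtain a b where ab: "u \<in> dyadic_grid a" "v \<in> dyadic_grid b" using u v by (auto simp: cube_dyadics_def)
    define L where "L = max l (max a b)"
    have "a \<le> L" "b \<le> L" by (auto simp: L_def)
    then have uL: "u \<in> dyadic_grid L" "v \<in> dyadic_grid L"
      using ab dyadic_grid_mono by blast+
    have fl: "\<bar>f w - f (dyadic_floor l w)\<bar> \<le> real ?d * chain_tail ?d l" if w: "w \<in> dyadic_grid L" for w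
    proof -
      have "\<bar>f (dyadic_floor L w) - f (dyadic_floor l w)\<bar> \<le> real ?d * (\<Sum>j=l..L. chain_step ?d j)"
        using w dyadic_grid_subset_unit_cube
        by (intro chain_levels adj chain_step_nonneg) (auto simp: l_def L_def)
      also have "\<dots> \<le> real ?d * chain_tail ?d l"
        by (intro mult_left_mono sum_chain_step_le_tail) (auto simp: L_def)
      finally show ?thesis using dyadic_floor_id[OF w] by simp
    qed
    have "\<bar>f v - f u\<bar> \<le> 2 * (real ?d * chain_tail ?d l) + real ?d * chain_step ?d l"
    proof (rule modulus_from_floor[where l = l])
      show "\<bar>v $ k - u $ k\<bar> \<le> 1 / 2 ^ l" for k
        using component_le_norm_cart[of "v - u" k] uv by (simp add: dist_norm)
      show "\<bar>f (bump l k w) - f w\<bar> \<le> chain_step ?d l" if "w \<in> dyadic_grid l" "bump l k w \<in> unit_cube" for w k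
        using that by (intro adj) (auto simp: l_def)
    qed (use uL fl dyadic_grid_subset_unit_cube chain_step_nonneg in auto)
    also have "\<dots> \<le> 3 * (real ?d * chain_tail ?d l)"
      using mult_left_mono[OF chain_step_le_tail[of l l ?d], of "real ?d"] by simp
    also have "\<dots> < e" using l1[of l] by (simp add: l_def)
    finally show "dist (f v) (f u) < e" by (simp add: dist_real_def)
  qed simp
qed

text \<open>The law is carried by functions continuous on the cube and arbitrary outside it, with
  the sigma-algebra generated by restriction to the cube. Working on path space lets independent
  copies be taken as a product measure. The hypothesis \<open>inc\<close> is the variance bound that
  the edge estimate requires, \<open>cont\<close> the passage from dyadic points to the
  cube.\<close>

lemma gaussian_continuous_measure:
  fixes K :: "real^'p \<Rightarrow> real^'p \<Rightarrow> real"
  assumes sym: "\<And>u v. K u v = K v u"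
    and psd: "\<And>(n::nat) c x. 0 \<le> (\<Sum>i<n. \<Sum>j<n. c i * c j * K (x i) (x j))"
    and inc: "\<And>j u k. u \<in> dyadic_grid j \<Longrightarrow> bump j k u \<in> unit_cube
        \<Longrightarrow> K (bump j k u) (bump j k u) - 2 * K (bump j k u) u + K u u \<le> 1 / 2 ^ j"
    and cont: "\<And>u v. u \<in> unit_cube \<Longrightarrow> v \<in> unit_cube \<Longrightarrow> (\<lambda>l. K (dyadic_floor l u) (dyadic_floor l v)) \<longlonglongrightarrow> K u v"
  obtains N :: "(real^'p \<Rightarrow> real) measure" where "prob_space N" "space N = {f. continuous_on unit_cube f}"
    "(\<lambda>f. restrict f unit_cube) \<in> measurable N (Pi\<^sub>M unit_cube (\<lambda>_. borel))"
    "\<And>(S::nat set) c z. finite S \<Longrightarrow> z ` S \<subseteq> unit_cube \<Longrightarrow>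
       (\<integral>f. cis (\<Sum>i\<in>S. c i * f (z i)) \<partial>N) = exp (- (\<Sum>i\<in>S. \<Sum>j\<in>S. c i * c j * K (z i) (z j)) / 2)"
proof -
  let ?d = "CARD('p)"
  interpret Q: prob_space gauss_seq by (rule prob_space_gauss_seq)
  define x where "x = from_nat_into (cube_dyadics :: (real^'p) set)"
  define ix where "ix = to_nat_on (cube_dyadics :: (real^'p) set)"
  have xix: "x (ix u) = u" if "u \<in> cube_dyadics" for u
    unfolding x_def ix_def by (rule from_nat_into_to_nat_on[OF countable_dyadics that])
  define Kn where "Kn i j = K (x i) (x j)" for i j
  have "psd_kernel Kn" unfolding psd_kernel_def Kn_def by (intro conjI allI sym psd)
  from gaussian_sequence_exists[OF this, where 'i = nat]
  obtain Y :: "nat \<Rightarrow> (nat \<Rightarrow> real) \<Rightarrow> real" where Ym [measurable]: "\<And>i. Y i \<in> borel_measurable gauss_seq"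
    and Ycf: "\<And>S (c::nat \<Rightarrow> real) x. finite S \<Longrightarrow> (\<integral>\<zeta>. cis (\<Sum>i\<in>S. c i * Y (x i) \<zeta>) \<partial>gauss_seq)
        = exp (- (\<Sum>i\<in>S. \<Sum>j\<in>S. c i * c j * Kn (x i) (x j)) / 2)"
    and Yint: "\<And>i j \<theta>. integrable gauss_seq (\<lambda>\<zeta>. exp (\<theta> * (Y i \<zeta> - Y j \<zeta>)))"
    and Ymgf: "\<And>i j \<theta>. (\<integral>\<zeta>. exp (\<theta> * (Y i \<zeta> - Y j \<zeta>)) \<partial>gauss_seq) = exp (\<theta>\<^sup>2 * (Kn i i - 2 * Kn i j + Kn j j) / 2)"
    by blast
  define f where "f \<zeta> u = Y (ix u) \<zeta>" for \<zeta> and u :: "real^'p"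
  have fm [measurable]: "(\<lambda>\<zeta>. f \<zeta> u) \<in> borel_measurable gauss_seq" for u unfolding f_def by (rule Ym)
  have bump_dy: "bump j k u \<in> cube_dyadics" if "u \<in> dyadic_grid j" "bump j k u \<in> unit_cube" for j k and u :: "real^'p"
  proof -
    have "bump j k u \<in> dyadic_grid j"
      unfolding dyadic_grid_iff using that by (auto simp: dyadic_grid_iff bump_def distrib_left)
    then show ?thesis by (auto simp: cube_dyadics_def)
  qed
  have mg: "integrable gauss_seq (\<lambda>\<zeta>. exp (\<theta> * (f \<zeta> (bump j k u) - f \<zeta> u)))
        \<and> Q.expectation (\<lambda>\<zeta>. exp (\<theta> * (f \<zeta> (bump j k u) - f \<zeta> u))) \<le> exp 2"
    if u: "u \<in> dyadic_grid j" "bump j k u \<in> unit_cube" and \<theta>: "\<bar>\<theta>\<bar> = sqrt 2 ^ j" for j u k \<theta>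
  proof
    show "integrable gauss_seq (\<lambda>\<zeta>. exp (\<theta> * (f \<zeta> (bump j k u) - f \<zeta> u)))" unfolding f_def by (rule Yint)
    have ud: "u \<in> cube_dyadics" using u by (auto simp: cube_dyadics_def)
    have "\<theta>\<^sup>2 = (sqrt 2 ^ j)\<^sup>2" using \<theta> by (metis power2_abs)
    also have "\<dots> = 2 ^ j" by (simp add: power_mult[symmetric] mult.commute[of j] power_mult)
    finally have "\<theta>\<^sup>2 * (K (bump j k u) (bump j k u) - 2 * K (bump j k u) u + K u u) \<le> 2 ^ j * (1 / 2 ^ j)"
      using inc[OF u] by (simp only: mult_left_mono zero_le_power zero_le_numeral)
    then show "Q.expectation (\<lambda>\<zeta>. exp (\<theta> * (f \<zeta> (bump j k u) - f \<zeta> u))) \<le> exp 2"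
      unfolding f_def Ymgf Kn_def xix[OF ud] xix[OF bump_dy[OF u]] by simp
  qed
  have lev: "level_bad gauss_seq f j \<in> Q.events" "Q.prob (level_bad gauss_seq f j) \<le> chain_prob ?d j" for j
    using Q.level_bad_prob[of j f, OF fm mg] by auto
  have "AE \<zeta> in gauss_seq. eventually (\<lambda>j. \<zeta> \<in> space gauss_seq - level_bad gauss_seq f j) sequentially"
  proof (rule borel_cantelli_AE1)
    show "summable (\<lambda>j. Q.prob (level_bad gauss_seq f j))"
      by (rule summable_comparison_test'[OF summable_chain_prob[of ?d]]) (simp add: lev)
  qed (use lev in \<open>auto simp: Q.emeasure_eq_measure\<close>)
  then have "AE \<zeta> in gauss_seq. uniformly_continuous_on cube_dyadics (f \<zeta>)"
  proof eventually_elim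
    case (elim \<zeta>)
    then obtain l0 where l0: "\<And>j. j \<ge> l0 \<Longrightarrow> \<zeta> \<in> space gauss_seq - level_bad gauss_seq f j"
      by (auto simp: eventually_sequentially)
    show ?case
      by (rule uniformly_continuous_on_dyadics[of l0]) (use l0 in \<open>force simp: level_bad_def not_less\<close>)
  qed
  then obtain N0 where N0: "{\<zeta>\<in>space gauss_seq. \<not> uniformly_continuous_on cube_dyadics (f \<zeta>)} \<subseteq> N0" "N0 \<in> Q.events"
    "emeasure gauss_seq N0 = 0" by (rule AE_E)
  \<comment> \<open>The limit along dyadic floors makes evaluation measurable at every point; the
    value 0 on the null set \<open>N0\<close> makes every path continuous, not only almost every
    one.\<close>
  define B where "B \<zeta> u = (if \<zeta> \<in> N0 then 0 else lim (\<lambda>l. f \<zeta> (dyadic_floor l u)))" for \<zeta> u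
  have Blim: "(\<lambda>l. f \<zeta> (dyadic_floor l u)) \<longlonglongrightarrow> B \<zeta> u" and Bcont: "continuous_on unit_cube (B \<zeta>)"
    if \<zeta>: "\<zeta> \<notin> N0" and u: "u \<in> unit_cube" for \<zeta> u
  proof -
    have "uniformly_continuous_on cube_dyadics (f \<zeta>)" using N0(1) \<zeta> by auto
    then obtain g where g: "uniformly_continuous_on (closure cube_dyadics) g" "\<And>v. v \<in> cube_dyadics \<Longrightarrow> f \<zeta> v = g v"
      using uniformly_continuous_on_extension_on_closure by metis
    have gc: "continuous_on (closure cube_dyadics) g" using g(1) by (rule uniformly_continuous_imp_continuous)
    have lim: "(\<lambda>l. f \<zeta> (dyadic_floor l v)) \<longlonglongrightarrow> g v" if v: "v \<in> unit_cube" for v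
    proof -
      have "(\<lambda>l. g (dyadic_floor l v)) \<longlonglongrightarrow> g v"
      proof (rule continuous_on_tendsto_compose[OF gc dyadic_floor_tendsto])
        show "v \<in> closure cube_dyadics" using v unit_cube_subset_closure_dyadics by blast
        show "eventually (\<lambda>l. dyadic_floor l v \<in> closure cube_dyadics) sequentially"
          using dyadic_floor_dyadics[OF v] closure_subset by (intro always_eventually allI) blast
      qed
      then show ?thesis using g(2) dyadic_floor_dyadics[OF v] by simp
    qed
    have Bg: "B \<zeta> v = g v" if "v \<in> unit_cube" for v
      unfolding B_def using \<zeta> limI[OF lim[OF that]] by simp
    show "(\<lambda>l. f \<zeta> (dyadic_floor l u)) \<longlonglongrightarrow> B \<zeta> u" using lim[OF u] Bg[OF u] by simp
    have "continuous_on unit_cube g" using gc unit_cube_subset_closure_dyadics by (rule continuous_on_subset)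
    then show "continuous_on unit_cube (B \<zeta>)" using Bg by (simp cong: continuous_on_cong)
  qed
  have one: "(1::real^'p) \<in> unit_cube" by (simp add: unit_cube_def)
  have Bc: "continuous_on unit_cube (B \<zeta>)" for \<zeta>
    using Bcont[OF _ one] by (cases "\<zeta> \<in> N0") (auto simp: B_def[abs_def])
  have Bm [measurable]: "(\<lambda>\<zeta>. B \<zeta> u) \<in> borel_measurable gauss_seq" for u
    unfolding B_def using N0(2) by (intro measurable_If_set) auto
  \<comment> \<open>The coarsest sigma-algebra making restriction measurable: all evaluations at
    points of the cube are measurable, and measurability of \<open>B\<close> reduces to that of its
    evaluations.\<close>
  define M1 where "M1 = vimage_algebra {h. continuous_on unit_cube h} (\<lambda>h. restrict h unit_cube)
     (Pi\<^sub>M (unit_cube :: (real^'p) set) (\<lambda>_. borel :: real measure))"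
  have rm: "(\<lambda>h. restrict h unit_cube) \<in> measurable M1 (Pi\<^sub>M unit_cube (\<lambda>_. borel))"
    unfolding M1_def by (rule measurable_vimage_algebra1) (auto simp: space_PiM)
  have BM: "B \<in> measurable gauss_seq M1"
    unfolding M1_def
  proof (rule measurable_vimage_algebra2)
    show "(\<lambda>\<zeta>. restrict (B \<zeta>) unit_cube) \<in> measurable gauss_seq (Pi\<^sub>M unit_cube (\<lambda>_. borel))"
      by (rule measurable_restrict) (rule Bm)
  qed (use Bc in auto)
  have em: "(\<lambda>h. h u) \<in> borel_measurable M1" if u: "u \<in> unit_cube" for u
  proof -
    have "(\<lambda>h. restrict h unit_cube u) \<in> borel_measurable M1"
      by (rule measurable_compose[OF rm measurable_component_singleton[OF u]])
    then show ?thesis using u by simp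
  qed
  show thesis
  proof (rule that[of "distr gauss_seq M1 B"])
    show "prob_space (distr gauss_seq M1 B)" by (rule Q.prob_space_distr[OF BM])
    show "space (distr gauss_seq M1 B) = {h. continuous_on unit_cube h}" by (simp add: M1_def)
    show "(\<lambda>h. restrict h unit_cube) \<in> measurable (distr gauss_seq M1 B) (Pi\<^sub>M unit_cube (\<lambda>_. borel))"
      using rm by simp
    fix S :: "nat set" and c and z :: "nat \<Rightarrow> real^'p" assume S: "finite S" "z ` S \<subseteq> unit_cube"
    have "(\<integral>h. cis (\<Sum>i\<in>S. c i * h (z i)) \<partial>distr gauss_seq M1 B) = (\<integral>\<zeta>. cis (\<Sum>i\<in>S. c i * B \<zeta> (z i)) \<partial>gauss_seq)"
      using S(2) em by (intro integral_distr[OF BM] borel_measurable_cis borel_measurable_sum borel_measurable_times) auto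
    also have "\<dots> = exp (- (\<Sum>i\<in>S. \<Sum>j\<in>S. c i * c j * K (z i) (z j)) / 2)"
    \<comment> \<open>The formula is known at dyadic points; both sides converge along the floors,
      the integrals by domination and the exponentials by \<open>cont\<close>.\<close>
    proof (rule LIMSEQ_unique)
      show "(\<lambda>l. \<integral>\<zeta>. cis (\<Sum>i\<in>S. c i * f \<zeta> (dyadic_floor l (z i))) \<partial>gauss_seq) \<longlonglongrightarrow> (\<integral>\<zeta>. cis (\<Sum>i\<in>S. c i * B \<zeta> (z i)) \<partial>gauss_seq)"
      proof (rule integral_dominated_convergence[where w = "\<lambda>_. 1"])
        have "AE \<zeta> in gauss_seq. \<zeta> \<notin> N0" using N0 by (intro AE_not_in) (auto simp: null_sets_def)
        then show "AE \<zeta> in gauss_seq. (\<lambda>l. cis (\<Sum>i\<in>S. c i * f \<zeta> (dyadic_floor l (z i)))) \<longlonglongrightarrow> cis (\<Sum>i\<in>S. c i * B \<zeta> (z i))"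
        proof eventually_elim
          case (elim \<zeta>)
          then show ?case unfolding cis_conv_exp using S(2)
            by (intro tendsto_intros Blim) auto
        qed
      qed (auto intro!: borel_measurable_cis)
      have "(\<integral>\<zeta>. cis (\<Sum>i\<in>S. c i * f \<zeta> (dyadic_floor l (z i))) \<partial>gauss_seq)
          = exp (- (\<Sum>i\<in>S. \<Sum>j\<in>S. c i * c j * K (dyadic_floor l (z i)) (dyadic_floor l (z j))) / 2)" for l
        unfolding f_def Ycf[OF S(1), of c "\<lambda>i. ix (dyadic_floor l (z i))"] Kn_def
        using S(2) by (simp add: xix dyadic_floor_dyadics image_subset_iff cong: sum.cong)
      moreover have "(\<lambda>l. complex_of_real (exp (- (\<Sum>i\<in>S. \<Sum>j\<in>S. c i * c j * K (dyadic_floor l (z i)) (dyadic_floor l (z j))) / 2)))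
          \<longlonglongrightarrow> complex_of_real (exp (- (\<Sum>i\<in>S. \<Sum>j\<in>S. c i * c j * K (z i) (z j)) / 2))"
        using S(2) by (intro tendsto_intros cont) auto
      ultimately show "(\<lambda>l. \<integral>\<zeta>. cis (\<Sum>i\<in>S. c i * f \<zeta> (dyadic_floor l (z i))) \<partial>gauss_seq)
          \<longlonglongrightarrow> complex_of_real (exp (- (\<Sum>i\<in>S. \<Sum>j\<in>S. c i * c j * K (z i) (z j)) / 2))" by simp
    qed
    finally show "(\<integral>h. cis (\<Sum>i\<in>S. c i * h (z i)) \<partial>distr gauss_seq M1 B) = exp (- (\<Sum>i\<in>S. \<Sum>j\<in>S. c i * c j * K (z i) (z j)) / 2)" .
  qed
qed

section \<open>Weak convergence in the space of bounded functions\<close>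

lemma scaled_std_gauss_cf:
  "(\<integral>x. cis (t * x) \<partial>distr std_gauss borel (\<lambda>x. \<sigma> * x)) = exp (- (t * \<sigma>)\<^sup>2 / 2)"
proof -
  have "(\<integral>x. cis (t * x) \<partial>distr std_gauss borel (\<lambda>x. \<sigma> * x)) = (\<integral>x. cis ((t * \<sigma>) * x) \<partial>std_gauss)"
    by (subst integral_distr) (auto intro!: borel_measurable_cis simp: mult.assoc)
  then show ?thesis by (simp only: std_gauss_cf)
qed

lemma (in prob_space) gaussian_from_cf:
  assumes Ym [measurable]: "Y \<in> borel_measurable M"
    and cf: "\<And>t. (\<integral>\<omega>. cis (t * Y \<omega>) \<partial>M) = exp (- (t\<^sup>2 * v) / 2)"
  shows "gaussian_rv M Y" "integrable M Y" "expectation Y = 0"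
    "integrable M (\<lambda>\<omega>. (Y \<omega>)\<^sup>2)" "expectation (\<lambda>\<omega>. (Y \<omega>)\<^sup>2) = v"
proof -
  have v: "0 \<le> v"
  proof -
    have "cmod (\<integral>\<omega>. cis (1 * Y \<omega>) \<partial>M) \<le> (\<integral>\<omega>. cmod (cis (1 * Y \<omega>)) \<partial>M)" by (rule integral_norm_bound)
    then have "cmod (exp (- (1\<^sup>2 * v) / 2)) \<le> 1" unfolding cf by (simp add: prob_space)
    then show ?thesis by simp
  qed
  define \<sigma> where "\<sigma> = sqrt v"
  have \<sigma>2: "\<sigma>\<^sup>2 = v" "0 \<le> \<sigma>" using v by (auto simp: \<sigma>_def)
  interpret S: prob_space std_gauss by (rule prob_space_std_gauss)
  have d: "distr M borel Y = distr std_gauss borel (\<lambda>x. \<sigma> * x)"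
  proof (rule Levy_uniqueness)
    show "real_distribution (distr M borel Y)" "real_distribution (distr std_gauss borel (\<lambda>x. \<sigma> * x))"
      by (auto simp: real_distribution_def real_distribution_axioms_def intro!: prob_space_distr S.prob_space_distr)
    show "char (distr M borel Y) = char (distr std_gauss borel (\<lambda>x. \<sigma> * x))"
    proof
      fix t
      have "char (distr M borel Y) t = (\<integral>\<omega>. cis (t * Y \<omega>) \<partial>M)"
        unfolding char_def cis_conv_exp by (subst integral_distr) auto
      moreover have "char (distr std_gauss borel (\<lambda>x. \<sigma> * x)) t = exp (- (t * \<sigma>)\<^sup>2 / 2)"
        using scaled_std_gauss_cf[where t = t and \<sigma> = \<sigma>] unfolding char_def cis_conv_exp by simp
      ultimately show "char (distr M borel Y) t = char (distr std_gauss borel (\<lambda>x. \<sigma> * x)) t"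
        unfolding cf by (simp add: power_mult_distrib \<sigma>2)
    qed
  qed
  have i1: "integrable std_gauss (\<lambda>x. \<sigma> * x)" "(\<integral>x. \<sigma> * x \<partial>std_gauss) = 0"
    using integrable_std_normal_distribution_moment[of 1] integral_std_normal_distribution_moment_odd[of 1] by auto
  have i2: "integrable std_gauss (\<lambda>x. (\<sigma> * x)\<^sup>2)" "(\<integral>x. (\<sigma> * x)\<^sup>2 \<partial>std_gauss) = v"
    using std_normal_distribution_even_moments[of 1] by (auto simp: power_mult_distrib \<sigma>2)
  have tr: "integrable M (\<lambda>\<omega>. g (Y \<omega>)) \<longleftrightarrow> integrable std_gauss (\<lambda>x. g (\<sigma> * x))"
    "expectation (\<lambda>\<omega>. g (Y \<omega>)) = (\<integral>x. g (\<sigma> * x) \<partial>std_gauss)"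
    if [measurable]: "g \<in> borel_measurable borel" for g :: "real \<Rightarrow> real"
  proof -
    have "integrable (distr M borel Y) g \<longleftrightarrow> integrable M (\<lambda>\<omega>. g (Y \<omega>))" by (rule integrable_distr_eq) auto
    moreover have "integrable (distr std_gauss borel (\<lambda>x. \<sigma> * x)) g \<longleftrightarrow> integrable std_gauss (\<lambda>x. g (\<sigma> * x))"
      by (rule integrable_distr_eq) auto
    ultimately show "integrable M (\<lambda>\<omega>. g (Y \<omega>)) \<longleftrightarrow> integrable std_gauss (\<lambda>x. g (\<sigma> * x))" by (simp add: d)
    have "(\<integral>x. g x \<partial>distr M borel Y) = expectation (\<lambda>\<omega>. g (Y \<omega>))" by (rule integral_distr) auto
    moreover have "(\<integral>x. g x \<partial>distr std_gauss borel (\<lambda>x. \<sigma> * x)) = (\<integral>x. g (\<sigma> * x) \<partial>std_gauss)"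
      by (rule integral_distr) auto
    ultimately show "expectation (\<lambda>\<omega>. g (Y \<omega>)) = (\<integral>x. g (\<sigma> * x) \<partial>std_gauss)" by (simp add: d)
  qed
  show "integrable M Y" "expectation Y = 0" using tr[of "\<lambda>x. x"] i1 by auto
  show "integrable M (\<lambda>\<omega>. (Y \<omega>)\<^sup>2)" "expectation (\<lambda>\<omega>. (Y \<omega>)\<^sup>2) = v"
    using tr[of "\<lambda>x. x\<^sup>2"] i2 by auto
  show "gaussian_rv M Y"
  proof (cases "\<sigma> = 0")
    case True
    have "AE \<omega> in M. (Y \<omega>)\<^sup>2 = 0"
      using integral_nonneg_eq_0_iff_AE[OF \<open>integrable M (\<lambda>\<omega>. (Y \<omega>)\<^sup>2)\<close>] \<open>expectation (\<lambda>\<omega>. (Y \<omega>)\<^sup>2) = v\<close> True \<sigma>2 by simp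
    then have "AE \<omega> in M. Y \<omega> = 0" by simp
    then show ?thesis unfolding gaussian_rv_def using Ym by blast
  next
    case False
    then have \<sigma>: "0 < \<sigma>" using \<sigma>2 by simp
    have "distributed std_gauss lborel (\<lambda>x. x) std_normal_density"
      unfolding distributed_def by (simp add: distr_id2)
    then have "distributed std_gauss lborel (\<lambda>x. 0 + \<sigma> * x) (normal_density (0 + \<sigma> * 0) (\<bar>\<sigma>\<bar> * 1))"
      using \<sigma> by (intro S.normal_density_affine) auto
    then have "distr std_gauss lborel (\<lambda>x. \<sigma> * x) = density lborel (normal_density 0 \<sigma>)"
      using \<sigma> by (simp add: distributed_def)
    moreover have "distr std_gauss lborel (\<lambda>x. \<sigma> * x) = distr std_gauss borel (\<lambda>x. \<sigma> * x)"
      "distr M lborel Y = distr M borel Y" by (auto intro!: distr_cong)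
    ultimately have "distributed M lborel Y (\<lambda>x. ennreal (normal_density 0 \<sigma> x))"
      unfolding distributed_def using d by simp
    then show ?thesis unfolding gaussian_rv_def using Ym \<sigma> by blast
  qed
qed

text \<open>Every finite combination is handled as a one-dimensional variable; mixed moments follow
  by polarisation from the squares of B u + B v, B u and B v.\<close>

lemma (in prob_space) gaussian_process_from_cf:
  assumes Bm: "\<And>u. u \<in> S \<Longrightarrow> (\<lambda>\<omega>. B \<omega> u) \<in> borel_measurable M"
    and sym: "\<And>u v. K u v = K v u"
    and cf: "\<And>F c. finite F \<Longrightarrow> F \<subseteq> S \<Longrightarrow>
       (\<integral>\<omega>. cis (\<Sum>u\<in>F. c u * B \<omega> u) \<partial>M) = exp (- (\<Sum>u\<in>F. \<Sum>v\<in>F. c u * c v * K u v) / 2)"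
  shows "centered_gaussian_process M B S K"
proof -
  have comb: "gaussian_rv M (\<lambda>\<omega>. \<Sum>u\<in>F. c u * B \<omega> u)" "integrable M (\<lambda>\<omega>. \<Sum>u\<in>F. c u * B \<omega> u)"
    "expectation (\<lambda>\<omega>. \<Sum>u\<in>F. c u * B \<omega> u) = 0"
    "integrable M (\<lambda>\<omega>. (\<Sum>u\<in>F. c u * B \<omega> u)\<^sup>2)"
    "expectation (\<lambda>\<omega>. (\<Sum>u\<in>F. c u * B \<omega> u)\<^sup>2) = (\<Sum>u\<in>F. \<Sum>v\<in>F. c u * c v * K u v)"
    if F: "finite F" "F \<subseteq> S" for F c
  proof -
    have Ym: "(\<lambda>\<omega>. \<Sum>u\<in>F. c u * B \<omega> u) \<in> borel_measurable M"
      using F Bm by (intro borel_measurable_sum borel_measurable_times) auto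
    have cf': "(\<integral>\<omega>. cis (t * (\<Sum>u\<in>F. c u * B \<omega> u)) \<partial>M) = exp (- (t\<^sup>2 * (\<Sum>u\<in>F. \<Sum>v\<in>F. c u * c v * K u v)) / 2)" for t
      using cf[OF F, of "\<lambda>u. t * c u"]
      by (simp add: sum_distrib_left mult.assoc power2_eq_square mult.left_commute)
    show "gaussian_rv M (\<lambda>\<omega>. \<Sum>u\<in>F. c u * B \<omega> u)" "integrable M (\<lambda>\<omega>. \<Sum>u\<in>F. c u * B \<omega> u)"
      "expectation (\<lambda>\<omega>. \<Sum>u\<in>F. c u * B \<omega> u) = 0"
      "integrable M (\<lambda>\<omega>. (\<Sum>u\<in>F. c u * B \<omega> u)\<^sup>2)"
      "expectation (\<lambda>\<omega>. (\<Sum>u\<in>F. c u * B \<omega> u)\<^sup>2) = (\<Sum>u\<in>F. \<Sum>v\<in>F. c u * c v * K u v)"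
      using gaussian_from_cf[OF Ym cf'] by auto
  qed
  have sq: "integrable M (\<lambda>\<omega>. (B \<omega> u)\<^sup>2)" "expectation (\<lambda>\<omega>. (B \<omega> u)\<^sup>2) = K u u" if "u \<in> S" for u
    using comb(4,5)[of "{u}" "\<lambda>_. 1"] that by auto
  have prd: "integrable M (\<lambda>\<omega>. B \<omega> u * B \<omega> v) \<and> expectation (\<lambda>\<omega>. B \<omega> u * B \<omega> v) = K u v"
    if uv: "u \<in> S" "v \<in> S" for u v
  proof (cases "u = v")
    case True
    then show ?thesis using sq[OF uv(1)] by (simp add: power2_eq_square)
  next
    case False
    have eq: "B \<omega> u * B \<omega> v = ((\<Sum>w\<in>{u, v}. 1 * B \<omega> w)\<^sup>2 - (B \<omega> u)\<^sup>2 - (B \<omega> v)\<^sup>2) / 2" for \<omega>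
      using False by (simp add: power2_eq_square algebra_simps)
    have i: "integrable M (\<lambda>\<omega>. (\<Sum>w\<in>{u, v}. 1 * B \<omega> w)\<^sup>2)"
      and e: "expectation (\<lambda>\<omega>. (\<Sum>w\<in>{u, v}. 1 * B \<omega> w)\<^sup>2) = (\<Sum>a\<in>{u, v}. \<Sum>b\<in>{u, v}. 1 * 1 * K a b)"
      using comb(4,5)[of "{u, v}" "\<lambda>_. 1"] uv by auto
    have e': "expectation (\<lambda>\<omega>. (\<Sum>w\<in>{u, v}. 1 * B \<omega> w)\<^sup>2) = K u u + 2 * K u v + K v v"
      unfolding e using False sym[of v u] by simp
    show ?thesis
      unfolding eq using i sq[OF uv(1)] sq[OF uv(2)] e' by (simp del: sum.insert mult_1)
  qed
  show ?thesis
    unfolding centered_gaussian_process_def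
  proof (intro conjI allI ballI impI)
    show "gaussian_rv M (\<lambda>\<omega>. \<Sum>u\<in>F. c u * B \<omega> u)" if "finite F \<and> F \<subseteq> S" for F c using comb(1) that by blast
    show "integrable M (\<lambda>\<omega>. B \<omega> u)" "expectation (\<lambda>\<omega>. B \<omega> u) = 0" if "u \<in> S" for u
      using comb(2,3)[of "{u}" "\<lambda>_. 1"] that by auto
  qed (use prd in auto)
qed

section \<open>Outer expectations of bounded functions\<close>

lemma outer_exp_le:
  assumes P: "prob_space P" and f: "\<And>\<omega>. \<omega> \<in> space P \<Longrightarrow> - b \<le> f \<omega>"
    and U: "integrable P U" "\<And>\<omega>. \<omega> \<in> space P \<Longrightarrow> f \<omega> \<le> U \<omega>"
  shows "outer_exp P f \<le> integral\<^sup>L P U"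
  unfolding outer_exp_def
proof (rule cInf_lower)
  interpret prob_space P by fact
  show "bdd_below {integral\<^sup>L P U |U. integrable P U \<and> (\<forall>\<omega>\<in>space P. f \<omega> \<le> U \<omega>)}"
  proof (rule bdd_belowI[of _ "- b"])
    fix y assume "y \<in> {integral\<^sup>L P U |U. integrable P U \<and> (\<forall>\<omega>\<in>space P. f \<omega> \<le> U \<omega>)}"
    then obtain U where U: "y = integral\<^sup>L P U" "integrable P U" "\<And>\<omega>. \<omega> \<in> space P \<Longrightarrow> f \<omega> \<le> U \<omega>" by auto
    have "(\<integral>\<omega>. - b \<partial>P) \<le> integral\<^sup>L P U"
      using U f by (intro integral_mono) (auto intro: order_trans)
    then show "- b \<le> y" using U by (simp add: prob_space)
  qed
qed (use U in auto)

lemma outer_exp_ge: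
  assumes P: "prob_space P" and f: "\<And>\<omega>. \<omega> \<in> space P \<Longrightarrow> f \<omega> \<le> b"
    and V: "integrable P V" "\<And>\<omega>. \<omega> \<in> space P \<Longrightarrow> V \<omega> \<le> f \<omega>"
  shows "integral\<^sup>L P V \<le> outer_exp P f"
  unfolding outer_exp_def
proof (rule cInf_greatest)
  interpret prob_space P by fact
  have "integrable P (\<lambda>_. b) \<and> (\<forall>\<omega>\<in>space P. f \<omega> \<le> b)" using f by simp
  then show "{integral\<^sup>L P U |U. integrable P U \<and> (\<forall>\<omega>\<in>space P. f \<omega> \<le> U \<omega>)} \<noteq> {}" by auto
  fix y assume "y \<in> {integral\<^sup>L P U |U. integrable P U \<and> (\<forall>\<omega>\<in>space P. f \<omega> \<le> U \<omega>)}"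
  then obtain U where U: "y = integral\<^sup>L P U" "integrable P U" "\<And>\<omega>. \<omega> \<in> space P \<Longrightarrow> f \<omega> \<le> U \<omega>" by auto
  have "integral\<^sup>L P V \<le> integral\<^sup>L P U"
    using U V by (intro integral_mono) (auto intro: order_trans)
  then show "integral\<^sup>L P V \<le> y" using U by simp
qed

lemma outer_exp_mono:
  assumes P: "prob_space P" and f: "\<And>\<omega>. \<omega> \<in> space P \<Longrightarrow> - b \<le> f \<omega>" and fg: "\<And>\<omega>. \<omega> \<in> space P \<Longrightarrow> f \<omega> \<le> g \<omega>"
    and g: "\<And>\<omega>. \<omega> \<in> space P \<Longrightarrow> g \<omega> \<le> b"
  shows "outer_exp P f \<le> outer_exp P g"
proof -
  interpret prob_space P by fact
  have "integrable P (\<lambda>_. b) \<and> (\<forall>\<omega>\<in>space P. g \<omega> \<le> b)" using g by simp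
  then have ne: "{integral\<^sup>L P U |U. integrable P U \<and> (\<forall>\<omega>\<in>space P. g \<omega> \<le> U \<omega>)} \<noteq> {}" by auto
  show ?thesis
    unfolding outer_exp_def[of P g]
  proof (rule cInf_greatest[OF ne])
    fix y assume "y \<in> {integral\<^sup>L P U |U. integrable P U \<and> (\<forall>\<omega>\<in>space P. g \<omega> \<le> U \<omega>)}"
    then obtain U where U: "y = integral\<^sup>L P U" "integrable P U" "\<And>\<omega>. \<omega> \<in> space P \<Longrightarrow> g \<omega> \<le> U \<omega>" by auto
    have "outer_exp P f \<le> integral\<^sup>L P U"
      by (rule outer_exp_le[OF P f U(2)]) (use U fg in \<open>auto intro: order_trans\<close>)
    then show "outer_exp P f \<le> y" using U by simp
  qed
qed

text \<open>No measurability of \<open>f\<close> is asked for: it lies between g - e - 2b 1_E and g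
  + e + 2b 1_E, which are integrable.\<close>

lemma outer_exp_approx:
  assumes P: "prob_space P" and E: "E \<in> sets P" and e: "0 \<le> e"
    and f: "\<And>\<omega>. \<omega> \<in> space P \<Longrightarrow> \<bar>f \<omega>\<bar> \<le> b" and g: "\<And>\<omega>. \<omega> \<in> space P \<Longrightarrow> \<bar>g \<omega>\<bar> \<le> b" "integrable P g"
    and fg: "\<And>\<omega>. \<omega> \<in> space P - E \<Longrightarrow> \<bar>f \<omega> - g \<omega>\<bar> \<le> e"
  shows "\<bar>outer_exp P f - integral\<^sup>L P g\<bar> \<le> e + 2 * b * measure P E"
proof -
  interpret prob_space P by fact
  have iE: "integrable P (indicator E :: _ \<Rightarrow> real)" using E by (simp add: emeasure_eq_measure)
  have IE: "(\<integral>\<omega>. indicator E \<omega> \<partial>P) = measure P E" using E by (simp add: sets.Int_space_eq2)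
  have ub: "f \<omega> \<le> g \<omega> + e + 2 * b * indicator E \<omega>" and lb: "g \<omega> - e - 2 * b * indicator E \<omega> \<le> f \<omega>"
    if "\<omega> \<in> space P" for \<omega>
    using f[OF that] g(1)[OF that] fg[of \<omega>] that e by (auto simp: indicator_def abs_le_iff)
  have "outer_exp P f \<le> (\<integral>\<omega>. g \<omega> + e + 2 * b * indicator E \<omega> \<partial>P)"
    by (rule outer_exp_le[OF P, of b]) (use f ub g iE in \<open>auto simp: abs_le_iff minus_le_iff\<close>)
  moreover have "(\<integral>\<omega>. g \<omega> - e - 2 * b * indicator E \<omega> \<partial>P) \<le> outer_exp P f"
    by (rule outer_exp_ge[OF P, of _ b]) (use f lb g iE in \<open>auto simp: abs_le_iff\<close>)
  ultimately show ?thesis using g iE sets.Int_space_eq2[OF E] by (simp add: prob_space)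
qed

section \<open>The sup distance on bounded functions\<close>

lemma linfE:
  assumes "f \<in> linf T" obtains a where "\<And>m u. (m, u) \<in> T \<Longrightarrow> \<bar>f m u\<bar> \<le> a"
proof -
  obtain a where a: "\<And>x. x \<in> T \<Longrightarrow> (case x of (m, u) \<Rightarrow> \<bar>f m u\<bar>) \<le> a"
    using assms unfolding linf_def bdd_above_def by blast
  show thesis using that[of a] a by fastforce
qed

lemma linf_diff_bdd:
  assumes "f \<in> linf T" "g \<in> linf T"
  shows "bdd_above ((\<lambda>x. \<bar>f (fst x) (snd x) - g (fst x) (snd x)\<bar>) ` T)"
proof -
  obtain a b where a: "\<And>m u. (m, u) \<in> T \<Longrightarrow> \<bar>f m u\<bar> \<le> a" and b: "\<And>m u. (m, u) \<in> T \<Longrightarrow> \<bar>g m u\<bar> \<le> b"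
    using linfE[OF assms(1)] linfE[OF assms(2)] by metis
  show ?thesis
  proof (rule bdd_aboveI2[of _ _ "a + b"])
    fix x assume "x \<in> T"
    then show "\<bar>f (fst x) (snd x) - g (fst x) (snd x)\<bar> \<le> a + b"
      using a[of "fst x" "snd x"] b[of "fst x" "snd x"] by (simp add: abs_le_iff)
  qed
qed

lemma sup_dist_upper:
  assumes "f \<in> linf T" "g \<in> linf T" "(m, u) \<in> T" shows "\<bar>f m u - g m u\<bar> \<le> sup_dist T f g"
  unfolding sup_dist_def using cSUP_upper[OF assms(3) linf_diff_bdd[OF assms(1,2)]] by simp

lemma sup_dist_least:
  assumes "T \<noteq> {}" "\<And>m u. (m, u) \<in> T \<Longrightarrow> \<bar>f m u - g m u\<bar> \<le> c" shows "sup_dist T f g \<le> c"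
  unfolding sup_dist_def using assms by (intro cSUP_least) auto

lemma sup_dist_nonneg:
  assumes "T \<noteq> {}" "f \<in> linf T" "g \<in> linf T" shows "0 \<le> sup_dist T f g"
proof -
  obtain m u where "(m, u) \<in> T" using assms(1) by auto
  from sup_dist_upper[OF assms(2,3) this] show ?thesis by linarith
qed

lemma sup_dist_commute: "sup_dist T f g = sup_dist T g f"
  by (simp add: sup_dist_def abs_minus_commute)

lemma sup_dist_triangle:
  assumes "T \<noteq> {}" "f \<in> linf T" "g \<in> linf T" "h \<in> linf T"
  shows "sup_dist T f h \<le> sup_dist T f g + sup_dist T g h"
proof (rule sup_dist_least[OF assms(1)])
  fix m u assume "(m, u) \<in> T"
  from sup_dist_upper[OF assms(2,3) this] sup_dist_upper[OF assms(3,4) this]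
  show "\<bar>f m u - h m u\<bar> \<le> sup_dist T f g + sup_dist T g h" by linarith
qed

definition lip_linf :: "(nat \<times> (real^'p)) set \<Rightarrow> real \<Rightarrow> ((nat \<Rightarrow> real^'p \<Rightarrow> real) \<Rightarrow> real) \<Rightarrow> bool" where
  "lip_linf T k h \<longleftrightarrow> (\<forall>f\<in>linf T. \<forall>g\<in>linf T. \<bar>h f - h g\<bar> \<le> k * sup_dist T f g)"

lemma lip_linf_bcont:
  assumes "lip_linf T k h" "\<And>f. f \<in> linf T \<Longrightarrow> \<bar>h f\<bar> \<le> b" "0 \<le> k"
  shows "bcont_linf T h"
  unfolding bcont_linf_def
proof (intro conjI ballI allI impI)
  show "\<exists>B. \<forall>f\<in>linf T. \<bar>h f\<bar> \<le> B" using assms by blast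
  fix f and e :: real assume f: "f \<in> linf T" and e: "0 < e"
  show "\<exists>d>0. \<forall>g\<in>linf T. sup_dist T f g < d \<longrightarrow> \<bar>h f - h g\<bar> < e"
  proof (intro exI[of _ "e / (k + 1)"] conjI ballI impI)
    show "0 < e / (k + 1)" using e assms(3) by simp
    fix g assume g: "g \<in> linf T" and d: "sup_dist T f g < e / (k + 1)"
    have "\<bar>h f - h g\<bar> \<le> k * sup_dist T f g" using assms(1) f g by (simp add: lip_linf_def)
    also have "\<dots> \<le> k * (e / (k + 1))" using d assms(3) by (intro mult_left_mono) auto
    also have "\<dots> < e" using e assms(3) by (simp add: field_simps)
    finally show "\<bar>h f - h g\<bar> < e" .
  qed
qed

text \<open>The Pasch--Hausdorff envelope, an infimal convolution of \<open>h\<close> with k times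
  the distance: for bounded \<open>h\<close> it is the largest k-Lipschitz minorant.\<close>

definition lower_env :: "(nat \<times> (real^'p)) set \<Rightarrow> real \<Rightarrow> ((nat \<Rightarrow> real^'p \<Rightarrow> real) \<Rightarrow> real) \<Rightarrow> (nat \<Rightarrow> real^'p \<Rightarrow> real) \<Rightarrow> real" where
  "lower_env T k h f = (INF g\<in>linf T. h g + k * sup_dist T f g)"

context
  fixes T :: "(nat \<times> (real^'p)) set" and h :: "(nat \<Rightarrow> real^'p \<Rightarrow> real) \<Rightarrow> real" and b :: real
  assumes T: "T \<noteq> {}" and hb: "\<And>f. f \<in> linf T \<Longrightarrow> \<bar>h f\<bar> \<le> b"
begin

lemma lower_env_bdd:
  assumes "0 \<le> k" "f \<in> linf T" shows "bdd_below ((\<lambda>g. h g + k * sup_dist T f g) ` linf T)"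
proof (rule bdd_belowI2[of _ "- b"])
  fix g assume g: "g \<in> linf T"
  have "0 \<le> k * sup_dist T f g" using assms sup_dist_nonneg[OF T assms(2) g] by simp
  then show "- b \<le> h g + k * sup_dist T f g" using hb[OF g] by linarith
qed

lemma lower_env_le: "0 \<le> k \<Longrightarrow> f \<in> linf T \<Longrightarrow> lower_env T k h f \<le> h f"
proof -
  assume k: "0 \<le> k" and f: "f \<in> linf T"
  have "sup_dist T f f = 0"
    using sup_dist_least[OF T, of f f 0] sup_dist_nonneg[OF T f f] by simp
  then show ?thesis
    unfolding lower_env_def using cINF_lower[OF lower_env_bdd[OF k f] f] by simp
qed

lemma lower_env_ge: "0 \<le> k \<Longrightarrow> f \<in> linf T \<Longrightarrow> - b \<le> lower_env T k h f"
  unfolding lower_env_def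
proof (rule cINF_greatest)
  assume k: "0 \<le> k" and f: "f \<in> linf T"
  then show "linf T \<noteq> {}" by blast
  fix g assume g: "g \<in> linf T"
  have "0 \<le> k * sup_dist T f g" using k sup_dist_nonneg[OF T f g] by simp
  then show "- b \<le> h g + k * sup_dist T f g" using hb[OF g] by linarith
qed

lemma lower_env_bound: "0 \<le> k \<Longrightarrow> f \<in> linf T \<Longrightarrow> \<bar>lower_env T k h f\<bar> \<le> b"
  using lower_env_le[of k f] lower_env_ge[of k f] hb[of f] by linarith

lemma lower_env_lip: assumes k: "0 \<le> k" shows "lip_linf T k (lower_env T k h)"
  unfolding lip_linf_def
proof (intro ballI)
  have *: "lower_env T k h f \<le> lower_env T k h g + k * sup_dist T f g" if f: "f \<in> linf T" and g: "g \<in> linf T" for f g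
  proof -
    have "lower_env T k h f - k * sup_dist T f g \<le> lower_env T k h g"
      unfolding lower_env_def[of T k h g]
    proof (rule cINF_greatest)
      show "linf T \<noteq> {}" using f by blast
      fix w assume w: "w \<in> linf T"
      have "lower_env T k h f \<le> h w + k * sup_dist T f w"
        unfolding lower_env_def by (rule cINF_lower[OF lower_env_bdd[OF k f] w])
      moreover have "k * sup_dist T f w \<le> k * (sup_dist T f g + sup_dist T g w)"
        using sup_dist_triangle[OF T f g w] k by (rule mult_left_mono)
      ultimately show "lower_env T k h f - k * sup_dist T f g \<le> h w + k * sup_dist T g w"
        by (simp add: distrib_left)
    qed
    then show ?thesis by simp
  qed
  fix f g assume fg: "f \<in> linf T" "g \<in> linf T"
  show "\<bar>lower_env T k h f - lower_env T k h g\<bar> \<le> k * sup_dist T f g"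
    using *[OF fg] *[OF fg(2,1)] sup_dist_commute[of T f g] by (simp add: abs_le_iff)
qed

text \<open>Points within d of \<open>f\<close> change \<open>h\<close> by less than e/2; for all
  others the penalty k d is at least 2b, which exceeds any possible gain.\<close>

lemma lower_env_tendsto:
  assumes cont: "\<And>f e. f \<in> linf T \<Longrightarrow> 0 < e \<Longrightarrow> \<exists>d>0. \<forall>g\<in>linf T. sup_dist T f g < d \<longrightarrow> \<bar>h f - h g\<bar> < e"
    and f: "f \<in> linf T"
  shows "(\<lambda>k. lower_env T (real k) h f) \<longlonglongrightarrow> h f"
proof (rule LIMSEQ_I)
  fix e :: real assume e: "0 < e"
  obtain d where d: "0 < d" "\<And>g. g \<in> linf T \<Longrightarrow> sup_dist T f g < d \<Longrightarrow> \<bar>h f - h g\<bar> < e / 2"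
    using cont[OF f, of "e / 2"] e by auto
  obtain k0 :: nat where k0: "2 * b / d \<le> real k0" using real_arch_simple by blast
  show "\<exists>no. \<forall>k\<ge>no. norm (lower_env T (real k) h f - h f) < e"
  proof (intro exI[of _ k0] allI impI)
    fix k assume "k0 \<le> k"
    then have "2 * b / d \<le> real k" using k0 by linarith
    then have kd: "2 * b \<le> real k * d" using d by (simp add: divide_le_eq)
    have "h f - e / 2 \<le> lower_env T (real k) h f"
      unfolding lower_env_def
    proof (rule cINF_greatest)
      show "linf T \<noteq> {}" using f by blast
      fix g assume g: "g \<in> linf T"
      show "h f - e / 2 \<le> h g + real k * sup_dist T f g"
      proof (cases "sup_dist T f g < d")
        case True
        have "0 \<le> real k * sup_dist T f g" using sup_dist_nonneg[OF T f g] by simp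
        then show ?thesis using d(2)[OF g True] by linarith
      next
        case False
        then have "real k * d \<le> real k * sup_dist T f g" by (intro mult_left_mono) auto
        then show ?thesis using kd hb[OF f] hb[OF g] e by linarith
      qed
    qed
    then show "norm (lower_env T (real k) h f - h f) < e"
      using lower_env_le[OF of_nat_0_le_iff f, of k] e by simp
  qed
qed

end

text \<open>Every bounded continuous function is a monotone limit of Lipschitz ones from either side, so testing against
  Lipschitz functions suffices; no tightness is needed.\<close>
lemma weak_conv_linf_lipschitz:
  assumes P: "prob_space P" and N: "prob_space N" and T: "T \<noteq> {}"
    and X: "\<And>n \<omega>. \<omega> \<in> space P \<Longrightarrow> X n \<omega> \<in> linf T" and G: "\<And>\<omega>. \<omega> \<in> space N \<Longrightarrow> G \<omega> \<in> linf T"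
    and Gm: "\<And>h. bcont_linf T h \<Longrightarrow> (\<lambda>\<omega>. h (G \<omega>)) \<in> borel_measurable N"
    and lip: "\<And>h k b. lip_linf T k h \<Longrightarrow> 0 \<le> k \<Longrightarrow> (\<And>f. f \<in> linf T \<Longrightarrow> \<bar>h f\<bar> \<le> b) \<Longrightarrow>
        (\<lambda>n. outer_exp P (\<lambda>\<omega>. h (X n \<omega>))) \<longlonglongrightarrow> integral\<^sup>L N (\<lambda>\<omega>. h (G \<omega>))"
  shows "weak_conv_linf T P X N G"
  unfolding weak_conv_linf_def
proof (intro allI impI conjI)
  interpret N: prob_space N by fact
  fix h assume h: "bcont_linf T h"
  then show hm: "(\<lambda>\<omega>. h (G \<omega>)) \<in> borel_measurable N" by (rule Gm)
  obtain b where b: "\<And>f. f \<in> linf T \<Longrightarrow> \<bar>h f\<bar> \<le> b" using h unfolding bcont_linf_def by blast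
  have cont: "\<exists>d>0. \<forall>g\<in>linf T. sup_dist T f g < d \<longrightarrow> \<bar>h f - h g\<bar> < e" if "f \<in> linf T" "0 < e" for f e
    using h that unfolding bcont_linf_def by blast
  have b': "\<bar>- h f\<bar> \<le> b" if "f \<in> linf T" for f using b[OF that] by simp
  have cont': "\<exists>d>0. \<forall>g\<in>linf T. sup_dist T f g < d \<longrightarrow> \<bar>- h f - - h g\<bar> < e" if "f \<in> linf T" "0 < e" for f e
    using cont[OF that] by (simp add: abs_minus_commute)
  define lo where "lo k f = lower_env T (real k) h f" for k :: nat and f
  \<comment> \<open>The upper envelope, obtained by reflection.\<close>
  define up where "up k f = - lower_env T (real k) (\<lambda>f. - h f) f" for k :: nat and f
  have lo_lip: "lip_linf T (real k) (lo k)" for k unfolding lo_def by (rule lower_env_lip[OF T b]) auto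
  have up_lip: "lip_linf T (real k) (up k)" for k
    using lower_env_lip[where k = "real k" and h = "\<lambda>f. - h f", OF T b'] unfolding lip_linf_def up_def by (simp add: abs_minus_commute)
  have lo_b: "\<bar>lo k f\<bar> \<le> b" if "f \<in> linf T" for k f
    unfolding lo_def by (rule lower_env_bound[OF T b _ that]) auto
  have up_b: "\<bar>up k f\<bar> \<le> b" if "f \<in> linf T" for k f
    unfolding up_def abs_minus_cancel by (rule lower_env_bound[where h = "\<lambda>f. - h f", OF T b' _ that]) auto
  have lo_le: "lo k f \<le> h f" if "f \<in> linf T" for k f
    unfolding lo_def by (rule lower_env_le[OF T b _ that]) auto
  have up_ge: "h f \<le> up k f" if "f \<in> linf T" for k f
    using lower_env_le[where k = "real k" and h = "\<lambda>f. - h f", OF T b' _ that] by (simp add: up_def)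
  have lo_lim: "(\<lambda>k. lo k f) \<longlonglongrightarrow> h f" if "f \<in> linf T" for f
    unfolding lo_def by (rule lower_env_tendsto[OF T b cont that]) auto
  have up_lim: "(\<lambda>k. up k f) \<longlonglongrightarrow> h f" if "f \<in> linf T" for f
    using tendsto_minus[OF lower_env_tendsto[where h = "\<lambda>f. - h f", OF T b' cont' that]] by (simp add: up_def)
  have lo_m: "(\<lambda>\<omega>. lo k (G \<omega>)) \<in> borel_measurable N" and up_m: "(\<lambda>\<omega>. up k (G \<omega>)) \<in> borel_measurable N" for k
    by (rule Gm[OF lip_linf_bcont[OF lo_lip lo_b]] Gm[OF lip_linf_bcont[OF up_lip up_b]]; simp)+
  have Elo: "(\<lambda>k. \<integral>\<omega>. lo k (G \<omega>) \<partial>N) \<longlonglongrightarrow> (\<integral>\<omega>. h (G \<omega>) \<partial>N)"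
    by (rule integral_dominated_convergence[where w = "\<lambda>_. b"]) (use hm lo_m lo_lim lo_b G in auto)
  have Eup: "(\<lambda>k. \<integral>\<omega>. up k (G \<omega>) \<partial>N) \<longlonglongrightarrow> (\<integral>\<omega>. h (G \<omega>) \<partial>N)"
    by (rule integral_dominated_convergence[where w = "\<lambda>_. b"]) (use hm up_m up_lim up_b G in auto)
  show "(\<lambda>n. outer_exp P (\<lambda>\<omega>. h (X n \<omega>))) \<longlonglongrightarrow> integral\<^sup>L N (\<lambda>\<omega>. h (G \<omega>))"
  proof (rule order_tendstoI)
    fix a assume "a < integral\<^sup>L N (\<lambda>\<omega>. h (G \<omega>))"
    from Elo this have "eventually (\<lambda>k. a < (\<integral>\<omega>. lo k (G \<omega>) \<partial>N)) sequentially" by (rule order_tendstoD)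
    then obtain k where k: "a < (\<integral>\<omega>. lo k (G \<omega>) \<partial>N)" by (auto simp: eventually_sequentially)
    have "(\<lambda>n. outer_exp P (\<lambda>\<omega>. lo k (X n \<omega>))) \<longlonglongrightarrow> (\<integral>\<omega>. lo k (G \<omega>) \<partial>N)"
      by (rule lip[OF lo_lip _ lo_b]) auto
    then have "eventually (\<lambda>n. a < outer_exp P (\<lambda>\<omega>. lo k (X n \<omega>))) sequentially" using k by (rule order_tendstoD)
    then show "eventually (\<lambda>n. a < outer_exp P (\<lambda>\<omega>. h (X n \<omega>))) sequentially"
    proof eventually_elim
      case (elim n)
      have "outer_exp P (\<lambda>\<omega>. lo k (X n \<omega>)) \<le> outer_exp P (\<lambda>\<omega>. h (X n \<omega>))"
        by (rule outer_exp_mono[OF P, of b]) (use lo_b[OF X] lo_le[OF X] b[OF X] in \<open>auto simp: abs_le_iff minus_le_iff\<close>)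
      then show ?case using elim by linarith
    qed
  next
    fix a assume "integral\<^sup>L N (\<lambda>\<omega>. h (G \<omega>)) < a"
    from Eup this have "eventually (\<lambda>k. (\<integral>\<omega>. up k (G \<omega>) \<partial>N) < a) sequentially" by (rule order_tendstoD)
    then obtain k where k: "(\<integral>\<omega>. up k (G \<omega>) \<partial>N) < a" by (auto simp: eventually_sequentially)
    have "(\<lambda>n. outer_exp P (\<lambda>\<omega>. up k (X n \<omega>))) \<longlonglongrightarrow> (\<integral>\<omega>. up k (G \<omega>) \<partial>N)"
      by (rule lip[OF up_lip _ up_b]) auto
    then have "eventually (\<lambda>n. outer_exp P (\<lambda>\<omega>. up k (X n \<omega>)) < a) sequentially" using k by (rule order_tendstoD)
    then show "eventually (\<lambda>n. outer_exp P (\<lambda>\<omega>. h (X n \<omega>)) < a) sequentially"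
    proof eventually_elim
      case (elim n)
      have "outer_exp P (\<lambda>\<omega>. h (X n \<omega>)) \<le> outer_exp P (\<lambda>\<omega>. up k (X n \<omega>))"
        by (rule outer_exp_mono[OF P, of b]) (use up_b[OF X] up_ge[OF X] b[OF X] in \<open>auto simp: abs_le_iff minus_le_iff\<close>)
      then show ?case using elim by linarith
    qed
  qed
qed

lemma continuous_dyadic_floor_uniform:
  fixes f :: "real^'p \<Rightarrow> real"
  assumes f: "continuous_on unit_cube f" and a: "0 < a"
  shows "eventually (\<lambda>l. \<forall>v\<in>unit_cube. \<bar>f v - f (dyadic_floor l v)\<bar> \<le> a) sequentially"
proof -
  have "uniformly_continuous_on unit_cube f"
    using f unfolding unit_cube_cbox by (intro compact_uniformly_continuous) auto
  then obtain d where d: "0 < d" "\<And>u w. u \<in> unit_cube \<Longrightarrow> w \<in> unit_cube \<Longrightarrow> dist w u < d \<Longrightarrow> dist (f w) (f u) < a"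
    unfolding uniformly_continuous_on_def using a by metis
  have "(\<lambda>l. real CARD('p) * (1 / 2) ^ l) \<longlonglongrightarrow> real CARD('p) * 0"
    by (intro tendsto_intros LIMSEQ_power_zero) simp
  from order_tendstoD(2)[OF this, of d] d(1) have "eventually (\<lambda>l. real CARD('p) * (1 / 2) ^ l < d) sequentially" by simp
  then show ?thesis
  proof eventually_elim
    case (elim l)
    show ?case
    proof
      fix v :: "real^'p" assume v: "v \<in> unit_cube"
      have "dist v (dyadic_floor l v) \<le> (\<Sum>k\<in>UNIV. \<bar>v $ k - dyadic_floor l v $ k\<bar>)"
        using norm_le_l1_cart[of "v - dyadic_floor l v"] by (simp add: dist_norm)
      also have "\<dots> \<le> (\<Sum>k\<in>(UNIV::'p set). 1 / 2 ^ l)"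
        using dyadic_floor_le[of l v] dyadic_floor_ge[of v _ l] by (intro sum_mono) (simp add: abs_le_iff algebra_simps)
      also have "\<dots> < d" using elim by (simp add: power_divide)
      finally have "dist (f v) (f (dyadic_floor l v)) < a"
        using d(2)[of "dyadic_floor l v" v] v dyadic_floor_in_grid[OF v] dyadic_grid_subset_unit_cube by blast
      then show "\<bar>f v - f (dyadic_floor l v)\<bar> \<le> a" by (simp add: dist_real_def)
    qed
  qed
qed

section \<open>The limit covariance and bounds for the limit map\<close>

context copula_sample
begin

lemma C_cont: "continuous_on unit_cube C"
  by (rule has_derivative_continuous_on[OF C_deriv])

lemma cov_sym: "cov u v = cov v u"
  by (simp add: cov_def min.commute mult_ac)

text \<open>The quadratic form is the variance of a linear combination of orthants.\<close>

lemma cov_psd: "0 \<le> (\<Sum>i<n. \<Sum>j<n. c i * c j * cov (x i) (x j))" for n :: nat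
proof -
  have "\<bar>\<Sum>i<n. c i * orthant (x i) s\<bar> \<le> (\<Sum>i<n. \<bar>c i\<bar>)" for s
    by (intro order_trans[OF sum_abs] sum_mono) (simp add: abs_mult abs_orthant_le mult_left_le)
  then show ?thesis
    unfolding evar_orthant_sum[OF finite_lessThan, symmetric]
    by (intro evar_nonneg(2)) (auto intro!: borel_measurable_sum borel_measurable_times orthant_meas)
qed

text \<open>The left side is the variance of the indicator of a strip of mass m, namely m - m^2, and
  m is at most the mesh.\<close>

lemma cov_increment:
  assumes u: "u \<in> dyadic_grid j" and b: "bump j k u \<in> unit_cube"
  shows "cov (bump j k u) (bump j k u) - 2 * cov (bump j k u) u + cov u u \<le> 1 / 2 ^ j"
proof -
  have le: "u $ i \<le> bump j k u $ i" for i by (simp add: bump_def)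
  have uc: "u \<in> unit_cube" using u dyadic_grid_subset_unit_cube by blast
  have min1: "(\<chi> i. min (bump j k u $ i) (u $ i)) = u"
    using le by (simp add: vec_eq_iff min_absorb2)
  have min2: "(\<chi> i. min (w $ i) (w $ i)) = w" for w :: "real^'p" by (simp add: vec_eq_iff)
  have "cov (bump j k u) (bump j k u) - 2 * cov (bump j k u) u + cov u u
      = (D (bump j k u) - D u) - (D (bump j k u) - D u)\<^sup>2"
    unfolding cov_def min1 min2 D_eq by (simp add: power2_eq_square algebra_simps)
  also have "\<dots> \<le> D (bump j k u) - D u" by simp
  also have "\<dots> \<le> (\<Sum>i\<in>UNIV. bump j k u $ i - u $ i)" using D_lip[OF uc b le] by blast
  also have "\<dots> = (\<Sum>i\<in>UNIV. if i = k then 1 / 2 ^ j else 0)" by (intro sum.cong refl) (simp add: bump_def)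
  finally show ?thesis by simp
qed

lemma cov_cont:
  assumes u: "u \<in> unit_cube" and v: "v \<in> unit_cube"
  shows "(\<lambda>l. cov (dyadic_floor l u) (dyadic_floor l v)) \<longlonglongrightarrow> cov u v"
proof -
  have fl: "dyadic_floor l w \<in> unit_cube" if "w \<in> unit_cube" for l w
    using dyadic_floor_in_grid[OF that] dyadic_grid_subset_unit_cube by blast
  have Clim: "(\<lambda>l. C (w l)) \<longlonglongrightarrow> C w0" if "w \<longlonglongrightarrow> w0" "w0 \<in> unit_cube" "\<And>l. w l \<in> unit_cube" for w w0
    by (rule continuous_on_tendsto_compose[OF C_cont that(1,2)]) (simp add: that(3))
  have mc: "(\<chi> k. min (a $ k) (b $ k)) \<in> unit_cube" if "a \<in> unit_cube" "b \<in> unit_cube" for a b :: "real^'p"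
    using that by (auto simp: unit_cube_def min_def)
  have "(\<lambda>l. (\<chi> k. min (dyadic_floor l u $ k) (dyadic_floor l v $ k))) \<longlonglongrightarrow> (\<chi> k. min (u $ k) (v $ k))"
    by (rule vec_tendstoI) (auto intro!: tendsto_min tendsto_vec_nth dyadic_floor_tendsto)
  then have "(\<lambda>l. C (\<chi> k. min (dyadic_floor l u $ k) (dyadic_floor l v $ k))) \<longlonglongrightarrow> C (\<chi> k. min (u $ k) (v $ k))"
    by (rule Clim) (use mc fl u v in auto)
  moreover have "(\<lambda>l. C (dyadic_floor l u)) \<longlonglongrightarrow> C u" "(\<lambda>l. C (dyadic_floor l v)) \<longlonglongrightarrow> C v"
    by (rule Clim[OF dyadic_floor_tendsto]; use fl u v in auto)+
  ultimately show ?thesis unfolding cov_def by (intro tendsto_intros)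
qed

lemma proc_orthant_sum:
  "proc n m (\<lambda>s. \<Sum>i\<in>S. c i * orthant (x i) s) \<omega> = (\<Sum>i\<in>S. c i * W n m \<omega> (x i))"
proof -
  have e: "emean (\<lambda>s. \<Sum>i\<in>S. c i * orthant (x i) s) = (\<Sum>i\<in>S. c i * emean (orthant (x i)))"
    unfolding emean_def using orthant_integrable by (simp add: Bochner_Integration.integral_sum)
  have a: "avg n (\<lambda>s. \<Sum>i\<in>S. c i * orthant (x i) s) y = (\<Sum>i\<in>S. c i * avg n (orthant (x i)) y)"
    for y :: "nat \<Rightarrow> (real^'p) \<times> (real^'q)"
    unfolding avg_def by (subst sum.swap) (simp add: sum_distrib_left sum_divide_distrib)
  have "(\<Sum>i<n. if m = 0 then (\<Sum>j\<in>S. c j * orthant (x j) (obs \<omega> i)) - emean (\<lambda>s. \<Sum>i\<in>S. c i * orthant (x i) s)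
      else (\<Sum>j\<in>S. c j * orthant (x j) (obs \<omega> (J (n, m, i) \<omega>))) - avg n (\<lambda>s. \<Sum>i\<in>S. c i * orthant (x i) s) (obs \<omega>))
    = (\<Sum>i<n. \<Sum>j\<in>S. c j * (if m = 0 then orthant (x j) (obs \<omega> i) - emean (orthant (x j))
        else orthant (x j) (obs \<omega> (J (n, m, i) \<omega>)) - avg n (orthant (x j)) (obs \<omega>)))"
    unfolding e a by (intro sum.cong refl) (simp add: sum_subtractf right_diff_distrib)
  also have "\<dots> = (\<Sum>j\<in>S. c j * (\<Sum>i<n. if m = 0 then orthant (x j) (obs \<omega> i) - emean (orthant (x j))
        else orthant (x j) (obs \<omega> (J (n, m, i) \<omega>)) - avg n (orthant (x j)) (obs \<omega>)))"
    by (subst sum.swap) (simp only: sum_distrib_left)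
  finally show ?thesis unfolding proc_def by (simp only: sum_divide_distrib[of _ S] times_divide_eq_right)
qed

text \<open>\<open>c\<close> bounds, for the sup norm over the cube, the operator norm of the linear
  map from a path to its image under \<open>Cinf\<close>. Positivity is included because
  \<open>c\<close> occurs as a divisor.\<close>

definition Cinf_opnorm :: "real \<Rightarrow> bool" where
  "Cinf_opnorm c \<longleftrightarrow> 0 < c \<and>
     (\<forall>u\<in>unit_cube. \<forall>f a. (\<forall>v\<in>unit_cube. \<bar>f v\<bar> \<le> a) \<longrightarrow> \<bar>Cinf p C dC f u\<bar> \<le> c * a)"

lemma Cinf_bound: "\<exists>c. Cinf_opnorm c"
proof -
  let ?d = "real CARD('p)"
  obtain c1 where c1: "0 \<le> c1" "\<And>u. u \<in> unit_cube \<Longrightarrow> norm (C' u) \<le> c1" using C'_bounded by blast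
  have d0: "0 \<le> ?d * (c1 * 2)" using c1(1) by simp
  show ?thesis
    unfolding Cinf_opnorm_def
  proof (intro exI[of _ "(2 + ?d * (c1 * 2)) / p"] conjI ballI allI impI)
    show "0 < (2 + ?d * (c1 * 2)) / p" using d0 pA_pos by (intro divide_pos_pos add_pos_nonneg) auto
    fix f :: "real^'p \<Rightarrow> real" and a and u :: "real^'p" assume u: "u \<in> unit_cube" and f': "\<forall>v\<in>unit_cube. \<bar>f v\<bar> \<le> a"
    have f: "\<bar>f v\<bar> \<le> a" if "v \<in> unit_cube" for v using f' that by blast
    have one: "(1::real^'p) \<in> unit_cube" by (simp add: unit_cube_def)
    have a0: "0 \<le> a" using f[OF one] by linarith
    have u01: "0 \<le> u $ k" "u $ k \<le> 1" for k using u by (auto simp: unit_cube_def)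
    have dCb: "\<bar>dC u k\<bar> \<le> c1" for k
      using norm_blinfun[of "C' u" "axis k 1"] c1(2)[OF u] by (simp add: norm_axis_1)
    have t: "\<bar>dC u k * (f (edge k (u $ k)) - u $ k * f 1)\<bar> \<le> c1 * (2 * a)" for k
    proof -
      have "\<bar>u $ k * f 1\<bar> \<le> 1 * a" unfolding abs_mult using u01[of k] f[OF one] by (intro mult_mono) auto
      moreover have "\<bar>f (edge k (u $ k))\<bar> \<le> a" using u01[of k] by (intro f) (auto simp: edge_def unit_cube_def)
      ultimately have "\<bar>f (edge k (u $ k)) - u $ k * f 1\<bar> \<le> 2 * a" by linarith
      then show ?thesis unfolding abs_mult using dCb c1(1) by (intro mult_mono) auto
    qed
    have pe: "p * Cinf p C dC f u = f u - (\<Sum>k\<in>UNIV. dC u k * (f (edge k (u $ k)) - u $ k * f 1)) - C u * f 1"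
      unfolding Cinf_def edge_def[symmetric] using pA_pos
      by (simp add: power2_eq_square right_diff_distrib sum_distrib_left)
    have "\<bar>\<Sum>k\<in>UNIV. dC u k * (f (edge k (u $ k)) - u $ k * f 1)\<bar> \<le> (\<Sum>k\<in>(UNIV::'p set). c1 * (2 * a))"
      by (intro order_trans[OF sum_abs] sum_mono t)
    moreover have "\<bar>C u * f 1\<bar> \<le> 1 * a"
      unfolding abs_mult using C_01[of u] f[OF one] by (intro mult_mono) auto
    ultimately have "\<bar>p * Cinf p C dC f u\<bar> \<le> a + ?d * (c1 * (2 * a)) + a"
      unfolding pe using f[OF u] by simp
    then have "p * \<bar>Cinf p C dC f u\<bar> \<le> (2 + ?d * (c1 * 2)) * a"
      using pA_pos by (simp add: abs_mult algebra_simps)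
    then show "\<bar>Cinf p C dC f u\<bar> \<le> (2 + ?d * (c1 * 2)) / p * a"
      using pA_pos by (simp add: field_simps)
  qed
qed

text \<open>If no observation falls in A, both counts are 0 and the quotient takes the default value
  0. This makes the copula process bounded for every n and every outcome.\<close>

lemma emp_copula_01: "0 \<le> emp_copula n s A u \<and> emp_copula n s A u \<le> 1"
proof -
  let ?a = "\<Sum>i<n. if (\<forall>k. ereal (fst (s i) $ k) \<le> ginv (emp_F n s A k) (u $ k)) \<and> snd (s i) \<in> A then 1 else 0::real"
  let ?b = "\<Sum>i<n. if snd (s i) \<in> A then 1 else 0::real"
  have "?a \<le> ?b" "0 \<le> ?a" by (auto intro!: sum_mono sum_nonneg)
  moreover have "emp_copula n s A u = ?a / ?b"
    by (cases "n = 0") (auto simp: emp_copula_def emp_pA_def)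
  ultimately show ?thesis by (auto simp: divide_le_eq intro!: divide_nonneg_nonneg)
qed

lemma copula_proc_bound: "\<bar>copula_proc P X Z J A n \<omega> m u\<bar> \<le> 2 * sqrt (real n)"
proof -
  have t: "\<bar>sqrt (real n) * (emp_copula n s A u - C u)\<bar> \<le> sqrt (real n)" for s :: "nat \<Rightarrow> (real^'p) \<times> (real^'q)"
  proof -
    have "\<bar>emp_copula n s A u - C u\<bar> \<le> 1" using emp_copula_01[of n s u] C_01[of u] by (auto simp: abs_le_iff)
    then show ?thesis by (simp add: abs_mult mult_left_le)
  qed
  show ?thesis unfolding copula_proc_eq using t[of "resample n m \<omega>"] t[of "resample n 0 \<omega>"] by auto
qed

end

section \<open>The joint limit as a product of path laws\<close>

locale copula_limit = copula_sample P X Z J A C'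
  for P :: "'a measure" and X :: "nat \<Rightarrow> 'a \<Rightarrow> real^'p" and Z :: "nat \<Rightarrow> 'a \<Rightarrow> real^'q"
    and J :: "nat \<times> nat \<times> nat \<Rightarrow> 'a \<Rightarrow> nat" and A :: "(real^'q) set" and C' :: "real^'p \<Rightarrow> ((real^'p) \<Rightarrow>\<^sub>L real)" +
  fixes N1 :: "(real^'p \<Rightarrow> real) measure" and M :: nat
  assumes N1: "prob_space N1" and space_N1: "space N1 = {f. continuous_on unit_cube f}"
    and N1_restrict: "(\<lambda>f. restrict f unit_cube) \<in> measurable N1 (Pi\<^sub>M unit_cube (\<lambda>_. borel))"
    and N1_cf: "\<And>(S::nat set) c z. finite S \<Longrightarrow> z ` S \<subseteq> unit_cube \<Longrightarrow>
       (\<integral>f. cis (\<Sum>i\<in>S. c i * f (z i)) \<partial>N1) = exp (- (\<Sum>i\<in>S. \<Sum>j\<in>S. c i * c j * cov (z i) (z j)) / 2)"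
begin

text \<open>Independence of the copies holds by construction, as \<open>B m\<close> becomes the m-th
  coordinate. The product runs over all of \<open>nat\<close>, although the process has the
  components up to \<open>M\<close>.\<close>

definition N :: "(nat \<Rightarrow> real^'p \<Rightarrow> real) measure" where "N = Pi\<^sub>M UNIV (\<lambda>_. N1)"

lemma prob_N: "prob_space N" unfolding N_def by (rule prob_space_PiM) (rule N1)

lemma N_cont: "\<omega> \<in> space N \<Longrightarrow> continuous_on unit_cube (\<omega> m)"
  by (auto simp: N_def space_PiM space_N1 PiE_iff)

lemma N_coord: "(\<lambda>\<omega>. \<omega> m) \<in> measurable N N1" unfolding N_def by measurable

lemma N1_eval: "u \<in> unit_cube \<Longrightarrow> (\<lambda>f. f u) \<in> borel_measurable N1"
  using measurable_compose[OF N1_restrict measurable_component_singleton, of u] by simp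

lemma N_eval: "u \<in> unit_cube \<Longrightarrow> (\<lambda>\<omega>. \<omega> m u) \<in> borel_measurable N"
  by (rule measurable_compose[OF N_coord N1_eval])

lemma N_coord_indep: "prob_space.indep_vars N (\<lambda>_. N1) (\<lambda>m \<omega>. \<omega> m) UNIV"
  unfolding N_def by (rule indep_vars_PiM_coords) (rule N1)

lemma N_indep: "prob_space.indep_vars N (\<lambda>_. Pi\<^sub>M unit_cube (\<lambda>_. borel)) (\<lambda>m \<omega>. restrict (\<omega> m) unit_cube) I"
proof -
  interpret N: prob_space N by (rule prob_N)
  have "N.indep_vars (\<lambda>_. Pi\<^sub>M unit_cube (\<lambda>_. borel)) (\<lambda>m \<omega>. restrict (\<omega> m) unit_cube) UNIV"
    by (rule N.indep_vars_compose2[OF N_coord_indep N1_restrict])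
  then show ?thesis by (rule N.indep_vars_subset) simp
qed

lemma N_component: "distr N N1 (\<lambda>\<omega>. \<omega> m) = N1"
proof -
  interpret product_prob_space "\<lambda>_::nat. N1" UNIV by (rule product_prob_spaceI) (rule N1)
  show ?thesis unfolding N_def using PiM_component[of m] by simp
qed

lemma N1_sum_meas:
  fixes z :: "nat \<Rightarrow> real^'p"
  assumes "z ` {..<k} \<subseteq> unit_cube"
  shows "(\<lambda>f. cis (\<Sum>i<k. c i * f (z i))) \<in> borel_measurable N1"
  using assms by (intro borel_measurable_cis borel_measurable_sum borel_measurable_times N1_eval) auto

lemma N_cf:
  fixes z :: "nat \<Rightarrow> real^'p"
  assumes z: "z ` {..<k} \<subseteq> unit_cube"
  shows "(\<integral>\<omega>. cis (\<Sum>m\<le>M. \<Sum>i<k. c m i * \<omega> m (z i)) \<partial>N)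
      = exp (- (\<Sum>m\<le>M. \<Sum>i<k. \<Sum>j<k. c m i * c m j * cov (z i) (z j)) / 2)"
proof -
  interpret N: prob_space N by (rule prob_N)
  define g where "g m f = cis (\<Sum>i<k. c m i * f (z i))" for m and f :: "real^'p \<Rightarrow> real"
  have gm: "g m \<in> borel_measurable N1" for m unfolding g_def by (rule N1_sum_meas[OF z])
  have "N.indep_vars (\<lambda>_. borel) (\<lambda>m \<omega>. g m (\<omega> m)) UNIV"
    by (rule N.indep_vars_compose2[OF N_coord_indep gm])
  then have ind: "N.indep_vars (\<lambda>_. borel) (\<lambda>m \<omega>. g m (\<omega> m)) {..M}" by (rule N.indep_vars_subset) simp
  have int: "integrable N (\<lambda>\<omega>. g m (\<omega> m))" for m
    by (rule N.integrable_const_bound[of _ 1]) (auto simp: g_def[of m, symmetric] measurable_compose[OF N_coord gm], simp add: g_def)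
  have "(\<integral>\<omega>. cis (\<Sum>m\<le>M. \<Sum>i<k. c m i * \<omega> m (z i)) \<partial>N) = (\<integral>\<omega>. (\<Prod>m\<le>M. g m (\<omega> m)) \<partial>N)"
    unfolding g_def by (simp add: cis_sum[symmetric])
  also have "\<dots> = (\<Prod>m\<le>M. \<integral>\<omega>. g m (\<omega> m) \<partial>N)"
    by (rule N.indep_vars_lebesgue_integral[OF _ ind int]) simp
  also have "\<dots> = (\<Prod>m\<le>M. complex_of_real (exp (- (\<Sum>i<k. \<Sum>j<k. c m i * c m j * cov (z i) (z j)) / 2)))"
  proof (intro prod.cong refl)
    fix m
    have "(\<integral>\<omega>. g m (\<omega> m) \<partial>N) = (\<integral>f. g m f \<partial>distr N N1 (\<lambda>\<omega>. \<omega> m))"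
      by (rule integral_distr[OF N_coord gm, symmetric])
    also have "\<dots> = exp (- (\<Sum>i<k. \<Sum>j<k. c m i * c m j * cov (z i) (z j)) / 2)"
      unfolding N_component g_def using N1_cf[OF finite_lessThan z] .
    finally show "(\<integral>\<omega>. g m (\<omega> m) \<partial>N) = exp (- (\<Sum>i<k. \<Sum>j<k. c m i * c m j * cov (z i) (z j)) / 2)" .
  qed
  also have "\<dots> = complex_of_real (\<Prod>m\<le>M. exp (- (\<Sum>i<k. \<Sum>j<k. c m i * c m j * cov (z i) (z j)) / 2))" by simp
  also have "(\<Prod>m\<le>M. exp (- (\<Sum>i<k. \<Sum>j<k. c m i * c m j * cov (z i) (z j)) / 2))
      = exp (- (\<Sum>m\<le>M. \<Sum>i<k. \<Sum>j<k. c m i * c m j * cov (z i) (z j)) / 2)"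
    by (subst exp_sum[symmetric]) (simp_all add: sum_negf sum_divide_distrib)
  finally show ?thesis .
qed

lemma N_gaussian: "centered_gaussian_process N (\<lambda>\<omega>. \<omega> m) unit_cube cov"
proof -
  interpret N: prob_space N by (rule prob_N)
  show ?thesis
  proof (rule N.gaussian_process_from_cf[OF N_eval cov_sym])
    fix F :: "(real^'p) set" and c assume F: "finite F" "F \<subseteq> unit_cube"
    obtain z where z: "bij_betw z {0..<card F} F" using ex_bij_betw_nat_finite[OF F(1)] by blast
    have zF: "z ` {0..<card F} \<subseteq> unit_cube" using z F(2) by (auto simp: bij_betw_def)
    have m: "(\<lambda>f. cis (\<Sum>u\<in>F. c u * f u)) \<in> borel_measurable N1"
      using F by (intro borel_measurable_cis borel_measurable_sum borel_measurable_times N1_eval) auto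
    have re: "(\<Sum>u\<in>F. h u) = (\<Sum>i\<in>{0..<card F}. h (z i))" for h :: "real^'p \<Rightarrow> real"
      by (rule sum.reindex_bij_betw[OF z, symmetric])
    have "(\<integral>\<omega>. cis (\<Sum>u\<in>F. c u * \<omega> m u) \<partial>N) = (\<integral>f. cis (\<Sum>u\<in>F. c u * f u) \<partial>distr N N1 (\<lambda>\<omega>. \<omega> m))"
      by (rule integral_distr[OF N_coord m, symmetric])
    also have "\<dots> = exp (- (\<Sum>u\<in>F. \<Sum>v\<in>F. c u * c v * cov u v) / 2)"
      unfolding N_component re using N1_cf[OF _ zF, of "\<lambda>i. c (z i)"] by simp
    finally show "(\<integral>\<omega>. cis (\<Sum>u\<in>F. c u * \<omega> m u) \<partial>N) = exp (- (\<Sum>u\<in>F. \<Sum>v\<in>F. c u * c v * cov u v) / 2)" .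
  qed
qed

lemma N_second_moment:
  assumes "u \<in> unit_cube"
  shows "integrable N (\<lambda>\<omega>. (\<omega> m u)\<^sup>2) \<and> (\<integral>\<omega>. (\<omega> m u)\<^sup>2 \<partial>N) \<le> moment_bound"
proof -
  have "integrable N (\<lambda>\<omega>. \<omega> m u * \<omega> m u) \<and> (\<integral>\<omega>. \<omega> m u * \<omega> m u \<partial>N) = cov u u"
    using N_gaussian[of m] assms unfolding centered_gaussian_process_def by blast
  moreover have "cov u u \<le> moment_bound"
  proof -
    have "(\<chi> k. min (u $ k) (u $ k)) = u" by (simp add: vec_eq_iff)
    then have "cov u u = p * C u - (p * C u)\<^sup>2" by (simp add: cov_def power2_eq_square mult_ac)
    also have "\<dots> \<le> p * C u" by simp
    also have "\<dots> \<le> 1 * 1" using p_le_1 C_01[of u] pA_pos by (intro mult_mono) auto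
    also have "\<dots> \<le> moment_bound" unfolding moment_bound_def using exp_ge_zero[of "2::real"] by linarith
    finally show ?thesis .
  qed
  ultimately show ?thesis by (simp add: power2_eq_square)
qed

text \<open>The pairs (component, point) are listed by \<open>e\<close>, whose values all lie in the
  index set; by \<open>cramer_wold_lipschitz\<close> it is enough to treat characteristic functions,
  which \<open>proc_cf_limit\<close> supplies.\<close>

lemma fidi_limit:
  fixes e :: "nat \<Rightarrow> nat \<times> (real^'p)" and f :: "(nat \<Rightarrow> real) \<Rightarrow> real"
  assumes e: "\<And>j. e j \<in> {0..M} \<times> unit_cube"
    and lip: "\<And>x y. \<bar>f x - f y\<bar> \<le> L * (\<Sum>j<k. \<bar>x j - y j\<bar>)" and L: "0 \<le> L"
    and bnd: "\<And>x. \<bar>f x\<bar> \<le> b"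
  shows "(\<lambda>n. expectation (\<lambda>\<omega>. f (\<lambda>j. W n (fst (e j)) \<omega> (snd (e j))))) \<longlonglongrightarrow> (\<integral>\<omega>. f (\<lambda>j. \<omega> (fst (e j)) (snd (e j))) \<partial>N)"
proof -
  have e1: "fst (e j) \<le> M" and e2: "snd (e j) \<in> unit_cube" for j using e[of j] by auto
  show ?thesis
  proof (rule cramer_wold_lipschitz[OF prob_space_axioms prob_N, where J = k and c = moment_bound and f = f and L = L and b = b
        and Y = "\<lambda>n \<omega> j. W n (fst (e j)) \<omega> (snd (e j))" and V = "\<lambda>\<omega> j. \<omega> (fst (e j)) (snd (e j))"])
    show "(\<lambda>\<omega>. W n (fst (e j)) \<omega> (snd (e j))) \<in> borel_measurable P" for n j by (rule measurable_proc[OF orthant_meas])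
    show "(\<lambda>\<omega>. \<omega> (fst (e j)) (snd (e j))) \<in> borel_measurable N" for j by (rule N_eval[OF e2])
    show "integrable P (\<lambda>\<omega>. (W n (fst (e j)) \<omega> (snd (e j)))\<^sup>2) \<and> expectation (\<lambda>\<omega>. (W n (fst (e j)) \<omega> (snd (e j)))\<^sup>2) \<le> moment_bound" for n j
      using proc_second_moment[OF orthant_meas abs_orthant_le] by blast
    show "integrable N (\<lambda>\<omega>. (\<omega> (fst (e j)) (snd (e j)))\<^sup>2) \<and> (\<integral>\<omega>. (\<omega> (fst (e j)) (snd (e j)))\<^sup>2 \<partial>N) \<le> moment_bound" for j
      by (rule N_second_moment[OF e2])
    fix t :: "nat \<Rightarrow> real"
    \<comment> \<open>Regroups the frequencies by component: all points that belong to component m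
      are merged into the single function \<open>y m\<close>, as \<open>proc_cf_limit\<close> takes
      one function per component.\<close>
    define c where "c m j = (if m = fst (e j) then t j else 0)" for m j
    have grp: "(\<Sum>j<k. t j * a (fst (e j)) j) = (\<Sum>m\<le>M. \<Sum>j<k. c m j * a m j)" for a :: "nat \<Rightarrow> nat \<Rightarrow> real"
    proof -
      have "(\<Sum>m\<le>M. \<Sum>j<k. c m j * a m j) = (\<Sum>j<k. \<Sum>m\<le>M. c m j * a m j)" by (rule sum.swap)
      also have "\<dots> = (\<Sum>j<k. \<Sum>m\<le>M. if m = fst (e j) then t j * a (fst (e j)) j else 0)"
        by (intro sum.cong refl) (auto simp: c_def)
      also have "\<dots> = (\<Sum>j<k. t j * a (fst (e j)) j)" using e1 by simp
      finally show ?thesis by simp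
    qed
    define y where "y m s = (\<Sum>j<k. c m j * orthant (snd (e j)) s)" for m s
    have ym: "y m \<in> borel_measurable borel" for m
      unfolding y_def by (intro borel_measurable_sum borel_measurable_times orthant_meas) auto
    define cc where "cc = (\<Sum>j<k. \<bar>t j\<bar>) + 1"
    have "\<bar>y m s\<bar> \<le> (\<Sum>j<k. \<bar>t j\<bar>)" for m s
      unfolding y_def
    proof (intro order_trans[OF sum_abs] sum_mono)
      fix j
      have "\<bar>c m j\<bar> * \<bar>orthant (snd (e j)) s\<bar> \<le> \<bar>t j\<bar> * 1"
        by (intro mult_mono abs_orthant_le) (auto simp: c_def)
      then show "\<bar>c m j * orthant (snd (e j)) s\<bar> \<le> \<bar>t j\<bar>" by (simp add: abs_mult)
    qed
    then have yb: "\<bar>y m s\<bar> \<le> cc" for m s unfolding cc_def by (rule order_trans) simp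
    \<comment> \<open>The summand 1 in \<open>cc\<close> keeps the bound positive even when all
      frequencies vanish.\<close>
    have cc: "0 < cc" unfolding cc_def by (intro add_nonneg_pos sum_nonneg) auto
    have "(\<lambda>n. expectation (\<lambda>\<omega>. cis (\<Sum>m\<le>M. proc n m (y m) \<omega>))) \<longlonglongrightarrow> exp (- (\<Sum>m\<le>M. evar (y m)) / 2)"
      by (rule proc_cf_limit[OF ym yb cc])
    moreover have "(\<Sum>m\<le>M. proc n m (y m) \<omega>) = (\<Sum>j<k. t j * W n (fst (e j)) \<omega> (snd (e j)))" for n \<omega>
      unfolding y_def proc_orthant_sum grp[of "\<lambda>m j. W n m \<omega> (snd (e j))"] ..
    moreover have "(\<integral>\<omega>. cis (\<Sum>j<k. t j * \<omega> (fst (e j)) (snd (e j))) \<partial>N) = exp (- (\<Sum>m\<le>M. evar (y m)) / 2)"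
    proof -
      have "(\<integral>\<omega>. cis (\<Sum>j<k. t j * \<omega> (fst (e j)) (snd (e j))) \<partial>N) = (\<integral>\<omega>. cis (\<Sum>m\<le>M. \<Sum>j<k. c m j * \<omega> m (snd (e j))) \<partial>N)"
        using grp[of "\<lambda>m j. \<omega> m (snd (e j))" for \<omega> :: "nat \<Rightarrow> real^'p \<Rightarrow> real"] by (simp only:)
      also have "\<dots> = exp (- (\<Sum>m\<le>M. \<Sum>i<k. \<Sum>j<k. c m i * c m j * cov (snd (e i)) (snd (e j))) / 2)"
        by (rule N_cf[of "\<lambda>j. snd (e j)"]) (use e2 in auto)
      finally show ?thesis unfolding y_def evar_orthant_sum[OF finite_lessThan] .
    qed
    ultimately show "(\<lambda>n. expectation (\<lambda>\<omega>. cis (\<Sum>j<k. t j * W n (fst (e j)) \<omega> (snd (e j)))))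
        \<longlonglongrightarrow> (\<integral>\<omega>. cis (\<Sum>j<k. t j * \<omega> (fst (e j)) (snd (e j))) \<partial>N)"
      by simp
  qed (use lip L bnd in auto)
qed

end

section \<open>From finite grids to the sup distance\<close>

context copula_limit
begin

abbreviation T where "T \<equiv> {0..M} \<times> (unit_cube :: (real^'p) set)"

definition Phi :: "(nat \<Rightarrow> real^'p \<Rightarrow> real) \<Rightarrow> nat \<Rightarrow> real^'p \<Rightarrow> real" where
  "Phi b m u = Cinf p C dC (b m) u"

definition grid_index :: "nat \<Rightarrow> (nat \<times> (real^'p)) set" where
  "grid_index l = {0..M} \<times> dyadic_grid l"

text \<open>Finite-dimensional marginals are coded in \<open>nat \<Rightarrow> real\<close>, because their dimension varies with the grid.\<close>
definition step_path :: "nat \<Rightarrow> (nat \<Rightarrow> real) \<Rightarrow> nat \<Rightarrow> real^'p \<Rightarrow> real" where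
  "step_path l b m u = b (to_nat_on (grid_index l) (m, dyadic_floor l u))"

lemma finite_grid_index: "finite (grid_index l)"
  by (simp add: grid_index_def finite_dyadic_grid)

lemma one_cube: "(1 :: real^'p) \<in> unit_cube" by (simp add: unit_cube_def)

lemma grid_index_floor: "(m, u) \<in> T \<Longrightarrow> (m, dyadic_floor l u) \<in> grid_index l"
  by (auto simp: grid_index_def dyadic_floor_in_grid)

lemma grid_index_ne: "grid_index l \<noteq> {}"
  using grid_index_floor[of 0 1 l] one_cube by auto

lemma from_grid_index: "from_nat_into (grid_index l) j \<in> T"
proof -
  have "grid_index l \<subseteq> T"
    unfolding grid_index_def by (intro Sigma_mono dyadic_grid_subset_unit_cube) simp
  then show ?thesis using from_nat_into[OF grid_index_ne, of l j] by blast
qed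

lemma to_grid_index_less: "x \<in> grid_index l \<Longrightarrow> to_nat_on (grid_index l) x < card (grid_index l)"
  using to_nat_on_finite[OF finite_grid_index] by (auto simp: bij_betw_def)

lemma step_path_eval:
  assumes "(m, u) \<in> T"
  shows "step_path l (\<lambda>j. f (fst (from_nat_into (grid_index l) j)) (snd (from_nat_into (grid_index l) j))) m u
    = f m (dyadic_floor l u)"
  unfolding step_path_def
  using from_nat_into_to_nat_on[OF countable_finite[OF finite_grid_index] grid_index_floor[OF assms]] by simp

lemma step_path_diff:
  assumes "(m, u) \<in> T"
  shows "\<bar>step_path l b m u - step_path l b' m u\<bar> \<le> (\<Sum>j<card (grid_index l). \<bar>b j - b' j\<bar>)"
  unfolding step_path_def using to_grid_index_less[OF grid_index_floor[OF assms]]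
  by (intro member_le_sum[of _ _ "\<lambda>j. \<bar>b j - b' j\<bar>"]) auto

lemma T_ne: "T \<noteq> {}" using one_cube by auto

lemma Cinf_opnormD:
  "Cinf_opnorm c \<Longrightarrow> u \<in> unit_cube \<Longrightarrow> (\<And>v. v \<in> unit_cube \<Longrightarrow> \<bar>f v\<bar> \<le> a) \<Longrightarrow> \<bar>Cinf p C dC f u\<bar> \<le> c * a"
  by (simp add: Cinf_opnorm_def)

lemma Phi_diff:
  assumes c: "Cinf_opnorm c"
    and b: "\<And>m u. (m, u) \<in> T \<Longrightarrow> \<bar>b m u - b' m u\<bar> \<le> a" and mu: "(m, u) \<in> T"
  shows "\<bar>Phi b m u - Phi b' m u\<bar> \<le> c * a"
  unfolding Phi_def Cinf_diff using mu b by (intro Cinf_opnormD[OF c]) auto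

lemma Phi_linf:
  assumes b: "\<And>m u. (m, u) \<in> T \<Longrightarrow> \<bar>b m u\<bar> \<le> a"
  shows "Phi b \<in> linf T"
proof -
  obtain c where c: "Cinf_opnorm c" using Cinf_bound by blast
  have "\<bar>Phi b m u\<bar> \<le> c * a" if "(m, u) \<in> T" for m u
    unfolding Phi_def using that b by (intro Cinf_opnormD[OF c]) auto
  then show ?thesis unfolding linf_def by (intro CollectI bdd_aboveI2[of _ _ "c * a"]) auto
qed

lemma Phi_step_linf: "Phi (step_path l b) \<in> linf T"
proof (rule Phi_linf)
  fix m u assume "(m, u) \<in> T"
  from step_path_diff[OF this, of l b "\<lambda>_. 0"]
  show "\<bar>step_path l b m u\<bar> \<le> (\<Sum>j<card (grid_index l). \<bar>b j\<bar>)" by (simp add: step_path_def)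
qed

lemma Phi_N_linf:
  assumes "\<omega> \<in> space N" shows "Phi \<omega> \<in> linf T"
proof -
  have "compact (\<omega> m ` unit_cube)" for m
    using N_cont[OF assms, of m] unfolding unit_cube_cbox by (intro compact_continuous_image) auto
  then have "\<exists>a. \<forall>u\<in>unit_cube. \<bar>\<omega> m u\<bar> \<le> a" for m
    using compact_imp_bounded[of "\<omega> m ` unit_cube"] by (auto simp: bounded_iff)
  then obtain a where a: "\<And>m u. u \<in> unit_cube \<Longrightarrow> \<bar>\<omega> m u\<bar> \<le> a m" by metis
  show ?thesis
  proof (rule Phi_linf)
    fix m u assume mu: "(m, u) \<in> T"
    then have "\<bar>\<omega> m u\<bar> \<le> \<bar>a m\<bar>" using a[of u m] by auto
    also have "\<dots> \<le> (\<Sum>m\<le>M. \<bar>a m\<bar>)" using mu by (intro member_le_sum) auto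
    finally show "\<bar>\<omega> m u\<bar> \<le> (\<Sum>m\<le>M. \<bar>a m\<bar>)" .
  qed
qed

text \<open>Only finitely many coordinates of \<open>b\<close> enter, so closeness in the product
  topology controls the sup distance of the images. This makes the functional of a grid restriction
  measurable.\<close>

lemma step_functional_continuous:
  assumes h: "bcont_linf T h"
  shows "continuous_on UNIV (\<lambda>b. h (Phi (step_path l b)))"
proof -
  obtain c where c: "Cinf_opnorm c" using Cinf_bound by blast
  have "((\<lambda>b. h (Phi (step_path l b))) \<longlongrightarrow> h (Phi (step_path l b0))) (at b0)" for b0
  proof (rule tendstoI)
    fix e :: real assume "0 < e"
    then obtain d where d: "0 < d" "\<And>g. g \<in> linf T \<Longrightarrow> sup_dist T (Phi (step_path l b0)) g < d
        \<Longrightarrow> \<bar>h (Phi (step_path l b0)) - h g\<bar> < e"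
      using h Phi_step_linf[of l b0] unfolding bcont_linf_def by metis
    have "((\<lambda>b. c * (\<Sum>j<card (grid_index l). \<bar>b0 j - b j\<bar>)) \<longlongrightarrow> c * (\<Sum>j<card (grid_index l). \<bar>b0 j - b0 j\<bar>)) (at b0)"
    proof (intro tendsto_intros)
      show "((\<lambda>b. b j) \<longlongrightarrow> b0 j) (at b0)" for j
        using continuous_on_product_coordinates[of j] by (auto simp: continuous_on_def)
    qed
    then have "eventually (\<lambda>b. c * (\<Sum>j<card (grid_index l). \<bar>b0 j - b j\<bar>) < d) (at b0)"
      using d(1) by (intro order_tendstoD(2)) auto
    then show "eventually (\<lambda>b. dist (h (Phi (step_path l b))) (h (Phi (step_path l b0))) < e) (at b0)"
    proof eventually_elim
      case (elim b)
      have "sup_dist T (Phi (step_path l b0)) (Phi (step_path l b)) \<le> c * (\<Sum>j<card (grid_index l). \<bar>b0 j - b j\<bar>)"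
        by (rule sup_dist_least[OF T_ne]) (rule Phi_diff[OF c step_path_diff])
      then show ?case using d(2)[OF Phi_step_linf[of l b]] elim by (simp add: dist_real_def abs_minus_commute)
    qed
  qed
  then show ?thesis by (simp add: continuous_on_def)
qed

abbreviation sampled :: "nat \<Rightarrow> (nat \<Rightarrow> real^'p \<Rightarrow> real) \<Rightarrow> nat \<Rightarrow> real" where
  "sampled l f \<equiv> (\<lambda>j. f (fst (from_nat_into (grid_index l) j)) (snd (from_nat_into (grid_index l) j)))"

text \<open>Paths of the limit are uniformly continuous on the cube, so their grid restrictions
  converge uniformly. Consequently \<open>h (Phi \<omega>)\<close> is a pointwise limit of
  measurable functions, without any separability argument in the space of bounded functions.\<close>

lemma sampled_tendsto:
  assumes h: "bcont_linf T h" and \<omega>: "\<omega> \<in> space N"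
  shows "(\<lambda>l. h (Phi (step_path l (sampled l \<omega>)))) \<longlonglongrightarrow> h (Phi \<omega>)"
proof (rule tendstoI)
  fix e :: real assume "0 < e"
  then obtain d where d: "0 < d" "\<And>g. g \<in> linf T \<Longrightarrow> sup_dist T (Phi \<omega>) g < d \<Longrightarrow> \<bar>h (Phi \<omega>) - h g\<bar> < e"
    using h Phi_N_linf[OF \<omega>] unfolding bcont_linf_def by metis
  obtain c where c: "Cinf_opnorm c" using Cinf_bound by blast
  then have c0: "0 < c" by (simp add: Cinf_opnorm_def)
  define a where "a = d / (2 * c)"
  have a: "0 < a" "c * a < d" using c0 d(1) by (auto simp: a_def)
  have "eventually (\<lambda>l. \<forall>m\<in>{0..M}. \<forall>v\<in>unit_cube. \<bar>\<omega> m v - \<omega> m (dyadic_floor l v)\<bar> \<le> a) sequentially"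
    by (intro eventually_ball_finite ballI continuous_dyadic_floor_uniform N_cont[OF \<omega>] a(1)) simp
  then show "eventually (\<lambda>l. dist (h (Phi (step_path l (sampled l \<omega>)))) (h (Phi \<omega>)) < e) sequentially"
  proof eventually_elim
    case (elim l)
    have "sup_dist T (Phi \<omega>) (Phi (step_path l (sampled l \<omega>))) \<le> c * a"
    proof (rule sup_dist_least[OF T_ne], rule Phi_diff[OF c])
      fix m u assume mu: "(m, u) \<in> T"
      show "\<bar>\<omega> m u - step_path l (sampled l \<omega>) m u\<bar> \<le> a"
        unfolding step_path_eval[OF mu, of l \<omega>] using elim mu by auto
    qed
    then show ?case using d(2)[OF Phi_step_linf[of l "sampled l \<omega>"]] a(2) by (simp add: dist_real_def abs_minus_commute)
  qed
qed

lemma sampled_meas: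
  assumes h: "bcont_linf T h"
  shows "(\<lambda>\<omega>. h (Phi (step_path l (sampled l \<omega>)))) \<in> borel_measurable N"
proof (rule borel_measurable_continuous_coords[OF step_functional_continuous[OF h]])
  show "(\<lambda>\<omega>. \<omega> (fst (from_nat_into (grid_index l) j)) (snd (from_nat_into (grid_index l) j))) \<in> borel_measurable N" for j
    using from_grid_index[of l j] by (intro N_eval) auto
qed

text \<open>Three comparisons through one grid: the copula process with the grid restriction of
  \<open>W\<close>, at cost \<epsilon>/2; that restriction with the one of the limit, and the latter
  with the full limit, at cost \<epsilon>/4 each.\<close>

lemma lipschitz_limit:
  assumes lip: "lip_linf T k h" and k: "0 \<le> k" and hb: "\<And>f. f \<in> linf T \<Longrightarrow> \<bar>h f\<bar> \<le> b"
  shows "(\<lambda>n. outer_exp P (\<lambda>\<omega>. h (copula_proc P X Z J A n \<omega>))) \<longlonglongrightarrow> (\<integral>\<omega>. h (Phi \<omega>) \<partial>N)"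
proof (rule LIMSEQ_I)
  interpret N: prob_space N by (rule prob_N)
  have bc: "bcont_linf T h" by (rule lip_linf_bcont[OF lip hb k])
  obtain c where c: "Cinf_opnorm c" using Cinf_bound by blast
  then have c0: "0 < c" by (simp add: Cinf_opnorm_def)
  have b0: "0 \<le> b" using hb[OF Phi_step_linf[of 0 "\<lambda>_. 0"]] by linarith
  fix \<epsilon> :: real assume \<epsilon>: "0 < \<epsilon>"
  \<comment> \<open>On the good event the two arguments of \<open>h\<close> differ by at most (1 +
    2c) \<eta>; the two bad events, of total probability at most 2 \<eta>, cost 4 b \<eta>. The
    summand 1 keeps \<open>q\<close> positive.\<close>
  define q where "q = k * (1 + 2 * c) + 4 * b + 1"
  define \<eta> where "\<eta> = \<epsilon> / (4 * q)"
  have q: "0 < q" unfolding q_def using k c0 b0 by (intro add_nonneg_pos add_nonneg_nonneg mult_nonneg_nonneg) auto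
  have \<eta>: "0 < \<eta>" using \<epsilon> q by (simp add: \<eta>_def)
  have \<eta>2: "k * (1 + 2 * c) * \<eta> + 4 * b * \<eta> < \<epsilon> / 2"
  proof -
    have "q * \<eta> = \<epsilon> / 4" using q by (simp add: \<eta>_def)
    then show ?thesis using \<eta> \<epsilon> unfolding q_def distrib_right by linarith
  qed
  have "(\<lambda>l. \<integral>\<omega>. h (Phi (step_path l (sampled l \<omega>))) \<partial>N) \<longlonglongrightarrow> (\<integral>\<omega>. h (Phi \<omega>) \<partial>N)"
  proof (rule integral_dominated_convergence[where w = "\<lambda>_. b"])
    show "(\<lambda>\<omega>. h (Phi \<omega>)) \<in> borel_measurable N"
      by (rule borel_measurable_LIMSEQ_metric[OF sampled_meas[OF bc] sampled_tendsto[OF bc]])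
  qed (use sampled_meas[OF bc] sampled_tendsto[OF bc] hb[OF Phi_step_linf] in auto)
  from LIMSEQ_D[OF this, of "\<epsilon> / 4"] \<epsilon> obtain l1 where
    l1: "\<And>l. l \<ge> l1 \<Longrightarrow> \<bar>(\<integral>\<omega>. h (Phi (step_path l (sampled l \<omega>))) \<partial>N) - (\<integral>\<omega>. h (Phi \<omega>) \<partial>N)\<bar> < \<epsilon> / 4"
    by auto
  obtain l0 where l0: "\<forall>l\<ge>l0. eventually (\<lambda>n. \<exists>E\<in>events. prob E \<le> \<eta> \<and>
     (\<forall>\<omega>\<in>space P - E. \<forall>m\<le>M. \<forall>u\<in>unit_cube. \<forall>v\<in>unit_cube. (\<forall>k. \<bar>u $ k - v $ k\<bar> \<le> 1 / 2 ^ l)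
        \<longrightarrow> \<bar>G n m \<omega> u - G n m \<omega> v\<bar> \<le> \<eta>)) sequentially"
    using asymptotic_equicontinuity[OF \<eta>, of M] by blast
  \<comment> \<open>The grid is fixed here, fine enough for both the limit and the oscillation of
    \<open>G\<close>; only afterwards does n tend to infinity.\<close>
  define l where "l = max l0 l1"
  have osc: "eventually (\<lambda>n. \<exists>E\<in>events. prob E \<le> \<eta> \<and>
     (\<forall>\<omega>\<in>space P - E. \<forall>m\<le>M. \<forall>u\<in>unit_cube. \<forall>v\<in>unit_cube. (\<forall>k. \<bar>u $ k - v $ k\<bar> \<le> 1 / 2 ^ l)
        \<longrightarrow> \<bar>G n m \<omega> u - G n m \<omega> v\<bar> \<le> \<eta>)) sequentially"
    using l0 by (simp add: l_def)
  let ?f = "\<lambda>b. h (Phi (step_path l b))"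
  have flip: "\<bar>?f x - ?f y\<bar> \<le> k * c * (\<Sum>j<card (grid_index l). \<bar>x j - y j\<bar>)" for x y
  proof -
    have "\<bar>?f x - ?f y\<bar> \<le> k * sup_dist T (Phi (step_path l x)) (Phi (step_path l y))"
      using lip Phi_step_linf unfolding lip_linf_def by blast
    also have "\<dots> \<le> k * (c * (\<Sum>j<card (grid_index l). \<bar>x j - y j\<bar>))"
      by (intro mult_left_mono k sup_dist_least[OF T_ne] Phi_diff[OF c step_path_diff])
    finally show ?thesis by (simp add: mult.assoc)
  qed
  have Wm: "(\<lambda>\<omega>. W n m \<omega> u) \<in> borel_measurable P" for n m u by (rule measurable_proc[OF orthant_meas])
  have "(\<lambda>n. expectation (\<lambda>\<omega>. ?f (sampled l (\<lambda>m. W n m \<omega>)))) \<longlonglongrightarrow> (\<integral>\<omega>. ?f (sampled l \<omega>) \<partial>N)"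
    by (rule fidi_limit[where f = ?f and L = "k * c" and k = "card (grid_index l)" and b = b and e = "from_nat_into (grid_index l)"])
      (use from_grid_index flip k c0 hb[OF Phi_step_linf] in auto)
  from LIMSEQ_D[OF this, of "\<epsilon> / 4"] \<epsilon> obtain n1 where
    n1: "\<And>n. n \<ge> n1 \<Longrightarrow> \<bar>expectation (\<lambda>\<omega>. ?f (sampled l (\<lambda>m. W n m \<omega>))) - (\<integral>\<omega>. ?f (sampled l \<omega>) \<partial>N)\<bar> < \<epsilon> / 4"
    by auto
  have "eventually (\<lambda>n. \<bar>outer_exp P (\<lambda>\<omega>. h (copula_proc P X Z J A n \<omega>))
      - expectation (\<lambda>\<omega>. ?f (sampled l (\<lambda>m. W n m \<omega>)))\<bar> < \<epsilon> / 2) sequentially"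
    using osc copula_proc_linearization[OF \<eta>, of M]
  proof eventually_elim
    case (elim n)
    obtain E1 where E1: "E1 \<in> events" "prob E1 \<le> \<eta>"
      and o: "\<And>\<omega> m u v. \<omega> \<in> space P - E1 \<Longrightarrow> m \<le> M \<Longrightarrow> u \<in> unit_cube \<Longrightarrow> v \<in> unit_cube
        \<Longrightarrow> (\<And>k. \<bar>u $ k - v $ k\<bar> \<le> 1 / 2 ^ l) \<Longrightarrow> \<bar>G n m \<omega> u - G n m \<omega> v\<bar> \<le> \<eta>" using elim(1) by blast
    obtain E2 where E2: "E2 \<in> events" "prob E2 \<le> \<eta>"
      and li: "\<And>\<omega> m u. \<omega> \<in> space P - E2 \<Longrightarrow> m \<le> M \<Longrightarrow> u \<in> unit_cube
        \<Longrightarrow> \<bar>copula_proc P X Z J A n \<omega> m u - Cinf p C dC (W n m \<omega>) u\<bar> \<le> \<eta>" using elim(2) by blast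
    have cpl: "copula_proc P X Z J A n \<omega> \<in> linf T" for \<omega>
      unfolding linf_def using copula_proc_bound
      by (intro CollectI bdd_aboveI2[of _ _ "2 * sqrt (real n)"]) auto
    have "\<bar>outer_exp P (\<lambda>\<omega>. h (copula_proc P X Z J A n \<omega>)) - expectation (\<lambda>\<omega>. ?f (sampled l (\<lambda>m. W n m \<omega>)))\<bar>
        \<le> k * (1 + 2 * c) * \<eta> + 2 * b * prob (E1 \<union> E2)"
    proof (rule outer_exp_approx[OF prob_space_axioms])
      show "E1 \<union> E2 \<in> events" using E1 E2 by auto
      show "0 \<le> k * (1 + 2 * c) * \<eta>" using k c0 \<eta> by simp
      show "\<bar>h (copula_proc P X Z J A n \<omega>)\<bar> \<le> b" for \<omega> by (rule hb[OF cpl])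
      show "\<bar>?f (sampled l (\<lambda>m. W n m \<omega>))\<bar> \<le> b" for \<omega> by (rule hb[OF Phi_step_linf])
      show "integrable P (\<lambda>\<omega>. ?f (sampled l (\<lambda>m. W n m \<omega>)))"
      proof (rule integrable_const_bound[of _ b])
        show "(\<lambda>\<omega>. ?f (sampled l (\<lambda>m. W n m \<omega>))) \<in> borel_measurable P"
          by (rule borel_measurable_continuous_coords[OF step_functional_continuous[OF bc] Wm])
      qed (use hb[OF Phi_step_linf] in auto)
      fix \<omega> assume \<omega>: "\<omega> \<in> space P - (E1 \<union> E2)"
      have "\<bar>h (copula_proc P X Z J A n \<omega>) - ?f (sampled l (\<lambda>m. W n m \<omega>))\<bar>
          \<le> k * sup_dist T (copula_proc P X Z J A n \<omega>) (Phi (step_path l (sampled l (\<lambda>m. W n m \<omega>))))"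
        using lip cpl Phi_step_linf unfolding lip_linf_def by blast
      also have "\<dots> \<le> k * (\<eta> + c * (2 * \<eta>))"
      proof (intro mult_left_mono k sup_dist_least[OF T_ne])
        fix m u assume mu: "(m, u) \<in> T"
        have "\<bar>copula_proc P X Z J A n \<omega> m u - Phi (\<lambda>m. W n m \<omega>) m u\<bar> \<le> \<eta>"
          unfolding Phi_def using \<omega> mu by (intro li) auto
        moreover have "\<bar>Phi (\<lambda>m. W n m \<omega>) m u - Phi (step_path l (sampled l (\<lambda>m. W n m \<omega>))) m u\<bar> \<le> c * (2 * \<eta>)"
        proof (rule Phi_diff[OF c _ mu])
          fix m u assume mu: "(m, u) \<in> T"
          have Gd: "\<bar>G n m' \<omega> u - G n m' \<omega> (dyadic_floor l u)\<bar> \<le> \<eta>" if "m' \<le> M" for m'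
          proof (rule o)
            show "dyadic_floor l u \<in> unit_cube"
              using mu dyadic_floor_in_grid[of u l] dyadic_grid_subset_unit_cube by auto
            show "\<bar>u $ k - dyadic_floor l u $ k\<bar> \<le> 1 / 2 ^ l" for k
              using dyadic_floor_le[of l u k] dyadic_floor_ge[of u k l] by linarith
          qed (use \<omega> mu that in auto)
          \<comment> \<open>For m >= 1 the process \<open>W n m\<close> is the difference of
            \<open>G n m\<close> and \<open>G n 0\<close>, so its oscillation is at most twice
            \<eta>.\<close>
          have "\<bar>W n m \<omega> u - W n m \<omega> (dyadic_floor l u)\<bar> \<le> 2 * \<eta>"
            using Gd[of m] Gd[of 0] mu \<eta> by (cases "m = 0") (auto simp: G_def abs_le_iff)
          then show "\<bar>W n m \<omega> u - step_path l (sampled l (\<lambda>m. W n m \<omega>)) m u\<bar> \<le> 2 * \<eta>"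
            unfolding step_path_eval[OF mu, of l "\<lambda>m. W n m \<omega>"] .
        qed
        ultimately show "\<bar>copula_proc P X Z J A n \<omega> m u - Phi (step_path l (sampled l (\<lambda>m. W n m \<omega>))) m u\<bar> \<le> \<eta> + c * (2 * \<eta>)"
          by linarith
      qed
      finally show "\<bar>h (copula_proc P X Z J A n \<omega>) - ?f (sampled l (\<lambda>m. W n m \<omega>))\<bar> \<le> k * (1 + 2 * c) * \<eta>"
        by (simp add: algebra_simps)
    qed
    also have "prob (E1 \<union> E2) \<le> \<eta> + \<eta>"
      using measure_Un_le[OF E1(1) E2(1)] E1(2) E2(2) by linarith
    then have "k * (1 + 2 * c) * \<eta> + 2 * b * prob (E1 \<union> E2) \<le> k * (1 + 2 * c) * \<eta> + 2 * b * (\<eta> + \<eta>)"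
      using b0 by (intro add_left_mono mult_left_mono) auto
    also have "\<dots> < \<epsilon> / 2" using \<eta>2 by (simp add: algebra_simps)
    finally show ?case by simp
  qed
  then obtain n2 where n2: "\<And>n. n \<ge> n2 \<Longrightarrow> \<bar>outer_exp P (\<lambda>\<omega>. h (copula_proc P X Z J A n \<omega>))
      - expectation (\<lambda>\<omega>. ?f (sampled l (\<lambda>m. W n m \<omega>)))\<bar> < \<epsilon> / 2" unfolding eventually_sequentially by blast
  show "\<exists>no. \<forall>n\<ge>no. norm (outer_exp P (\<lambda>\<omega>. h (copula_proc P X Z J A n \<omega>)) - (\<integral>\<omega>. h (Phi \<omega>) \<partial>N)) < \<epsilon>"
  proof (intro exI[of _ "max n1 n2"] allI impI)
    fix n assume "max n1 n2 \<le> n"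
    then show "norm (outer_exp P (\<lambda>\<omega>. h (copula_proc P X Z J A n \<omega>)) - (\<integral>\<omega>. h (Phi \<omega>) \<partial>N)) < \<epsilon>"
      using n1[of n] n2[of n] l1[of l] unfolding l_def real_norm_def by linarith
  qed
qed

lemma copula_weak_limit: "weak_conv_linf T P (copula_proc P X Z J A) N Phi"
proof (rule weak_conv_linf_lipschitz[OF prob_space_axioms prob_N T_ne])
  show "copula_proc P X Z J A n \<omega> \<in> linf T" for n \<omega>
    unfolding linf_def using copula_proc_bound
    by (intro CollectI bdd_aboveI2[of _ _ "2 * sqrt (real n)"]) auto
  show "(\<lambda>\<omega>. h (Phi \<omega>)) \<in> borel_measurable N" if "bcont_linf T h" for h
    by (rule borel_measurable_LIMSEQ_metric[OF sampled_meas[OF that] sampled_tendsto[OF that]])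
qed (auto intro: Phi_N_linf lipschitz_limit)

end

theorem theorem7:
  fixes P :: "'a measure"
    and X :: "nat \<Rightarrow> 'a \<Rightarrow> real^'p"
    and Z :: "nat \<Rightarrow> 'a \<Rightarrow> real^'q"
    and J :: "nat \<times> nat \<times> nat \<Rightarrow> 'a \<Rightarrow> nat"
    and A :: "(real^'q) set"
    and C' :: "real^'p \<Rightarrow> ((real^'p) \<Rightarrow>\<^sub>L real)"
    and M :: nat
  assumes P: "prob_space P"
    and X_meas: "\<And>i. X i \<in> borel_measurable P"
    and Z_meas: "\<And>i. Z i \<in> borel_measurable P"
    and iid_indep: "prob_space.indep_vars P (\<lambda>_. borel) (\<lambda>i \<omega>. (X i \<omega>, Z i \<omega>)) UNIV"
    and iid_dist: "\<And>i. distr P borel (\<lambda>\<omega>. (X i \<omega>, Z i \<omega>)) = distr P borel (\<lambda>\<omega>. (X 0 \<omega>, Z 0 \<omega>))"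
    and boot_indep: "prob_space.indep_vars P (\<lambda>_. count_space UNIV) J UNIV"
    and boot_unif: "\<And>n m i. i < n \<Longrightarrow>
          distr P (count_space UNIV) (J (n, m, i)) = measure_pmf (pmf_of_set {..<n})"
    and boot_data_indep: "\<And>S T. S \<in> sets (Pi\<^sub>M UNIV (\<lambda>_. borel)) \<Longrightarrow>
          T \<in> sets (Pi\<^sub>M UNIV (\<lambda>_. count_space UNIV)) \<Longrightarrow>
          measure P {\<omega>\<in>space P. (\<lambda>i. (X i \<omega>, Z i \<omega>)) \<in> S \<and> (\<lambda>k. J k \<omega>) \<in> T}
          = measure P {\<omega>\<in>space P. (\<lambda>i. (X i \<omega>, Z i \<omega>)) \<in> S}
            * measure P {\<omega>\<in>space P. (\<lambda>k. J k \<omega>) \<in> T}"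
    and A_borel: "A \<in> sets borel"
    and pA_pos: "pA P (Z 0) A > 0"
    and margins_cont: "\<And>k. continuous_on UNIV (condF P (X 0) (Z 0) A k)"
    and C_deriv: "\<And>u. u \<in> unit_cube \<Longrightarrow>
          (condC P (X 0) (Z 0) A has_derivative blinfun_apply (C' u)) (at u within unit_cube)"
    and C'_cont: "continuous_on unit_cube C'"
    and M: "M \<ge> 2"
  shows "\<exists>(N :: (nat \<Rightarrow> real^'p \<Rightarrow> real) measure) (B :: nat \<Rightarrow> (nat \<Rightarrow> real^'p \<Rightarrow> real) \<Rightarrow> real^'p \<Rightarrow> real).
           prob_space N \<and>
           (\<forall>m\<le>M. centered_gaussian_process N (B m) unit_cube
              (\<lambda>u v. pA P (Z 0) A * condC P (X 0) (Z 0) A (\<chi> k. min (u $ k) (v $ k))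
                     - (pA P (Z 0) A)\<^sup>2 * condC P (X 0) (Z 0) A u * condC P (X 0) (Z 0) A v)) \<and>
           (\<forall>m\<le>M. \<forall>\<omega>\<in>space N. continuous_on unit_cube (B m \<omega>)) \<and>
           prob_space.indep_vars N (\<lambda>_. Pi\<^sub>M unit_cube (\<lambda>_. borel))
              (\<lambda>m \<omega>. restrict (B m \<omega>) unit_cube) {0..M} \<and>
           weak_conv_linf ({0..M} \<times> unit_cube) P
              (\<lambda>n \<omega> m u. copula_proc P X Z J A n \<omega> m u) N
              (\<lambda>\<omega> m u. Cinf (pA P (Z 0) A) (condC P (X 0) (Z 0) A)
                          (\<lambda>v k. blinfun_apply (C' v) (axis k 1)) (B m \<omega>) u)"
proof -
  interpret prob_space P by (rule P)
  interpret copula_sample P X Z J A C'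
    by unfold_locales (fact X_meas Z_meas iid_indep iid_dist boot_indep boot_unif boot_data_indep A_borel pA_pos margins_cont
        C_deriv C'_cont)+
  obtain N1 :: "(real^'p \<Rightarrow> real) measure" where "prob_space N1" "space N1 = {f. continuous_on unit_cube f}"
    "(\<lambda>f. restrict f unit_cube) \<in> measurable N1 (Pi\<^sub>M unit_cube (\<lambda>_. borel))"
    "\<And>(S::nat set) c z. finite S \<Longrightarrow> z ` S \<subseteq> unit_cube \<Longrightarrow>
       (\<integral>f. cis (\<Sum>i\<in>S. c i * f (z i)) \<partial>N1) = exp (- (\<Sum>i\<in>S. \<Sum>j\<in>S. c i * c j * cov (z i) (z j)) / 2)"
    using gaussian_continuous_measure[OF cov_sym cov_psd cov_increment cov_cont] by blast
  then interpret copula_limit P X Z J A C' N1 M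
    by (intro copula_limit.intro copula_sample_axioms copula_limit_axioms.intro)
  have cov_eq: "cov = (\<lambda>u v. pA P (Z 0) A * condC P (X 0) (Z 0) A (\<chi> k. min (u $ k) (v $ k))
      - (pA P (Z 0) A)\<^sup>2 * condC P (X 0) (Z 0) A u * condC P (X 0) (Z 0) A v)"
    by (simp add: fun_eq_iff cov_def)
  have Phi_eq: "Phi = (\<lambda>\<omega> m u. Cinf p C dC (\<omega> m) u)" by (simp add: fun_eq_iff Phi_def)
  show ?thesis
  proof (intro exI[of _ N] exI[of _ "\<lambda>m \<omega>. \<omega> m"] conjI allI impI ballI)
    show "prob_space N" by (rule prob_N)
    show "centered_gaussian_process N (\<lambda>\<omega>. \<omega> m) unit_cube (\<lambda>u v. pA P (Z 0) A * condC P (X 0) (Z 0) A (\<chi> k. min (u $ k) (v $ k))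
      - (pA P (Z 0) A)\<^sup>2 * condC P (X 0) (Z 0) A u * condC P (X 0) (Z 0) A v)" for m
      using N_gaussian[of m] unfolding cov_eq .
    show "continuous_on unit_cube (\<omega> m)" if "\<omega> \<in> space N" for m \<omega> using that by (rule N_cont)
    show "prob_space.indep_vars N (\<lambda>_. Pi\<^sub>M unit_cube (\<lambda>_. borel)) (\<lambda>m \<omega>. restrict (\<omega> m) unit_cube) {0..M}"
      by (rule N_indep)
    show "weak_conv_linf ({0..M} \<times> unit_cube) P (\<lambda>n \<omega> m u. copula_proc P X Z J A n \<omega> m u) N
        (\<lambda>\<omega> m u. Cinf (pA P (Z 0) A) (condC P (X 0) (Z 0) A) (\<lambda>v k. blinfun_apply (C' v) (axis k 1)) (\<omega> m) u)"
      using copula_weak_limit unfolding Phi_eq .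
  qed
qed

end
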